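(* Fix $i\in I$. (1) For $n\ge0$ there is a canonical isomorphism, natural in $M\in\mathcal H[i]$, $$\mathrm{ad}_{E_i}^n(M)\simeq\pi_i(E_i^nM).$$ (2) For all $n\ge0$ there is an algebra morphism $H_{ni}^{\mathrm{op}}\to\mathrm{End}(\mathrm{ad}_{E_i}^n)$, induced through the isomorphism of (1) by the right multiplication action of $H_{ni}$ on $E_i^n$. Hence the affine nil Hecke algebra $H_{ni}$ acts on $\mathrm{ad}_{E_i}^n$. (Here $\mathrm{End}$ denotes all $K$-linear natural endomorphisms, not necessarily of degree $0$.)
   Context: Let $I$ be a nonempty set and $\cdot:\mathbb{Z}I\otimes\mathbb{Z}I\to\mathbb{Z}$ a symmetric bilinear form with $i\cdot i\in 2\mathbb{Z}_{>0}$ for all $i\in I$ and $c_{i,j}:=2(i\cdot j)/(i\cdot i)\in\mathbb{Z}_{\le 0}$ for $i\neq j$ (and $c_{i,i}=2$). Put $d_i=(i\cdot i)/2$, $Q=\bigoplus_{i\in I}\mathbb{Z}i$, $Q^+=\bigoplus_{i\in I}\mathbb{Z}_{\ge 0}i$. The height of $\beta=\sum n_i i\in Q^+$ is $|\beta|=\sum n_i$, and $I^\beta=\{\nu\in I^{|\beta|}:\sum_k\nu_k=\beta\}$. Components of tuples are numbered from right to left, $\nu=(\nu_n,\dots,\nu_1)$, and $s_k$ exchanges $\nu_k$ and $\nu_{k+1}$. $K$ is a commutative ring, $\otimes=\otimes_K$. For $i,j\in I$ fix $Q_{i,j}(u,v)\in K[u,v]$ with $Q_{i,i}=0$, $Q_{i,j}(u,v)=Q_{j,i}(v,u)$,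 and for $i\ne j$: if $c_{i,j}<0$, $Q_{i,j}(u,v)\in t_{i,j}u^{-c_{i,j}}+t_{j,i}v^{-c_{j,i}}+\sum_{s,t>0,\ d_is+d_jt=-i\cdot j}Ku^sv^t$ with $t_{i,j},t_{j,i}\in K^\times$; if $c_{i,j}=0$, $Q_{i,j}$ is an invertible constant. KLR algebra. For $\beta\in Q^+$ of height $n$, $H_\beta$ is the unital $K$-algebra generated by $1_\nu$ ($\nu\in I^\beta$), $x_1,\dots,x_n$, $\tau_1,\dots,\tau_{n-1}$ with relations: $1_\nu1_{\nu'}=\delta_{\nu,\nu'}1_\nu$, $\sum_\nu1_\nu=1_\beta$ (the unit); $x_k1_\nu=1_\nu x_k$; $\tau_k1_\nu=1_{s_k(\nu)}\tau_k$; $x_kx_\ell=x_\ell x_k$; $\tau_k^21_\nu=Q_{\nu_k,\nu_{k+1}}(x_k,x_{k+1})1_\nu$; $(\tau_kx_\ell-x_{s_k(\ell)}\tau_k)1_\nu$ equals $1_\nu$ if $\ell=k+1,\nu_k=\nu_{k+1}$, equals $-1_\nu$ if $\ell=k,\nu_k=\nu_{k+1}$, and is $0$ otherwise; $\tau_k\tau_\ell=\tau_\ell\tau_k$ if $|k-\ell|>1$; $(\tau_{k+1}\tau_k\tau_{k+1}-\tau_k\tau_{k+1}\tau_k)1_\nu=\delta_{\nu_k,\nu_{k+2}}\frac{Q_{\nu_k,\nu_{k+1}}(x_{k+2},x_{k+1})-Q_{\nu_k,\nu_{k+1}}(x_k,x_{k+1})}{x_{k+2}-x_k}1_\nu$.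 Grading: $\deg 1_\nu=0$, $\deg x_k1_\nu=\nu_k\cdot\nu_k$, $\deg\tau_k1_\nu=-\nu_k\cdot\nu_{k+1}$. In particular $H_{ni}$ is the affine nil Hecke algebra of rank $n$. Monoidal structure. For $|\beta|=m$, $|\gamma|=n$ there is a non-unital morphism $H_\beta\otimes H_\gamma\to H_{\beta+\gamma}$, $y\otimes z\mapsto y\diamond z$, where $1_\mu\diamond1_\nu=1_{\mu\nu}$ (concatenation), generators $x_k,\tau_\ell$ of the left factor $H_\beta$ are sent to $x_{n+k},\tau_{n+\ell}$ and those of the right factor $H_\gamma$ to $x_k,\tau_\ell$. Put $1_{\beta,\gamma}=1_\beta\diamond1_\gamma$; set $1_{\beta-i,i}=0$ if $\beta-i\notin Q^+$. $\mathcal H=\bigoplus_{\beta\in Q^+}H_\beta\text{-mod}$ is the category of finitely generated graded modules with degree preserving morphisms. For $M\in H_\beta$-mod, $N\in H_\gamma$-mod, $MN=H_{\beta+\gamma}1_{\beta,\gamma}\otimes_{H_\beta\otimes H_\gamma}(M\otimes N)$. $E_i$ is the free $H_i$-module of rank one, and $E_i^n$ is the free $H_{ni}$-module of rank one. $H_\beta^i=H_\beta/(1_{\beta-i,i})$ (quotient by the two-sided ideal), $\mathcal H[i]=\bigoplus_{\beta}H_\beta^i\text{-mod}$ (finitely generated graded modules), viewed as a full subcategory of $\mathcal H$. For $M\in H_\beta$-mod, $\pi_i(M)=M/H_\beta1_{\beta-i,i}M$. The functor $\mathrm{ad}_{E_i}:\mathcal H[i]\to\mathcal H[i]$ is $\mathrm{ad}_{E_i}(M)=\pi_i(E_iM)$,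 and $\mathrm{ad}_{E_i}^n$ is its $n$-fold iterate. *)

theory Defs
  imports
    "HOL-Algebra.QuotRing"
    "HOL-Algebra.Module"
    "HOL-Algebra.Generated_Groups"
    "HOL-Library.Poly_Mapping"
    "HOL-Library.Multiset"
    "HOL-Combinatorics.Transposition"
begin

hide_const (open) Multiset.mult

section \<open>Data\<close>

text \<open>
  The index set \<open>I\<close> is the type \<open>'i\<close>; \<open>Q\<^sup>+\<close> is \<open>'i multiset\<close>, the height is \<^const>\<open>size\<close>, and
  \<open>\<beta> - i \<in> Q\<^sup>+\<close> means \<open>i \<in># \<beta>\<close>. The bilinear form is given by its values on the basis \<open>I\<close> of \<open>\<int>I\<close>.
  A polynomial in \<open>K[u,v]\<close> is a finitely supported function on exponents: \<open>(s, t)\<close> stands for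
  \<open>u\<^sup>s v\<^sup>t\<close>. The sort \<open>{comm_ring, comm_monoid_mult}\<close> is that of commutative rings with one;
  unlike \<open>comm_ring_1\<close> it admits the zero ring.
\<close>

record (overloaded) ('i, 'k::zero) klr_datum =
  form :: "'i \<Rightarrow> 'i \<Rightarrow> int"
  Qpol :: "'i \<Rightarrow> 'i \<Rightarrow> (nat \<times> nat) \<Rightarrow>\<^sub>0 'k"

definition cartan :: "('i, 'k::zero) klr_datum \<Rightarrow> 'i \<Rightarrow> 'i \<Rightarrow> int" where
  "cartan D i j = (2 * form D i j) div form D i i"

definition is_klr_datum :: "('i, 'k::{comm_ring,comm_monoid_mult}) klr_datum \<Rightarrow> bool" where
  "is_klr_datum D \<longleftrightarrow>
     (\<forall>i j. form D i j = form D j i) \<and>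
     (\<forall>i. even (form D i i) \<and> form D i i > 0) \<and>
     (\<forall>i j. i \<noteq> j \<longrightarrow> form D i i dvd 2 * form D i j \<and> cartan D i j \<le> 0) \<and>
     (\<forall>i. Qpol D i i = 0) \<and>
     (\<forall>i j s t. Poly_Mapping.lookup (Qpol D i j) (s, t) = Poly_Mapping.lookup (Qpol D j i) (t, s)) \<and>
     (\<exists>r. (\<forall>i j. i \<noteq> j \<longrightarrow> r i j dvd 1) \<and>
        (\<forall>i j. i \<noteq> j \<longrightarrow> cartan D i j < 0 \<longrightarrow>
           Poly_Mapping.keys (Qpol D i j - Poly_Mapping.single (nat (- cartan D i j), 0) (r i j)
                            - Poly_Mapping.single (0, nat (- cartan D j i)) (r j i))
           \<subseteq> {(s, t). s > 0 \<and> t > 0 \<and>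
                form D i i div 2 * int s + form D j j div 2 * int t = - form D i j})) \<and>
     (\<forall>i j. i \<noteq> j \<longrightarrow> cartan D i j = 0 \<longrightarrow>
        (\<exists>u. u dvd 1 \<and> Qpol D i j = Poly_Mapping.single (0, 0) u))"

section \<open>Free algebras\<close>

text \<open>Lists are the free monoid, so \<open>'g list \<Rightarrow>\<^sub>0 'k\<close> with its convolution product is the free
  \<open>K\<close>-algebra on \<open>'g\<close>.\<close>

instantiation list :: (type) monoid_add
begin
definition zero_list :: "'a list" where "zero_list = []"
definition plus_list :: "'a list \<Rightarrow> 'a list \<Rightarrow> 'a list" where "plus_list = (@)"
instance by standard (simp_all add: zero_list_def plus_list_def)
end

abbreviation mon :: "'g list \<Rightarrow> 'g list \<Rightarrow>\<^sub>0 'k::{comm_ring,comm_monoid_mult}" where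
  "mon w \<equiv> Poly_Mapping.single w 1"

definition free_algebra :: "'g set \<Rightarrow> ('g list \<Rightarrow>\<^sub>0 'k::{comm_ring,comm_monoid_mult}) ring" where
  "free_algebra S = \<lparr>carrier = {p. \<forall>w\<in>Poly_Mapping.keys p. set w \<subseteq> S}, mult = (\<lambda>p q. p * q),
     one = mon [], zero = 0, add = (\<lambda>p q. p + q)\<rparr>"

text \<open>Substitution of \<open>f g\<close> for each letter \<open>g\<close>.\<close>

definition subst_free :: "('g \<Rightarrow> 'g list \<Rightarrow>\<^sub>0 'k) \<Rightarrow> ('g list \<Rightarrow>\<^sub>0 'k::{comm_ring,comm_monoid_mult})
    \<Rightarrow> 'g list \<Rightarrow>\<^sub>0 'k" where
  "subst_free f p =
     (\<Sum>w\<in>Poly_Mapping.keys p. Poly_Mapping.single [] (Poly_Mapping.lookup p w) * foldr (\<lambda>g q. f g * q) w (mon []))"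

section \<open>KLR algebras\<close>

datatype 'i gen = Idm "'i list" | Dot nat | Cross nat  \<comment> \<open>\<open>1\<^sub>\<nu>\<close>, \<open>x\<^sub>k\<close>, \<open>\<tau>\<^sub>k\<close>\<close>

type_synonym ('i, 'k) free = "'i gen list \<Rightarrow>\<^sub>0 'k"
type_synonym ('i, 'k) klr = "('i, 'k) free set"  \<comment> \<open>elements of \<open>H\<^sub>\<beta>\<close> are cosets of the ideal of relations\<close>

definition seqs :: "'i multiset \<Rightarrow> 'i list set" where  \<comment> \<open>\<open>I\<^sup>\<beta>\<close>\<close>
  "seqs \<beta> = {\<nu>. mset \<nu> = \<beta>}"

text \<open>The list \<open>[\<nu>\<^sub>n, \<dots>, \<nu>\<^sub>1]\<close> is read from right to left, starting with 1.\<close>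

definition entry :: "'i list \<Rightarrow> nat \<Rightarrow> 'i" where
  "entry \<nu> k = \<nu> ! (length \<nu> - k)"

definition swap_seq :: "nat \<Rightarrow> 'i list \<Rightarrow> 'i list" where
  "swap_seq k \<nu> = \<nu>[length \<nu> - k := entry \<nu> (k + 1), length \<nu> - (k + 1) := entry \<nu> k]"

definition gens :: "'i multiset \<Rightarrow> 'i gen set" where
  "gens \<beta> = Idm ` seqs \<beta> \<union> Dot ` {1..size \<beta>} \<union> Cross ` {1..<size \<beta>}"

definition eval_pol :: "((nat \<times> nat) \<Rightarrow>\<^sub>0 'k::{comm_ring,comm_monoid_mult}) \<Rightarrow> nat \<Rightarrow> nat \<Rightarrow> ('i, 'k) free" where
  "eval_pol q k l = (\<Sum>(s, t)\<in>Poly_Mapping.keys q.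
     Poly_Mapping.single (replicate s (Dot k) @ replicate t (Dot l)) (Poly_Mapping.lookup q (s, t)))"

text \<open>The polynomial \<open>(q(x\<^sub>k\<^sub>+\<^sub>2, x\<^sub>k\<^sub>+\<^sub>1) - q(x\<^sub>k, x\<^sub>k\<^sub>+\<^sub>1)) / (x\<^sub>k\<^sub>+\<^sub>2 - x\<^sub>k)\<close>, from
  \<open>(a\<^sup>s - b\<^sup>s) / (a - b) = (\<Sum>r<s. a\<^sup>r b\<^sup>s\<^sup>-\<^sup>1\<^sup>-\<^sup>r)\<close>.\<close>

definition div_diff :: "((nat \<times> nat) \<Rightarrow>\<^sub>0 'k::{comm_ring,comm_monoid_mult}) \<Rightarrow> nat \<Rightarrow> ('i, 'k) free" where
  "div_diff q k = (\<Sum>(s, t)\<in>Poly_Mapping.keys q. \<Sum>r<s.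
     Poly_Mapping.single (replicate r (Dot (k + 2)) @ replicate (s - 1 - r) (Dot k) @
       replicate t (Dot (k + 1))) (Poly_Mapping.lookup q (s, t)))"

inductive_set relators :: "('i, 'k::{comm_ring,comm_monoid_mult}) klr_datum \<Rightarrow> 'i multiset \<Rightarrow> ('i, 'k) free set"
  for D :: "('i, 'k) klr_datum" and \<beta> :: "'i multiset" where
  idem_idem: "\<lbrakk>\<nu> \<in> seqs \<beta>; \<nu>' \<in> seqs \<beta>\<rbrakk> \<Longrightarrow>
    mon [Idm \<nu>, Idm \<nu>'] - (if \<nu> = \<nu>' then mon [Idm \<nu>] else 0) \<in> relators D \<beta>"
| idem_sum: "(\<Sum>\<nu>\<in>seqs \<beta>. mon [Idm \<nu>]) - mon [] \<in> relators D \<beta>"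
| dot_idem: "\<lbrakk>\<nu> \<in> seqs \<beta>; k \<in> {1..size \<beta>}\<rbrakk> \<Longrightarrow>
    mon [Dot k, Idm \<nu>] - mon [Idm \<nu>, Dot k] \<in> relators D \<beta>"
| cross_idem: "\<lbrakk>\<nu> \<in> seqs \<beta>; k \<in> {1..<size \<beta>}\<rbrakk> \<Longrightarrow>
    mon [Cross k, Idm \<nu>] - mon [Idm (swap_seq k \<nu>), Cross k] \<in> relators D \<beta>"
| dot_dot: "\<lbrakk>k \<in> {1..size \<beta>}; l \<in> {1..size \<beta>}\<rbrakk> \<Longrightarrow>
    mon [Dot k, Dot l] - mon [Dot l, Dot k] \<in> relators D \<beta>"
| cross_sq: "\<lbrakk>\<nu> \<in> seqs \<beta>; k \<in> {1..<size \<beta>}\<rbrakk> \<Longrightarrow>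
    mon [Cross k, Cross k, Idm \<nu>]
      - eval_pol (Qpol D (entry \<nu> k) (entry \<nu> (k + 1))) k (k + 1) * mon [Idm \<nu>] \<in> relators D \<beta>"
| cross_dot: "\<lbrakk>\<nu> \<in> seqs \<beta>; k \<in> {1..<size \<beta>}; l \<in> {1..size \<beta>}\<rbrakk> \<Longrightarrow>
    mon [Cross k, Dot l, Idm \<nu>] - mon [Dot (transpose k (k + 1) l), Cross k, Idm \<nu>]
      - (if l = k + 1 \<and> entry \<nu> k = entry \<nu> (k + 1) then mon [Idm \<nu>]
         else if l = k \<and> entry \<nu> k = entry \<nu> (k + 1) then - mon [Idm \<nu>]
         else 0) \<in> relators D \<beta>"
| cross_cross: "\<lbrakk>k \<in> {1..<size \<beta>}; l \<in> {1..<size \<beta>}; k + 1 < l \<or> l + 1 < k\<rbrakk> \<Longrightarrow>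
    mon [Cross k, Cross l] - mon [Cross l, Cross k] \<in> relators D \<beta>"
| braid: "\<lbrakk>\<nu> \<in> seqs \<beta>; k \<ge> 1; k + 2 \<le> size \<beta>\<rbrakk> \<Longrightarrow>
    mon [Cross (k + 1), Cross k, Cross (k + 1), Idm \<nu>] - mon [Cross k, Cross (k + 1), Cross k, Idm \<nu>]
      - (if entry \<nu> k = entry \<nu> (k + 2)
         then div_diff (Qpol D (entry \<nu> k) (entry \<nu> (k + 1))) k * mon [Idm \<nu>] else 0) \<in> relators D \<beta>"

definition klr_ideal :: "('i, 'k::{comm_ring,comm_monoid_mult}) klr_datum \<Rightarrow> 'i multiset \<Rightarrow> ('i, 'k) free set" where
  "klr_ideal D \<beta> = genideal (free_algebra (gens \<beta>)) (relators D \<beta>)"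

definition klr_class :: "('i, 'k::{comm_ring,comm_monoid_mult}) klr_datum \<Rightarrow> 'i multiset \<Rightarrow> ('i, 'k) free \<Rightarrow> ('i, 'k) klr" where
  "klr_class D \<beta> p = klr_ideal D \<beta> +>\<^bsub>free_algebra (gens \<beta>)\<^esub> p"

definition KLR :: "('i, 'k::{comm_ring,comm_monoid_mult}) klr_datum \<Rightarrow> 'i multiset \<Rightarrow> ('i, 'k) klr ring" where  \<comment> \<open>\<open>H\<^sub>\<beta>\<close>\<close>
  "KLR D \<beta> = free_algebra (gens \<beta>) Quot klr_ideal D \<beta>"

definition klr_scalar :: "('i, 'k::{comm_ring,comm_monoid_mult}) klr_datum \<Rightarrow> 'i multiset \<Rightarrow> 'k \<Rightarrow> ('i, 'k) klr" where
  "klr_scalar D \<beta> c = klr_class D \<beta> (Poly_Mapping.single [] c)"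

text \<open>\<open>klr_homogeneous D \<beta> d\<close> is the degree \<open>d\<close> component of \<open>H\<^sub>\<beta>\<close>.\<close>

inductive klr_homogeneous :: "('i, 'k::{comm_ring,comm_monoid_mult}) klr_datum \<Rightarrow> 'i multiset \<Rightarrow> int \<Rightarrow> ('i, 'k) klr \<Rightarrow> bool"
  for D :: "('i, 'k) klr_datum" and \<beta> :: "'i multiset" where
  hom_zero: "klr_homogeneous D \<beta> d \<zero>\<^bsub>KLR D \<beta>\<^esub>"
| hom_add: "\<lbrakk>klr_homogeneous D \<beta> d a; klr_homogeneous D \<beta> d b\<rbrakk> \<Longrightarrow> klr_homogeneous D \<beta> d (a \<oplus>\<^bsub>KLR D \<beta>\<^esub> b)"
| hom_mult: "\<lbrakk>klr_homogeneous D \<beta> d a; klr_homogeneous D \<beta> e b\<rbrakk> \<Longrightarrow> klr_homogeneous D \<beta> (d + e) (a \<otimes>\<^bsub>KLR D \<beta>\<^esub> b)"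
| hom_scalar: "klr_homogeneous D \<beta> 0 (klr_scalar D \<beta> c)"
| hom_idem: "\<nu> \<in> seqs \<beta> \<Longrightarrow> klr_homogeneous D \<beta> 0 (klr_class D \<beta> (mon [Idm \<nu>]))"
| hom_dot: "\<lbrakk>\<nu> \<in> seqs \<beta>; k \<in> {1..size \<beta>}\<rbrakk> \<Longrightarrow>
    klr_homogeneous D \<beta> (form D (entry \<nu> k) (entry \<nu> k)) (klr_class D \<beta> (mon [Dot k, Idm \<nu>]))"
| hom_cross: "\<lbrakk>\<nu> \<in> seqs \<beta>; k \<in> {1..<size \<beta>}\<rbrakk> \<Longrightarrow>
    klr_homogeneous D \<beta> (- form D (entry \<nu> k) (entry \<nu> (k + 1))) (klr_class D \<beta> (mon [Cross k, Idm \<nu>]))"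

section \<open>The morphism from \<open>H\<^sub>\<beta> \<otimes> H\<^sub>\<gamma>\<close> to \<open>H\<^sub>\<beta>\<^sub>+\<^sub>\<gamma>\<close>\<close>

fun left_gen :: "'i multiset \<Rightarrow> 'i gen \<Rightarrow> ('i, 'k::{comm_ring,comm_monoid_mult}) free" where
  "left_gen \<gamma> (Idm \<mu>) = (\<Sum>\<nu>\<in>seqs \<gamma>. mon [Idm (\<mu> @ \<nu>)])"
| "left_gen \<gamma> (Dot k) = mon [Dot (size \<gamma> + k)]"
| "left_gen \<gamma> (Cross k) = mon [Cross (size \<gamma> + k)]"

fun right_gen :: "'i multiset \<Rightarrow> 'i gen \<Rightarrow> ('i, 'k::{comm_ring,comm_monoid_mult}) free" where
  "right_gen \<beta> (Idm \<nu>) = (\<Sum>\<mu>\<in>seqs \<beta>. mon [Idm (\<mu> @ \<nu>)])"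
| "right_gen \<beta> (Dot k) = mon [Dot k]"
| "right_gen \<beta> (Cross k) = mon [Cross k]"

text \<open>\<open>y \<diamondop> z\<close> is \<open>(y \<diamondop> 1\<^sub>\<gamma>) (1\<^sub>\<beta> \<diamondop> z)\<close>; the map being non-unital, everything is cut down by the
  idempotent \<open>1\<^sub>\<beta>\<^sub>,\<^sub>\<gamma> = (\<Sum>\<mu> \<nu>. 1\<^sub>\<mu>\<^sub>\<nu>)\<close>. As for \<^const>\<open>rcoset_mult\<close>, the value is a union over
  representatives, all of which give the same coset.\<close>

definition diamond :: "('i, 'k::{comm_ring,comm_monoid_mult}) klr_datum \<Rightarrow> 'i multiset \<Rightarrow> 'i multiset
    \<Rightarrow> ('i, 'k) klr \<Rightarrow> ('i, 'k) klr \<Rightarrow> ('i, 'k) klr" where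
  "diamond D \<beta> \<gamma> y z = (\<Union>p\<in>y. \<Union>q\<in>z. klr_class D (\<beta> + \<gamma>)
     (subst_free (left_gen \<gamma>) p * subst_free (right_gen \<beta>) q *
       (\<Sum>\<mu>\<in>seqs \<beta>. \<Sum>\<nu>\<in>seqs \<gamma>. mon [Idm (\<mu> @ \<nu>)])))"

definition klr_idem :: "('i, 'k::{comm_ring,comm_monoid_mult}) klr_datum \<Rightarrow> 'i multiset \<Rightarrow> 'i multiset \<Rightarrow> ('i, 'k) klr" where
  "klr_idem D \<beta> \<gamma> = diamond D \<beta> \<gamma> \<one>\<^bsub>KLR D \<beta>\<^esub> \<one>\<^bsub>KLR D \<gamma>\<^esub>"

definition klr_idem_at :: "('i, 'k::{comm_ring,comm_monoid_mult}) klr_datum \<Rightarrow> 'i \<Rightarrow> 'i multiset \<Rightarrow> ('i, 'k) klr" where  \<comment> \<open>\<open>1\<^sub>\<beta>\<^sub>-\<^sub>i\<^sub>,\<^sub>i\<close>\<close>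
  "klr_idem_at D i \<beta> = (if i \<in># \<beta> then klr_idem D (\<beta> - {#i#}) {#i#} else \<zero>\<^bsub>KLR D \<beta>\<^esub>)"

section \<open>Graded modules\<close>

text \<open>\<^locale>\<open>module\<close> is restricted to commutative rings; here is the same for left modules over any
  ring. The fields \<open>mult\<close> and \<open>one\<close> of a module record are meaningless.\<close>

locale left_module = R?: ring R + M?: abelian_group M for R (structure) and M (structure) +
  assumes lm_closed: "\<lbrakk>a \<in> carrier R; x \<in> carrier M\<rbrakk> \<Longrightarrow> a \<odot>\<^bsub>M\<^esub> x \<in> carrier M"
    and lm_l_distr: "\<lbrakk>a \<in> carrier R; b \<in> carrier R; x \<in> carrier M\<rbrakk> \<Longrightarrow>
      (a \<oplus>\<^bsub>R\<^esub> b) \<odot>\<^bsub>M\<^esub> x = a \<odot>\<^bsub>M\<^esub> x \<oplus>\<^bsub>M\<^esub> b \<odot>\<^bsub>M\<^esub> x"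
    and lm_r_distr: "\<lbrakk>a \<in> carrier R; x \<in> carrier M; y \<in> carrier M\<rbrakk> \<Longrightarrow>
      a \<odot>\<^bsub>M\<^esub> (x \<oplus>\<^bsub>M\<^esub> y) = a \<odot>\<^bsub>M\<^esub> x \<oplus>\<^bsub>M\<^esub> a \<odot>\<^bsub>M\<^esub> y"
    and lm_assoc: "\<lbrakk>a \<in> carrier R; b \<in> carrier R; x \<in> carrier M\<rbrakk> \<Longrightarrow>
      (a \<otimes>\<^bsub>R\<^esub> b) \<odot>\<^bsub>M\<^esub> x = a \<odot>\<^bsub>M\<^esub> (b \<odot>\<^bsub>M\<^esub> x)"
    and lm_one: "x \<in> carrier M \<Longrightarrow> \<one>\<^bsub>R\<^esub> \<odot>\<^bsub>M\<^esub> x = x"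

record ('h, 'u) gmodule = "('h, 'u) module" +
  grade :: "int \<Rightarrow> 'u set"

definition finitely_generated :: "('h, 'm) ring_scheme \<Rightarrow> ('h, 'u, 'z) module_scheme \<Rightarrow> bool" where
  "finitely_generated R M \<longleftrightarrow> (\<exists>S \<subseteq> carrier M. finite S \<and>
     carrier M = generate (add_monoid M) {a \<odot>\<^bsub>M\<^esub> s |a s. a \<in> carrier R \<and> s \<in> S})"

definition graded_by :: "('u, 'z) ring_scheme \<Rightarrow> (int \<Rightarrow> 'u set) \<Rightarrow> bool" where
  "graded_by M G \<longleftrightarrow> (\<forall>d. subgroup (G d) (add_monoid M)) \<and>
     (\<forall>x\<in>carrier M. \<exists>!f. (\<forall>d. f d \<in> G d) \<and> finite {d. f d \<noteq> \<zero>\<^bsub>M\<^esub>} \<and>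
        x = finsum M f {d. f d \<noteq> \<zero>\<^bsub>M\<^esub>})"

definition fg_graded_module :: "('i, 'k::{comm_ring,comm_monoid_mult}) klr_datum \<Rightarrow> 'i multiset
    \<Rightarrow> (('i, 'k) klr, 'u) gmodule \<Rightarrow> bool" where
  "fg_graded_module D \<beta> M \<longleftrightarrow> left_module (KLR D \<beta>) M \<and> finitely_generated (KLR D \<beta>) M \<and>
     graded_by M (grade M) \<and>
     (\<forall>d e a x. klr_homogeneous D \<beta> d a \<longrightarrow> x \<in> grade M e \<longrightarrow> a \<odot>\<^bsub>M\<^esub> x \<in> grade M (d + e))"

definition linear_maps :: "('h, 'm) ring_scheme \<Rightarrow> ('h, 'u, 'y) module_scheme \<Rightarrow> ('h, 'v, 'z) module_scheme
    \<Rightarrow> ('u \<Rightarrow> 'v) set" where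
  "linear_maps R M N = {f \<in> carrier M \<rightarrow>\<^sub>E carrier N.
     (\<forall>x\<in>carrier M. \<forall>y\<in>carrier M. f (x \<oplus>\<^bsub>M\<^esub> y) = f x \<oplus>\<^bsub>N\<^esub> f y) \<and>
     (\<forall>a\<in>carrier R. \<forall>x\<in>carrier M. f (a \<odot>\<^bsub>M\<^esub> x) = a \<odot>\<^bsub>N\<^esub> f x)}"

section \<open>The categories \<open>\<H>\<close> and \<open>\<H>[i]\<close>\<close>

text \<open>
  So that the functors below are endofunctors, and can be iterated, all modules have their carrier
  in one type, closed under the constructions: \<open>Atom\<close> serves for arbitrary given modules (\<open>'a\<close> is
  arbitrary), \<open>Alg\<close> for free modules, and \<open>Tens [(h\<^sub>1, m\<^sub>1, n\<^sub>1), \<dots>]\<close> for the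
  sum of the \<open>h\<^sub>k \<otimes> m\<^sub>k \<otimes> n\<^sub>k\<close>. For the same reason a quotient has as its elements chosen
  representatives of the classes rather than the classes themselves.
\<close>

datatype ('h, 'a) elt = Atom 'a | Alg (unAlg: 'h) | Tens (unTens: "('h \<times> ('h, 'a) elt \<times> ('h, 'a) elt) list")

type_synonym ('i, 'k, 'a) kelt = "(('i, 'k) klr, 'a) elt"
type_synonym ('i, 'k, 'a) kmod = "(('i, 'k) klr, ('i, 'k, 'a) kelt) gmodule"

text \<open>An object of \<open>\<H>\<close>, the direct sum over \<open>\<beta>\<close> of the categories of \<open>H\<^sub>\<beta>\<close>-modules, is a family
  \<open>(M\<^sub>\<beta>)\<^sub>\<beta>\<close> of modules, almost all zero.\<close>

type_synonym ('i, 'k, 'a) obj = "'i multiset \<Rightarrow> ('i, 'k, 'a) kmod"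
type_synonym ('i, 'k, 'a) mor = "'i multiset \<Rightarrow> ('i, 'k, 'a) kelt \<Rightarrow> ('i, 'k, 'a) kelt"

definition Obj :: "('i, 'k::{comm_ring,comm_monoid_mult}) klr_datum \<Rightarrow> ('i, 'k, 'a) obj set" where
  "Obj D = {M. (\<forall>\<beta>. fg_graded_module D \<beta> (M \<beta>)) \<and> finite {\<beta>. carrier (M \<beta>) \<noteq> {\<zero>\<^bsub>M \<beta>\<^esub>}}}"

definition Hom :: "('i, 'k::{comm_ring,comm_monoid_mult}) klr_datum \<Rightarrow> ('i, 'k, 'a) obj \<Rightarrow> ('i, 'k, 'a) obj
    \<Rightarrow> ('i, 'k, 'a) mor set" where
  "Hom D M N = {f. \<forall>\<beta>. f \<beta> \<in> linear_maps (KLR D \<beta>) (M \<beta>) (N \<beta>) \<and>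
     (\<forall>d. f \<beta> ` grade (M \<beta>) d \<subseteq> grade (N \<beta>) d)}"

text \<open>\<open>H\<^sub>\<beta>\<^sup>i\<close>-modules are the \<open>H\<^sub>\<beta>\<close>-modules annihilated by the two-sided ideal \<open>(1\<^sub>\<beta>\<^sub>-\<^sub>i\<^sub>,\<^sub>i)\<close>.\<close>

definition Obj_i :: "('i, 'k::{comm_ring,comm_monoid_mult}) klr_datum \<Rightarrow> 'i \<Rightarrow> ('i, 'k, 'a) obj set" where
  "Obj_i D i = {M \<in> Obj D. \<forall>\<beta>. \<forall>a\<in>genideal (KLR D \<beta>) {klr_idem_at D i \<beta>}.
     \<forall>x\<in>carrier (M \<beta>). a \<odot>\<^bsub>M \<beta>\<^esub> x = \<zero>\<^bsub>M \<beta>\<^esub>}"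

definition iso_i :: "('i, 'k::{comm_ring,comm_monoid_mult}) klr_datum \<Rightarrow> 'i \<Rightarrow> ('i, 'k, 'a) obj \<Rightarrow> ('i, 'k, 'a) obj
    \<Rightarrow> ('i, 'k, 'a) mor set" where
  "iso_i D i M N = {f. M \<in> Obj_i D i \<and> N \<in> Obj_i D i \<and> f \<in> Hom D M N \<and>
     (\<exists>g\<in>Hom D N M. \<forall>\<beta>. (\<forall>x\<in>carrier (M \<beta>). g \<beta> (f \<beta> x) = x) \<and>
        (\<forall>y\<in>carrier (N \<beta>). f \<beta> (g \<beta> y) = y))}"

definition zero_module :: "('h, ('h, 'a) elt) gmodule" where
  "zero_module = \<lparr>carrier = {Tens []}, mult = undefined, one = undefined, zero = Tens [],
     add = (\<lambda>x y. Tens []), smult = (\<lambda>h x. Tens []), grade = (\<lambda>d. {Tens []})\<rparr>"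

section \<open>Induction product\<close>

definition triples :: "('i, 'k::{comm_ring,comm_monoid_mult}) klr_datum \<Rightarrow> 'i multiset \<Rightarrow> 'i multiset
    \<Rightarrow> ('i, 'k, 'a) kmod \<Rightarrow> ('i, 'k, 'a) kmod
    \<Rightarrow> (('i, 'k) klr \<times> ('i, 'k, 'a) kelt \<times> ('i, 'k, 'a) kelt) set" where
  "triples D \<beta> \<gamma> M N =
     {h \<otimes>\<^bsub>KLR D (\<beta> + \<gamma>)\<^esub> klr_idem D \<beta> \<gamma> |h. h \<in> carrier (KLR D (\<beta> + \<gamma>))} \<times> carrier M \<times> carrier N"

text \<open>
  \<open>H\<^sub>\<beta>\<^sub>+\<^sub>\<gamma>1\<^sub>\<beta>\<^sub>,\<^sub>\<gamma> \<otimes> (M \<otimes> N)\<close>, tensored over \<open>H\<^sub>\<beta> \<otimes> H\<^sub>\<gamma>\<close>, is the abelian group of formal sums of triples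
  \<open>h \<otimes> m \<otimes> n\<close> modulo additivity in each argument and \<open>h (y \<diamondop> z) \<otimes> m \<otimes> n = h \<otimes> y m \<otimes> z n\<close>. The
  relation \<open>h \<otimes> c m \<otimes> n = h \<otimes> m \<otimes> c n\<close> of \<open>M \<otimes>\<^sub>K N\<close> is an instance of the latter, as
  \<open>c 1\<^sub>\<beta> \<diamondop> 1\<^sub>\<gamma> = 1\<^sub>\<beta> \<diamondop> c 1\<^sub>\<gamma>\<close>. Negatives need no separate treatment: \<open>- (h \<otimes> m \<otimes> n) = (- h) \<otimes> m \<otimes> n\<close>.
\<close>

inductive tens_eq :: "('i, 'k::{comm_ring,comm_monoid_mult}) klr_datum \<Rightarrow> 'i multiset \<Rightarrow> 'i multiset
    \<Rightarrow> ('i, 'k, 'a) kmod \<Rightarrow> ('i, 'k, 'a) kmod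
    \<Rightarrow> (('i, 'k) klr \<times> ('i, 'k, 'a) kelt \<times> ('i, 'k, 'a) kelt) list
    \<Rightarrow> (('i, 'k) klr \<times> ('i, 'k, 'a) kelt \<times> ('i, 'k, 'a) kelt) list \<Rightarrow> bool"
  for D :: "('i, 'k) klr_datum" and \<beta> \<gamma> :: "'i multiset" and M N :: "('i, 'k, 'a) kmod" where
  refl: "xs \<in> lists (triples D \<beta> \<gamma> M N) \<Longrightarrow> tens_eq D \<beta> \<gamma> M N xs xs"
| sym: "tens_eq D \<beta> \<gamma> M N xs ys \<Longrightarrow> tens_eq D \<beta> \<gamma> M N ys xs"
| trans: "\<lbrakk>tens_eq D \<beta> \<gamma> M N xs ys; tens_eq D \<beta> \<gamma> M N ys zs\<rbrakk> \<Longrightarrow> tens_eq D \<beta> \<gamma> M N xs zs"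
| append: "\<lbrakk>tens_eq D \<beta> \<gamma> M N xs xs'; tens_eq D \<beta> \<gamma> M N ys ys'\<rbrakk> \<Longrightarrow> tens_eq D \<beta> \<gamma> M N (xs @ ys) (xs' @ ys')"
| commute: "\<lbrakk>xs \<in> lists (triples D \<beta> \<gamma> M N); ys \<in> lists (triples D \<beta> \<gamma> M N)\<rbrakk> \<Longrightarrow>
    tens_eq D \<beta> \<gamma> M N (xs @ ys) (ys @ xs)"
| zero: "(\<zero>\<^bsub>KLR D (\<beta> + \<gamma>)\<^esub>, m, n) \<in> triples D \<beta> \<gamma> M N \<Longrightarrow>
    tens_eq D \<beta> \<gamma> M N [(\<zero>\<^bsub>KLR D (\<beta> + \<gamma>)\<^esub>, m, n)] []"
| add1: "\<lbrakk>(h, m, n) \<in> triples D \<beta> \<gamma> M N; (h', m, n) \<in> triples D \<beta> \<gamma> M N\<rbrakk> \<Longrightarrow>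
    tens_eq D \<beta> \<gamma> M N [(h \<oplus>\<^bsub>KLR D (\<beta> + \<gamma>)\<^esub> h', m, n)] [(h, m, n), (h', m, n)]"
| add2: "\<lbrakk>(h, m, n) \<in> triples D \<beta> \<gamma> M N; (h, m', n) \<in> triples D \<beta> \<gamma> M N\<rbrakk> \<Longrightarrow>
    tens_eq D \<beta> \<gamma> M N [(h, m \<oplus>\<^bsub>M\<^esub> m', n)] [(h, m, n), (h, m', n)]"
| add3: "\<lbrakk>(h, m, n) \<in> triples D \<beta> \<gamma> M N; (h, m, n') \<in> triples D \<beta> \<gamma> M N\<rbrakk> \<Longrightarrow>
    tens_eq D \<beta> \<gamma> M N [(h, m, n \<oplus>\<^bsub>N\<^esub> n')] [(h, m, n), (h, m, n')]"
| balance: "\<lbrakk>(h, m, n) \<in> triples D \<beta> \<gamma> M N; y \<in> carrier (KLR D \<beta>); z \<in> carrier (KLR D \<gamma>)\<rbrakk> \<Longrightarrow>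
    tens_eq D \<beta> \<gamma> M N [(h \<otimes>\<^bsub>KLR D (\<beta> + \<gamma>)\<^esub> diamond D \<beta> \<gamma> y z, m, n)] [(h, y \<odot>\<^bsub>M\<^esub> m, z \<odot>\<^bsub>N\<^esub> n)]"

definition tens_class :: "('i, 'k::{comm_ring,comm_monoid_mult}) klr_datum \<Rightarrow> 'i multiset \<Rightarrow> 'i multiset
    \<Rightarrow> ('i, 'k, 'a) kmod \<Rightarrow> ('i, 'k, 'a) kmod
    \<Rightarrow> (('i, 'k) klr \<times> ('i, 'k, 'a) kelt \<times> ('i, 'k, 'a) kelt) list \<Rightarrow> ('i, 'k, 'a) kelt" where
  "tens_class D \<beta> \<gamma> M N xs = Tens (SOME ys. tens_eq D \<beta> \<gamma> M N xs ys)"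

definition ind_prod :: "('i, 'k::{comm_ring,comm_monoid_mult}) klr_datum \<Rightarrow> 'i multiset \<Rightarrow> 'i multiset
    \<Rightarrow> ('i, 'k, 'a) kmod \<Rightarrow> ('i, 'k, 'a) kmod \<Rightarrow> ('i, 'k, 'a) kmod" where
  "ind_prod D \<beta> \<gamma> M N = (let cl = tens_class D \<beta> \<gamma> M N in
     \<lparr>carrier = cl ` lists (triples D \<beta> \<gamma> M N), mult = undefined, one = undefined,
      zero = cl [],
      add = (\<lambda>x y. cl (unTens x @ unTens y)),
      smult = (\<lambda>a x. cl (map (\<lambda>(h, m, n). (a \<otimes>\<^bsub>KLR D (\<beta> + \<gamma>)\<^esub> h, m, n)) (unTens x))),
      grade = (\<lambda>d. cl ` lists {(h, m, n) \<in> triples D \<beta> \<gamma> M N.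
        \<exists>a b c. a + b + c = d \<and> klr_homogeneous D (\<beta> + \<gamma>) a h \<and> m \<in> grade M b \<and> n \<in> grade N c})\<rparr>)"

definition ind_prod_map :: "('i, 'k::{comm_ring,comm_monoid_mult}) klr_datum \<Rightarrow> 'i multiset \<Rightarrow> 'i multiset
    \<Rightarrow> ('i, 'k, 'a) kmod \<Rightarrow> ('i, 'k, 'a) kmod \<Rightarrow> ('i, 'k, 'a) kmod \<Rightarrow> ('i, 'k, 'a) kmod
    \<Rightarrow> (('i, 'k, 'a) kelt \<Rightarrow> ('i, 'k, 'a) kelt) \<Rightarrow> (('i, 'k, 'a) kelt \<Rightarrow> ('i, 'k, 'a) kelt)
    \<Rightarrow> ('i, 'k, 'a) kelt \<Rightarrow> ('i, 'k, 'a) kelt" where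
  "ind_prod_map D \<beta> \<gamma> M N M' N' f g = (\<lambda>x\<in>carrier (ind_prod D \<beta> \<gamma> M N).
     tens_class D \<beta> \<gamma> M' N' (map (\<lambda>(h, m, n). (h, f m, g n)) (unTens x)))"

section \<open>The functors\<close>

text \<open>The free \<open>H\<^sub>n\<^sub>i\<close>-module of rank one.\<close>

definition E_pow :: "('i, 'k::{comm_ring,comm_monoid_mult}) klr_datum \<Rightarrow> 'i \<Rightarrow> nat \<Rightarrow> ('i, 'k, 'a) kmod" where
  "E_pow D i n = (let R = KLR D (replicate_mset n i) in
     \<lparr>carrier = Alg ` carrier R, mult = undefined, one = undefined, zero = Alg \<zero>\<^bsub>R\<^esub>,
      add = (\<lambda>x y. Alg (unAlg x \<oplus>\<^bsub>R\<^esub> unAlg y)),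
      smult = (\<lambda>a x. Alg (a \<otimes>\<^bsub>R\<^esub> unAlg x)),
      grade = (\<lambda>d. Alg ` {a. klr_homogeneous D (replicate_mset n i) d a})\<rparr>)"

text \<open>\<open>M \<mapsto> E\<^sub>i\<^sup>nM\<close>. As \<open>E\<^sub>i\<^sup>n\<close> is concentrated in weight \<open>ni\<close>, the component of \<open>E\<^sub>i\<^sup>nM\<close> in weight
  \<open>\<gamma>\<close> is the product of \<open>E\<^sub>i\<^sup>n\<close> and the component of \<open>M\<close> in weight \<open>\<gamma> - ni\<close>.\<close>

definition E_prod :: "('i, 'k::{comm_ring,comm_monoid_mult}) klr_datum \<Rightarrow> 'i \<Rightarrow> nat \<Rightarrow> ('i, 'k, 'a) obj \<Rightarrow> ('i, 'k, 'a) obj" where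
  "E_prod D i n M = (\<lambda>\<gamma>. let \<delta> = replicate_mset n i in
     if \<delta> \<subseteq># \<gamma> then ind_prod D \<delta> (\<gamma> - \<delta>) (E_pow D i n) (M (\<gamma> - \<delta>)) else zero_module)"

definition E_prod_map :: "('i, 'k::{comm_ring,comm_monoid_mult}) klr_datum \<Rightarrow> 'i \<Rightarrow> nat
    \<Rightarrow> (('i, 'k, 'a) kelt \<Rightarrow> ('i, 'k, 'a) kelt)
    \<Rightarrow> ('i, 'k, 'a) obj \<Rightarrow> ('i, 'k, 'a) obj \<Rightarrow> ('i, 'k, 'a) mor \<Rightarrow> ('i, 'k, 'a) mor" where
  "E_prod_map D i n e M N f = (\<lambda>\<gamma>. let \<delta> = replicate_mset n i in
     if \<delta> \<subseteq># \<gamma> then ind_prod_map D \<delta> (\<gamma> - \<delta>) (E_pow D i n) (M (\<gamma> - \<delta>)) (E_pow D i n) (N (\<gamma> - \<delta>)) e (f (\<gamma> - \<delta>))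
     else (\<lambda>x\<in>carrier zero_module. x))"

definition pi_sub :: "('i, 'k::{comm_ring,comm_monoid_mult}) klr_datum \<Rightarrow> 'i \<Rightarrow> 'i multiset
    \<Rightarrow> ('i, 'k, 'a) kmod \<Rightarrow> ('i, 'k, 'a) kelt set" where  \<comment> \<open>\<open>H\<^sub>\<beta>1\<^sub>\<beta>\<^sub>-\<^sub>i\<^sub>,\<^sub>iM\<close>\<close>
  "pi_sub D i \<beta> M = generate (add_monoid M)
     {a \<odot>\<^bsub>M\<^esub> (klr_idem_at D i \<beta> \<odot>\<^bsub>M\<^esub> x) |a x. a \<in> carrier (KLR D \<beta>) \<and> x \<in> carrier M}"

definition pi_class :: "('i, 'k::{comm_ring,comm_monoid_mult}) klr_datum \<Rightarrow> 'i \<Rightarrow> 'i multiset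
    \<Rightarrow> ('i, 'k, 'a) kmod \<Rightarrow> ('i, 'k, 'a) kelt \<Rightarrow> ('i, 'k, 'a) kelt" where
  "pi_class D i \<beta> M x = (SOME y. y \<in> pi_sub D i \<beta> M +>\<^bsub>M\<^esub> x)"

definition pi_mod :: "('i, 'k::{comm_ring,comm_monoid_mult}) klr_datum \<Rightarrow> 'i \<Rightarrow> 'i multiset
    \<Rightarrow> ('i, 'k, 'a) kmod \<Rightarrow> ('i, 'k, 'a) kmod" where
  "pi_mod D i \<beta> M = (let cl = pi_class D i \<beta> M in
     \<lparr>carrier = cl ` carrier M, mult = undefined, one = undefined, zero = cl \<zero>\<^bsub>M\<^esub>,
      add = (\<lambda>x y. cl (x \<oplus>\<^bsub>M\<^esub> y)), smult = (\<lambda>a x. cl (a \<odot>\<^bsub>M\<^esub> x)), grade = (\<lambda>d. cl ` grade M d)\<rparr>)"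

definition pi_obj :: "('i, 'k::{comm_ring,comm_monoid_mult}) klr_datum \<Rightarrow> 'i \<Rightarrow> ('i, 'k, 'a) obj \<Rightarrow> ('i, 'k, 'a) obj" where
  "pi_obj D i M = (\<lambda>\<beta>. pi_mod D i \<beta> (M \<beta>))"

definition pi_map :: "('i, 'k::{comm_ring,comm_monoid_mult}) klr_datum \<Rightarrow> 'i
    \<Rightarrow> ('i, 'k, 'a) obj \<Rightarrow> ('i, 'k, 'a) obj \<Rightarrow> ('i, 'k, 'a) mor \<Rightarrow> ('i, 'k, 'a) mor" where
  "pi_map D i M N f = (\<lambda>\<beta>. \<lambda>x\<in>carrier (pi_mod D i \<beta> (M \<beta>)). pi_class D i \<beta> (N \<beta>) (f \<beta> x))"

definition piE :: "('i, 'k::{comm_ring,comm_monoid_mult}) klr_datum \<Rightarrow> 'i \<Rightarrow> nat \<Rightarrow> ('i, 'k, 'a) obj \<Rightarrow> ('i, 'k, 'a) obj" where  \<comment> \<open>\<open>M \<mapsto> \<pi>\<^sub>i(E\<^sub>i\<^sup>nM)\<close>\<close>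
  "piE D i n M = pi_obj D i (E_prod D i n M)"

definition piE_map :: "('i, 'k::{comm_ring,comm_monoid_mult}) klr_datum \<Rightarrow> 'i \<Rightarrow> nat
    \<Rightarrow> (('i, 'k, 'a) kelt \<Rightarrow> ('i, 'k, 'a) kelt)
    \<Rightarrow> ('i, 'k, 'a) obj \<Rightarrow> ('i, 'k, 'a) obj \<Rightarrow> ('i, 'k, 'a) mor \<Rightarrow> ('i, 'k, 'a) mor" where
  "piE_map D i n e M N f = pi_map D i (E_prod D i n M) (E_prod D i n N) (E_prod_map D i n e M N f)"

definition id_mor :: "('i, 'k, 'a) obj \<Rightarrow> ('i, 'k, 'a) mor" where
  "id_mor M = (\<lambda>\<beta>. \<lambda>x\<in>carrier (M \<beta>). x)"

definition ad :: "('i, 'k::{comm_ring,comm_monoid_mult}) klr_datum \<Rightarrow> 'i \<Rightarrow> ('i, 'k, 'a) obj \<Rightarrow> ('i, 'k, 'a) obj" where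
  "ad D i M = piE D i 1 M"

definition ad_map :: "('i, 'k::{comm_ring,comm_monoid_mult}) klr_datum \<Rightarrow> 'i
    \<Rightarrow> ('i, 'k, 'a) obj \<Rightarrow> ('i, 'k, 'a) obj \<Rightarrow> ('i, 'k, 'a) mor \<Rightarrow> ('i, 'k, 'a) mor" where
  "ad_map D i M N f = piE_map D i 1 (\<lambda>x. x) M N f"

primrec ad_pow_map :: "('i, 'k::{comm_ring,comm_monoid_mult}) klr_datum \<Rightarrow> 'i \<Rightarrow> nat
    \<Rightarrow> ('i, 'k, 'a) obj \<Rightarrow> ('i, 'k, 'a) obj \<Rightarrow> ('i, 'k, 'a) mor \<Rightarrow> ('i, 'k, 'a) mor" where
  "ad_pow_map D i 0 M N f = f"
| "ad_pow_map D i (Suc n) M N f =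
     ad_map D i ((ad D i ^^ n) M) ((ad D i ^^ n) N) (ad_pow_map D i n M N f)"

definition right_mult :: "('i, 'k::{comm_ring,comm_monoid_mult}) klr_datum \<Rightarrow> 'i \<Rightarrow> nat \<Rightarrow> ('i, 'k) klr
    \<Rightarrow> ('i, 'k, 'a) kelt \<Rightarrow> ('i, 'k, 'a) kelt" where
  "right_mult D i n a = (\<lambda>x. Alg (unAlg x \<otimes>\<^bsub>KLR D (replicate_mset n i)\<^esub> a))"

section \<open>Canonical generators\<close>

text \<open>\<open>piE_gen D i n M \<beta> m\<close> is the class of \<open>1\<^sub>n\<^sub>i\<^sub>,\<^sub>\<beta> \<otimes> 1\<^sub>n\<^sub>i \<otimes> m\<close> in \<open>\<pi>\<^sub>i(E\<^sub>i\<^sup>nM)\<close>, and \<open>ad_gen D i M \<beta> m n\<close>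
  is obtained from \<open>m\<close> by \<open>n\<close>-fold iteration of this construction for \<open>E\<^sub>i\<close>. These elements
  generate the respective modules over the KLR algebras, so a natural transformation is determined
  by its values on them.\<close>

definition piE_gen :: "('i, 'k::{comm_ring,comm_monoid_mult}) klr_datum \<Rightarrow> 'i \<Rightarrow> nat \<Rightarrow> ('i, 'k, 'a) obj
    \<Rightarrow> 'i multiset \<Rightarrow> ('i, 'k, 'a) kelt \<Rightarrow> ('i, 'k, 'a) kelt" where
  "piE_gen D i n M \<beta> m = (let \<delta> = replicate_mset n i in
     pi_class D i (\<delta> + \<beta>) (E_prod D i n M (\<delta> + \<beta>))
       (tens_class D \<delta> \<beta> (E_pow D i n) (M \<beta>) [(klr_idem D \<delta> \<beta>, Alg \<one>\<^bsub>KLR D \<delta>\<^esub>, m)]))"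

primrec ad_gen :: "('i, 'k::{comm_ring,comm_monoid_mult}) klr_datum \<Rightarrow> 'i \<Rightarrow> ('i, 'k, 'a) obj
    \<Rightarrow> 'i multiset \<Rightarrow> ('i, 'k, 'a) kelt \<Rightarrow> nat \<Rightarrow> ('i, 'k, 'a) kelt" where
  "ad_gen D i M \<beta> m 0 = m"
| "ad_gen D i M \<beta> m (Suc n) =
     piE_gen D i 1 ((ad D i ^^ n) M) (replicate_mset n i + \<beta>) (ad_gen D i M \<beta> m n)"

section \<open>Natural transformations\<close>

text \<open>\<open>F\<close> and \<open>G\<close> are the action on objects of two endofunctors of \<open>\<H>[i]\<close>, \<open>F1\<close> and \<open>G1\<close> their
  action on morphisms; \<open>F1 M N f\<close> is the image of \<open>f : M \<rightarrow> N\<close>.\<close>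

type_synonym ('i, 'k, 'a) functor_obj = "('i, 'k, 'a) obj \<Rightarrow> ('i, 'k, 'a) obj"
type_synonym ('i, 'k, 'a) functor_mor = "('i, 'k, 'a) obj \<Rightarrow> ('i, 'k, 'a) obj \<Rightarrow> ('i, 'k, 'a) mor \<Rightarrow> ('i, 'k, 'a) mor"

definition natural :: "('i, 'k::{comm_ring,comm_monoid_mult}) klr_datum \<Rightarrow> 'i
    \<Rightarrow> ('i, 'k, 'a) functor_obj \<Rightarrow> ('i, 'k, 'a) functor_mor \<Rightarrow> ('i, 'k, 'a) functor_mor
    \<Rightarrow> (('i, 'k, 'a) obj \<Rightarrow> ('i, 'k, 'a) mor) \<Rightarrow> bool" where
  "natural D i F F1 G1 \<phi> \<longleftrightarrow> (\<forall>M\<in>Obj_i D i. \<forall>N\<in>Obj_i D i. \<forall>f\<in>Hom D M N. \<forall>\<beta>. \<forall>x\<in>carrier (F M \<beta>).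
     \<phi> N \<beta> (F1 M N f \<beta> x) = G1 M N f \<beta> (\<phi> M \<beta> x))"

definition nat_iso :: "('i, 'k::{comm_ring,comm_monoid_mult}) klr_datum \<Rightarrow> 'i
    \<Rightarrow> ('i, 'k, 'a) functor_obj \<Rightarrow> ('i, 'k, 'a) functor_mor \<Rightarrow> ('i, 'k, 'a) functor_obj \<Rightarrow> ('i, 'k, 'a) functor_mor
    \<Rightarrow> (('i, 'k, 'a) obj \<Rightarrow> ('i, 'k, 'a) mor) \<Rightarrow> bool" where
  "nat_iso D i F F1 G G1 \<phi> \<longleftrightarrow>
     (\<forall>M\<in>Obj_i D i. \<phi> M \<in> iso_i D i (F M) (G M)) \<and> natural D i F F1 G1 \<phi>"

text \<open>The algebra of natural endomorphisms of arbitrary degree. Their components are \<open>H\<^sub>\<beta>\<close>-linear,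
  hence \<open>K\<close>-linear, but need not preserve degrees.\<close>

definition nat_End :: "('i, 'k::{comm_ring,comm_monoid_mult}) klr_datum \<Rightarrow> 'i
    \<Rightarrow> ('i, 'k, 'a) functor_obj \<Rightarrow> ('i, 'k, 'a) functor_mor
    \<Rightarrow> (('i, 'k, 'a) obj \<Rightarrow> ('i, 'k, 'a) mor) ring" where
  "nat_End D i F F1 =
     \<lparr>carrier = {\<alpha> \<in> extensional (Obj_i D i).
        (\<forall>M\<in>Obj_i D i. \<forall>\<beta>. \<alpha> M \<beta> \<in> linear_maps (KLR D \<beta>) (F M \<beta>) (F M \<beta>)) \<and> natural D i F F1 F1 \<alpha>},
      mult = (\<lambda>\<alpha> \<alpha>'. \<lambda>M\<in>Obj_i D i. \<lambda>\<beta>. \<lambda>x\<in>carrier (F M \<beta>). \<alpha> M \<beta> (\<alpha>' M \<beta> x)),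
      one = (\<lambda>M\<in>Obj_i D i. id_mor (F M)),
      zero = (\<lambda>M\<in>Obj_i D i. \<lambda>\<beta>. \<lambda>x\<in>carrier (F M \<beta>). \<zero>\<^bsub>F M \<beta>\<^esub>),
      add = (\<lambda>\<alpha> \<alpha>'. \<lambda>M\<in>Obj_i D i. \<lambda>\<beta>. \<lambda>x\<in>carrier (F M \<beta>). \<alpha> M \<beta> x \<oplus>\<^bsub>F M \<beta>\<^esub> \<alpha>' M \<beta> x)\<rparr>"

definition nat_End_scale :: "('i, 'k::{comm_ring,comm_monoid_mult}) klr_datum \<Rightarrow> 'i
    \<Rightarrow> ('i, 'k, 'a) functor_obj \<Rightarrow> 'k \<Rightarrow> (('i, 'k, 'a) obj \<Rightarrow> ('i, 'k, 'a) mor)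
    \<Rightarrow> ('i, 'k, 'a) obj \<Rightarrow> ('i, 'k, 'a) mor" where
  "nat_End_scale D i F c \<alpha> =
     (\<lambda>M\<in>Obj_i D i. \<lambda>\<beta>. \<lambda>x\<in>carrier (F M \<beta>). klr_scalar D \<beta> c \<odot>\<^bsub>F M \<beta>\<^esub> \<alpha> M \<beta> x)"

definition opposite_ring :: "'h ring \<Rightarrow> 'h ring" where
  "opposite_ring R = R\<lparr>mult := (\<lambda>x y. y \<otimes>\<^bsub>R\<^esub> x)\<rparr>"

text \<open>The endomorphism of \<open>ad\<^sup>n\<close> corresponding under \<open>\<phi> : ad\<^sup>n \<simeq> \<pi>\<^sub>i(E\<^sub>i\<^sup>n -)\<close> to right multiplication
  by \<open>a\<close> on \<open>E\<^sub>i\<^sup>n\<close>.\<close>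

definition induced_endo :: "('i, 'k::{comm_ring,comm_monoid_mult}) klr_datum \<Rightarrow> 'i \<Rightarrow> nat
    \<Rightarrow> (('i, 'k, 'a) obj \<Rightarrow> ('i, 'k, 'a) mor) \<Rightarrow> ('i, 'k) klr \<Rightarrow> ('i, 'k, 'a) obj \<Rightarrow> ('i, 'k, 'a) mor" where
  "induced_endo D i n \<phi> a = (\<lambda>M\<in>Obj_i D i. \<lambda>\<beta>. \<lambda>x\<in>carrier ((ad D i ^^ n) M \<beta>).
     inv_into (carrier ((ad D i ^^ n) M \<beta>)) (\<phi> M \<beta>)
       (piE_map D i n (right_mult D i n a) M M (id_mor M) \<beta> (\<phi> M \<beta> x)))"

end

theory Submission imports Defs begin

text \<open>
  Both \<open>\<pi>\<^sub>i(E\<^sub>i\<^sup>nM)\<close> and \<open>ad\<^sup>n(M)\<close> represent the same functor on modules \<open>N\<close> killed by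
  \<open>1\<^sub>\<gamma>\<^sub>-\<^sub>i\<^sub>,\<^sub>i\<close>: the additive maps \<open>s : M \<rightarrow> N\<close> with \<open>s(z m) = (1\<^sub>n\<^sub>i \<diamondop> z) s(m)\<close>. For the former this is
  the universal property of the tensor product and of the quotient. For the latter it follows by
  induction on \<open>n\<close>: such an \<open>s\<close> takes values in \<open>1\<^sub>i\<^sub>,\<^sub>\<gamma>N\<close>, which is again killed by the idempotent in
  question when viewed as an \<open>H\<^sub>\<gamma>\<close>-module through \<open>z \<mapsto> 1\<^sub>i \<diamondop> z\<close>, and \<open>1\<^sub>i \<diamondop> 1\<^sub>n\<^sub>i = 1\<^sub>(\<^sub>n\<^sub>+\<^sub>1\<^sub>)\<^sub>i\<close>. The
  resulting isomorphism matches the canonical generators, on which right multiplication by \<open>a\<close> is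
  the action of \<open>a \<diamondop> 1\<close>; all identities between maps are checked on these generators.
\<close>

section \<open>Free algebras and the ideal of relations\<close>

text \<open>The algebra \<open>KLR D \<beta>\<close> is given by generators and relations only, and
  no basis is used. Every map out of it, its degree projections included, is built on the free
  algebra and checked on relators. A graded module must have unique homogeneous decompositions, so
  each construction (algebra, induction product, quotient) needs projections of its own before it
  counts as an object; much of the length comes from this. The universal property carries two
  clauses on degrees, which make the comparison maps homogeneous of degree 0, while its test modules
  are ungraded. That restriction to \<open>1_{i,\<gamma>}N\<close> stays in the class of killed
  modules rests on one identity: a sequence that begins and ends with i in particular ends with i,
  so \<open>1_{\<gamma>,i}\<close> absorbs \<open>1_i \<diamondop> 1_{\<gamma>-i,i}\<close> on its
  right. The opposite algebra appears because linear maps that multiply generators by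
  \<open>a \<diamondop> 1\<close> compose in reverse order. In weights not of the form ni + \<beta>
  there are no generators; both modules vanish there.\<close>

lemma set_plus_list: "w + v = w @ v" for w v :: "'a list"
  by (simp add: plus_list_def)

lemma single_times_single [simp]:
  "Poly_Mapping.single u a * Poly_Mapping.single v b = Poly_Mapping.single (u @ v) (a * b)"
  for a b :: "'k::{comm_ring,comm_monoid_mult}"
  by (simp add: mult_single set_plus_list)

lemma poly_mapping_sum_singles: "p = (\<Sum>w\<in>Poly_Mapping.keys p. Poly_Mapping.single w (Poly_Mapping.lookup p w))"
  by (rule poly_mapping_eqI) (auto simp: lookup_sum lookup_single when_def sum.delta' in_keys_iff)

text \<open>The coefficient \<open>1\<close> may equal \<open>0\<close>, so the unit is treated as
  the monomial \<open>mon []\<close>; both laws follow from those for monomials by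
  distributivity.\<close>

lemma mon_Nil_mult [simp]:
  fixes p :: "'g list \<Rightarrow>\<^sub>0 'k::{comm_ring,comm_monoid_mult}"
  shows "mon [] * p = p" "p * mon [] = p"
proof -
  show "mon [] * p = p"
    by (subst (1 2) poly_mapping_sum_singles[of p]) (simp add: sum_distrib_left)
  show "p * mon [] = p"
    by (subst (1 2) poly_mapping_sum_singles[of p]) (simp add: sum_distrib_right)
qed

text \<open>Coefficients commute, and the empty word commutes with every word, so scalars are
  central in the free algebra. This lets coefficients move to the front in spans and
  substitutions.\<close>

lemma scalar_commute:
  fixes p :: "'g list \<Rightarrow>\<^sub>0 'k::{comm_ring,comm_monoid_mult}"
  shows "p * Poly_Mapping.single [] c = Poly_Mapping.single [] c * p"
  by (subst (1 2) poly_mapping_sum_singles[of p]) (simp add: sum_distrib_left sum_distrib_right mult.commute)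

abbreviation free_carrier :: "'g set \<Rightarrow> ('g list \<Rightarrow>\<^sub>0 'k::{comm_ring,comm_monoid_mult}) set" where
  "free_carrier S \<equiv> carrier (free_algebra S)"

lemma free_algebra_simps [simp]:
  "mult (free_algebra S) = (\<lambda>p q. p * q)" "one (free_algebra S) = mon []"
  "zero (free_algebra S) = 0" "add (free_algebra S) = (\<lambda>p q. p + q)"
  by (simp_all add: free_algebra_def)

lemma free_carrier_iff: "p \<in> free_carrier S \<longleftrightarrow> (\<forall>w\<in>Poly_Mapping.keys p. set w \<subseteq> S)"
  by (simp add: free_algebra_def)

lemma free_carrier_single [simp, intro]: "set w \<subseteq> S \<Longrightarrow> Poly_Mapping.single w c \<in> free_carrier S"
  by (auto simp: free_carrier_iff)

lemma free_carrier_zero [simp, intro]: "0 \<in> free_carrier S"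
  by (simp add: free_carrier_iff)

lemma free_carrier_add [simp, intro]:
  "p \<in> free_carrier S \<Longrightarrow> q \<in> free_carrier S \<Longrightarrow> p + q \<in> free_carrier S"
  using keys_add[of p q] by (fastforce simp: free_carrier_iff)

lemma free_carrier_uminus [simp, intro]: "p \<in> free_carrier S \<Longrightarrow> - p \<in> free_carrier S"
  by (simp add: free_carrier_iff in_keys_iff)

lemma free_carrier_diff [simp, intro]:
  "p \<in> free_carrier S \<Longrightarrow> q \<in> free_carrier S \<Longrightarrow> p - q \<in> free_carrier S"
  using free_carrier_add[of p S "- q"] free_carrier_uminus[of q S] by simp

lemma free_carrier_sum [simp, intro]: "(\<And>x. x \<in> A \<Longrightarrow> f x \<in> free_carrier S) \<Longrightarrow> sum f A \<in> free_carrier S"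
  by (induction A rule: infinite_finite_induct) auto

lemma free_carrier_mult [simp, intro]:
  assumes "p \<in> free_carrier S" "q \<in> free_carrier S"
  shows "p * q \<in> free_carrier S"
  using keys_mult[of p q] assms by (fastforce simp: free_carrier_iff set_plus_list)

text \<open>Additive statements over the free algebra on \<open>S\<close> are checked on monomials.
  In the additive case the summands are known to lie in the carrier, as congruences modulo relations
  require.\<close>

lemma free_carrier_induct [consumes 1, case_names single zero add]:
  assumes "p \<in> free_carrier S"
    and "\<And>w c. set w \<subseteq> S \<Longrightarrow> P (Poly_Mapping.single w c)"
    and "P 0"
    and "\<And>p q. p \<in> free_carrier S \<Longrightarrow> q \<in> free_carrier S \<Longrightarrow> P p \<Longrightarrow> P q \<Longrightarrow> P (p + q)"
  shows "P p"
proof -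
  have "P (\<Sum>w\<in>A. Poly_Mapping.single w (Poly_Mapping.lookup p w))" if "A \<subseteq> Poly_Mapping.keys p" for A
    using finite_subset[OF that finite_keys] that
  proof (induction A rule: finite_induct)
    case (insert w A)
    then show ?case
      using assms(1) by (auto intro!: assms(2,4) simp: free_carrier_iff[of p] intro!: free_carrier_sum free_carrier_single)
  qed (simp add: assms(3))
  from this[OF order_refl] show ?thesis
    by (simp flip: poly_mapping_sum_singles)
qed

lemma ring_free_algebra: "ring (free_algebra S)"
proof (rule ringI)
  show "abelian_group (free_algebra S)"
  proof (rule abelian_groupI)
    show "\<exists>y\<in>free_carrier S. y \<oplus>\<^bsub>free_algebra S\<^esub> x = \<zero>\<^bsub>free_algebra S\<^esub>" if "x \<in> free_carrier S" for x
      using that by (auto intro!: bexI[of _ "- x"])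
  qed (auto simp: add_ac)
  show "monoid (free_algebra S)"
    by (rule monoidI) (auto simp: mult.assoc)
qed (auto simp: algebra_simps)

lemma free_a_inv: "p \<in> free_carrier S \<Longrightarrow> \<ominus>\<^bsub>free_algebra S\<^esub> p = - p"
proof -
  interpret ring "free_algebra S" by (rule ring_free_algebra)
  show "p \<in> free_carrier S \<Longrightarrow> \<ominus>\<^bsub>free_algebra S\<^esub> p = - p"
    using minus_equality[of "- p" p] by auto
qed

text \<open>Serves both the substitutions (\<open>subst_free\<close>) and the degree projections
  (\<open>klr_proj\<close>), which differ only in the function on words that is extended
  linearly.\<close>

definition lin_ext :: "('g list \<Rightarrow> 'h list \<Rightarrow>\<^sub>0 'k) \<Rightarrow> ('g list \<Rightarrow>\<^sub>0 'k::{comm_ring,comm_monoid_mult}) \<Rightarrow> 'h list \<Rightarrow>\<^sub>0 'k" where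
  "lin_ext F p = (\<Sum>w\<in>Poly_Mapping.keys p. Poly_Mapping.single [] (Poly_Mapping.lookup p w) * F w)"

text \<open>Words outside the support contribute 0, so two polynomials can be expanded over a common
  finite set of words, where additivity is termwise.\<close>

lemma lin_ext_superset:
  assumes "finite A" "Poly_Mapping.keys p \<subseteq> A"
  shows "lin_ext F p = (\<Sum>w\<in>A. Poly_Mapping.single [] (Poly_Mapping.lookup p w) * F w)"
  unfolding lin_ext_def using assms by (intro sum.mono_neutral_left) (auto simp: in_keys_iff)

lemma lin_ext_single [simp]: "lin_ext F (Poly_Mapping.single w c) = Poly_Mapping.single [] c * F w"
  by (subst lin_ext_superset[of "{w}"]) auto

lemma lin_ext_zero [simp]: "lin_ext F 0 = 0"
  by (simp add: lin_ext_def)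

lemma lin_ext_add: "lin_ext F (p + q) = lin_ext F p + lin_ext F q"
  by (subst (1 2 3) lin_ext_superset[of "Poly_Mapping.keys p \<union> Poly_Mapping.keys q"])
    (use keys_add[of p q] in \<open>auto simp: lookup_add single_add algebra_simps sum.distrib\<close>)

lemma lin_ext_uminus: "lin_ext F (- p) = - lin_ext F p"
  using lin_ext_add[of F p "- p"] by (simp add: eq_neg_iff_add_eq_0 add.commute)

lemma lin_ext_diff: "lin_ext F (p - q) = lin_ext F p - lin_ext F q"
  using lin_ext_add[of F p "- q"] by (simp add: lin_ext_uminus)

lemma lin_ext_sum: "lin_ext F (sum f A) = (\<Sum>x\<in>A. lin_ext F (f x))"
  by (induction A rule: infinite_finite_induct) (auto simp: lin_ext_add)

lemma lin_ext_carrier: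
  assumes "p \<in> free_carrier S" "\<And>w. set w \<subseteq> S \<Longrightarrow> F w \<in> free_carrier T"
  shows "lin_ext F p \<in> free_carrier T"
  using assms(1) by (induction rule: free_carrier_induct) (auto simp: lin_ext_add intro!: assms(2) free_carrier_mult)

lemma subst_free_lin_ext: "subst_free f = lin_ext (\<lambda>w. foldr (\<lambda>g q. f g * q) w (mon []))"
  by (simp add: subst_free_def lin_ext_def fun_eq_iff)

lemma subst_word_append: "foldr (\<lambda>g q. f g * q) (v @ w) (mon []) =
    foldr (\<lambda>g q. f g * q) v (mon []) * foldr (\<lambda>g q. f g * (q :: 'h list \<Rightarrow>\<^sub>0 'k::{comm_ring,comm_monoid_mult})) w (mon [])"
  by (induction v) (auto simp: mult.assoc)

lemma subst_free_zero [simp]: "subst_free f 0 = 0"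
  by (simp add: subst_free_lin_ext)

lemma subst_free_add: "subst_free f (p + q) = subst_free f p + subst_free f q"
  by (simp add: subst_free_lin_ext lin_ext_add)

lemma subst_free_diff: "subst_free f (p - q) = subst_free f p - subst_free f q"
  by (simp add: subst_free_lin_ext lin_ext_diff)

lemma subst_free_uminus: "subst_free f (- p) = - subst_free f p"
  by (simp add: subst_free_lin_ext lin_ext_uminus)

lemma subst_free_sum: "subst_free f (sum h A) = (\<Sum>x\<in>A. subst_free f (h x))"
  by (simp add: subst_free_lin_ext lin_ext_sum)

lemma subst_free_single: "subst_free f (Poly_Mapping.single w c) =
    Poly_Mapping.single [] c * foldr (\<lambda>g q. f g * q) w (mon [])"
  by (simp add: subst_free_lin_ext)

lemma subst_free_Nil [simp]: "subst_free f (Poly_Mapping.single [] c) = Poly_Mapping.single [] c"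
  by (simp add: subst_free_single)

lemma free_carrier_UNIV: "p \<in> free_carrier UNIV"
  by (simp add: free_carrier_iff)

text \<open>On words this is \<open>subst_word_append\<close>; the coefficient of the right factor
  passes the image of the left word because scalars are central.\<close>

lemma subst_free_mult: "subst_free f (p * q) = subst_free f p * subst_free f q"
proof -
  have 1: "subst_free f (Poly_Mapping.single w c * q) = subst_free f (Poly_Mapping.single w c) * subst_free f q" for w c
    using free_carrier_UNIV[of q]
  proof (induction q rule: free_carrier_induct)
    case (single v b)
    have "subst_free f (Poly_Mapping.single w c * Poly_Mapping.single v b) =
        Poly_Mapping.single [] c * (Poly_Mapping.single [] b * foldr (\<lambda>g q. f g * q) w (mon [])) * foldr (\<lambda>g q. f g * q) v (mon [])"
      by (simp add: subst_free_single subst_word_append mult.assoc del: foldr_append) (simp flip: mult.assoc)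
    also have "\<dots> = subst_free f (Poly_Mapping.single w c) * subst_free f (Poly_Mapping.single v b)"
      unfolding subst_free_single by (simp only: mult.assoc[symmetric] scalar_commute[of "foldr (\<lambda>g q. f g * q) w (mon [])" b, symmetric])
    finally show ?case .
  qed (auto simp: algebra_simps subst_free_add)
  show ?thesis
    using free_carrier_UNIV[of p]
    by (induction p rule: free_carrier_induct) (auto simp: algebra_simps subst_free_add 1)
qed

lemma subst_word_carrier:
  assumes "\<And>g. g \<in> set w \<Longrightarrow> f g \<in> free_carrier T"
  shows "foldr (\<lambda>g q. f g * q) w (mon []) \<in> free_carrier T"
  using assms by (induction w) auto

lemma subst_free_carrier:
  assumes "p \<in> free_carrier S" "\<And>g. g \<in> S \<Longrightarrow> f g \<in> free_carrier T"
  shows "subst_free f p \<in> free_carrier T"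
  unfolding subst_free_lin_ext
  by (rule lin_ext_carrier[OF assms(1)]) (auto intro!: subst_word_carrier assms(2))

text \<open>The two-sided ideal generated by \<open>R\<close> in additive form. One coefficient on
  the left is enough as scalars are central, and \<open>u\<close>, \<open>v\<close> are words: an
  additive map kills the ideal once it kills these multiples \<open>u r v\<close>.\<close>

inductive_set free_span :: "'g set \<Rightarrow> ('g list \<Rightarrow>\<^sub>0 'k::{comm_ring,comm_monoid_mult}) set \<Rightarrow> ('g list \<Rightarrow>\<^sub>0 'k) set"
  for S :: "'g set" and R :: "('g list \<Rightarrow>\<^sub>0 'k) set" where
  base: "\<lbrakk>set u \<subseteq> S; set v \<subseteq> S; r \<in> R\<rbrakk> \<Longrightarrow> Poly_Mapping.single u c * r * mon v \<in> free_span S R"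
| zero: "0 \<in> free_span S R"
| add: "\<lbrakk>p \<in> free_span S R; q \<in> free_span S R\<rbrakk> \<Longrightarrow> p + q \<in> free_span S R"

lemma free_span_carrier:
  assumes "R \<subseteq> free_carrier S" "p \<in> free_span S R"
  shows "p \<in> free_carrier S"
  using assms(2) by (induction rule: free_span.induct) (use assms(1) in \<open>auto intro!: free_carrier_mult\<close>)

lemma free_span_mult_single:
  assumes "p \<in> free_span S R" "set w \<subseteq> S"
  shows "Poly_Mapping.single w c * p \<in> free_span S R" "p * Poly_Mapping.single w c \<in> free_span S R"
  using assms(1)
proof (induction rule: free_span.induct)
  case (base u v r b)
  {
    case 1
    show ?case
      using free_span.base[of "w @ u" S v r R "c * b"] base assms(2) by (simp flip: mult.assoc)
  next
    case 2
    have "Poly_Mapping.single u (c * b) * r * mon (v @ w) = Poly_Mapping.single u b * r * mon v * Poly_Mapping.single w c"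
    proof -
      have "Poly_Mapping.single u (c * b) * r * mon (v @ w) = Poly_Mapping.single [] c * (Poly_Mapping.single u b * r * mon v * mon w)"
        by (simp add: mult.assoc[symmetric]) (simp add: mult.assoc)
      also have "\<dots> = (Poly_Mapping.single u b * r * mon v * mon w) * Poly_Mapping.single [] c"
        by (simp add: scalar_commute)
      finally show ?thesis by (simp add: mult.assoc)
    qed
    then show ?case
      using free_span.base[of u S "v @ w" r R "c * b"] base assms(2) by simp
  }
next
  case zero
  { case 1 show ?case by (simp add: free_span.zero)
  next case 2 show ?case by (simp add: free_span.zero) }
next
  case (add p q)
  { case 1 show ?case using add by (auto simp: algebra_simps intro: free_span.add)
  next case 2 show ?case using add by (auto simp: algebra_simps intro: free_span.add) }
qed

lemma free_span_mult:
  assumes "p \<in> free_span S R" "q \<in> free_carrier S"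
  shows "q * p \<in> free_span S R" "p * q \<in> free_span S R"
  using assms(2)
proof (induction q rule: free_carrier_induct)
  case (single w c)
  { case 1 show ?case by (rule free_span_mult_single(1)[OF assms(1) single])
  next case 2 show ?case by (rule free_span_mult_single(2)[OF assms(1) single]) }
next
  case zero
  { case 1 show ?case by (simp add: free_span.zero)
  next case 2 show ?case by (simp add: free_span.zero) }
next
  case (add p q)
  { case 1 show ?case using add by (auto simp: algebra_simps intro: free_span.add)
  next case 2 show ?case using add by (auto simp: algebra_simps intro: free_span.add) }
qed

lemma free_span_uminus: 
  assumes "p \<in> free_span S R"
  shows "- p \<in> free_span S R"
proof -
  have "Poly_Mapping.single [] (- 1) * p \<in> free_span S R"
    using free_span_mult_single(1)[OF assms] by simp
  moreover have "Poly_Mapping.single [] (- 1) * p = - p"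
    by (simp add: single_uminus)
  ultimately show ?thesis by simp
qed

text \<open>The span is closed under multiplication by words, hence by polynomials, so it is an
  ideal containing \<open>R\<close>; conversely each \<open>u r v\<close> lies in every such
  ideal.\<close>

lemma genideal_free_algebra:
  assumes R: "R \<subseteq> free_carrier S"
  shows "genideal (free_algebra S) R = free_span S R"
proof
  interpret ring "free_algebra S" by (rule ring_free_algebra)
  have "ideal (free_span S R) (free_algebra S)"
  proof (rule idealI[OF ring_free_algebra])
    show "subgroup (free_span S R) (add_monoid (free_algebra S))"
    proof (rule group.subgroupI)
      show "group (add_monoid (free_algebra S))" by (rule a_group)
      show "inv\<^bsub>add_monoid (free_algebra S)\<^esub> a \<in> free_span S R" if "a \<in> free_span S R" for a
        using free_a_inv[OF free_span_carrier[OF R that]] free_span_uminus[OF that] by (simp add: a_inv_def)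
    qed (auto intro: free_span.add free_span.zero free_span_carrier[OF R])
  qed (auto intro: free_span_mult)
  moreover have "R \<subseteq> free_span S R"
    using free_span.base[of "[]" S "[]" _ R 1] by auto
  ultimately show "genideal (free_algebra S) R \<subseteq> free_span S R"
    by (rule genideal_minimal)
  have I: "ideal (genideal (free_algebra S) R) (free_algebra S)"
    by (rule genideal_ideal) (use R in auto)
  show "free_span S R \<subseteq> genideal (free_algebra S) R"
  proof
    fix p assume "p \<in> free_span S R"
    then show "p \<in> genideal (free_algebra S) R"
    proof (induction rule: free_span.induct)
      case (base u v r c)
      have "r \<in> genideal (free_algebra S) R"
        using genideal_self[OF R] base by auto
      then show ?case
        using ideal.I_l_closed[OF I, of r "Poly_Mapping.single u c"] ideal.I_r_closed[OF I, of _ "mon v"] base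
        by auto
    next
      case zero
      then show ?case using additive_subgroup.zero_closed[OF ideal.axioms(1)[OF I]] by simp
    next
      case (add p q)
      then show ?case using additive_subgroup.a_closed[OF ideal.axioms(1)[OF I], of p q] by simp
    qed
  qed
qed

section \<open>Sequences of given weight and the simple transpositions acting on them\<close>

lemma finite_seqs [simp]: "finite (seqs \<beta>)"
proof -
  have "seqs \<beta> \<subseteq> {xs. set xs \<subseteq> set_mset \<beta> \<and> length xs = size \<beta>}"
    by (auto simp: seqs_def)
  then show ?thesis
    by (rule finite_subset) (rule finite_lists_length_eq, simp)
qed

lemma seqs_length: "\<nu> \<in> seqs \<beta> \<Longrightarrow> length \<nu> = size \<beta>"
  by (auto simp: seqs_def)

lemma seqs_append: "\<mu> \<in> seqs \<beta> \<Longrightarrow> \<nu> \<in> seqs \<gamma> \<Longrightarrow> \<mu> @ \<nu> \<in> seqs (\<beta> + \<gamma>)"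
  by (auto simp: seqs_def)

text \<open>In weight ni there is a single idempotent \<open>1_\<nu>\<close>. Concatenation with it
  only prefixes n copies of i, which makes \<open>1_i \<diamondop> 1_{ni}\<close> comparable with
  \<open>1_{(n+1)i}\<close>.\<close>

lemma seqs_replicate: "seqs (replicate_mset n i) = {replicate n i}"
proof -
  have "\<nu> = replicate n i" if "mset \<nu> = replicate_mset n i" for \<nu>
  proof -
    have "length \<nu> = n"
      using arg_cong[OF that, of size] by simp
    moreover have "set \<nu> \<subseteq> {i}"
      using arg_cong[OF that, of set_mset] by (simp split: if_splits)
    ultimately show ?thesis
      using replicate_eqI[of \<nu> n i] by blast
  qed
  then show ?thesis by (auto simp: seqs_def)
qed

lemma seqs_empty [simp]: "seqs {#} = {[]}"
  by (auto simp: seqs_def)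

lemma seqs_single [simp]: "seqs {#i#} = {[i]}"
  using seqs_replicate[of 1 i] by simp

lemma length_swap_seq [simp]: "length (swap_seq k \<nu>) = length \<nu>"
  by (simp add: swap_seq_def)

lemma entry_append_left: "1 \<le> k \<Longrightarrow> k \<le> length \<mu> \<Longrightarrow> entry (\<mu> @ \<nu>) (length \<nu> + k) = entry \<mu> k"
  by (auto simp: entry_def nth_append)

lemma entry_append_right: "1 \<le> k \<Longrightarrow> k \<le> length \<nu> \<Longrightarrow> entry (\<mu> @ \<nu>) k = entry \<nu> k"
  by (auto simp: entry_def nth_append)

text \<open>Identities between sequences are reduced to positions counted from the right, where
  \<open>swap_seq\<close> becomes \<open>transpose\<close> and list indices disappear.\<close>

lemma entry_ext:
  assumes "length \<mu> = length \<nu>" "\<And>k. 1 \<le> k \<Longrightarrow> k \<le> length \<nu> \<Longrightarrow> entry \<mu> k = entry \<nu> k"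
  shows "\<mu> = \<nu>"
proof (rule nth_equalityI[OF assms(1)])
  fix j assume "j < length \<mu>"
  then show "\<mu> ! j = \<nu> ! j"
    using assms(2)[of "length \<nu> - j"] assms(1) by (simp add: entry_def)
qed

lemma entry_swap_seq:
  assumes "1 \<le> k" "k < length \<nu>" "1 \<le> l" "l \<le> length \<nu>"
  shows "entry (swap_seq k \<nu>) l = entry \<nu> (transpose k (k + 1) l)"
proof -
  consider "l = k" | "l = k + 1" | "l \<noteq> k" "l \<noteq> k + 1" by auto
  then show ?thesis
  proof cases
    case 1
    \<comment> \<open>The two list indices written by \<open>swap_seq\<close> are distinct and in
      range, so the second update does not overwrite the first.\<close>
    have "length \<nu> - (k + 1) \<noteq> length \<nu> - k" "length \<nu> - k < length \<nu>" using assms by auto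
    then show ?thesis using 1 by (simp add: entry_def[of "swap_seq k \<nu>" k]) (simp add: swap_seq_def)
  next
    case 2
    have "length \<nu> - (k + 1) < length \<nu>" using assms by auto
    then show ?thesis using 2 by (simp add: entry_def[of "swap_seq k \<nu>" "Suc k"]) (simp add: swap_seq_def)
  next
    case 3
    then have "length \<nu> - l \<noteq> length \<nu> - k" "length \<nu> - l \<noteq> length \<nu> - (k + 1)" using assms by auto
    then show ?thesis using 3 by (simp add: entry_def swap_seq_def transpose_def)
  qed
qed

lemma swap_seq_seqs: "\<nu> \<in> seqs \<beta> \<Longrightarrow> 1 \<le> k \<Longrightarrow> k < size \<beta> \<Longrightarrow> swap_seq k \<nu> \<in> seqs \<beta>"
  using mset_swap[of "length \<nu> - (k + 1)" \<nu> "length \<nu> - k"]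
  by (auto simp: seqs_def swap_seq_def entry_def)

lemma transpose_in: "1 \<le> k \<Longrightarrow> k < n \<Longrightarrow> l \<in> {1..n} \<Longrightarrow> transpose k (k + 1) l \<in> {1..n}" for k n l :: nat
  by (auto simp: transpose_def)

lemma swap_seq_swap_seq [simp]:
  assumes "1 \<le> k" "k < length \<nu>"
  shows "swap_seq k (swap_seq k \<nu>) = \<nu>"
proof (rule entry_ext)
  fix l assume l: "1 \<le> l" "l \<le> length \<nu>"
  then have "transpose k (k + 1) l \<in> {1..length \<nu>}"
    using transpose_in[of k "length \<nu>" l] assms by auto
  then show "entry (swap_seq k (swap_seq k \<nu>)) l = entry \<nu> l"
    using l assms by (simp add: entry_swap_seq)
qed simp

text \<open>Positions are counted from the right, so those of the left part \<open>\<mu>\<close>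
  start after \<open>length \<nu>\<close>, and the transposition moves nothing in the right
  part.\<close>

lemma swap_seq_append_left:
  assumes "1 \<le> k" "k < length \<mu>"
  shows "swap_seq (length \<nu> + k) (\<mu> @ \<nu>) = swap_seq k \<mu> @ \<nu>"
proof (rule entry_ext)
  fix l assume l: "1 \<le> l" "l \<le> length (swap_seq k \<mu> @ \<nu>)"
  show "entry (swap_seq (length \<nu> + k) (\<mu> @ \<nu>)) l = entry (swap_seq k \<mu> @ \<nu>) l"
  proof (cases "l \<le> length \<nu>")
    case True
    then show ?thesis
      using l assms by (subst entry_swap_seq) (auto simp: entry_append_right transpose_def)
  next
    case False
    define j where "j = l - length \<nu>"
    then have j: "l = length \<nu> + j" "1 \<le> j" "j \<le> length \<mu>" using False l by auto
    have "transpose (length \<nu> + k) (length \<nu> + k + 1) (length \<nu> + j) = length \<nu> + transpose k (k + 1) j"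
      by (auto simp: transpose_def)
    moreover have "transpose k (k + 1) j \<in> {1..length \<mu>}"
      using transpose_in[of k "length \<mu>" j] assms j by auto
    ultimately show ?thesis
      using j assms entry_append_left[of j "swap_seq k \<mu>" \<nu>]
      by (simp add: entry_swap_seq entry_append_left)
  qed
qed simp

lemma swap_seq_append_right:
  assumes "1 \<le> k" "k < length \<nu>"
  shows "swap_seq k (\<mu> @ \<nu>) = \<mu> @ swap_seq k \<nu>"
proof (rule entry_ext)
  fix l assume l: "1 \<le> l" "l \<le> length (\<mu> @ swap_seq k \<nu>)"
  show "entry (swap_seq k (\<mu> @ \<nu>)) l = entry (\<mu> @ swap_seq k \<nu>) l"
  proof (cases "l \<le> length \<nu>")
    case True
    moreover have "transpose k (k + 1) l \<in> {1..length \<nu>}"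
      using transpose_in[of k "length \<nu>" l] assms l True by auto
    ultimately show ?thesis
      using l assms entry_append_right[of l "swap_seq k \<nu>" \<mu>]
      by (simp add: entry_swap_seq entry_append_right)
  next
    case False
    define j where "j = l - length \<nu>"
    then have j: "l = length \<nu> + j" "1 \<le> j" "j \<le> length \<mu>" using False l by auto
    then show ?thesis
      using assms entry_append_left[of j \<mu> "swap_seq k \<nu>"] entry_append_left[of j \<mu> \<nu>]
      by (subst entry_swap_seq) (auto simp: transpose_def)
  qed
qed simp

text \<open>Only the support is recorded, since degrees are tested word by word. An inclusion is
  enough for that, so possible cancellation does no harm.\<close>

lemma keys_eval_pol: "Poly_Mapping.keys (eval_pol q k l) \<subseteq>
    (\<lambda>(s, t). replicate s (Dot k) @ replicate t (Dot l)) ` Poly_Mapping.keys q"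
  unfolding eval_pol_def by (rule order_trans[OF keys_sum]) (force split: if_splits)

lemma keys_div_diff: "Poly_Mapping.keys (div_diff q k) \<subseteq>
    {replicate r (Dot (k + 2)) @ replicate (s - 1 - r) (Dot k) @ replicate t (Dot (k + 1)) |r s t.
       (s, t) \<in> Poly_Mapping.keys q \<and> r < s}"
proof -
  have "Poly_Mapping.keys (\<Sum>r<s. Poly_Mapping.single (replicate r (Dot (k + 2)) @ replicate (s - 1 - r) (Dot k) @
       replicate t (Dot (k + 1))) (Poly_Mapping.lookup q (s, t))) \<subseteq>
    {replicate r (Dot (k + 2)) @ replicate (s - 1 - r) (Dot k) @ replicate t (Dot (k + 1)) |r. r < s}" for s t
    by (rule order_trans[OF keys_sum]) (auto split: if_splits)
  then show ?thesis
    unfolding div_diff_def by (intro order_trans[OF keys_sum]) fastforce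
qed

lemma eval_pol_carrier: "k \<in> {1..size \<beta>} \<Longrightarrow> l \<in> {1..size \<beta>} \<Longrightarrow> eval_pol q k l \<in> free_carrier (gens \<beta>)"
  using keys_eval_pol[of q k l] by (fastforce simp: free_carrier_iff gens_def)

lemma div_diff_carrier: "k \<ge> 1 \<Longrightarrow> k + 2 \<le> size \<beta> \<Longrightarrow> div_diff q k \<in> free_carrier (gens \<beta>)"
  unfolding div_diff_def
  by (intro free_carrier_sum) (auto intro!: free_carrier_sum free_carrier_single simp: gens_def split: prod.splits)

lemma gens_iff [simp]:
  "Idm \<nu> \<in> gens \<beta> \<longleftrightarrow> \<nu> \<in> seqs \<beta>"
  "Dot k \<in> gens \<beta> \<longleftrightarrow> 1 \<le> k \<and> k \<le> size \<beta>"
  "Cross k \<in> gens \<beta> \<longleftrightarrow> 1 \<le> k \<and> k < size \<beta>"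
  by (auto simp: gens_def)

lemma gens_cases:
  assumes "g \<in> gens \<beta>"
  obtains \<nu> where "g = Idm \<nu>" "\<nu> \<in> seqs \<beta>"
  | k where "g = Dot k" "1 \<le> k" "k \<le> size \<beta>"
  | k where "g = Cross k" "1 \<le> k" "k < size \<beta>"
  using assms by (auto simp: gens_def)

lemma relators_carrier: "r \<in> relators D \<beta> \<Longrightarrow> r \<in> free_carrier (gens \<beta>)"
proof (induction rule: relators.induct)
  case (cross_sq \<nu> k)
  then show ?case by (auto intro!: free_carrier_diff free_carrier_mult free_carrier_single eval_pol_carrier)
next
  case (cross_dot \<nu> k l)
  then show ?case
    using transpose_in[of k "size \<beta>" l] by (auto intro!: free_carrier_diff free_carrier_mult free_carrier_single)
next
  case (braid \<nu> k)
  then show ?case by (auto intro!: free_carrier_diff free_carrier_mult free_carrier_single div_diff_carrier)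
next
  case (cross_idem \<nu> k)
  then show ?case by (auto intro!: free_carrier_diff free_carrier_single swap_seq_seqs)
qed (auto intro!: free_carrier_diff free_carrier_mult free_carrier_single free_carrier_sum)

section \<open>The ideal of relations and computation modulo it\<close>

lemma klr_ideal_free_span: "klr_ideal D \<beta> = free_span (gens \<beta>) (relators D \<beta>)"
  unfolding klr_ideal_def by (rule genideal_free_algebra) (auto intro: relators_carrier)

lemma klr_ideal: "ideal (klr_ideal D \<beta>) (free_algebra (gens \<beta>))"
  unfolding klr_ideal_def
  by (rule ring.genideal_ideal[OF ring_free_algebra]) (auto intro: relators_carrier)

lemma ring_KLR: "ring (KLR D \<beta>)"
  unfolding KLR_def by (rule ideal.quotient_is_ring[OF klr_ideal])

lemma klr_ideal_zero: "0 \<in> klr_ideal D \<beta>"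
  by (simp add: klr_ideal_free_span free_span.zero)

lemma klr_ideal_add: "p \<in> klr_ideal D \<beta> \<Longrightarrow> q \<in> klr_ideal D \<beta> \<Longrightarrow> p + q \<in> klr_ideal D \<beta>"
  by (simp add: klr_ideal_free_span free_span.add)

lemma klr_ideal_uminus: "p \<in> klr_ideal D \<beta> \<Longrightarrow> - p \<in> klr_ideal D \<beta>"
  by (simp add: klr_ideal_free_span free_span_uminus)

lemma klr_ideal_mult:
  "p \<in> klr_ideal D \<beta> \<Longrightarrow> q \<in> free_carrier (gens \<beta>) \<Longrightarrow> q * p \<in> klr_ideal D \<beta>"
  "p \<in> klr_ideal D \<beta> \<Longrightarrow> q \<in> free_carrier (gens \<beta>) \<Longrightarrow> p * q \<in> klr_ideal D \<beta>"
  by (simp_all add: klr_ideal_free_span free_span_mult)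

lemma klr_ideal_relator: "r \<in> relators D \<beta> \<Longrightarrow> r \<in> klr_ideal D \<beta>"
  using free_span.base[of "[]" "gens \<beta>" "[]" r "relators D \<beta>" 1] by (simp add: klr_ideal_free_span)

lemma klr_ideal_carrier: "p \<in> klr_ideal D \<beta> \<Longrightarrow> p \<in> free_carrier (gens \<beta>)"
  unfolding klr_ideal_free_span by (rule free_span_carrier) (auto intro: relators_carrier)

text \<open>Calculations in \<open>KLR D \<beta>\<close> are carried out on representatives, as
  chains of congruences. Membership of both sides in the carrier is built in: for such
  representatives the relation is equality of classes (\<open>klr_class_eq_iff\<close>), and the
  carrier can be read off a congruence.\<close>

definition klr_cong :: "('i, 'k::{comm_ring,comm_monoid_mult}) klr_datum \<Rightarrow> 'i multiset \<Rightarrow> ('i, 'k) free \<Rightarrow> ('i, 'k) free \<Rightarrow> bool" where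
  "klr_cong D \<beta> p q \<longleftrightarrow> p \<in> free_carrier (gens \<beta>) \<and> q \<in> free_carrier (gens \<beta>) \<and> p - q \<in> klr_ideal D \<beta>"

lemma kc_refl: "p \<in> free_carrier (gens \<beta>) \<Longrightarrow> klr_cong D \<beta> p p"
  by (simp add: klr_cong_def klr_ideal_zero)

lemma kc_sym: "klr_cong D \<beta> p q \<Longrightarrow> klr_cong D \<beta> q p"
  using klr_ideal_uminus[of "p - q" D \<beta>] by (simp add: klr_cong_def)

lemma kc_trans [trans]: "klr_cong D \<beta> p q \<Longrightarrow> klr_cong D \<beta> q r \<Longrightarrow> klr_cong D \<beta> p r"
  using klr_ideal_add[of "p - q" D \<beta> "q - r"] by (simp add: klr_cong_def)

lemma kc_eq_trans [trans]: "klr_cong D \<beta> p q \<Longrightarrow> q = r \<Longrightarrow> klr_cong D \<beta> p r" "p = q \<Longrightarrow> klr_cong D \<beta> q r \<Longrightarrow> klr_cong D \<beta> p r"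
  by simp_all

lemma kc_add: "klr_cong D \<beta> p p' \<Longrightarrow> klr_cong D \<beta> q q' \<Longrightarrow> klr_cong D \<beta> (p + q) (p' + q')"
  using klr_ideal_add[of "p - p'" D \<beta> "q - q'"] by (auto simp: klr_cong_def algebra_simps)

lemma kc_uminus: "klr_cong D \<beta> p p' \<Longrightarrow> klr_cong D \<beta> (- p) (- p')"
  using klr_ideal_uminus[of "p - p'" D \<beta>] by (auto simp: klr_cong_def algebra_simps)

lemma kc_diff: "klr_cong D \<beta> p p' \<Longrightarrow> klr_cong D \<beta> q q' \<Longrightarrow> klr_cong D \<beta> (p - q) (p' - q')"
  using kc_add[of D \<beta> p p' "- q" "- q'"] kc_uminus[of D \<beta> q q'] by simp

text \<open>Uses \<open>p q - p' q' = (p - p') q + p' (q - q')\<close>, a sum of a right and a left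
  multiple of elements of the ideal.\<close>

lemma kc_mult:
  assumes "klr_cong D \<beta> p p'" "klr_cong D \<beta> q q'"
  shows "klr_cong D \<beta> (p * q) (p' * q')"
proof -
  have "(p - p') * q + p' * (q - q') \<in> klr_ideal D \<beta>"
    using assms by (intro klr_ideal_add klr_ideal_mult) (auto simp: klr_cong_def)
  then show ?thesis
    using assms by (auto simp: klr_cong_def algebra_simps)
qed

lemma kc_mult_left: "klr_cong D \<beta> q q' \<Longrightarrow> p \<in> free_carrier (gens \<beta>) \<Longrightarrow> klr_cong D \<beta> (p * q) (p * q')"
  by (auto intro: kc_mult kc_refl)

lemma kc_mult_right: "klr_cong D \<beta> q q' \<Longrightarrow> p \<in> free_carrier (gens \<beta>) \<Longrightarrow> klr_cong D \<beta> (q * p) (q' * p)"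
  by (auto intro: kc_mult kc_refl)

lemma kc_sum: "(\<And>x. x \<in> A \<Longrightarrow> klr_cong D \<beta> (f x) (g x)) \<Longrightarrow> klr_cong D \<beta> (sum f A) (sum g A)"
  by (induction A rule: infinite_finite_induct) (auto intro: kc_add kc_refl)

lemma kc_carrier: "klr_cong D \<beta> p q \<Longrightarrow> p \<in> free_carrier (gens \<beta>)" "klr_cong D \<beta> p q \<Longrightarrow> q \<in> free_carrier (gens \<beta>)"
  by (auto simp: klr_cong_def)

lemma kc_zero_iff: "klr_cong D \<beta> p 0 \<longleftrightarrow> p \<in> klr_ideal D \<beta>"
  by (auto simp: klr_cong_def klr_ideal_carrier)

lemma kc_zero_mult:
  "klr_cong D \<beta> q 0 \<Longrightarrow> p \<in> free_carrier (gens \<beta>) \<Longrightarrow> klr_cong D \<beta> (p * q) 0"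
  "klr_cong D \<beta> q 0 \<Longrightarrow> p \<in> free_carrier (gens \<beta>) \<Longrightarrow> klr_cong D \<beta> (q * p) 0"
  by (auto simp: kc_zero_iff klr_ideal_mult)

lemma kc_sum_zero: "(\<And>x. x \<in> A \<Longrightarrow> klr_cong D \<beta> (f x) 0) \<Longrightarrow> klr_cong D \<beta> (sum f A) 0"
  using kc_sum[of A D \<beta> f "\<lambda>_. 0"] by simp

text \<open>A relator lies in the carrier, so membership of \<open>p\<close> follows from that of
  \<open>q\<close>.\<close>

lemma kc_relator:
  assumes "p - q \<in> relators D \<beta>" "q \<in> free_carrier (gens \<beta>)"
  shows "klr_cong D \<beta> p q"
  using klr_ideal_relator[OF assms(1)] free_carrier_add[OF relators_carrier[OF assms(1)] assms(2)] assms(2)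
  by (simp add: klr_cong_def)

lemma kc_idem_idem:
  assumes "\<nu> \<in> seqs \<beta>" "\<nu>' \<in> seqs \<beta>"
  shows "klr_cong D \<beta> (mon [Idm \<nu>, Idm \<nu>']) (if \<nu> = \<nu>' then mon [Idm \<nu>] else 0)"
  by (rule kc_relator[OF relators.idem_idem[OF assms]]) (use assms in auto)

lemma kc_idem_sum: "klr_cong D \<beta> (\<Sum>\<nu>\<in>seqs \<beta>. mon [Idm \<nu>]) (mon [])"
  by (rule kc_relator[OF relators.idem_sum]) auto

lemma kc_dot_idem:
  assumes "\<nu> \<in> seqs \<beta>" "1 \<le> k" "k \<le> size \<beta>"
  shows "klr_cong D \<beta> (mon [Dot k, Idm \<nu>]) (mon [Idm \<nu>, Dot k])"
  by (rule kc_relator[OF relators.dot_idem]) (use assms in auto)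

lemma kc_cross_idem:
  assumes "\<nu> \<in> seqs \<beta>" "1 \<le> k" "k < size \<beta>"
  shows "klr_cong D \<beta> (mon [Cross k, Idm \<nu>]) (mon [Idm (swap_seq k \<nu>), Cross k])"
  by (rule kc_relator[OF relators.cross_idem]) (use assms in \<open>auto intro!: free_carrier_single swap_seq_seqs\<close>)

lemma klr_class_self: "p \<in> free_carrier (gens \<beta>) \<Longrightarrow> p \<in> klr_class D \<beta> p"
  unfolding klr_class_def by (rule abelian_subgroup.a_rcos_self) (auto intro: abelian_subgroupI3 ideal.axioms klr_ideal ring.is_abelian_group ring_free_algebra)

lemma klr_class_mem:
  assumes p: "p \<in> free_carrier (gens \<beta>)"
  shows "q \<in> klr_class D \<beta> p \<longleftrightarrow> klr_cong D \<beta> q p"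
proof -
  interpret I: ideal "klr_ideal D \<beta>" "free_algebra (gens \<beta>)" by (rule klr_ideal)
  have "q \<in> free_carrier (gens \<beta>)" if "q \<in> klr_class D \<beta> p"
    using I.a_elemrcos_carrier[OF p] that by (simp add: klr_class_def)
  moreover have "q \<in> klr_class D \<beta> p \<longleftrightarrow> q - p \<in> klr_ideal D \<beta>" if "q \<in> free_carrier (gens \<beta>)"
    using I.a_rcos_module[OF p that] p by (simp add: klr_class_def free_a_inv)
  ultimately show ?thesis
    using p unfolding klr_cong_def by blast
qed

lemma klr_class_eq_iff:
  assumes "p \<in> free_carrier (gens \<beta>)" "q \<in> free_carrier (gens \<beta>)"
  shows "klr_class D \<beta> p = klr_class D \<beta> q \<longleftrightarrow> klr_cong D \<beta> p q"
proof -
  interpret I: ideal "klr_ideal D \<beta>" "free_algebra (gens \<beta>)" by (rule klr_ideal)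
  show ?thesis
    using klr_class_mem[OF assms(2), of p D] klr_class_self[OF assms(1), of D]
      I.a_repr_independence'[OF _ assms(2), of p] by (auto simp: klr_class_def)
qed

lemma kc_class: "klr_cong D \<beta> p q \<Longrightarrow> klr_class D \<beta> p = klr_class D \<beta> q"
  using klr_class_eq_iff[of p \<beta> q D] by (simp add: klr_cong_def)

lemma KLR_carrier: "carrier (KLR D \<beta>) = klr_class D \<beta> ` free_carrier (gens \<beta>)"
  by (auto simp: KLR_def FactRing_def A_RCOSETS_def' klr_class_def)

lemma klr_class_closed [simp, intro]: "p \<in> free_carrier (gens \<beta>) \<Longrightarrow> klr_class D \<beta> p \<in> carrier (KLR D \<beta>)"
  by (simp add: KLR_carrier)

lemma klr_class_add: "p \<in> free_carrier (gens \<beta>) \<Longrightarrow> q \<in> free_carrier (gens \<beta>) \<Longrightarrow>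
    klr_class D \<beta> p \<oplus>\<^bsub>KLR D \<beta>\<^esub> klr_class D \<beta> q = klr_class D \<beta> (p + q)"
  using ring_hom_add[OF ideal.rcos_ring_hom[OF klr_ideal], of p \<beta> q]
  by (simp add: KLR_def klr_class_def)

lemma klr_class_mult: "p \<in> free_carrier (gens \<beta>) \<Longrightarrow> q \<in> free_carrier (gens \<beta>) \<Longrightarrow>
    klr_class D \<beta> p \<otimes>\<^bsub>KLR D \<beta>\<^esub> klr_class D \<beta> q = klr_class D \<beta> (p * q)"
  using ring_hom_mult[OF ideal.rcos_ring_hom[OF klr_ideal], of p \<beta> q]
  by (simp add: KLR_def klr_class_def)

lemma klr_class_one: "\<one>\<^bsub>KLR D \<beta>\<^esub> = klr_class D \<beta> (mon [])"
  using ring_hom_one[OF ideal.rcos_ring_hom[OF klr_ideal[where D = D and \<beta> = \<beta>]]]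
  by (simp add: KLR_def klr_class_def)

lemma klr_class_zero: "\<zero>\<^bsub>KLR D \<beta>\<^esub> = klr_class D \<beta> 0"
proof -
  interpret R: ring "KLR D \<beta>" by (rule ring_KLR)
  have "klr_class D \<beta> 0 \<oplus>\<^bsub>KLR D \<beta>\<^esub> klr_class D \<beta> 0 = klr_class D \<beta> 0"
    by (subst klr_class_add) auto
  then show ?thesis
    using R.add.r_cancel_one[of "klr_class D \<beta> 0" "klr_class D \<beta> 0"] by auto
qed

lemma klr_class_uminus:
  assumes "p \<in> free_carrier (gens \<beta>)"
  shows "\<ominus>\<^bsub>KLR D \<beta>\<^esub> klr_class D \<beta> p = klr_class D \<beta> (- p)"
proof -
  interpret R: ring "KLR D \<beta>" by (rule ring_KLR)
  show ?thesis
    by (rule R.minus_equality) (use assms in \<open>simp_all add: klr_class_add klr_class_zero free_carrier_uminus\<close>)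
qed

lemma klr_class_sum:
  assumes "finite A" "\<And>x. x \<in> A \<Longrightarrow> f x \<in> free_carrier (gens \<beta>)"
  shows "klr_class D \<beta> (sum f A) = finsum (KLR D \<beta>) (\<lambda>x. klr_class D \<beta> (f x)) A"
proof -
  interpret R: ring "KLR D \<beta>" by (rule ring_KLR)
  show ?thesis
    using assms
    by (induction A rule: finite_induct) (auto simp: klr_class_zero klr_class_add[symmetric] free_carrier_sum)
qed

section \<open>Additive maps and gradings\<close>

text \<open>Formulated over \<open>ring_scheme\<close>, so that algebras and modules share one
  notion of additive map. Extensionality is not demanded, so composites and lambda terms qualify as
  they stand.\<close>

definition add_hom :: "('a, 'x) ring_scheme \<Rightarrow> ('b, 'y) ring_scheme \<Rightarrow> ('a \<Rightarrow> 'b) \<Rightarrow> bool" where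
  "add_hom A B f \<longleftrightarrow> (\<forall>x\<in>carrier A. f x \<in> carrier B) \<and>
     (\<forall>x\<in>carrier A. \<forall>y\<in>carrier A. f (x \<oplus>\<^bsub>A\<^esub> y) = f x \<oplus>\<^bsub>B\<^esub> f y)"

lemma add_homI:
  assumes "\<And>x. x \<in> carrier A \<Longrightarrow> f x \<in> carrier B"
    and "\<And>x y. x \<in> carrier A \<Longrightarrow> y \<in> carrier A \<Longrightarrow> f (x \<oplus>\<^bsub>A\<^esub> y) = f x \<oplus>\<^bsub>B\<^esub> f y"
  shows "add_hom A B f"
  using assms by (auto simp: add_hom_def)

lemma add_hom_closed: "add_hom A B f \<Longrightarrow> x \<in> carrier A \<Longrightarrow> f x \<in> carrier B"
  by (simp add: add_hom_def)

lemma add_hom_add: "add_hom A B f \<Longrightarrow> x \<in> carrier A \<Longrightarrow> y \<in> carrier A \<Longrightarrow> f (x \<oplus>\<^bsub>A\<^esub> y) = f x \<oplus>\<^bsub>B\<^esub> f y"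
  by (simp add: add_hom_def)

lemma add_hom_comp: "add_hom A B f \<Longrightarrow> add_hom B C g \<Longrightarrow> add_hom A C (\<lambda>x. g (f x))"
  by (auto simp: add_hom_def)

lemma add_hom_zero:
  assumes "abelian_group A" "abelian_group B" "add_hom A B f"
  shows "f \<zero>\<^bsub>A\<^esub> = \<zero>\<^bsub>B\<^esub>"
proof -
  interpret A: abelian_group A by fact
  interpret B: abelian_group B by fact
  have "f \<zero>\<^bsub>A\<^esub> \<oplus>\<^bsub>B\<^esub> f \<zero>\<^bsub>A\<^esub> = f \<zero>\<^bsub>A\<^esub>"
    using add_hom_add[OF assms(3), of "\<zero>\<^bsub>A\<^esub>" "\<zero>\<^bsub>A\<^esub>"] by simp
  then show ?thesis
    using add_hom_closed[OF assms(3), of "\<zero>\<^bsub>A\<^esub>"] B.add.r_cancel_one by auto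
qed

lemma add_hom_a_inv:
  assumes "abelian_group A" "abelian_group B" "add_hom A B f" "x \<in> carrier A"
  shows "f (\<ominus>\<^bsub>A\<^esub> x) = \<ominus>\<^bsub>B\<^esub> f x"
proof -
  interpret A: abelian_group A by fact
  interpret B: abelian_group B by fact
  have "f (\<ominus>\<^bsub>A\<^esub> x) \<oplus>\<^bsub>B\<^esub> f x = \<zero>\<^bsub>B\<^esub>"
    using add_hom_add[OF assms(3), of "\<ominus>\<^bsub>A\<^esub> x" x] assms add_hom_zero[OF assms(1-3)] by (simp add: A.l_neg)
  then show ?thesis
    using B.minus_equality assms add_hom_closed[OF assms(3)] by (metis A.a_inv_closed)
qed

lemma add_hom_finsum:
  assumes "abelian_group A" "abelian_group B" "add_hom A B f" "finite S" "\<And>s. s \<in> S \<Longrightarrow> g s \<in> carrier A"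
  shows "f (finsum A g S) = finsum B (\<lambda>s. f (g s)) S"
proof -
  interpret A: abelian_group A by fact
  interpret B: abelian_group B by fact
  show ?thesis
    using assms(4,5)
  proof (induction S rule: finite_induct)
    case empty
    then show ?case using add_hom_zero[OF assms(1-3)] by simp
  next
    case (insert s S)
    then have "finsum A g (insert s S) = g s \<oplus>\<^bsub>A\<^esub> finsum A g S"
      by (intro A.finsum_insert) auto
    moreover have "finsum B (\<lambda>s. f (g s)) (insert s S) = f (g s) \<oplus>\<^bsub>B\<^esub> finsum B (\<lambda>s. f (g s)) S"
      using insert add_hom_closed[OF assms(3)] by (intro B.finsum_insert) auto
    moreover have "finsum A g S \<in> carrier A"
      using insert by (intro A.finsum_closed) auto
    ultimately show ?case
      using insert add_hom_add[OF assms(3)] by simp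
  qed
qed

text \<open>The groups constructed below are all generated additively by explicit elements:
  homogeneous elements, pure tensors, multiples of canonical generators. Identities between additive
  maps are reduced to these.\<close>

lemma add_hom_eq_on_generate:
  assumes "abelian_group A" "abelian_group B" "add_hom A B f" "add_hom A B g"
    and "S \<subseteq> carrier A" "\<And>x. x \<in> S \<Longrightarrow> f x = g x" "x \<in> generate (add_monoid A) S"
  shows "f x = g x"
proof -
  interpret A: abelian_group A by fact
  have S: "generate (add_monoid A) S \<subseteq> carrier A"
    using A.add.generate_incl[of S] assms(5) by auto
  show ?thesis
    using assms(7)
  proof (induction rule: generate.induct)
    case one
    then show ?case using add_hom_zero[OF assms(1,2,3)] add_hom_zero[OF assms(1,2,4)] by simp
  next
    case (incl h)
    then show ?case using assms(6) by simp
  next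
    case (inv h)
    then show ?case
      using add_hom_a_inv[OF assms(1,2,3), of h] add_hom_a_inv[OF assms(1,2,4), of h] assms(5,6)
      by (auto simp: a_inv_def)
  next
    case (eng h1 h2)
    then show ?case
      using add_hom_add[OF assms(3), of h1 h2] add_hom_add[OF assms(4), of h1 h2] S eng by (simp add: subset_iff)
  qed
qed

text \<open>The analogue for membership. It shows that a map preserves degrees, or, with
  \<open>G\<close> the subgroup generated by certain elements and f the identity, that these
  elements generate a whole module.\<close>

lemma add_hom_generate_in_subgroup:
  assumes "abelian_group A" "abelian_group B" "add_hom A B f" "subgroup G (add_monoid B)"
    and "S \<subseteq> carrier A" "\<And>x. x \<in> S \<Longrightarrow> f x \<in> G" "x \<in> generate (add_monoid A) S"
  shows "f x \<in> G"
proof -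
  interpret A: abelian_group A by fact
  interpret B: abelian_group B by fact
  have S: "generate (add_monoid A) S \<subseteq> carrier A"
    using A.add.generate_incl[of S] assms(5) by auto
  show ?thesis
    using assms(7)
  proof (induction rule: generate.induct)
    case one
    then show ?case using add_hom_zero[OF assms(1,2,3)] subgroup.one_closed[OF assms(4)] by simp
  next
    case (incl h)
    then show ?case using assms(6) by simp
  next
    case (inv h)
    then show ?case
      using add_hom_a_inv[OF assms(1,2,3), of h] subgroup.m_inv_closed[OF assms(4), of "f h"] assms(5,6)
      by (auto simp: a_inv_def)
  next
    case (eng h1 h2)
    then show ?case
      using add_hom_add[OF assms(3), of h1 h2] subgroup.m_closed[OF assms(4), of "f h1" "f h2"] S eng by (simp add: subset_iff)
  qed
qed

lemma add_hom_id: "add_hom A A (\<lambda>x. x)"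
  by (simp add: add_hom_def)

lemma generate_finsum:
  assumes "abelian_group A" "S \<subseteq> carrier A" "finite I" "\<And>j. j \<in> I \<Longrightarrow> f j \<in> generate (add_monoid A) S"
  shows "finsum A f I \<in> generate (add_monoid A) S"
proof -
  interpret A: abelian_group A by fact
  have S: "generate (add_monoid A) S \<subseteq> carrier A"
    using A.add.generate_incl[of S] assms(2) by auto
  show ?thesis
    using assms(3,4)
  proof (induction I rule: finite_induct)
    case empty
    then show ?case using generate.one[of "add_monoid A" S] by simp
  next
    case (insert j I)
    then have "finsum A f (insert j I) = f j \<oplus>\<^bsub>A\<^esub> finsum A f I"
      using S by (intro A.finsum_insert) auto
    then show ?case using generate.eng[of "f j" "add_monoid A" S] insert by auto
  qed
qed

section \<open>Graded abelian groups and maps defined degree by degree\<close>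

definition graded_comp :: "('u, 'z) ring_scheme \<Rightarrow> (int \<Rightarrow> 'u set) \<Rightarrow> 'u \<Rightarrow> int \<Rightarrow> 'u" where
  "graded_comp M G x = (THE f. (\<forall>d. f d \<in> G d) \<and> finite {d. f d \<noteq> \<zero>\<^bsub>M\<^esub>} \<and>
        x = finsum M f {d. f d \<noteq> \<zero>\<^bsub>M\<^esub>})"

locale graded_group = abelian_group M for M (structure) +
  fixes G :: "int \<Rightarrow> 'a set"
  assumes graded: "graded_by M G"
begin

lemma is_abelian: "abelian_group M"
  by (rule abelian_group_axioms)

lemma G_subgroup: "subgroup (G d) (add_monoid M)"
  using graded by (simp add: graded_by_def)

lemma G_carrier: "x \<in> G d \<Longrightarrow> x \<in> carrier M"
  using subgroup.subset[OF G_subgroup, of d] by auto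

lemma G_zero: "\<zero> \<in> G d"
  using subgroup.one_closed[OF G_subgroup, of d] by simp

lemma G_add: "x \<in> G d \<Longrightarrow> y \<in> G d \<Longrightarrow> x \<oplus> y \<in> G d"
  using subgroup.m_closed[OF G_subgroup, of x d y] by simp

lemma finsum_superset:
  assumes "finite A" "{d. f d \<noteq> \<zero>} \<subseteq> A" "\<And>d. f d \<in> carrier M"
  shows "finsum M f {d. f d \<noteq> \<zero>} = finsum M f A"
  using assms by (intro add.finprod_mono_neutral_cong_left) auto

lemma comp_props:
  assumes "x \<in> carrier M"
  shows "graded_comp M G x d \<in> G d" "finite {d. graded_comp M G x d \<noteq> \<zero>}"
    "x = finsum M (graded_comp M G x) {d. graded_comp M G x d \<noteq> \<zero>}"
proof -
  have "\<exists>!f. (\<forall>d. f d \<in> G d) \<and> finite {d. f d \<noteq> \<zero>} \<and> x = finsum M f {d. f d \<noteq> \<zero>}"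
    using graded assms by (simp add: graded_by_def)
  from theI'[OF this]
  have "(\<forall>d. graded_comp M G x d \<in> G d) \<and> finite {d. graded_comp M G x d \<noteq> \<zero>} \<and>
     x = finsum M (graded_comp M G x) {d. graded_comp M G x d \<noteq> \<zero>}"
    unfolding graded_comp_def[symmetric] .
  then show "graded_comp M G x d \<in> G d" "finite {d. graded_comp M G x d \<noteq> \<zero>}"
    "x = finsum M (graded_comp M G x) {d. graded_comp M G x d \<noteq> \<zero>}" by auto
qed

lemma comp_carrier: "x \<in> carrier M \<Longrightarrow> graded_comp M G x d \<in> carrier M"
  using comp_props(1) G_carrier by blast

lemma comp_sum:
  assumes "x \<in> carrier M" "finite A" "{d. graded_comp M G x d \<noteq> \<zero>} \<subseteq> A"
  shows "finsum M (graded_comp M G x) A = x"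
proof -
  have "finsum M (graded_comp M G x) {d. graded_comp M G x d \<noteq> \<zero>} = finsum M (graded_comp M G x) A"
    by (rule finsum_superset) (use assms comp_carrier in auto)
  then show ?thesis using comp_props(3)[OF assms(1)] by simp
qed

text \<open>\<open>A\<close> may be any finite set containing the support, so that components of a
  sum can be compared over the union of two supports.\<close>

lemma comp_unique:
  assumes "x \<in> carrier M" "\<And>d. f d \<in> G d" "finite A" "{d. f d \<noteq> \<zero>} \<subseteq> A" "x = finsum M f A"
  shows "graded_comp M G x = f"
proof -
  have "\<exists>!f. (\<forall>d. f d \<in> G d) \<and> finite {d. f d \<noteq> \<zero>} \<and> x = finsum M f {d. f d \<noteq> \<zero>}"
    using graded assms by (simp add: graded_by_def)
  then show ?thesis
    unfolding graded_comp_def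
  proof (rule the1_equality)
    show "(\<forall>d. f d \<in> G d) \<and> finite {d. f d \<noteq> \<zero>} \<and> x = finsum M f {d. f d \<noteq> \<zero>}"
      using assms(2,5) finsum_superset[OF assms(3,4)] G_carrier[OF assms(2)] finite_subset[OF assms(4,3)] by simp
  qed
qed

lemma comp_homogeneous:
  assumes "x \<in> G e"
  shows "graded_comp M G x d = (if d = e then x else \<zero>)"
proof -
  have "finsum M (\<lambda>d. if d = e then x else \<zero>) {e} = x"
    using G_carrier[OF assms] by simp
  then have "graded_comp M G x = (\<lambda>d. if d = e then x else \<zero>)"
    using assms G_carrier[OF assms] G_zero by (intro comp_unique[where A = "{e}"]) auto
  then show ?thesis by simp
qed

lemma comp_add:
  assumes "x \<in> carrier M" "y \<in> carrier M"
  shows "graded_comp M G (x \<oplus> y) d = graded_comp M G x d \<oplus> graded_comp M G y d"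
proof -
  define A where "A = {d. graded_comp M G x d \<noteq> \<zero>} \<union> {d. graded_comp M G y d \<noteq> \<zero>}"
  have A: "finite A" unfolding A_def using comp_props(2) assms by auto
  have "graded_comp M G (x \<oplus> y) = (\<lambda>d. graded_comp M G x d \<oplus> graded_comp M G y d)"
  proof (rule comp_unique[OF _ _ A])
    show "x \<oplus> y = finsum M (\<lambda>d. graded_comp M G x d \<oplus> graded_comp M G y d) A"
      using assms A comp_sum[OF assms(1) A] comp_sum[OF assms(2) A] comp_carrier
      by (subst finsum_addf) (auto simp: A_def)
  qed (use assms G_add comp_props(1) in \<open>auto simp: A_def\<close>)
  then show ?thesis by simp
qed

lemma comp_add_hom: "add_hom M M (\<lambda>x. graded_comp M G x d)"
  by (rule add_homI) (auto simp: comp_add comp_carrier)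

lemma generate_homogeneous: "generate (add_monoid M) (\<Union>d. G d) = carrier M"
proof
  have sub: "(\<Union>d. G d) \<subseteq> carrier M" using G_carrier by auto
  then show "generate (add_monoid M) (\<Union>d. G d) \<subseteq> carrier M"
    using add.generate_incl[of "\<Union>d. G d"] by simp
  show "carrier M \<subseteq> generate (add_monoid M) (\<Union>d. G d)"
  proof
    fix x assume x: "x \<in> carrier M"
    have "finsum M (graded_comp M G x) {d. graded_comp M G x d \<noteq> \<zero>} \<in> generate (add_monoid M) (\<Union>d. G d)"
      using comp_props[OF x] by (intro generate_finsum[OF is_abelian sub]) (auto intro: generate.incl)
    then show "x \<in> generate (add_monoid M) (\<Union>d. G d)"
      using comp_props(3)[OF x] by simp
  qed
qed

lemma eq_on_homogeneous:
  assumes "abelian_group B" "add_hom M B f" "add_hom M B g" "\<And>d x. x \<in> G d \<Longrightarrow> f x = g x" "x \<in> carrier M"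
  shows "f x = g x"
  by (rule add_hom_eq_on_generate[OF is_abelian assms(1-3), of "\<Union>d. G d"])
    (use assms G_carrier generate_homogeneous in auto)

lemma in_subgroup_on_homogeneous:
  assumes "abelian_group B" "add_hom M B f" "subgroup H (add_monoid B)" "\<And>d x. x \<in> G d \<Longrightarrow> f x \<in> H" "x \<in> carrier M"
  shows "f x \<in> H"
  by (rule add_hom_generate_in_subgroup[OF is_abelian assms(1-3), of "\<Union>d. G d"])
    (use assms G_carrier generate_homogeneous in auto)

text \<open>From one additive map per degree, the additive map that applies the d-th of them to the
  component of degree d. Nested over three arguments it yields the degree projections of an
  induction product.\<close>

definition graded_ext :: "('c, 'y) ring_scheme \<Rightarrow> (int \<Rightarrow> 'a \<Rightarrow> 'c) \<Rightarrow> 'a \<Rightarrow> 'c" where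
  "graded_ext B f x = finsum B (\<lambda>d. f d (graded_comp M G x d)) {d. graded_comp M G x d \<noteq> \<zero>}"

context
  fixes B :: "('c, 'y) ring_scheme" (structure)
  assumes B: "abelian_group B"
begin

lemma graded_ext_superset:
  assumes "\<And>d. add_hom M B (f d)" "x \<in> carrier M" "finite A" "{d. graded_comp M G x d \<noteq> \<zero>\<^bsub>M\<^esub>} \<subseteq> A"
  shows "graded_ext B f x = finsum B (\<lambda>d. f d (graded_comp M G x d)) A"
proof -
  interpret B: abelian_group B by (rule B)
  show ?thesis
    unfolding graded_ext_def
    using assms comp_carrier[OF assms(2)] add_hom_closed[OF assms(1)] add_hom_zero[OF is_abelian B assms(1)]
    by (intro B.add.finprod_mono_neutral_cong_left) auto
qed

lemma graded_ext_closed: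
  assumes "\<And>d. add_hom M B (f d)" "x \<in> carrier M"
  shows "graded_ext B f x \<in> carrier B"
proof -
  interpret B: abelian_group B by (rule B)
  show ?thesis
    unfolding graded_ext_def using comp_carrier[OF assms(2)] add_hom_closed[OF assms(1)] by (intro B.finsum_closed) auto
qed

lemma graded_ext_add_hom:
  assumes f: "\<And>d. add_hom M B (f d)"
  shows "add_hom M B (graded_ext B f)"
proof (rule add_homI)
  interpret B: abelian_group B by (rule B)
  fix x y assume xy: "x \<in> carrier M" "y \<in> carrier M"
  define A where "A = {d. graded_comp M G x d \<noteq> \<zero>\<^bsub>M\<^esub>} \<union> {d. graded_comp M G y d \<noteq> \<zero>\<^bsub>M\<^esub>}"
  have A: "finite A" unfolding A_def using comp_props(2) xy by auto
  have "graded_ext B f (x \<oplus>\<^bsub>M\<^esub> y) = finsum B (\<lambda>d. f d (graded_comp M G (x \<oplus>\<^bsub>M\<^esub> y) d)) A"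
    using xy by (intro graded_ext_superset f A) (auto simp: A_def comp_add)
  also have "\<dots> = finsum B (\<lambda>d. f d (graded_comp M G x d) \<oplus>\<^bsub>B\<^esub> f d (graded_comp M G y d)) A"
    using xy comp_carrier add_hom_closed[OF f] add_hom_add[OF f] by (intro B.finsum_cong') (auto simp: comp_add)
  also have "\<dots> = graded_ext B f x \<oplus>\<^bsub>B\<^esub> graded_ext B f y"
    using xy comp_carrier add_hom_closed[OF f] A
    by (subst B.finsum_addf) (auto simp: graded_ext_superset[OF f _ A] A_def)
  finally show "graded_ext B f (x \<oplus>\<^bsub>M\<^esub> y) = graded_ext B f x \<oplus>\<^bsub>B\<^esub> graded_ext B f y" .
qed (rule graded_ext_closed[OF f])

lemma graded_ext_homogeneous:
  assumes "\<And>d. add_hom M B (f d)" "x \<in> G e"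
  shows "graded_ext B f x = f e x"
proof -
  interpret B: abelian_group B by (rule B)
  have "graded_ext B f x = finsum B (\<lambda>d. f d (graded_comp M G x d)) {e}"
    using assms G_carrier[OF assms(2)] by (intro graded_ext_superset) (auto simp: comp_homogeneous[OF assms(2)])
  then show ?thesis
    using add_hom_closed[OF assms(1), of x e] G_carrier[OF assms(2)] by (simp add: comp_homogeneous[OF assms(2)])
qed

text \<open>Additivity in the family of maps rather than in the argument, for families that depend
  additively on a further parameter; see \<open>graded_ext_param\<close>.\<close>

lemma graded_ext_add:
  assumes "\<And>d. add_hom M B (f d)" "\<And>d. add_hom M B (g d)" "\<And>d x. x \<in> carrier M \<Longrightarrow> h d x = f d x \<oplus>\<^bsub>B\<^esub> g d x"
    "x \<in> carrier M"
  shows "graded_ext B h x = graded_ext B f x \<oplus>\<^bsub>B\<^esub> graded_ext B g x"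
proof -
  interpret B: abelian_group B by (rule B)
  show ?thesis
    unfolding graded_ext_def
    using comp_props(2)[OF assms(4)] comp_carrier[OF assms(4)] add_hom_closed[OF assms(1)] add_hom_closed[OF assms(2)]
    by (subst B.finsum_addf[symmetric]) (auto intro!: B.finsum_cong' simp: assms(3))
qed

end

end

text \<open>Directness is witnessed by additive operators \<open>p d\<close> that are the identity
  on \<open>G d\<close> and zero on the other pieces: applied to any decomposition they return its
  terms. With generation by homogeneous elements this gives existence and uniqueness. All gradings
  below are established in this way.\<close>

lemma graded_groupI:
  assumes "abelian_group M" "\<And>d. subgroup (G d) (add_monoid M)"
    and p: "\<And>d. add_hom M M (p d)"
    and pG: "\<And>d e x. x \<in> G e \<Longrightarrow> p d x = (if d = e then x else \<zero>\<^bsub>M\<^esub>)"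
    and gen: "carrier M \<subseteq> generate (add_monoid M) (\<Union>d. G d)"
  shows "graded_by M G"
proof -
  interpret M: abelian_group M by fact
  have GC: "x \<in> carrier M" if "x \<in> G d" for x d
    using subgroup.subset[OF assms(2), of d] that by auto
  have G0: "\<zero>\<^bsub>M\<^esub> \<in> G d" for d
    using subgroup.one_closed[OF assms(2), of d] by simp
  have GA: "x \<oplus>\<^bsub>M\<^esub> y \<in> G d" if "x \<in> G d" "y \<in> G d" for x y d
    using subgroup.m_closed[OF assms(2) that] by simp
  have ss: "finsum M f {d. f d \<noteq> \<zero>\<^bsub>M\<^esub>} = finsum M f A"
    if "finite A" "{d. f d \<noteq> \<zero>\<^bsub>M\<^esub>} \<subseteq> A" "\<And>d. f d \<in> carrier M" for A :: "int set" and f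
    using that by (intro M.add.finprod_mono_neutral_cong_left) auto
  \<comment> \<open>The elements equal to a finite sum of their own projections include the
    homogeneous ones and their negatives, and are closed under addition.\<close>
  have ex: "(\<forall>d. p d x \<in> G d) \<and> (\<exists>A. finite A \<and> {d. p d x \<noteq> \<zero>\<^bsub>M\<^esub>} \<subseteq> A \<and> x = finsum M (\<lambda>d. p d x) A)"
    if "x \<in> generate (add_monoid M) (\<Union>d. G d)" for x
    using that
  proof (induction rule: generate.induct)
    case one
    then show ?case
      using add_hom_zero[OF assms(1,1) p] G0 by (auto intro!: exI[of _ "{}"])
  next
    case (incl h)
    then obtain e where e: "h \<in> G e" by auto
    then have "finsum M (\<lambda>d. p d h) {e} = h"
      using GC by (simp add: pG)
    then show ?case using e G0 pG by (auto intro!: exI[of _ "{e}"])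
  next
    case (inv h)
    then obtain e where e': "h \<in> G e" by auto
    have e: "inv\<^bsub>add_monoid M\<^esub> h \<in> G e"
      using subgroup.m_inv_closed[OF assms(2) e'] .
    then have "finsum M (\<lambda>d. p d (inv\<^bsub>add_monoid M\<^esub> h)) {e} = inv\<^bsub>add_monoid M\<^esub> h"
      using GC by (simp add: pG)
    then show ?case using e G0 pG[OF e] by (auto intro!: exI[of _ "{e}"])
  next
    case (eng h1 h2)
    from eng(3,4) obtain A1 A2 where A: "finite A1" "{d. p d h1 \<noteq> \<zero>\<^bsub>M\<^esub>} \<subseteq> A1" "h1 = finsum M (\<lambda>d. p d h1) A1"
      "finite A2" "{d. p d h2 \<noteq> \<zero>\<^bsub>M\<^esub>} \<subseteq> A2" "h2 = finsum M (\<lambda>d. p d h2) A2" by blast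
    have c: "h1 \<in> carrier M" "h2 \<in> carrier M"
      using eng(1,2) M.add.generate_incl[of "\<Union>d. G d"] GC by auto
    have pc: "p d h1 \<in> carrier M" "p d h2 \<in> carrier M" for d
      using add_hom_closed[OF p] c by auto
    have pa: "p d (h1 \<oplus>\<^bsub>M\<^esub> h2) = p d h1 \<oplus>\<^bsub>M\<^esub> p d h2" for d
      using add_hom_add[OF p c] .
    have "h1 = finsum M (\<lambda>d. p d h1) (A1 \<union> A2)" "h2 = finsum M (\<lambda>d. p d h2) (A1 \<union> A2)"
      using A(3) A(6) ss[of "A1" "\<lambda>d. p d h1"] ss[of "A1 \<union> A2" "\<lambda>d. p d h1"]
        ss[of "A2" "\<lambda>d. p d h2"] ss[of "A1 \<union> A2" "\<lambda>d. p d h2"] A(1,2,4,5) pc by (simp_all add: le_supI1 le_supI2)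
    then have "h1 \<oplus>\<^bsub>M\<^esub> h2 = finsum M (\<lambda>d. p d (h1 \<oplus>\<^bsub>M\<^esub> h2)) (A1 \<union> A2)"
      using M.finsum_addf[of "\<lambda>d. p d h1" "A1 \<union> A2" "\<lambda>d. p d h2"] pc A(1,4) by (simp add: pa)
    moreover have "{d. p d (h1 \<oplus>\<^bsub>M\<^esub> h2) \<noteq> \<zero>\<^bsub>M\<^esub>} \<subseteq> A1 \<union> A2"
    proof
      fix d assume d: "d \<in> {d. p d (h1 \<oplus>\<^bsub>M\<^esub> h2) \<noteq> \<zero>\<^bsub>M\<^esub>}"
      have "p d (h1 \<oplus>\<^bsub>M\<^esub> h2) = \<zero>\<^bsub>M\<^esub>" if "p d h1 = \<zero>\<^bsub>M\<^esub>" "p d h2 = \<zero>\<^bsub>M\<^esub>"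
        using that by (simp add: pa)
      then show "d \<in> A1 \<union> A2" using d A(2,5) by blast
    qed
    moreover have "\<forall>d. p d (h1 \<oplus>\<^bsub>M\<^esub> h2) \<in> G d"
      using eng(3,4) GA by (simp add: pa)
    moreover have "finite (A1 \<union> A2)" using A(1,4) by simp
    ultimately show ?case
      unfolding monoid.simps by blast
  qed
  show ?thesis
    unfolding graded_by_def
  proof (intro conjI allI ballI assms(2))
    fix x assume x: "x \<in> carrier M"
    show "\<exists>!f. (\<forall>d. f d \<in> G d) \<and> finite {d. f d \<noteq> \<zero>\<^bsub>M\<^esub>} \<and> x = finsum M f {d. f d \<noteq> \<zero>\<^bsub>M\<^esub>}"
    proof (rule ex1I[of _ "\<lambda>d. p d x"])
      from ex[OF subsetD[OF gen x]] obtain A where A: "\<forall>d. p d x \<in> G d" "finite A" "{d. p d x \<noteq> \<zero>\<^bsub>M\<^esub>} \<subseteq> A"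
        "x = finsum M (\<lambda>d. p d x) A" by blast
      have "p d x \<in> carrier M" for d using A(1) GC by blast
      then have "finsum M (\<lambda>d. p d x) {d. p d x \<noteq> \<zero>\<^bsub>M\<^esub>} = finsum M (\<lambda>d. p d x) A"
        using ss[OF A(2,3)] by simp
      then show "(\<forall>d. p d x \<in> G d) \<and> finite {d. p d x \<noteq> \<zero>\<^bsub>M\<^esub>} \<and> x = finsum M (\<lambda>d. p d x) {d. p d x \<noteq> \<zero>\<^bsub>M\<^esub>}"
        using A(1,4) finite_subset[OF A(3,2)] by simp
    next
      fix f assume f: "(\<forall>d. f d \<in> G d) \<and> finite {d. f d \<noteq> \<zero>\<^bsub>M\<^esub>} \<and> x = finsum M f {d. f d \<noteq> \<zero>\<^bsub>M\<^esub>}"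
      show "f = (\<lambda>d. p d x)"
      proof
        fix d
        have fc: "f e \<in> carrier M" for e using f GC by blast
        \<comment> \<open>The index d is adjoined because \<open>f d\<close> may vanish, while the
          sum has to single out its term at d.\<close>
        define A where "A = insert d {d. f d \<noteq> \<zero>\<^bsub>M\<^esub>}"
        have A: "finite A" using f by (simp add: A_def)
        have "x = finsum M f A" using f ss[OF A, of f] fc by (auto simp: A_def)
        then have "p d x = finsum M (\<lambda>e. p d (f e)) A"
          using add_hom_finsum[OF assms(1,1) p A] fc by simp
        also have "\<dots> = finsum M (\<lambda>e. if d = e then f e else \<zero>\<^bsub>M\<^esub>) A"
          using fc pG[of "f e" e d for e] f by (intro M.finsum_cong') (auto dest: spec)
        also have "\<dots> = f d"
          using M.finsum_singleton[of d A f] A fc by (simp add: A_def)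
        finally show "f d = p d x" ..
      qed
    qed
  qed
qed

section \<open>The grading of the KLR algebras\<close>

text \<open>A generator acts on an idempotent to its right: \<open>g 1_\<nu>\<close> equals
  \<open>1_\<mu> g 1_\<nu>\<close> for \<mu> the value at \<nu>. For \<open>Idm \<kappa>\<close>
  with \<kappa> different from \<nu> the product is zero, and the value \<nu> is a convention; the
  same holds for the degree 0 given to it by \<open>gen_deg\<close>.\<close>

fun gen_end :: "'i gen \<Rightarrow> 'i list \<Rightarrow> 'i list" where
  "gen_end (Cross k) \<nu> = swap_seq k \<nu>"
| "gen_end (Dot k) \<nu> = \<nu>"
| "gen_end (Idm \<mu>) \<nu> = \<nu>"

fun gen_deg :: "('i, 'k::zero) klr_datum \<Rightarrow> 'i gen \<Rightarrow> 'i list \<Rightarrow> int" where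
  "gen_deg D (Cross k) \<nu> = - form D (entry \<nu> k) (entry \<nu> (k + 1))"
| "gen_deg D (Dot k) \<nu> = form D (entry \<nu> k) (entry \<nu> k)"
| "gen_deg D (Idm \<mu>) \<nu> = 0"

primrec word_end :: "'i gen list \<Rightarrow> 'i list \<Rightarrow> 'i list" where
  "word_end [] \<nu> = \<nu>"
| "word_end (g # w) \<nu> = gen_end g (word_end w \<nu>)"

primrec word_deg :: "('i, 'k::zero) klr_datum \<Rightarrow> 'i gen list \<Rightarrow> 'i list \<Rightarrow> int" where
  "word_deg D [] \<nu> = 0"
| "word_deg D (g # w) \<nu> = gen_deg D g (word_end w \<nu>) + word_deg D w \<nu>"

lemma word_end_append [simp]: "word_end (u @ w) \<nu> = word_end u (word_end w \<nu>)"
  by (induction u) auto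

lemma word_deg_append [simp]: "word_deg D (u @ w) \<nu> = word_deg D u (word_end w \<nu>) + word_deg D w \<nu>"
  by (induction u) auto

lemma word_end_replicate_Dot [simp]: "word_end (replicate s (Dot k)) \<nu> = \<nu>"
  by (induction s) auto

lemma word_deg_replicate_Dot [simp]:
  "word_deg D (replicate s (Dot k)) \<nu> = int s * form D (entry \<nu> k) (entry \<nu> k)"
  by (induction s) (auto simp: algebra_simps)

lemma word_end_seqs: "set w \<subseteq> gens \<beta> \<Longrightarrow> \<nu> \<in> seqs \<beta> \<Longrightarrow> word_end w \<nu> \<in> seqs \<beta>"
proof (induction w)
  case (Cons g w)
  then show ?case by (cases g) (auto simp: swap_seq_seqs)
qed simp

text \<open>Carries the idempotent across one letter while keeping a copy on the right, which allows
  iteration along a word.\<close>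

lemma kc_gen_idem:
  assumes g: "g \<in> gens \<beta>" and \<nu>: "\<nu> \<in> seqs \<beta>"
  shows "klr_cong D \<beta> (mon [g, Idm \<nu>]) (mon [Idm (gen_end g \<nu>), g, Idm \<nu>])"
proof -
  have idem: "klr_cong D \<beta> (mon [g, Idm \<nu>]) (mon [g, Idm \<nu>, Idm \<nu>])"
    using kc_mult_left[OF kc_sym[OF kc_idem_idem[OF \<nu> \<nu>]], of "mon [g]" D] g by simp
  show ?thesis
    using g
  proof (cases rule: gens_cases)
    case (1 \<mu>)
    show ?thesis
    proof (cases "\<mu> = \<nu>")
      case True
      then show ?thesis using idem 1 by simp
    next
      case False
      \<comment> \<open>For distinct \<mu> and \<nu> both sides of the claim are zero.\<close>
      have z: "klr_cong D \<beta> (mon [g, Idm \<nu>]) 0"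
        using kc_idem_idem[OF 1(2) \<nu>, of D] False 1 by simp
      then show ?thesis
        using kc_zero_mult(1)[OF z, of "mon [Idm \<nu>]"] 1 \<nu> kc_trans[OF z kc_sym] by simp
    qed
  next
    case (2 k)
    then show ?thesis
      using kc_trans[OF idem] kc_mult_right[OF kc_dot_idem[OF \<nu>, of k D], of "mon [Idm \<nu>]"] \<nu> by simp
  next
    case (3 k)
    then show ?thesis
      using kc_trans[OF idem] kc_mult_right[OF kc_cross_idem[OF \<nu>, of k D], of "mon [Idm \<nu>]"] \<nu> by simp
  qed
qed

lemma kc_word_idem:
  assumes "set w \<subseteq> gens \<beta>" and \<nu>: "\<nu> \<in> seqs \<beta>"
  shows "klr_cong D \<beta> (mon (w @ [Idm \<nu>])) (mon (Idm (word_end w \<nu>) # w @ [Idm \<nu>]))"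
  using assms(1)
proof (induction w)
  case Nil
  then show ?case using kc_sym[OF kc_idem_idem[OF \<nu> \<nu>, of D]] by simp
next
  case (Cons g w)
  define \<nu>' where "\<nu>' = word_end w \<nu>"
  have \<nu>': "\<nu>' \<in> seqs \<beta>" unfolding \<nu>'_def using Cons word_end_seqs \<nu> by auto
  have g: "g \<in> gens \<beta>" "set w \<subseteq> gens \<beta>" using Cons by auto
  have e: "gen_end g \<nu>' \<in> seqs \<beta>"
    using word_end_seqs[of "[g]" \<beta> \<nu>'] g \<nu>' by simp
  have IH: "klr_cong D \<beta> (mon (w @ [Idm \<nu>])) (mon (Idm \<nu>' # w @ [Idm \<nu>]))"
    using Cons by (simp add: \<nu>'_def)
  have "klr_cong D \<beta> (mon (g # w @ [Idm \<nu>])) (mon [g, Idm \<nu>'] * mon (w @ [Idm \<nu>]))"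
    using kc_mult_left[OF IH, of "mon [g]"] g by simp
  also have "klr_cong D \<beta> \<dots> (mon [Idm (gen_end g \<nu>'), g, Idm \<nu>'] * mon (w @ [Idm \<nu>]))"
    using kc_gen_idem[OF g(1) \<nu>'] g \<nu> by (intro kc_mult_right) auto
  also have "klr_cong D \<beta> \<dots> (mon [Idm (gen_end g \<nu>'), g] * mon (w @ [Idm \<nu>]))"
    using kc_mult_left[OF kc_sym[OF IH], of "mon [Idm (gen_end g \<nu>'), g]"] g e by simp
  finally show ?case by (simp add: \<nu>'_def)
qed

text \<open>By \<open>kc_word_idem\<close> the left idempotent meets the idempotent at the end of
  the word, and distinct idempotents are orthogonal.\<close>

lemma kc_word_idem_other:
  assumes "set w \<subseteq> gens \<beta>" "\<nu> \<in> seqs \<beta>" "\<mu> \<in> seqs \<beta>" "\<mu> \<noteq> word_end w \<nu>"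
  shows "klr_cong D \<beta> (mon (Idm \<mu> # w @ [Idm \<nu>])) 0"
proof -
  have e: "word_end w \<nu> \<in> seqs \<beta>" using word_end_seqs assms by auto
  have "klr_cong D \<beta> (mon (Idm \<mu> # w @ [Idm \<nu>])) (mon [Idm \<mu>, Idm (word_end w \<nu>)] * mon (w @ [Idm \<nu>]))"
    using kc_mult_left[OF kc_word_idem[OF assms(1,2)], of "mon [Idm \<mu>]" D] assms by simp
  also have "klr_cong D \<beta> \<dots> 0"
    using kc_idem_idem[OF assms(3) e, of D] assms by (intro kc_zero_mult) auto
  finally show ?thesis .
qed

text \<open>With u and v in degrees i.i and j.j, \<open>Qpol D i j\<close> is homogeneous of degree
  -2 i.j, the degree of the square of a crossing. The pure powers have degree -c_{ij} i.i = -c_{ji}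
  j.j = -2 i.j, the mixed terms satisfy half of the equation by assumption, and for c_{ij} = 0 there
  is only a constant while i.j = 0.\<close>

lemma Qpol_homogeneous:
  assumes D: "is_klr_datum D" and st: "(s, t) \<in> Poly_Mapping.keys (Qpol D i j)"
  shows "int s * form D i i + int t * form D j j = - 2 * form D i j"
proof -
  have ne: "i \<noteq> j"
    using D st by (auto simp: is_klr_datum_def)
  have ev: "even (form D i i)" "even (form D j j)" "form D i i > 0" "form D j j > 0"
    and sym: "form D i j = form D j i"
    and dv: "form D i i dvd 2 * form D i j" "form D j j dvd 2 * form D j i" "cartan D i j \<le> 0" "cartan D j i \<le> 0"
    using D ne unfolding is_klr_datum_def by metis+
  \<comment> \<open>The divisibility clause of the datum makes the integer division in
    \<open>cartan\<close> exact.\<close>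
  have c: "form D i i * cartan D i j = 2 * form D i j" "form D j j * cartan D j i = 2 * form D i j"
    using dv sym by (simp_all add: cartan_def)
  show ?thesis
  proof (cases "cartan D i j = 0")
    case True
    then obtain u where "Qpol D i j = Poly_Mapping.single (0, 0) u"
      using D ne unfolding is_klr_datum_def by metis
    then have "s = 0" "t = 0" using st by (auto split: if_splits)
    then show ?thesis using c True by simp
  next
    case False
    then have "cartan D i j < 0" using dv by simp
    moreover obtain R where "\<forall>i j. i \<noteq> j \<longrightarrow> cartan D i j < 0 \<longrightarrow>
           Poly_Mapping.keys (Qpol D i j - Poly_Mapping.single (nat (- cartan D i j), 0) (R i j)
                            - Poly_Mapping.single (0, nat (- cartan D j i)) (R j i))
           \<subseteq> {(s, t). s > 0 \<and> t > 0 \<and>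
                form D i i div 2 * int s + form D j j div 2 * int t = - form D i j}"
      using D unfolding is_klr_datum_def by (elim conjE exE) (rule that)
    ultimately obtain r r' where K: "Poly_Mapping.keys (Qpol D i j - Poly_Mapping.single (nat (- cartan D i j), 0) r
                            - Poly_Mapping.single (0, nat (- cartan D j i)) r')
           \<subseteq> {(s, t). s > 0 \<and> t > 0 \<and>
                form D i i div 2 * int s + form D j j div 2 * int t = - form D i j}"
      using ne by blast
    \<comment> \<open>A monomial other than the two pure powers survives their subtraction with its
      coefficient.\<close>
    have "(s, t) \<in> Poly_Mapping.keys (Qpol D i j - Poly_Mapping.single (nat (- cartan D i j), 0) r
                            - Poly_Mapping.single (0, nat (- cartan D j i)) r')"
      if "(nat (- cartan D i j), 0) \<noteq> (s, t)" "(0, nat (- cartan D j i)) \<noteq> (s, t)"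
      using st unfolding in_keys_iff lookup_minus lookup_single_not_eq[OF that(1)] lookup_single_not_eq[OF that(2)] by simp
    then consider "(s, t) = (nat (- cartan D i j), 0)" | "(s, t) = (0, nat (- cartan D j i))"
      | "(s, t) \<in> Poly_Mapping.keys (Qpol D i j - Poly_Mapping.single (nat (- cartan D i j), 0) r
                            - Poly_Mapping.single (0, nat (- cartan D j i)) r')"
      by metis
    then show ?thesis
    proof cases
      case 1
      then show ?thesis using c dv by (simp add: algebra_simps)
    next
      case 2
      then show ?thesis using c dv by (simp add: algebra_simps)
    next
      case 3
      then have "form D i i div 2 * int s + form D j j div 2 * int t = - form D i j" using K by auto
      moreover from ev obtain a b where "form D i i = 2 * a" "form D j j = 2 * b"
        by (auto elim!: evenE)
      ultimately show ?thesis
        using distrib_left[of 2 "a * int s" "b * int t"] by (simp add: algebra_simps)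
    qed
  qed
qed

lemma keys_diff_subset: "Poly_Mapping.keys (p - q) \<subseteq> Poly_Mapping.keys p \<union> Poly_Mapping.keys q"
  for p q :: "'b \<Rightarrow>\<^sub>0 'k::ab_group_add"
  by (auto simp: in_keys_iff lookup_minus)

lemma keys_single_subset: "Poly_Mapping.keys (Poly_Mapping.single w c) \<subseteq> {w}"
  by (simp split: if_splits)

lemma keys_mult_mon: "Poly_Mapping.keys (p * mon v) \<subseteq> (\<lambda>w. w @ v) ` Poly_Mapping.keys p"
  for p :: "'g list \<Rightarrow>\<^sub>0 'k::{comm_ring,comm_monoid_mult}"
proof -
  have "Poly_Mapping.keys (p * mon v) \<subseteq> {a + b |a b. a \<in> Poly_Mapping.keys p \<and> b \<in> Poly_Mapping.keys (mon v :: _ \<Rightarrow>\<^sub>0 'k)}"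
    by (rule keys_mult)
  also have "\<dots> \<subseteq> (\<lambda>w. w @ v) ` Poly_Mapping.keys p"
    using keys_single_subset[of v "1 :: 'k"] by (auto simp: set_plus_list)
  finally show ?thesis .
qed

text \<open>The grading of \<open>H\<^sub>\<beta>\<close> rests on this: after right multiplication by an idempotent, a word has a
  well-defined degree, and each relator becomes homogeneous or termwise zero.\<close>

definition homogeneous_at :: "('i, 'k::{comm_ring,comm_monoid_mult}) klr_datum \<Rightarrow> 'i multiset \<Rightarrow> 'i gen list set \<Rightarrow> 'i list \<Rightarrow> bool" where
  "homogeneous_at D \<beta> W \<nu> \<longleftrightarrow> (\<forall>w\<in>W. klr_cong D \<beta> (mon (w @ [Idm \<nu>])) 0) \<or>
     (\<exists>d \<mu>. \<forall>w\<in>W. word_deg D w \<nu> = d \<and> word_end w \<nu> = \<mu>)"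

lemma homogeneous_at_subset: "homogeneous_at D \<beta> W \<nu> \<Longrightarrow> V \<subseteq> W \<Longrightarrow> homogeneous_at D \<beta> V \<nu>"
  unfolding homogeneous_at_def by blast

text \<open>For relators all of whose words end in \<open>1_\<mu>\<close>: against a different
  idempotent every word vanishes, so a common degree and end have to be verified at \<mu>
  only.\<close>

lemma homogeneous_at_idem:
  assumes "\<And>w. w \<in> W \<Longrightarrow> \<exists>v. w = v @ [Idm \<mu>] \<and> set v \<subseteq> gens \<beta>" "\<mu> \<in> seqs \<beta>" "\<nu> \<in> seqs \<beta>"
    and "\<And>w. w \<in> W \<Longrightarrow> word_deg D w \<mu> = d \<and> word_end w \<mu> = \<kappa>"
  shows "homogeneous_at D \<beta> W \<nu>"
proof (cases "\<mu> = \<nu>")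
  case True
  then show ?thesis using assms(4) unfolding homogeneous_at_def by blast
next
  case False
  have "klr_cong D \<beta> (mon (w @ [Idm \<nu>])) 0" if w: "w \<in> W" for w
  proof -
    from assms(1)[OF w] obtain v where v: "w = v @ [Idm \<mu>]" "set v \<subseteq> gens \<beta>" by blast
    have "klr_cong D \<beta> (mon v * mon [Idm \<mu>, Idm \<nu>]) 0"
      using kc_idem_idem[OF assms(2,3), of D] False v by (intro kc_zero_mult) auto
    then show ?thesis using v by simp
  qed
  then show ?thesis unfolding homogeneous_at_def by blast
qed

text \<open>Both sides exchange the entries at k and k + 2 and fix all others.\<close>

lemma swap_seq_braid:
  assumes "1 \<le> k" "k + 2 \<le> length \<nu>"
  shows "swap_seq (k + 1) (swap_seq k (swap_seq (k + 1) \<nu>)) = swap_seq k (swap_seq (k + 1) (swap_seq k \<nu>))"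
proof (rule entry_ext)
  fix l assume l: "1 \<le> l" "l \<le> length (swap_seq k (swap_seq (k + 1) (swap_seq k \<nu>)))"
  have t: "transpose (k + 1) (k + 1 + 1) j \<in> {1..length \<nu>}" "transpose k (k + 1) j \<in> {1..length \<nu>}"
    if "j \<in> {1..length \<nu>}" for j
    using transpose_in[of "k + 1" "length \<nu>" j] transpose_in[of k "length \<nu>" j] assms that by auto
  have 1: "entry (swap_seq (k + 1) \<mu>) j = entry \<mu> (transpose (k + 1) (k + 1 + 1) j)"
    "entry (swap_seq k \<mu>) j = entry \<mu> (transpose k (k + 1) j)"
    if "j \<in> {1..length \<nu>}" "length \<mu> = length \<nu>" for j \<mu>
    using that assms by (simp_all add: entry_swap_seq)
  have l': "l \<in> {1..length \<nu>}" using l by simp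
  show "entry (swap_seq (k + 1) (swap_seq k (swap_seq (k + 1) \<nu>))) l =
      entry (swap_seq k (swap_seq (k + 1) (swap_seq k \<nu>))) l"
    by (simp only: 1 t l' length_swap_seq) (auto simp: transpose_def)
qed simp

lemma swap_seq_eq_self:
  assumes "1 \<le> k" "k < length \<nu>" "entry \<nu> k = entry \<nu> (k + 1)"
  shows "swap_seq k \<nu> = \<nu>"
  by (rule entry_ext) (use assms in \<open>auto simp: entry_swap_seq transpose_def\<close>)

text \<open>This is the case in which the braid relation has a correction term; it contains dots
  only, so the three crossings must return to \<nu> for the relator to have a single end.\<close>

lemma swap_seq_braid_eq_self:
  assumes "1 \<le> k" "k + 2 \<le> length \<nu>" "entry \<nu> k = entry \<nu> (k + 2)"
  shows "swap_seq k (swap_seq (k + 1) (swap_seq k \<nu>)) = \<nu>"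
proof (rule entry_ext)
  fix l assume l: "1 \<le> l" "l \<le> length \<nu>"
  have t: "transpose (k + 1) (k + 1 + 1) j \<in> {1..length \<nu>}" "transpose k (k + 1) j \<in> {1..length \<nu>}"
    if "j \<in> {1..length \<nu>}" for j
    using transpose_in[of "k + 1" "length \<nu>" j] transpose_in[of k "length \<nu>" j] assms that by auto
  have 1: "entry (swap_seq (k + 1) \<mu>) j = entry \<mu> (transpose (k + 1) (k + 1 + 1) j)"
    "entry (swap_seq k \<mu>) j = entry \<mu> (transpose k (k + 1) j)"
    if "j \<in> {1..length \<nu>}" "length \<mu> = length \<nu>" for j \<mu>
    using that assms by (simp_all add: entry_swap_seq)
  have l': "l \<in> {1..length \<nu>}" using l by simp
  show "entry (swap_seq k (swap_seq (k + 1) (swap_seq k \<nu>))) l = entry \<nu> l"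
    by (simp only: 1 t l' length_swap_seq) (use assms in \<open>auto simp: transpose_def numeral_2_eq_2\<close>)
qed simp

text \<open>Degrees are compared relation by relation. \<open>Qpol_homogeneous\<close> settles the
  square of a crossing. In \<open>cross_dot\<close> a correction occurs only for equal entries,
  where crossing and dot have opposite degrees. In \<open>braid\<close> it occurs only for equal
  outer entries a; division by a difference of dots lowers the degree -2 a.b by a.a, which is the
  total degree of the three crossings.\<close>

lemma relator_homogeneous:
  assumes D: "is_klr_datum D" and "r \<in> relators D \<beta>" and \<nu>: "\<nu> \<in> seqs \<beta>"
  shows "homogeneous_at D \<beta> (Poly_Mapping.keys r) \<nu>"
proof -
  have fsym: "form D a b = form D b a" for a b using D by (simp add: is_klr_datum_def)
  have all: "homogeneous_at D \<beta> W \<nu>" if "\<And>w. w \<in> W \<Longrightarrow> word_deg D w \<nu> = d \<and> word_end w \<nu> = \<mu>" for W d \<mu>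
    using that unfolding homogeneous_at_def by blast
  from assms(2) show ?thesis
  proof (cases rule: relators.cases)
    case (idem_idem \<nu>1 \<nu>2)
    have "Poly_Mapping.keys r \<subseteq> {[Idm \<nu>1, Idm \<nu>2], [Idm \<nu>1]}"
      unfolding idem_idem(1) by (rule order_trans[OF keys_diff_subset]) (auto split: if_splits)
    then show ?thesis by (rule homogeneous_at_subset[rotated]) (rule all[of _ 0 \<nu>], auto)
  next
    case idem_sum
    have "Poly_Mapping.keys r \<subseteq> {[]} \<union> (\<lambda>\<nu>. [Idm \<nu>]) ` seqs \<beta>"
      unfolding idem_sum(1) by (rule order_trans[OF keys_diff_subset]) (use keys_sum in \<open>fastforce split: if_splits\<close>)
    then show ?thesis by (rule homogeneous_at_subset[rotated]) (rule all[of _ 0 \<nu>], auto)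
  next
    case (dot_idem \<mu> k)
    have "Poly_Mapping.keys r \<subseteq> {[Dot k, Idm \<mu>], [Idm \<mu>, Dot k]}"
      unfolding dot_idem(1) by (rule order_trans[OF keys_diff_subset]) (auto split: if_splits)
    then show ?thesis
      by (rule homogeneous_at_subset[rotated]) (rule all[of _ "gen_deg D (Dot k) \<nu>" \<nu>], auto)
  next
    case (cross_idem \<mu> k)
    have "Poly_Mapping.keys r \<subseteq> {[Cross k, Idm \<mu>], [Idm (swap_seq k \<mu>), Cross k]}"
      unfolding cross_idem(1) by (rule order_trans[OF keys_diff_subset]) (auto split: if_splits)
    then show ?thesis
      by (rule homogeneous_at_subset[rotated]) (rule all[of _ "gen_deg D (Cross k) \<nu>" "swap_seq k \<nu>"], auto)
  next
    case (dot_dot k l)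
    have "Poly_Mapping.keys r \<subseteq> {[Dot k, Dot l], [Dot l, Dot k]}"
      unfolding dot_dot(1) by (rule order_trans[OF keys_diff_subset]) (auto split: if_splits)
    then show ?thesis
      by (rule homogeneous_at_subset[rotated]) (rule all[of _ "gen_deg D (Dot k) \<nu> + gen_deg D (Dot l) \<nu>" \<nu>], auto)
  next
    case (cross_sq \<mu> k)
    define Q where "Q = Qpol D (entry \<mu> k) (entry \<mu> (k + 1))"
    have len: "length \<mu> = size \<beta>" using cross_sq seqs_length by auto
    have "Poly_Mapping.keys r \<subseteq> {[Cross k, Cross k, Idm \<mu>]} \<union>
       {replicate s (Dot k) @ replicate t (Dot (k + 1)) @ [Idm \<mu>] |s t. (s, t) \<in> Poly_Mapping.keys Q}" (is "_ \<subseteq> ?W")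
      unfolding cross_sq(1) Q_def[symmetric]
      using keys_mult_mon[of "eval_pol Q k (k + 1)" "[Idm \<mu>]"] keys_eval_pol[of Q k "k + 1"]
      by (intro order_trans[OF keys_diff_subset]) (fastforce split: if_splits)
    moreover have "homogeneous_at D \<beta> ?W \<nu>"
    proof (rule homogeneous_at_idem)
      show "\<exists>v. w = v @ [Idm \<mu>] \<and> set v \<subseteq> gens \<beta>" if "w \<in> ?W" for w
        using that
      proof
        assume "w \<in> {[Cross k, Cross k, Idm \<mu>]}"
        then show ?thesis using cross_sq by (intro exI[of _ "[Cross k, Cross k]"]) auto
      next
        assume "w \<in> {replicate s (Dot k) @ replicate t (Dot (k + 1)) @ [Idm \<mu>] |s t. (s, t) \<in> Poly_Mapping.keys Q}"
        then obtain s t where "w = replicate s (Dot k) @ replicate t (Dot (k + 1)) @ [Idm \<mu>]" by auto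
        then show ?thesis
          using cross_sq by (intro exI[of _ "replicate s (Dot k) @ replicate t (Dot (k + 1))"]) auto
      qed
      show "word_deg D w \<mu> = - 2 * form D (entry \<mu> k) (entry \<mu> (k + 1)) \<and> word_end w \<mu> = \<mu>" if "w \<in> ?W" for w
        using that cross_sq len fsym[of "entry \<mu> (k + 1)" "entry \<mu> k"] Qpol_homogeneous[OF D, of _ _ "entry \<mu> k" "entry \<mu> (k + 1)"]
        by (auto simp: entry_swap_seq Q_def)
    qed (use cross_sq \<nu> in auto)
    ultimately show ?thesis by (rule homogeneous_at_subset[rotated])
  next
    case (cross_dot \<mu> k l)
    have len: "length \<mu> = size \<beta>" using cross_dot seqs_length by auto
    have t: "transpose k (k + 1) l \<in> {1..size \<beta>}" using transpose_in[of k "size \<beta>" l] cross_dot by auto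
    define V where "V = (if (l = k \<or> l = k + 1) \<and> entry \<mu> k = entry \<mu> (k + 1) then {[Idm \<mu>]} else {})"
    have "Poly_Mapping.keys r \<subseteq> {[Cross k, Dot l, Idm \<mu>], [Dot (transpose k (k + 1) l), Cross k, Idm \<mu>]} \<union> V" (is "_ \<subseteq> ?W")
      unfolding cross_dot(1)
      apply (rule order_trans[OF keys_diff_subset])
      apply (rule Un_least)
       apply (rule order_trans[OF keys_diff_subset])
      by (auto simp: V_def split: if_splits)
    moreover have "homogeneous_at D \<beta> ?W \<nu>"
    proof (rule homogeneous_at_idem)
      show "\<exists>v. w = v @ [Idm \<mu>] \<and> set v \<subseteq> gens \<beta>" if "w \<in> ?W" for w
      proof -
        have "w = [Cross k, Dot l] @ [Idm \<mu>] \<or> w = [Dot (transpose k (k + 1) l), Cross k] @ [Idm \<mu>] \<or> w = [] @ [Idm \<mu>]"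
          using that by (auto simp: V_def split: if_splits)
        moreover have "set [Cross k, Dot l] \<subseteq> gens \<beta>" "set [Dot (transpose k (k + 1) l), Cross k] \<subseteq> gens \<beta>" "set [] \<subseteq> gens \<beta>"
          using cross_dot t by auto
        ultimately show ?thesis by blast
      qed
      \<comment> \<open>The dot sits on the same strand before and after the crossing, so it
        contributes the same degree to both words.\<close>
      have "entry (swap_seq k \<mu>) (transpose k (k + 1) l) = entry \<mu> l"
        using t cross_dot len by (subst entry_swap_seq) auto
      then show "word_deg D w \<mu> = gen_deg D (Cross k) \<mu> + gen_deg D (Dot l) \<mu> \<and> word_end w \<mu> = swap_seq k \<mu>" if "w \<in> ?W" for w
        using that cross_dot len swap_seq_eq_self[of k \<mu>] by (auto simp: V_def split: if_splits)
    qed (use cross_dot \<nu> in auto)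
    ultimately show ?thesis by (rule homogeneous_at_subset[rotated])
  next
    case (cross_cross k l)
    have len: "length \<nu> = size \<beta>" using \<nu> seqs_length by auto
    have "Poly_Mapping.keys r \<subseteq> {[Cross k, Cross l], [Cross l, Cross k]}"
      unfolding cross_cross(1) by (rule order_trans[OF keys_diff_subset]) (auto split: if_splits)
    moreover have "swap_seq k (swap_seq l \<nu>) = swap_seq l (swap_seq k \<nu>)"
    proof (rule entry_ext)
      fix j assume j: "1 \<le> j" "j \<le> length (swap_seq l (swap_seq k \<nu>))"
      then have "transpose k (k + 1) j \<in> {1..length \<nu>}" "transpose l (l + 1) j \<in> {1..length \<nu>}"
        using transpose_in[of k "size \<beta>" j] transpose_in[of l "size \<beta>" j] cross_cross len by auto
      then show "entry (swap_seq k (swap_seq l \<nu>)) j = entry (swap_seq l (swap_seq k \<nu>)) j"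
        using j cross_cross len by (simp add: entry_swap_seq) (auto simp: transpose_def)
    qed simp
    moreover have "gen_deg D (Cross k) (swap_seq l \<nu>) = gen_deg D (Cross k) \<nu>"
      "gen_deg D (Cross l) (swap_seq k \<nu>) = gen_deg D (Cross l) \<nu>"
      using cross_cross len by (auto simp: entry_swap_seq transpose_def)
    ultimately show ?thesis
      by (elim homogeneous_at_subset[rotated])
        (rule all[of _ "gen_deg D (Cross k) \<nu> + gen_deg D (Cross l) \<nu>" "swap_seq k (swap_seq l \<nu>)"], auto)
  next
    case (braid \<mu> k)
    define a where "a = entry \<mu> k"
    define b where "b = entry \<mu> (k + 1)"
    define c where "c = entry \<mu> (k + 2)"
    define Q where "Q = Qpol D a b"
    define V where "V = (if a = c then {replicate j (Dot (k + 2)) @ replicate (s - 1 - j) (Dot k) @ replicate t (Dot (k + 1)) @ [Idm \<mu>] |j s t.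
       (s, t) \<in> Poly_Mapping.keys Q \<and> j < s} else {})"
    have len: "length \<mu> = size \<beta>" using braid seqs_length by auto
    have kV: "Poly_Mapping.keys (if a = c then div_diff Q k * mon [Idm \<mu>] else 0) \<subseteq> V"
    proof (cases "a = c")
      case True
      show ?thesis
      proof
        fix w assume "w \<in> Poly_Mapping.keys (if a = c then div_diff Q k * mon [Idm \<mu>] else 0)"
        then have "w \<in> (\<lambda>w. w @ [Idm \<mu>]) ` Poly_Mapping.keys (div_diff Q k)"
          using True keys_mult_mon[of "div_diff Q k" "[Idm \<mu>]"] by (simp add: subset_iff)
        then obtain v where v: "v \<in> Poly_Mapping.keys (div_diff Q k)" "w = v @ [Idm \<mu>]" by blast
        then obtain j s t where "v = replicate j (Dot (k + 2)) @ replicate (s - 1 - j) (Dot k) @ replicate t (Dot (k + 1))"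
          and st: "(s, t) \<in> Poly_Mapping.keys Q" "j < s"
          using keys_div_diff[of Q k] by blast
        then have "w = replicate j (Dot (k + 2)) @ replicate (s - 1 - j) (Dot k) @ replicate t (Dot (k + 1)) @ [Idm \<mu>]"
          using v by simp
        then show "w \<in> V"
          unfolding V_def if_P[OF True] using st by blast
      qed
    qed simp
    have "Poly_Mapping.keys r \<subseteq> {[Cross (k + 1), Cross k, Cross (k + 1), Idm \<mu>], [Cross k, Cross (k + 1), Cross k, Idm \<mu>]} \<union> V" (is "_ \<subseteq> ?W")
      unfolding braid(1) a_def[symmetric] b_def[symmetric] c_def[symmetric] Q_def[symmetric]
      apply (rule order_trans[OF keys_diff_subset])
      apply (rule Un_least)
       apply (rule order_trans[OF keys_diff_subset])
      using kV by (auto split: if_splits)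
    moreover have "homogeneous_at D \<beta> ?W \<nu>"
    proof (rule homogeneous_at_idem)
      show "\<exists>v. w = v @ [Idm \<mu>] \<and> set v \<subseteq> gens \<beta>" if "w \<in> ?W" for w
        using that
      proof
        assume "w \<in> {[Cross (k + 1), Cross k, Cross (k + 1), Idm \<mu>], [Cross k, Cross (k + 1), Cross k, Idm \<mu>]}"
        then have "w = [Cross (k + 1), Cross k, Cross (k + 1)] @ [Idm \<mu>] \<or> w = [Cross k, Cross (k + 1), Cross k] @ [Idm \<mu>]" by auto
        moreover have "set [Cross (k + 1), Cross k, Cross (k + 1)] \<subseteq> gens \<beta>" "set [Cross k, Cross (k + 1), Cross k] \<subseteq> gens \<beta>"
          using braid by auto
        ultimately show ?thesis by blast
      next
        assume "w \<in> V"
        then obtain j s t where "w = replicate j (Dot (k + 2)) @ replicate (s - 1 - j) (Dot k) @ replicate t (Dot (k + 1)) @ [Idm \<mu>]"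
          by (auto simp: V_def split: if_splits)
        then show ?thesis
          using braid by (intro exI[of _ "replicate j (Dot (k + 2)) @ replicate (s - 1 - j) (Dot k) @ replicate t (Dot (k + 1))"]) auto
      qed
      show "word_deg D w \<mu> = - form D a b - form D a c - form D b c \<and>
          word_end w \<mu> = swap_seq k (swap_seq (k + 1) (swap_seq k \<mu>))" if "w \<in> ?W" for w
        using that
      proof
        assume w: "w \<in> {[Cross (k + 1), Cross k, Cross (k + 1), Idm \<mu>], [Cross k, Cross (k + 1), Cross k, Idm \<mu>]}"
        have "word_deg D [Cross (k + 1), Cross k, Cross (k + 1), Idm \<mu>] \<mu> = - form D a b - form D a c - form D b c"
          using braid len by (simp add: entry_swap_seq a_def b_def c_def)
        moreover have "word_deg D [Cross k, Cross (k + 1), Cross k, Idm \<mu>] \<mu> = - form D a b - form D a c - form D b c"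
          using braid len by (simp add: entry_swap_seq a_def b_def c_def)
        ultimately show ?thesis
          using w swap_seq_braid[of k \<mu>] braid len by auto
      next
        assume "w \<in> V"
        then obtain j s t where w: "w = replicate j (Dot (k + 2)) @ replicate (s - 1 - j) (Dot k) @ replicate t (Dot (k + 1)) @ [Idm \<mu>]"
          and st: "(s, t) \<in> Poly_Mapping.keys Q" "j < s" and ac: "a = c"
          by (auto simp: V_def split: if_splits)
        have "int s * form D a a + int t * form D b b = - 2 * form D a b"
          using Qpol_homogeneous[OF D] st by (simp add: Q_def)
        moreover have "word_deg D w \<mu> = int j * form D c c + int (s - 1 - j) * form D a a + int t * form D b b"
          by (simp add: w a_def b_def c_def)
        \<comment> \<open>Natural subtraction is exact here, since j < s in every term of the
          divided difference.\<close>
        moreover have "int (s - 1 - j) = int s - 1 - int j" using st by simp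
        ultimately have "word_deg D w \<mu> = - form D a b - form D a c - form D b c"
          using ac fsym[of b a] by (simp add: algebra_simps)
        moreover have "word_end w \<mu> = \<mu>" by (simp add: w)
        moreover have "swap_seq k (swap_seq (k + 1) (swap_seq k \<mu>)) = \<mu>"
          using swap_seq_braid_eq_self[of k \<mu>] ac braid len by (simp add: a_def c_def)
        ultimately show ?thesis by simp
      qed
    qed (use braid \<nu> in auto)
    ultimately show ?thesis by (rule homogeneous_at_subset[rotated])
  qed
qed

text \<open>The projection to degree d before passing to the quotient: a word is split into its
  products with the \<open>1_\<nu>\<close>, and those of degree d are kept. It descends by
  \<open>klr_proj_ideal\<close>.\<close>

definition klr_proj :: "('i, 'k::{comm_ring,comm_monoid_mult}) klr_datum \<Rightarrow> 'i multiset \<Rightarrow> int \<Rightarrow> ('i, 'k) free \<Rightarrow> ('i, 'k) free" where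
  "klr_proj D \<beta> d = lin_ext (\<lambda>w. \<Sum>\<nu>\<in>{\<nu>\<in>seqs \<beta>. word_deg D w \<nu> = d}. mon (w @ [Idm \<nu>]))"

lemma klr_proj_single: "klr_proj D \<beta> d (Poly_Mapping.single w c) =
    (\<Sum>\<nu>\<in>{\<nu>\<in>seqs \<beta>. word_deg D w \<nu> = d}. Poly_Mapping.single (w @ [Idm \<nu>]) c)"
  by (simp add: klr_proj_def sum_distrib_left)

lemma klr_proj_add: "klr_proj D \<beta> d (p + q) = klr_proj D \<beta> d p + klr_proj D \<beta> d q"
  by (simp add: klr_proj_def lin_ext_add)

lemma klr_proj_diff: "klr_proj D \<beta> d (p - q) = klr_proj D \<beta> d p - klr_proj D \<beta> d q"
  by (simp add: klr_proj_def lin_ext_diff)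

lemma klr_proj_sum: "klr_proj D \<beta> d (sum f A) = (\<Sum>x\<in>A. klr_proj D \<beta> d (f x))"
  by (simp add: klr_proj_def lin_ext_sum)

lemma klr_proj_zero [simp]: "klr_proj D \<beta> d 0 = 0"
  by (simp add: klr_proj_def)

lemma klr_proj_carrier: "p \<in> free_carrier (gens \<beta>) \<Longrightarrow> klr_proj D \<beta> d p \<in> free_carrier (gens \<beta>)"
  unfolding klr_proj_def by (erule lin_ext_carrier) auto

text \<open>The sum over idempotents is taken outermost. For fixed \<nu> the word v leads from \<nu>
  to some \<nu>', where by \<open>relator_homogeneous\<close> either all words of r vanish, or all
  words \<open>u w v\<close> have one common degree, so that the projection keeps the whole of
  \<open>u r v 1_\<nu>\<close> or nothing of it.\<close>

lemma klr_proj_relator: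
  assumes D: "is_klr_datum D" and r: "r \<in> relators D \<beta>" and uv: "set u \<subseteq> gens \<beta>" "set v \<subseteq> gens \<beta>"
  shows "klr_cong D \<beta> (klr_proj D \<beta> d (Poly_Mapping.single u c * r * mon v)) 0"
proof -
  define K where "K = Poly_Mapping.keys r"
  define q where "q w \<nu> = Poly_Mapping.single (u @ w @ v @ [Idm \<nu>]) (c * Poly_Mapping.lookup r w)" for w \<nu>
  have wK: "set w \<subseteq> gens \<beta>" if "w \<in> K" for w
    using relators_carrier[OF r] that by (auto simp: K_def free_carrier_iff)
  have "Poly_Mapping.single u c * r * mon v = (\<Sum>w\<in>K. Poly_Mapping.single (u @ w @ v) (c * Poly_Mapping.lookup r w))"
    unfolding K_def by (subst poly_mapping_sum_singles[of r]) (simp add: sum_distrib_left sum_distrib_right)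
  then have "klr_proj D \<beta> d (Poly_Mapping.single u c * r * mon v) =
      (\<Sum>w\<in>K. \<Sum>\<nu>\<in>{\<nu>\<in>seqs \<beta>. word_deg D (u @ w @ v) \<nu> = d}. q w \<nu>)"
    by (simp add: klr_proj_sum klr_proj_single q_def)
  also have "\<dots> = (\<Sum>w\<in>K. \<Sum>\<nu>\<in>seqs \<beta>. if word_deg D (u @ w @ v) \<nu> = d then q w \<nu> else 0)"
    by (intro sum.cong refl sum.mono_neutral_cong_left) auto
  also have "\<dots> = (\<Sum>\<nu>\<in>seqs \<beta>. \<Sum>w\<in>K. if word_deg D (u @ w @ v) \<nu> = d then q w \<nu> else 0)"
    by (rule sum.swap)
  also have "klr_cong D \<beta> \<dots> 0"
  proof (rule kc_sum_zero)
    fix \<nu> assume \<nu>: "\<nu> \<in> seqs \<beta>"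
    define \<nu>' where "\<nu>' = word_end v \<nu>"
    have \<nu>': "\<nu>' \<in> seqs \<beta>" unfolding \<nu>'_def by (rule word_end_seqs[OF uv(2) \<nu>])
    have "homogeneous_at D \<beta> K \<nu>'"
      unfolding K_def by (rule relator_homogeneous[OF D r \<nu>'])
    then show "klr_cong D \<beta> (\<Sum>w\<in>K. if word_deg D (u @ w @ v) \<nu> = d then q w \<nu> else 0) 0"
      unfolding homogeneous_at_def
    proof
      assume z: "\<forall>w\<in>K. klr_cong D \<beta> (mon (w @ [Idm \<nu>'])) 0"
      have "klr_cong D \<beta> (q w \<nu>) 0" if w: "w \<in> K" for w
      proof -
        have "q w \<nu> = Poly_Mapping.single (u @ w) (c * Poly_Mapping.lookup r w) * mon (v @ [Idm \<nu>])"
          by (simp add: q_def)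
        also have "klr_cong D \<beta> \<dots> (Poly_Mapping.single (u @ w) (c * Poly_Mapping.lookup r w) * mon (Idm \<nu>' # v @ [Idm \<nu>]))"
          unfolding \<nu>'_def using uv wK[OF w] by (intro kc_mult_left kc_word_idem \<nu>) auto
        also have "\<dots> = (Poly_Mapping.single u (c * Poly_Mapping.lookup r w) * mon (w @ [Idm \<nu>'])) * mon (v @ [Idm \<nu>])"
          by simp
        also have "klr_cong D \<beta> \<dots> 0"
          by (rule kc_zero_mult(2)[OF kc_zero_mult(1)]) (use z w uv \<nu> in auto)
        finally show ?thesis .
      qed
      then show ?thesis
        by (intro kc_sum_zero) (auto intro: kc_refl)
    next
      assume "\<exists>d \<mu>. \<forall>w\<in>K. word_deg D w \<nu>' = d \<and> word_end w \<nu>' = \<mu>"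
      then obtain e \<mu> where e: "\<And>w. w \<in> K \<Longrightarrow> word_deg D w \<nu>' = e \<and> word_end w \<nu>' = \<mu>" by blast
      have full: "Poly_Mapping.single u c * r * mon (v @ [Idm \<nu>]) = (\<Sum>w\<in>K. q w \<nu>)"
        unfolding K_def q_def by (subst poly_mapping_sum_singles[of r]) (simp add: sum_distrib_left sum_distrib_right)
      \<comment> \<open>Degrees add along the word: v acts on \<nu>, then r on \<nu>', then u on the
        common end \<mu>.\<close>
      define e' where "e' = word_deg D u \<mu> + e + word_deg D v \<nu>"
      have "(\<Sum>w\<in>K. if word_deg D (u @ w @ v) \<nu> = d then q w \<nu> else 0) = (\<Sum>w\<in>K. if e' = d then q w \<nu> else 0)"
        using e by (intro sum.cong refl) (auto simp: e'_def \<nu>'_def)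
      also have "\<dots> = (if e' = d then Poly_Mapping.single u c * r * mon (v @ [Idm \<nu>]) else 0)"
        by (simp add: full)
      also have "klr_cong D \<beta> \<dots> 0"
      proof -
        have "klr_cong D \<beta> (Poly_Mapping.single u c * r) 0"
          by (rule kc_zero_mult(1)) (use klr_ideal_relator[OF r] uv in \<open>auto simp: kc_zero_iff\<close>)
        then have "klr_cong D \<beta> (Poly_Mapping.single u c * r * mon (v @ [Idm \<nu>])) 0"
          by (rule kc_zero_mult(2)) (use uv \<nu> in auto)
        then show ?thesis by (simp add: kc_refl)
      qed
      finally show ?thesis .
    qed
  qed
  finally show ?thesis .
qed

lemma klr_proj_ideal:
  assumes D: "is_klr_datum D" and p: "p \<in> klr_ideal D \<beta>"
  shows "klr_proj D \<beta> d p \<in> klr_ideal D \<beta>"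
  using p unfolding klr_ideal_free_span
proof (induction rule: free_span.induct)
  case (base u v r c)
  then show ?case
    using klr_proj_relator[OF D base(3,1,2)] by (simp add: kc_zero_iff klr_ideal_free_span)
qed (auto simp: klr_proj_add intro: free_span.intros)

lemma klr_proj_cong:
  assumes "is_klr_datum D" "klr_cong D \<beta> p q"
  shows "klr_cong D \<beta> (klr_proj D \<beta> d p) (klr_proj D \<beta> d q)"
  using assms klr_proj_ideal[of D "p - q" \<beta> d] by (auto simp: klr_cong_def klr_proj_diff klr_proj_carrier)

text \<open>A representative is chosen; by \<open>klr_proj_cong\<close> the resulting class does not
  depend on it.\<close>

definition klr_comp :: "('i, 'k::{comm_ring,comm_monoid_mult}) klr_datum \<Rightarrow> 'i multiset \<Rightarrow> int \<Rightarrow> ('i, 'k) klr \<Rightarrow> ('i, 'k) klr" where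
  "klr_comp D \<beta> d x = klr_class D \<beta> (klr_proj D \<beta> d (SOME p. p \<in> x))"

lemma klr_comp_class:
  assumes "is_klr_datum D" "p \<in> free_carrier (gens \<beta>)"
  shows "klr_comp D \<beta> d (klr_class D \<beta> p) = klr_class D \<beta> (klr_proj D \<beta> d p)"
proof -
  have "(SOME q. q \<in> klr_class D \<beta> p) \<in> klr_class D \<beta> p"
    using klr_class_self[OF assms(2), of D] by (rule someI)
  then have "klr_cong D \<beta> (SOME q. q \<in> klr_class D \<beta> p) p"
    using klr_class_mem[OF assms(2)] by blast
  then show ?thesis
    unfolding klr_comp_def using kc_class klr_proj_cong[OF assms(1)] by blast
qed

text \<open>Sums of monomials ending in an idempotent, the shape on which \<open>klr_proj\<close>
  can be computed. They connect the inductive predicate \<open>klr_homogeneous\<close> with the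
  projections.\<close>

inductive_set homogeneous_words :: "('i, 'k::{comm_ring,comm_monoid_mult}) klr_datum \<Rightarrow> 'i multiset \<Rightarrow> int \<Rightarrow> ('i, 'k) free set"
  for D :: "('i, 'k) klr_datum" and \<beta> :: "'i multiset" and d :: int where
  zero: "0 \<in> homogeneous_words D \<beta> d"
| add: "p \<in> homogeneous_words D \<beta> d \<Longrightarrow> q \<in> homogeneous_words D \<beta> d \<Longrightarrow> p + q \<in> homogeneous_words D \<beta> d"
| single: "set w \<subseteq> gens \<beta> \<Longrightarrow> \<nu> \<in> seqs \<beta> \<Longrightarrow> word_deg D w \<nu> = d \<Longrightarrow>
    Poly_Mapping.single (w @ [Idm \<nu>]) c \<in> homogeneous_words D \<beta> d"

lemma homogeneous_words_sum: "(\<And>x. x \<in> A \<Longrightarrow> f x \<in> homogeneous_words D \<beta> d) \<Longrightarrow> sum f A \<in> homogeneous_words D \<beta> d"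
  by (induction A rule: infinite_finite_induct) (auto intro: homogeneous_words.intros)

lemma homogeneous_words_carrier: "p \<in> homogeneous_words D \<beta> d \<Longrightarrow> p \<in> free_carrier (gens \<beta>)"
  by (induction rule: homogeneous_words.induct) auto

text \<open>By orthogonality only the idempotent in which the word already ends contributes.\<close>

lemma klr_proj_homogeneous:
  assumes "p \<in> homogeneous_words D \<beta> e"
  shows "klr_cong D \<beta> (klr_proj D \<beta> d p) (if d = e then p else 0)"
  using assms
proof (induction rule: homogeneous_words.induct)
  case zero
  then show ?case by (auto intro: kc_refl)
next
  case (add p q)
  then show ?case using kc_add[OF add.IH] by (auto simp: klr_proj_add)
next
  case (single w \<nu> c)
  define A where "A = {\<nu>' \<in> seqs \<beta>. word_deg D (w @ [Idm \<nu>]) \<nu>' = d}"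
  have A: "finite A" "\<nu> \<in> A \<longleftrightarrow> d = e" unfolding A_def using single by auto
  have "klr_cong D \<beta> (\<Sum>\<nu>'\<in>A. Poly_Mapping.single ((w @ [Idm \<nu>]) @ [Idm \<nu>']) c)
      (\<Sum>\<nu>'\<in>A. if \<nu>' = \<nu> then Poly_Mapping.single (w @ [Idm \<nu>]) c else 0)"
  proof (rule kc_sum)
    fix \<nu>' assume "\<nu>' \<in> A"
    then have "klr_cong D \<beta> (Poly_Mapping.single w c * mon [Idm \<nu>, Idm \<nu>'])
        (Poly_Mapping.single w c * (if \<nu> = \<nu>' then mon [Idm \<nu>] else 0))"
      using single by (intro kc_mult_left kc_idem_idem) (auto simp: A_def)
    then show "klr_cong D \<beta> (Poly_Mapping.single ((w @ [Idm \<nu>]) @ [Idm \<nu>']) c)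
        (if \<nu>' = \<nu> then Poly_Mapping.single (w @ [Idm \<nu>]) c else 0)"
      by (auto split: if_splits)
  qed
  also have "(\<Sum>\<nu>'\<in>A. if \<nu>' = \<nu> then Poly_Mapping.single (w @ [Idm \<nu>]) c else 0) =
      (if d = e then Poly_Mapping.single (w @ [Idm \<nu>]) c else 0)"
    using A by simp
  finally show ?case
    by (simp add: klr_proj_single A_def)
qed

section \<open>Homogeneous elements versus homogeneous words, and the grading of the algebra\<close>

lemma klr_homogeneous_carrier: "klr_homogeneous D \<beta> d x \<Longrightarrow> x \<in> carrier (KLR D \<beta>)"
proof (induction rule: klr_homogeneous.induct)
  interpret R: ring "KLR D \<beta>" by (rule ring_KLR)
  {
    case hom_zero show ?case by simp
  next
    case hom_add then show ?case by simp
  next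
    case hom_mult then show ?case by simp
  next
    case hom_scalar show ?case by (auto simp: klr_scalar_def)
  }
qed auto

text \<open>The rules for \<open>klr_homogeneous\<close> concern single letters next to an
  idempotent, so idempotents are inserted between all letters by
  \<open>kc_word_idem\<close>.\<close>

lemma klr_homogeneous_word:
  assumes "set w \<subseteq> gens \<beta>" and \<nu>: "\<nu> \<in> seqs \<beta>"
  shows "klr_homogeneous D \<beta> (word_deg D w \<nu>) (klr_class D \<beta> (mon (w @ [Idm \<nu>])))"
  using assms(1)
proof (induction w)
  case Nil
  then show ?case using klr_homogeneous.hom_idem[OF \<nu>] by simp
next
  case (Cons g w)
  define \<nu>' where "\<nu>' = word_end w \<nu>"
  have \<nu>': "\<nu>' \<in> seqs \<beta>" unfolding \<nu>'_def using Cons word_end_seqs \<nu> by auto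
  have g: "g \<in> gens \<beta>" "set w \<subseteq> gens \<beta>" using Cons by auto
  have "klr_cong D \<beta> (mon [g] * mon (w @ [Idm \<nu>])) (mon [g] * mon (Idm \<nu>' # w @ [Idm \<nu>]))"
    unfolding \<nu>'_def using g by (intro kc_mult_left kc_word_idem \<nu>) auto
  then have "klr_class D \<beta> (mon ((g # w) @ [Idm \<nu>])) = klr_class D \<beta> (mon [g, Idm \<nu>'] * mon (w @ [Idm \<nu>]))"
    by (intro kc_class) simp
  also have "\<dots> = klr_class D \<beta> (mon [g, Idm \<nu>']) \<otimes>\<^bsub>KLR D \<beta>\<^esub> klr_class D \<beta> (mon (w @ [Idm \<nu>]))"
    using g \<nu>' \<nu> by (subst klr_class_mult) auto
  finally have eq: "klr_class D \<beta> (mon ((g # w) @ [Idm \<nu>])) = klr_class D \<beta> (mon [g, Idm \<nu>']) \<otimes>\<^bsub>KLR D \<beta>\<^esub> klr_class D \<beta> (mon (w @ [Idm \<nu>]))" .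
  have "klr_homogeneous D \<beta> (gen_deg D g \<nu>') (klr_class D \<beta> (mon [g, Idm \<nu>']))"
    using g(1)
  proof (cases rule: gens_cases)
    case (1 \<mu>)
    have "klr_class D \<beta> (mon [g, Idm \<nu>']) = klr_class D \<beta> (mon [Idm \<mu>]) \<otimes>\<^bsub>KLR D \<beta>\<^esub> klr_class D \<beta> (mon [Idm \<nu>'])"
      using 1 \<nu>' by (subst klr_class_mult) auto
    then show ?thesis
      using klr_homogeneous.hom_mult[OF klr_homogeneous.hom_idem[OF 1(2)] klr_homogeneous.hom_idem[OF \<nu>'], of D] 1 by simp
  next
    case (2 k)
    then show ?thesis using klr_homogeneous.hom_dot[OF \<nu>', of k D] by simp
  next
    case (3 k)
    then show ?thesis using klr_homogeneous.hom_cross[OF \<nu>', of k D] by simp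
  qed
  then show ?case
    unfolding eq using klr_homogeneous.hom_mult Cons by (fastforce simp: \<nu>'_def)
qed

lemma homogeneous_words_klr_homogeneous:
  "p \<in> homogeneous_words D \<beta> d \<Longrightarrow> klr_homogeneous D \<beta> d (klr_class D \<beta> p)"
proof (induction rule: homogeneous_words.induct)
  case zero
  then show ?case using klr_homogeneous.hom_zero[of D \<beta> d] by (simp add: klr_class_zero)
next
  case (add p q)
  then show ?case using klr_homogeneous.hom_add[OF add.IH] homogeneous_words_carrier[of p D \<beta> d] homogeneous_words_carrier[of q D \<beta> d]
    by (simp add: klr_class_add)
next
  case (single w \<nu> c)
  have "klr_class D \<beta> (Poly_Mapping.single (w @ [Idm \<nu>]) c) = klr_scalar D \<beta> c \<otimes>\<^bsub>KLR D \<beta>\<^esub> klr_class D \<beta> (mon (w @ [Idm \<nu>]))"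
    unfolding klr_scalar_def using single by (subst klr_class_mult) auto
  then show ?case
    using klr_homogeneous.hom_mult[OF klr_homogeneous.hom_scalar klr_homogeneous_word[OF single(1,2)], of D c] single by simp
qed

lemma kc_single_idem_sum:
  assumes "set w \<subseteq> gens \<beta>"
  shows "klr_cong D \<beta> (Poly_Mapping.single w c) (\<Sum>\<nu>\<in>seqs \<beta>. Poly_Mapping.single (w @ [Idm \<nu>]) c)"
  using kc_sym[OF kc_mult_left[OF kc_idem_sum, of "Poly_Mapping.single w c" \<beta> D]] assms by (simp add: sum_distrib_left)

text \<open>The idempotent in the middle either equals the end of the right word, is absorbed, and
  degrees add; or the product vanishes. This holds only modulo relations, hence the
  existential.\<close>

lemma homogeneous_words_mult:
  assumes "p \<in> homogeneous_words D \<beta> d" "q \<in> homogeneous_words D \<beta> e"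
  shows "\<exists>r\<in>homogeneous_words D \<beta> (d + e). klr_cong D \<beta> (p * q) r"
  using assms(1)
proof (induction rule: homogeneous_words.induct)
  case zero
  then show ?case by (auto intro!: bexI[of _ 0] kc_refl homogeneous_words.zero)
next
  case (add p p')
  then obtain r r' where r: "r \<in> homogeneous_words D \<beta> (d + e)" "klr_cong D \<beta> (p * q) r"
    "r' \<in> homogeneous_words D \<beta> (d + e)" "klr_cong D \<beta> (p' * q) r'" by blast
  then show ?case
    using kc_add[OF r(2,4)] homogeneous_words.add[OF r(1,3)] by (auto simp: distrib_right)
next
  case (single w \<nu> c)
  show ?case
    using assms(2)
  proof (induction rule: homogeneous_words.induct)
    case zero
    then show ?case by (auto intro!: bexI[of _ 0] kc_refl homogeneous_words.zero)
  next
    case (add q q')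
    then obtain r r' where r: "r \<in> homogeneous_words D \<beta> (d + e)" "klr_cong D \<beta> (Poly_Mapping.single (w @ [Idm \<nu>]) c * q) r"
      "r' \<in> homogeneous_words D \<beta> (d + e)" "klr_cong D \<beta> (Poly_Mapping.single (w @ [Idm \<nu>]) c * q') r'" by blast
    then show ?case
      using kc_add[OF r(2,4)] homogeneous_words.add[OF r(1,3)] by (auto simp: distrib_left)
  next
    case (single v \<mu> b)
    note w = \<open>set w \<subseteq> gens \<beta>\<close> \<open>\<nu> \<in> seqs \<beta>\<close> \<open>word_deg D w \<nu> = d\<close>
    have ve: "word_end v \<mu> \<in> seqs \<beta>" using word_end_seqs single by auto
    show ?case
    proof (cases "\<nu> = word_end v \<mu>")
      case True
      have "klr_cong D \<beta> (Poly_Mapping.single w (c * b) * mon (Idm \<nu> # v @ [Idm \<mu>])) (Poly_Mapping.single w (c * b) * mon (v @ [Idm \<mu>]))"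
        unfolding True using w single by (intro kc_mult_left kc_sym[OF kc_word_idem]) auto
      moreover have "Poly_Mapping.single (w @ v @ [Idm \<mu>]) (c * b) \<in> homogeneous_words D \<beta> (d + e)"
        using w single True homogeneous_words.single[of "w @ v" \<beta> \<mu> D "d + e"] by simp
      ultimately show ?thesis by (auto intro!: bexI)
    next
      case False
      have "klr_cong D \<beta> (Poly_Mapping.single w (c * b) * mon (Idm \<nu> # v @ [Idm \<mu>])) 0"
        using w single False by (intro kc_zero_mult kc_word_idem_other) auto
      then show ?thesis by (auto intro!: bexI[of _ 0] homogeneous_words.zero)
    qed
  qed
qed

lemma klr_homogeneous_homogeneous_words:
  "klr_homogeneous D \<beta> d x \<Longrightarrow> \<exists>p\<in>homogeneous_words D \<beta> d. x = klr_class D \<beta> p"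
proof (induction rule: klr_homogeneous.induct)
  case (hom_zero d)
  then show ?case by (auto simp: klr_class_zero intro: homogeneous_words.zero)
next
  case (hom_add d a b)
  then obtain p q where pq: "p \<in> homogeneous_words D \<beta> d" "a = klr_class D \<beta> p"
    "q \<in> homogeneous_words D \<beta> d" "b = klr_class D \<beta> q" by blast
  then show ?case
    using homogeneous_words.add[OF pq(1,3)] homogeneous_words_carrier[OF pq(1)] homogeneous_words_carrier[OF pq(3)]
    by (auto simp: klr_class_add)
next
  case (hom_mult d a e b)
  then obtain p q where pq: "p \<in> homogeneous_words D \<beta> d" "a = klr_class D \<beta> p"
    "q \<in> homogeneous_words D \<beta> e" "b = klr_class D \<beta> q" by blast
  obtain r where "r \<in> homogeneous_words D \<beta> (d + e)" "klr_cong D \<beta> (p * q) r"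
    using homogeneous_words_mult[OF pq(1,3)] by blast
  moreover have "a \<otimes>\<^bsub>KLR D \<beta>\<^esub> b = klr_class D \<beta> (p * q)"
    using homogeneous_words_carrier[OF pq(1)] homogeneous_words_carrier[OF pq(3)] by (simp add: pq klr_class_mult)
  ultimately show ?case
    using kc_class by metis
next
  case (hom_scalar c)
  have "(\<Sum>\<nu>\<in>seqs \<beta>. Poly_Mapping.single ([] @ [Idm \<nu>]) c) \<in> homogeneous_words D \<beta> 0"
    by (rule homogeneous_words_sum) (rule homogeneous_words.single, auto)
  then show ?case
    unfolding klr_scalar_def using kc_class[OF kc_single_idem_sum[of "[]" \<beta> D c]] by auto
next
  case (hom_idem \<nu>)
  then show ?case using homogeneous_words.single[of "[]" \<beta> \<nu> D 0 1] by auto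
next
  case (hom_dot \<nu> k)
  then show ?case using homogeneous_words.single[of "[Dot k]" \<beta> \<nu> D _ 1] by fastforce
next
  case (hom_cross \<nu> k)
  then show ?case using homogeneous_words.single[of "[Cross k]" \<beta> \<nu> D _ 1] by fastforce
qed

text \<open>Negation is multiplication by the scalar -1, which has degree 0.\<close>

lemma klr_homogeneous_uminus:
  assumes "klr_homogeneous D \<beta> d x"
  shows "klr_homogeneous D \<beta> d (\<ominus>\<^bsub>KLR D \<beta>\<^esub> x)"
proof -
  interpret R: ring "KLR D \<beta>" by (rule ring_KLR)
  have "klr_homogeneous D \<beta> d (klr_scalar D \<beta> (- 1) \<otimes>\<^bsub>KLR D \<beta>\<^esub> x)"
    using klr_homogeneous.hom_mult[OF klr_homogeneous.hom_scalar assms, of "- 1"] by simp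
  moreover have "klr_scalar D \<beta> (- 1) = \<ominus>\<^bsub>KLR D \<beta>\<^esub> \<one>\<^bsub>KLR D \<beta>\<^esub>"
    by (simp add: klr_scalar_def klr_class_one klr_class_uminus single_uminus)
  ultimately show ?thesis
    using klr_homogeneous_carrier[OF assms] by (simp add: R.l_minus)
qed

lemma klr_graded_by:
  assumes D: "is_klr_datum D"
  shows "graded_by (KLR D \<beta>) (\<lambda>d. {a. klr_homogeneous D \<beta> d a})"
proof (rule graded_groupI[where p = "klr_comp D \<beta>"])
  interpret R: ring "KLR D \<beta>" by (rule ring_KLR)
  show "abelian_group (KLR D \<beta>)" by (rule R.is_abelian_group)
  show "subgroup {a. klr_homogeneous D \<beta> d a} (add_monoid (KLR D \<beta>))" for d
  proof (rule group.subgroupI[OF R.a_group])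
    show "inv\<^bsub>add_monoid (KLR D \<beta>)\<^esub> a \<in> {a. klr_homogeneous D \<beta> d a}" if "a \<in> {a. klr_homogeneous D \<beta> d a}" for a
      using klr_homogeneous_uminus[of D \<beta> d a] that by (simp add: a_inv_def)
  qed (auto intro: klr_homogeneous_carrier klr_homogeneous.hom_zero klr_homogeneous.hom_add)
  show "add_hom (KLR D \<beta>) (KLR D \<beta>) (klr_comp D \<beta> d)" for d
    by (rule add_homI)
      (auto simp: KLR_carrier klr_comp_class[OF D] klr_class_add klr_proj_add klr_proj_carrier)
  show "klr_comp D \<beta> d x = (if d = e then x else \<zero>\<^bsub>KLR D \<beta>\<^esub>)" if "x \<in> {a. klr_homogeneous D \<beta> e a}" for d e x
  proof -
    from klr_homogeneous_homogeneous_words[of D \<beta> e x] that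
    obtain p where p: "p \<in> homogeneous_words D \<beta> e" "x = klr_class D \<beta> p" by blast
    show ?thesis
      using kc_class[OF klr_proj_homogeneous[OF p(1), of d]]
      by (simp add: p klr_comp_class[OF D homogeneous_words_carrier[OF p(1)]] klr_class_zero split: if_splits)
  qed
  show "carrier (KLR D \<beta>) \<subseteq> generate (add_monoid (KLR D \<beta>)) (\<Union>d. {a. klr_homogeneous D \<beta> d a})"
  proof
    fix x assume "x \<in> carrier (KLR D \<beta>)"
    then obtain p where p: "p \<in> free_carrier (gens \<beta>)" "x = klr_class D \<beta> p"
      by (auto simp: KLR_carrier)
    have "klr_class D \<beta> p \<in> generate (add_monoid (KLR D \<beta>)) (\<Union>d. {a. klr_homogeneous D \<beta> d a})"
      using p(1)
    proof (induction rule: free_carrier_induct)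
      case (single w c)
      \<comment> \<open>Multiplication by 1, the sum of all idempotents, splits a monomial into
        homogeneous words.\<close>
      have "klr_class D \<beta> (Poly_Mapping.single w c) = klr_class D \<beta> (\<Sum>\<nu>\<in>seqs \<beta>. Poly_Mapping.single (w @ [Idm \<nu>]) c)"
        by (rule kc_class[OF kc_single_idem_sum[OF single]])
      also have "\<dots> = finsum (KLR D \<beta>) (\<lambda>\<nu>. klr_class D \<beta> (Poly_Mapping.single (w @ [Idm \<nu>]) c)) (seqs \<beta>)"
        using single by (intro klr_class_sum) auto
      also have "\<dots> \<in> generate (add_monoid (KLR D \<beta>)) (\<Union>d. {a. klr_homogeneous D \<beta> d a})"
      proof (rule generate_finsum[OF R.is_abelian_group])
        show "(\<Union>d. {a. klr_homogeneous D \<beta> d a}) \<subseteq> carrier (KLR D \<beta>)"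
          by (auto intro: klr_homogeneous_carrier)
        show "klr_class D \<beta> (Poly_Mapping.single (w @ [Idm \<nu>]) c) \<in> generate (add_monoid (KLR D \<beta>)) (\<Union>d. {a. klr_homogeneous D \<beta> d a})"
          if "\<nu> \<in> seqs \<beta>" for \<nu>
          using homogeneous_words_klr_homogeneous[OF homogeneous_words.single[OF single that HOL.refl]]
          by (intro generate.incl) blast
      qed simp
      finally show ?case .
    next
      case zero
      then show ?case using generate.one[of "add_monoid (KLR D \<beta>)"] by (simp add: klr_class_zero)
    next
      case (add p q)
      then show ?case using generate.eng[OF add.IH] by (simp add: klr_class_add)
    qed
    then show "x \<in> generate (add_monoid (KLR D \<beta>)) (\<Union>d. {a. klr_homogeneous D \<beta> d a})"
      using p by simp
  qed
qed

lemma klr_graded_group: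
  assumes "is_klr_datum D"
  shows "graded_group (KLR D \<beta>) (\<lambda>d. {a. klr_homogeneous D \<beta> d a})"
  by (intro graded_group.intro graded_group_axioms.intro klr_graded_by assms ring.is_abelian_group ring_KLR)

lemma klr_homogeneous_one: "klr_homogeneous D \<beta> 0 \<one>\<^bsub>KLR D \<beta>\<^esub>"
  using klr_homogeneous.hom_scalar[of D \<beta> 1] by (simp add: klr_scalar_def klr_class_one)

section \<open>The product \<open>y \<diamondop> z\<close>\<close>

lemma kc_commute_add:
  "klr_cong D \<beta> (p * a) (a * p) \<Longrightarrow> klr_cong D \<beta> (p * b) (b * p) \<Longrightarrow> klr_cong D \<beta> (p * (a + b)) ((a + b) * p)"
  by (simp add: distrib_left distrib_right kc_add)

lemma kc_commute_sum:
  "(\<And>x. x \<in> A \<Longrightarrow> klr_cong D \<beta> (p * f x) (f x * p)) \<Longrightarrow> klr_cong D \<beta> (p * sum f A) (sum f A * p)"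
  by (simp add: sum_distrib_left sum_distrib_right kc_sum)

lemma kc_commute_mult:
  assumes "klr_cong D \<beta> (p * a) (a * p)" "klr_cong D \<beta> (p * b) (b * p)"
    "a \<in> free_carrier (gens \<beta>)" "b \<in> free_carrier (gens \<beta>)"
  shows "klr_cong D \<beta> (p * (a * b)) ((a * b) * p)"
proof -
  have "klr_cong D \<beta> (p * a * b) (a * p * b)" by (rule kc_mult_right[OF assms(1,4)])
  also have "a * p * b = a * (p * b)" by (simp add: mult.assoc)
  also have "klr_cong D \<beta> (a * (p * b)) (a * (b * p))" by (rule kc_mult_left[OF assms(2,3)])
  finally show ?thesis by (simp add: mult.assoc)
qed

text \<open>The elements commuting with p modulo relations form a subalgebra, so the images of
  letters suffice. Applied once in each factor this yields
  \<open>left_right_commute\<close>.\<close>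

lemma kc_commute_subst:
  assumes p: "p \<in> free_carrier (gens \<beta>)" and q: "q \<in> free_carrier S"
    and f: "\<And>g. g \<in> S \<Longrightarrow> f g \<in> free_carrier (gens \<beta>)" "\<And>g. g \<in> S \<Longrightarrow> klr_cong D \<beta> (p * f g) (f g * p)"
  shows "klr_cong D \<beta> (p * subst_free f q) (subst_free f q * p)"
  using q
proof (induction rule: free_carrier_induct)
  case (single w c)
  have "klr_cong D \<beta> (p * foldr (\<lambda>g q. f g * q) w (mon [])) (foldr (\<lambda>g q. f g * q) w (mon []) * p)"
    using single
  proof (induction w)
    case Nil
    then show ?case using p by (simp add: kc_refl)
  next
    case (Cons g w)
    then show ?case
      using f subst_word_carrier[of w f "gens \<beta>"] by (auto intro!: kc_commute_mult)
  qed
  moreover have "klr_cong D \<beta> (p * Poly_Mapping.single [] c) (Poly_Mapping.single [] c * p)"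
    using p by (simp add: scalar_commute kc_refl)
  ultimately show ?case
    unfolding subst_free_single using single f by (intro kc_commute_mult subst_word_carrier) auto
qed (use p in \<open>auto simp: subst_free_add intro!: kc_commute_add kc_refl\<close>)

lemma kc_commute_sym: "klr_cong D \<beta> (p * q) (q * p) \<Longrightarrow> klr_cong D \<beta> (q * p) (p * q)"
  by (rule kc_sym)

lemma kc_idem_commute:
  assumes "\<nu> \<in> seqs \<beta>" "\<nu>' \<in> seqs \<beta>"
  shows "klr_cong D \<beta> (mon [Idm \<nu>] * mon [Idm \<nu>']) (mon [Idm \<nu>'] * mon [Idm \<nu>])"
proof (cases "\<nu> = \<nu>'")
  case True
  then show ?thesis using assms by (simp add: kc_refl)
next
  case False
  then show ?thesis
    using kc_trans[OF _ kc_sym, of D \<beta> "mon [Idm \<nu>, Idm \<nu>']" 0 "mon [Idm \<nu>', Idm \<nu>]"]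
      kc_idem_idem[OF assms, of D] kc_idem_idem[OF assms(2,1), of D] by simp
qed

lemma kc_idem_sums_commute:
  assumes "A \<subseteq> seqs \<beta>" "B \<subseteq> seqs \<beta>"
  shows "klr_cong D \<beta> ((\<Sum>\<nu>\<in>A. mon [Idm \<nu>]) * (\<Sum>\<nu>\<in>B. mon [Idm \<nu>])) ((\<Sum>\<nu>\<in>B. mon [Idm \<nu>]) * (\<Sum>\<nu>\<in>A. mon [Idm \<nu>]))"
  using assms by (intro kc_commute_sum kc_commute_sym[OF kc_commute_sum] kc_idem_commute) auto

text \<open>Sums of idempotents multiply as their index sets intersect, so absorption between
  idempotents becomes inclusion of sets of sequences.\<close>

lemma kc_idem_sums_mult:
  assumes "A \<subseteq> seqs \<beta>" "B \<subseteq> seqs \<beta>"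
  shows "klr_cong D \<beta> ((\<Sum>\<nu>\<in>A. mon [Idm \<nu>]) * (\<Sum>\<nu>\<in>B. mon [Idm \<nu>])) (\<Sum>\<nu>\<in>A \<inter> B. mon [Idm \<nu>])"
proof -
  have fin: "finite A" "finite B" using assms finite_subset[OF _ finite_seqs] by auto
  have "(\<Sum>\<nu>\<in>A. mon [Idm \<nu>]) * (\<Sum>\<nu>\<in>B. mon [Idm \<nu>]) = (\<Sum>\<nu>\<in>A. \<Sum>\<nu>'\<in>B. mon [Idm \<nu>, Idm \<nu>'])"
    by (simp add: sum_product)
  also have "klr_cong D \<beta> \<dots> (\<Sum>\<nu>\<in>A. \<Sum>\<nu>'\<in>B. if \<nu> = \<nu>' then mon [Idm \<nu>] else 0)"
    using assms by (intro kc_sum kc_idem_idem) auto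
  also have "\<dots> = (\<Sum>\<nu>\<in>A. if \<nu> \<in> B then mon [Idm \<nu>] else 0)"
    using fin by (intro sum.cong HOL.refl) simp
  also have "\<dots> = (\<Sum>\<nu>\<in>A \<inter> B. mon [Idm \<nu>])"
    using fin by (simp add: sum.inter_restrict)
  finally show ?thesis .
qed

lemma kc_dot_idem_sum:
  assumes "A \<subseteq> seqs \<beta>" "1 \<le> k" "k \<le> size \<beta>"
  shows "klr_cong D \<beta> (mon [Dot k] * (\<Sum>\<nu>\<in>A. mon [Idm \<nu>])) ((\<Sum>\<nu>\<in>A. mon [Idm \<nu>]) * mon [Dot k])"
  using assms kc_dot_idem[of _ \<beta> k D] by (intro kc_commute_sum) auto

text \<open>\<open>swap_seq k\<close> is an involution, so the two inclusions make it a bijection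
  from A to B, along which the sum is reindexed. For A = B the crossing commutes with the
  idempotent.\<close>

lemma kc_cross_idem_sum:
  assumes "A \<subseteq> seqs \<beta>" "1 \<le> k" "k < size \<beta>" "swap_seq k ` A \<subseteq> B" "swap_seq k ` B \<subseteq> A"
  shows "klr_cong D \<beta> (mon [Cross k] * (\<Sum>\<nu>\<in>A. mon [Idm \<nu>])) ((\<Sum>\<nu>\<in>B. mon [Idm \<nu>]) * mon [Cross k])"
proof -
  have B: "B \<subseteq> seqs \<beta>"
  proof
    fix \<nu> assume \<nu>: "\<nu> \<in> B"
    then have s: "swap_seq k \<nu> \<in> seqs \<beta>" using assms by auto
    have "length \<nu> = size \<beta>" using seqs_length[OF s] by simp
    moreover have "swap_seq k (swap_seq k \<nu>) \<in> seqs \<beta>" by (rule swap_seq_seqs[OF s assms(2,3)])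
    ultimately show "\<nu> \<in> seqs \<beta>" using assms by simp
  qed
  have len: "length \<nu> = size \<beta>" if "\<nu> \<in> A \<union> B" for \<nu> using that assms B seqs_length by blast
  have "klr_cong D \<beta> (mon [Cross k] * (\<Sum>\<nu>\<in>A. mon [Idm \<nu>])) (\<Sum>\<nu>\<in>A. mon [Idm (swap_seq k \<nu>)] * mon [Cross k])"
    unfolding sum_distrib_left using assms kc_cross_idem[of _ \<beta> k D] by (intro kc_sum) auto
  also have "(\<Sum>\<nu>\<in>A. mon [Idm (swap_seq k \<nu>)] * mon [Cross k]) = (\<Sum>\<nu>\<in>B. mon [Idm \<nu>] * mon [Cross k])"
    using assms len by (intro sum.reindex_bij_witness[of _ "swap_seq k" "swap_seq k"]) auto
  finally show ?thesis by (simp add: sum_distrib_right)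
qed

text \<open>The defining relation is given next to an idempotent; summing over all \<nu> removes
  it.\<close>

lemma kc_cross_dot_far:
  assumes "1 \<le> k" "k < size \<beta>" "1 \<le> l" "l \<le> size \<beta>" "l \<noteq> k" "l \<noteq> k + 1"
  shows "klr_cong D \<beta> (mon [Cross k] * mon [Dot l]) (mon [Dot l] * mon [Cross k])"
proof -
  have "klr_cong D \<beta> (mon [Cross k, Dot l, Idm \<nu>]) (mon [Dot l, Cross k, Idm \<nu>])" if "\<nu> \<in> seqs \<beta>" for \<nu>
    using relators.cross_dot[OF that, of k l D] assms that by (intro kc_relator) (auto simp: transpose_def)
  then have "klr_cong D \<beta> (\<Sum>\<nu>\<in>seqs \<beta>. mon [Cross k, Dot l, Idm \<nu>]) (\<Sum>\<nu>\<in>seqs \<beta>. mon [Dot l, Cross k, Idm \<nu>])"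
    by (rule kc_sum)
  then show ?thesis
    using kc_single_idem_sum[of "[Cross k, Dot l]" \<beta> D 1] kc_sym[OF kc_single_idem_sum[of "[Dot l, Cross k]" \<beta> D 1]] assms
    by (auto intro: kc_trans)
qed

text \<open>The common form of \<open>left_gen\<close> and \<open>right_gen\<close>, so that the
  relations are verified once for both factors.\<close>

fun block_gen :: "nat \<Rightarrow> ('i list \<Rightarrow> 'i list set) \<Rightarrow> 'i gen \<Rightarrow> ('i, 'k::{comm_ring,comm_monoid_mult}) free" where
  "block_gen m K (Idm \<mu>) = (\<Sum>\<kappa>\<in>K \<mu>. mon [Idm \<kappa>])"
| "block_gen m K (Dot k) = mon [Dot (m + k)]"
| "block_gen m K (Cross k) = mon [Cross (m + k)]"

lemma left_gen_block_gen: "left_gen \<gamma> = block_gen (size \<gamma>) (\<lambda>\<mu>. (\<lambda>\<nu>. \<mu> @ \<nu>) ` seqs \<gamma>)"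
proof
  show "left_gen \<gamma> g = block_gen (size \<gamma>) (\<lambda>\<mu>. (\<lambda>\<nu>. \<mu> @ \<nu>) ` seqs \<gamma>) g" for g :: "'a gen"
    by (cases g) (auto simp: sum.reindex inj_on_def)
qed

lemma right_gen_block_gen: "right_gen \<beta> = block_gen 0 (\<lambda>\<nu>. (\<lambda>\<mu>. \<mu> @ \<nu>) ` seqs \<beta>)"
proof
  show "right_gen \<beta> g = block_gen 0 (\<lambda>\<nu>. (\<lambda>\<mu>. \<mu> @ \<nu>) ` seqs \<beta>) g" for g :: "'a gen"
    by (cases g) (auto simp: sum.reindex inj_on_def)
qed

text \<open>Both factors of \<open>H\<^sub>\<beta> \<otimes> H\<^sub>\<gamma>\<close> act on a block of consecutive strands, shifted by \<open>m\<close>; \<open>K \<mu>\<close> is the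
  set of sequences whose restriction to the block is \<open>\<mu>\<close>.\<close>

locale klr_block =
  fixes D :: "('i, 'k::{comm_ring,comm_monoid_mult}) klr_datum" and \<beta> B :: "'i multiset" and m :: nat
    and K :: "'i list \<Rightarrow> 'i list set"
  assumes size_block: "m + size \<beta> \<le> size B"
    and K_seqs: "\<mu> \<in> seqs \<beta> \<Longrightarrow> K \<mu> \<subseteq> seqs B"
    and K_disjoint: "\<mu> \<in> seqs \<beta> \<Longrightarrow> \<mu>' \<in> seqs \<beta> \<Longrightarrow> \<mu> \<noteq> \<mu>' \<Longrightarrow> K \<mu> \<inter> K \<mu>' = {}"
    and K_entry: "\<mu> \<in> seqs \<beta> \<Longrightarrow> \<kappa> \<in> K \<mu> \<Longrightarrow> 1 \<le> k \<Longrightarrow> k \<le> size \<beta> \<Longrightarrow> entry \<kappa> (m + k) = entry \<mu> k"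
    and K_swap: "\<mu> \<in> seqs \<beta> \<Longrightarrow> 1 \<le> k \<Longrightarrow> k < size \<beta> \<Longrightarrow> swap_seq (m + k) ` K \<mu> \<subseteq> K (swap_seq k \<mu>)"
begin

abbreviation F :: "('i, 'k) free \<Rightarrow> ('i, 'k) free" where
  "F \<equiv> subst_free (block_gen m K)"

text \<open>\<open>F\<close> sends the sum of all \<open>1_\<mu>\<close> to \<open>E\<close> but the
  empty word to the empty word. The two agree after multiplication by \<open>E\<close>, which is how
  the non-unital morphism is handled.\<close>

definition E :: "('i, 'k) free" where
  "E = (\<Sum>\<mu>\<in>seqs \<beta>. \<Sum>\<kappa>\<in>K \<mu>. mon [Idm \<kappa>])"

lemma finite_K: "\<mu> \<in> seqs \<beta> \<Longrightarrow> finite (K \<mu>)"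
  using finite_subset[OF K_seqs finite_seqs] .

lemma E_Union: "E = (\<Sum>\<kappa>\<in>(\<Union>\<mu>\<in>seqs \<beta>. K \<mu>). mon [Idm \<kappa>])"
  unfolding E_def by (rule sum.UNION_disjoint[symmetric]) (use K_disjoint finite_K in auto)

lemma K_Union: "(\<Union>\<mu>\<in>seqs \<beta>. K \<mu>) \<subseteq> seqs B"
  using K_seqs by blast

lemma K_seqsD: "\<mu> \<in> seqs \<beta> \<Longrightarrow> \<kappa> \<in> K \<mu> \<Longrightarrow> \<kappa> \<in> seqs B"
  using K_seqs by blast

lemma K_sum_carrier: "\<mu> \<in> seqs \<beta> \<Longrightarrow> (\<Sum>\<kappa>\<in>K \<mu>. mon [Idm \<kappa>]) \<in> free_carrier (gens B)"
  by (intro free_carrier_sum free_carrier_single) (use K_seqsD in auto)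

lemma block_gen_carrier: "g \<in> gens \<beta> \<Longrightarrow> block_gen m K g \<in> free_carrier (gens B)"
  using size_block by (cases g) (auto intro: K_sum_carrier)

lemma F_carrier: "p \<in> free_carrier (gens \<beta>) \<Longrightarrow> F p \<in> free_carrier (gens B)"
  by (erule subst_free_carrier) (rule block_gen_carrier)

lemma E_carrier: "E \<in> free_carrier (gens B)"
  unfolding E_def by (intro free_carrier_sum K_sum_carrier)

lemma E_idem: "klr_cong D B (E * E) E"
  unfolding E_Union using kc_idem_sums_mult[OF K_Union K_Union] by simp

lemma E_commute:
  assumes "p \<in> free_carrier (gens \<beta>)"
  shows "klr_cong D B (E * F p) (F p * E)"
proof (rule kc_commute_subst[OF E_carrier assms])
  fix g assume g: "g \<in> gens \<beta>"
  then show "block_gen m K g \<in> free_carrier (gens B)" by (rule block_gen_carrier)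
  from g show "klr_cong D B (E * block_gen m K g) (block_gen m K g * E)"
  proof (cases rule: gens_cases)
    case (1 \<nu>)
    then show ?thesis
      unfolding E_Union using kc_idem_sums_commute[OF K_Union K_seqs] by simp
  next
    case (2 k)
    then show ?thesis
      unfolding E_Union using kc_sym[OF kc_dot_idem_sum[OF K_Union, of "m + k" D]] size_block by simp
  next
    case (3 k)
    have "swap_seq (m + k) ` (\<Union>\<mu>\<in>seqs \<beta>. K \<mu>) \<subseteq> (\<Union>\<mu>\<in>seqs \<beta>. K \<mu>)"
      using K_swap[OF _ 3(2,3)] swap_seq_seqs[OF _ 3(2,3)] by blast
    then show ?thesis
      unfolding E_Union using kc_sym[OF kc_cross_idem_sum[OF K_Union, of "m + k"]] 3 size_block by simp
  qed
qed

lemma F_dots: "foldr (\<lambda>g q. block_gen m K g * q) (map Dot ks) (mon []) = (mon (map (\<lambda>k. Dot (m + k)) ks) :: ('i, 'k) free)"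
  by (induction ks) auto

text \<open>Polynomials involve dots only, on which the substitution shifts the index by m.\<close>

lemma F_eval_pol: "F (eval_pol q k l) = eval_pol q (m + k) (m + l)"
proof -
  have *: "replicate s (Dot k) @ replicate t (Dot l) = map Dot (replicate s k @ replicate t l)" for s t and k l :: nat
    by simp
  show ?thesis
    unfolding eval_pol_def subst_free_sum *
    by (intro sum.cong HOL.refl) (simp add: subst_free_single F_dots case_prod_unfold del: map_append foldr_append, simp)
qed

lemma F_div_diff: "F (div_diff q k) = div_diff q (m + k)"
proof -
  have *: "replicate r (Dot a) @ replicate s (Dot b) @ replicate t (Dot c) =
      map Dot (replicate r a @ replicate s b @ replicate t c)" for r s t and a b c :: nat
    by simp
  show ?thesis
    unfolding div_diff_def * subst_free_sum
    by (intro sum.cong HOL.refl)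
      (simp add: subst_free_sum subst_free_single F_dots case_prod_unfold add.assoc del: map_append foldr_append, simp)
qed

lemma kc_idem_relator:
  assumes "p = (\<Sum>\<kappa>\<in>K \<mu>. f \<kappa>)" "\<mu> \<in> seqs \<beta>" "\<And>\<kappa>. \<kappa> \<in> K \<mu> \<Longrightarrow> f \<kappa> \<in> relators D B"
  shows "klr_cong D B p 0"
  unfolding assms(1) using assms(3) klr_ideal_relator by (intro kc_sum_zero) (auto simp: kc_zero_iff)

text \<open>The factor \<open>E\<close> matters for \<open>idem_sum\<close>, whose image is
  \<open>E\<close> minus the unit. The images of the other relators vanish already without it: most
  are sums of relators of the larger algebra, one for each extension \<kappa> of \<mu>, because
  \<kappa> has the entries of \<mu> at the shifted positions; \<open>idem_idem\<close> and
  \<open>cross_idem\<close> follow from products and reindexing of idempotent sums.\<close>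

lemma F_relator:
  assumes "r \<in> relators D \<beta>"
  shows "klr_cong D B (F r * E) 0"
proof (cases "r = (\<Sum>\<nu>\<in>seqs \<beta>. mon [Idm \<nu>]) - mon []")
  case True
  have "F r = E - mon []"
    by (simp add: True subst_free_diff subst_free_sum subst_free_single E_def)
  then show ?thesis
    using kc_diff[OF E_idem kc_refl[OF E_carrier]] by (simp add: left_diff_distrib)
next
  case ns: False
  have "klr_cong D B (F r) 0"
    using assms
  proof (cases rule: relators.cases)
    case (idem_idem \<mu> \<mu>')
    have "F r = (\<Sum>\<kappa>\<in>K \<mu>. mon [Idm \<kappa>]) * (\<Sum>\<kappa>\<in>K \<mu>'. mon [Idm \<kappa>]) - (if \<mu> = \<mu>' then \<Sum>\<kappa>\<in>K \<mu>. mon [Idm \<kappa>] else 0)"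
      by (simp add: idem_idem(1) subst_free_diff subst_free_single)
    also have "klr_cong D B \<dots> ((\<Sum>\<kappa>\<in>K \<mu> \<inter> K \<mu>'. mon [Idm \<kappa>]) - (if \<mu> = \<mu>' then \<Sum>\<kappa>\<in>K \<mu>. mon [Idm \<kappa>] else 0))"
      using idem_idem K_seqs by (intro kc_diff kc_idem_sums_mult kc_refl) (auto intro: K_sum_carrier)
    also have "\<dots> = 0"
      using K_disjoint[of \<mu> \<mu>'] idem_idem by auto
    finally show ?thesis .
  next
    case idem_sum
    then show ?thesis using ns by simp
  next
    case (dot_idem \<mu> k)
    show ?thesis
    proof (rule kc_idem_relator[OF _ dot_idem(2)])
      show "F r = (\<Sum>\<kappa>\<in>K \<mu>. mon [Dot (m + k), Idm \<kappa>] - mon [Idm \<kappa>, Dot (m + k)])"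
        by (simp add: dot_idem(1) subst_free_diff subst_free_single sum_distrib_left sum_distrib_right sum_subtractf)
    qed (use dot_idem size_block in \<open>auto intro!: relators.dot_idem K_seqsD\<close>)
  next
    case (cross_idem \<mu> k)
    have s: "swap_seq k (swap_seq k \<mu>) = \<mu>"
      using cross_idem seqs_length[of \<mu> \<beta>] by simp
    have s': "swap_seq k \<mu> \<in> seqs \<beta>"
      using cross_idem by (auto intro: swap_seq_seqs)
    have "klr_cong D B (mon [Cross (m + k)] * (\<Sum>\<kappa>\<in>K \<mu>. mon [Idm \<kappa>])) ((\<Sum>\<kappa>\<in>K (swap_seq k \<mu>). mon [Idm \<kappa>]) * mon [Cross (m + k)])"
      using K_swap[of \<mu> k] K_swap[OF s', of k] K_seqs[of \<mu>] cross_idem s size_block by (intro kc_cross_idem_sum) auto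
    then have "klr_cong D B (mon [Cross (m + k)] * (\<Sum>\<kappa>\<in>K \<mu>. mon [Idm \<kappa>]) - (\<Sum>\<kappa>\<in>K (swap_seq k \<mu>). mon [Idm \<kappa>]) * mon [Cross (m + k)]) 0"
      by (auto simp: klr_cong_def)
    then show ?thesis
      by (simp add: cross_idem(1) subst_free_diff subst_free_single)
  next
    case (dot_dot k l)
    then have "mon [Dot (m + k), Dot (m + l)] - mon [Dot (m + l), Dot (m + k)] \<in> relators D B"
      using size_block by (intro relators.dot_dot) auto
    then show ?thesis
      using klr_ideal_relator by (fastforce simp: dot_dot(1) subst_free_diff subst_free_single kc_zero_iff)
  next
    case (cross_sq \<mu> k)
    show ?thesis
    proof (rule kc_idem_relator[OF _ cross_sq(2)])
      show "F r = (\<Sum>\<kappa>\<in>K \<mu>. mon [Cross (m + k), Cross (m + k), Idm \<kappa>]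
          - eval_pol (Qpol D (entry \<mu> k) (entry \<mu> (k + 1))) (m + k) (m + k + 1) * mon [Idm \<kappa>])"
        by (simp add: cross_sq(1) subst_free_diff subst_free_mult subst_free_single F_eval_pol sum_distrib_left sum_distrib_right sum_subtractf)
      fix \<kappa> assume \<kappa>: "\<kappa> \<in> K \<mu>"
      have "entry \<kappa> (m + k) = entry \<mu> k" "entry \<kappa> (m + k + 1) = entry \<mu> (k + 1)"
        using K_entry[OF cross_sq(2) \<kappa>, of k] K_entry[OF cross_sq(2) \<kappa>, of "k + 1"] cross_sq(3) by auto
      then show "mon [Cross (m + k), Cross (m + k), Idm \<kappa>]
          - eval_pol (Qpol D (entry \<mu> k) (entry \<mu> (k + 1))) (m + k) (m + k + 1) * mon [Idm \<kappa>] \<in> relators D B"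
        using relators.cross_sq[of \<kappa> B "m + k" D] K_seqsD[OF cross_sq(2) \<kappa>] cross_sq(3) size_block by simp
    qed
  next
    case (cross_dot \<mu> k l)
    have t: "transpose (m + k) (m + k + 1) (m + l) = m + transpose k (k + 1) l"
      by (auto simp: transpose_def)
    show ?thesis
    proof (rule kc_idem_relator[OF _ cross_dot(2)])
      show "F r = (\<Sum>\<kappa>\<in>K \<mu>. mon [Cross (m + k), Dot (m + l), Idm \<kappa>] - mon [Dot (m + transpose k (k + 1) l), Cross (m + k), Idm \<kappa>]
          - (if l = k + 1 \<and> entry \<mu> k = entry \<mu> (k + 1) then mon [Idm \<kappa>]
             else if l = k \<and> entry \<mu> k = entry \<mu> (k + 1) then - mon [Idm \<kappa>] else 0))"
        by (simp add: cross_dot(1) subst_free_diff subst_free_uminus subst_free_single sum_distrib_left sum_subtractf sum.distrib sum_negf,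
            auto intro!: sum.neutral)
      fix \<kappa> assume \<kappa>: "\<kappa> \<in> K \<mu>"
      have e: "entry \<mu> k = entry \<kappa> (m + k)" "entry \<mu> (k + 1) = entry \<kappa> (m + k + 1)"
        using K_entry[OF cross_dot(2) \<kappa>, of k] K_entry[OF cross_dot(2) \<kappa>, of "k + 1"] cross_dot(3) by auto
      have c: "l = k + 1 \<longleftrightarrow> m + l = m + k + 1" "l = k \<longleftrightarrow> m + l = m + k" by auto
      show "mon [Cross (m + k), Dot (m + l), Idm \<kappa>] - mon [Dot (m + transpose k (k + 1) l), Cross (m + k), Idm \<kappa>]
          - (if l = k + 1 \<and> entry \<mu> k = entry \<mu> (k + 1) then mon [Idm \<kappa>]
             else if l = k \<and> entry \<mu> k = entry \<mu> (k + 1) then - mon [Idm \<kappa>] else 0) \<in> relators D B"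
        unfolding c t[symmetric] e
        by (rule relators.cross_dot) (use K_seqsD[OF cross_dot(2) \<kappa>] cross_dot(3,4) size_block in auto)
    qed
  next
    case (cross_cross k l)
    then have "mon [Cross (m + k), Cross (m + l)] - mon [Cross (m + l), Cross (m + k)] \<in> relators D B"
      using size_block by (intro relators.cross_cross) auto
    then show ?thesis
      using klr_ideal_relator by (fastforce simp: cross_cross(1) subst_free_diff subst_free_single kc_zero_iff)
  next
    case (braid \<mu> k)
    show ?thesis
    proof (rule kc_idem_relator[OF _ braid(2)])
      show "F r = (\<Sum>\<kappa>\<in>K \<mu>. mon [Cross (m + k + 1), Cross (m + k), Cross (m + k + 1), Idm \<kappa>] - mon [Cross (m + k), Cross (m + k + 1), Cross (m + k), Idm \<kappa>]
          - (if entry \<mu> k = entry \<mu> (k + 2)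
             then div_diff (Qpol D (entry \<mu> k) (entry \<mu> (k + 1))) (m + k) * mon [Idm \<kappa>] else 0))"
        by (simp add: braid(1) subst_free_diff subst_free_mult subst_free_single F_div_diff sum_distrib_left sum_subtractf)
      fix \<kappa> assume \<kappa>: "\<kappa> \<in> K \<mu>"
      have e: "entry \<mu> k = entry \<kappa> (m + k)" "entry \<mu> (k + 1) = entry \<kappa> (m + k + 1)" "entry \<mu> (k + 2) = entry \<kappa> (m + k + 2)"
        using K_entry[OF braid(2) \<kappa>, of k] K_entry[OF braid(2) \<kappa>, of "k + 1"] K_entry[OF braid(2) \<kappa>, of "k + 2"] braid(3,4)
        by (auto simp: add.assoc)
      show "mon [Cross (m + k + 1), Cross (m + k), Cross (m + k + 1), Idm \<kappa>] - mon [Cross (m + k), Cross (m + k + 1), Cross (m + k), Idm \<kappa>]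
          - (if entry \<mu> k = entry \<mu> (k + 2)
             then div_diff (Qpol D (entry \<mu> k) (entry \<mu> (k + 1))) (m + k) * mon [Idm \<kappa>] else 0) \<in> relators D B"
        unfolding e
        by (rule relators.braid) (use K_seqsD[OF braid(2) \<kappa>] braid(3,4) size_block in auto)
    qed
  qed
  then show ?thesis
    by (rule kc_zero_mult(2)[OF _ E_carrier])
qed

text \<open>In a multiple \<open>u r v\<close> the factor \<open>E\<close> is moved leftwards
  through the image of v until it stands beside that of r.\<close>

lemma F_ideal:
  assumes "p \<in> klr_ideal D \<beta>"
  shows "klr_cong D B (F p * E) 0"
  using assms unfolding klr_ideal_free_span
proof (induction rule: free_span.induct)
  case (base u v r c)
  have c: "F (Poly_Mapping.single u c) \<in> free_carrier (gens B)" "F (mon v) \<in> free_carrier (gens B)" "F r \<in> free_carrier (gens B)"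
    using base relators_carrier by (auto intro!: F_carrier)
  have "klr_cong D B (F (Poly_Mapping.single u c) * F r * (F (mon v) * E)) (F (Poly_Mapping.single u c) * F r * (E * F (mon v)))"
    using c base by (intro kc_mult_left kc_sym[OF E_commute]) auto
  also have "\<dots> = F (Poly_Mapping.single u c) * (F r * E) * F (mon v)"
    by (simp add: mult.assoc)
  also have "klr_cong D B \<dots> 0"
    by (rule kc_zero_mult(2)[OF kc_zero_mult(1)[OF F_relator[OF base(3)]]]) (use c in auto)
  finally show ?case by (simp add: subst_free_mult mult.assoc)
next
  case zero
  then show ?case by (simp add: kc_refl)
next
  case (add p q)
  then show ?case using kc_add[OF add.IH] by (simp add: subst_free_add distrib_right)
qed

lemma F_cong:
  assumes "klr_cong D \<beta> p q"
  shows "klr_cong D B (F p * E) (F q * E)"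
proof -
  have "klr_cong D B (F (p - q) * E + F q * E) (0 + F q * E)"
    using assms F_ideal F_carrier E_carrier by (intro kc_add kc_refl) (auto simp: klr_cong_def)
  then show ?thesis by (simp add: subst_free_diff left_diff_distrib)
qed

lemma homogeneous_sum:
  assumes "finite A" "\<And>x. x \<in> A \<Longrightarrow> f x \<in> free_carrier (gens B)" "\<And>x. x \<in> A \<Longrightarrow> klr_homogeneous D B d (klr_class D B (f x))"
  shows "klr_homogeneous D B d (klr_class D B (sum f A))"
  using assms
proof (induction A rule: finite_induct)
  case empty
  then show ?case using klr_homogeneous.hom_zero[of D B d] by (simp add: klr_class_zero)
next
  case (insert x A)
  have "klr_homogeneous D B d (klr_class D B (f x) \<oplus>\<^bsub>KLR D B\<^esub> klr_class D B (sum f A))"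
    using insert by (intro klr_homogeneous.hom_add) auto
  then show ?case using insert by (simp add: klr_class_add free_carrier_sum)
qed

lemma E_homogeneous: "klr_homogeneous D B 0 (klr_class D B E)"
  unfolding E_Union using K_Union finite_K
  by (intro homogeneous_sum klr_homogeneous.hom_idem) (auto intro!: K_seqsD)

lemma F_idem_homogeneous: "\<mu> \<in> seqs \<beta> \<Longrightarrow> klr_homogeneous D B 0 (klr_class D B (F (mon [Idm \<mu>])))"
  using finite_K K_seqsD by (auto simp: subst_free_single intro!: homogeneous_sum klr_homogeneous.hom_idem)

lemma F_dot_homogeneous:
  assumes "\<mu> \<in> seqs \<beta>" "1 \<le> k" "k \<le> size \<beta>"
  shows "klr_homogeneous D B (form D (entry \<mu> k) (entry \<mu> k)) (klr_class D B (F (mon [Dot k, Idm \<mu>])))"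
proof -
  have "F (mon [Dot k, Idm \<mu>]) = (\<Sum>\<kappa>\<in>K \<mu>. mon [Dot (m + k), Idm \<kappa>])"
    by (simp add: subst_free_single sum_distrib_left)
  moreover have "klr_homogeneous D B (form D (entry \<mu> k) (entry \<mu> k)) (klr_class D B (mon [Dot (m + k), Idm \<kappa>]))" if "\<kappa> \<in> K \<mu>" for \<kappa>
    using klr_homogeneous.hom_dot[OF K_seqsD[OF assms(1) that], of "m + k" D] K_entry[OF assms(1) that assms(2,3)] assms size_block by simp
  ultimately show ?thesis
    using assms finite_K[OF assms(1)] K_seqsD[OF assms(1)] size_block by (auto intro!: homogeneous_sum)
qed

lemma F_cross_homogeneous:
  assumes "\<mu> \<in> seqs \<beta>" "1 \<le> k" "k < size \<beta>"
  shows "klr_homogeneous D B (- form D (entry \<mu> k) (entry \<mu> (k + 1))) (klr_class D B (F (mon [Cross k, Idm \<mu>])))"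
proof -
  have "F (mon [Cross k, Idm \<mu>]) = (\<Sum>\<kappa>\<in>K \<mu>. mon [Cross (m + k), Idm \<kappa>])"
    by (simp add: subst_free_single sum_distrib_left)
  moreover have "klr_homogeneous D B (- form D (entry \<mu> k) (entry \<mu> (k + 1))) (klr_class D B (mon [Cross (m + k), Idm \<kappa>]))" if "\<kappa> \<in> K \<mu>" for \<kappa>
    using klr_homogeneous.hom_cross[OF K_seqsD[OF assms(1) that], of "m + k" D] K_entry[OF assms(1) that assms(2)]
      K_entry[OF assms(1) that, of "k + 1"] assms size_block by simp
  ultimately show ?thesis
    using assms finite_K[OF assms(1)] K_seqsD[OF assms(1)] size_block by (auto intro!: homogeneous_sum)
qed

end

section \<open>The two embeddings and the product on classes\<close>

lemma left_klr_block: "klr_block \<beta> (\<beta> + \<gamma>) (size \<gamma>) (\<lambda>\<mu>. (\<lambda>\<nu>. \<mu> @ \<nu>) ` seqs \<gamma>)"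
proof
  show "entry \<kappa> (size \<gamma> + k) = entry \<mu> k"
    if "\<mu> \<in> seqs \<beta>" "\<kappa> \<in> (\<lambda>\<nu>. \<mu> @ \<nu>) ` seqs \<gamma>" "1 \<le> k" "k \<le> size \<beta>" for \<mu> \<kappa> k
  proof -
    from that obtain \<nu> where "\<nu> \<in> seqs \<gamma>" "\<kappa> = \<mu> @ \<nu>" by blast
    then show ?thesis
      using that(3,4) seqs_length[OF that(1)] seqs_length[of \<nu> \<gamma>] entry_append_left[of k \<mu> \<nu>] by simp
  qed
  show "swap_seq (size \<gamma> + k) ` (\<lambda>\<nu>. \<mu> @ \<nu>) ` seqs \<gamma> \<subseteq> (\<lambda>\<nu>. swap_seq k \<mu> @ \<nu>) ` seqs \<gamma>"
    if "\<mu> \<in> seqs \<beta>" "1 \<le> k" "k < size \<beta>" for \<mu> k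
  proof
    fix \<kappa> assume "\<kappa> \<in> swap_seq (size \<gamma> + k) ` (\<lambda>\<nu>. \<mu> @ \<nu>) ` seqs \<gamma>"
    then obtain \<nu> where "\<nu> \<in> seqs \<gamma>" "\<kappa> = swap_seq (size \<gamma> + k) (\<mu> @ \<nu>)" by blast
    then show "\<kappa> \<in> (\<lambda>\<nu>. swap_seq k \<mu> @ \<nu>) ` seqs \<gamma>"
      using that(2,3) seqs_length[OF that(1)] seqs_length[of \<nu> \<gamma>] swap_seq_append_left[of k \<mu> \<nu>] by simp
  qed
qed (auto simp: seqs_append seqs_length)

lemma right_klr_block: "klr_block \<gamma> (\<beta> + \<gamma>) 0 (\<lambda>\<nu>. (\<lambda>\<mu>. \<mu> @ \<nu>) ` seqs \<beta>)"
proof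
  show "entry \<kappa> (0 + k) = entry \<nu> k"
    if "\<nu> \<in> seqs \<gamma>" "\<kappa> \<in> (\<lambda>\<mu>. \<mu> @ \<nu>) ` seqs \<beta>" "1 \<le> k" "k \<le> size \<gamma>" for \<nu> \<kappa> k
    using that seqs_length[of \<nu> \<gamma>] by (auto simp: entry_append_right)
  show "swap_seq (0 + k) ` (\<lambda>\<mu>. \<mu> @ \<nu>) ` seqs \<beta> \<subseteq> (\<lambda>\<mu>. \<mu> @ swap_seq k \<nu>) ` seqs \<beta>"
    if "\<nu> \<in> seqs \<gamma>" "1 \<le> k" "k < size \<gamma>" for \<nu> k
    using that seqs_length[of \<nu> \<gamma>] by (auto simp: swap_seq_append_right)
  show "(\<lambda>\<mu>. \<mu> @ \<nu>) ` seqs \<beta> \<inter> (\<lambda>\<mu>. \<mu> @ \<nu>') ` seqs \<beta> = {}"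
    if "\<nu> \<in> seqs \<gamma>" "\<nu>' \<in> seqs \<gamma>" "\<nu> \<noteq> \<nu>'" for \<nu> \<nu>'
    using that seqs_length[of \<nu> \<gamma>] seqs_length[of \<nu>' \<gamma>] by auto
qed (auto simp: seqs_append)

lemma klr_scalar_closed: "klr_scalar D \<beta> c \<in> carrier (KLR D \<beta>)"
  by (auto simp: klr_scalar_def)

lemma klr_scalar_mult:
  "p \<in> free_carrier (gens \<beta>) \<Longrightarrow> klr_scalar D \<beta> c \<otimes>\<^bsub>KLR D \<beta>\<^esub> klr_class D \<beta> p = klr_class D \<beta> (Poly_Mapping.single [] c * p)"
  by (simp add: klr_scalar_def klr_class_mult)

lemma klr_scalar_commute: "x \<in> carrier (KLR D \<beta>) \<Longrightarrow> x \<otimes>\<^bsub>KLR D \<beta>\<^esub> klr_scalar D \<beta> c = klr_scalar D \<beta> c \<otimes>\<^bsub>KLR D \<beta>\<^esub> x"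
  by (auto simp: KLR_carrier klr_scalar_def klr_class_mult scalar_commute)

definition tensor_idem :: "'i multiset \<Rightarrow> 'i multiset \<Rightarrow> ('i, 'k::{comm_ring,comm_monoid_mult}) free" where
  "tensor_idem \<beta> \<gamma> = (\<Sum>\<mu>\<in>seqs \<beta>. \<Sum>\<nu>\<in>seqs \<gamma>. mon [Idm (\<mu> @ \<nu>)])"

context
  fixes D :: "('i, 'k::{comm_ring,comm_monoid_mult}) klr_datum" and \<beta> \<gamma> :: "'i multiset"
begin

interpretation L: klr_block D \<beta> "\<beta> + \<gamma>" "size \<gamma>" "\<lambda>\<mu>. (\<lambda>\<nu>. \<mu> @ \<nu>) ` seqs \<gamma>"
  by (rule left_klr_block)

interpretation R: klr_block D \<gamma> "\<beta> + \<gamma>" 0 "\<lambda>\<nu>. (\<lambda>\<mu>. \<mu> @ \<nu>) ` seqs \<beta>"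
  by (rule right_klr_block)

interpretation H: ring "KLR D (\<beta> + \<gamma>)" by (rule ring_KLR)
interpretation HL: ring "KLR D \<beta>" by (rule ring_KLR)
interpretation HR: ring "KLR D \<gamma>" by (rule ring_KLR)

abbreviation (input) FL :: "('i, 'k) free \<Rightarrow> ('i, 'k) free" where "FL \<equiv> subst_free (left_gen \<gamma>)"
abbreviation (input) FR :: "('i, 'k) free \<Rightarrow> ('i, 'k) free" where "FR \<equiv> subst_free (right_gen \<beta>)"

text \<open>Both embeddings have the same idempotent, the two sums merely coming in opposite order.
  Hence \<open>1_{\<beta>,\<gamma>}\<close> commutes with both images.\<close>

lemma LE: "L.E = tensor_idem \<beta> \<gamma>"
  unfolding L.E_def tensor_idem_def by (rule sum.cong[OF HOL.refl]) (subst sum.reindex, auto simp: inj_on_def)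

lemma RE: "R.E = tensor_idem \<beta> \<gamma>"
  unfolding R.E_def tensor_idem_def
  by (rule HOL.trans[OF _ sum.swap], rule sum.cong[OF HOL.refl]) (subst sum.reindex, auto simp: inj_on_def)

lemmas FL_props = L.F_carrier[folded left_gen_block_gen] L.E_commute[folded left_gen_block_gen, unfolded LE]
  L.F_cong[folded left_gen_block_gen, unfolded LE]
lemmas FR_props = R.F_carrier[folded right_gen_block_gen] R.E_commute[folded right_gen_block_gen, unfolded RE]
  R.F_cong[folded right_gen_block_gen, unfolded RE]

lemma tensor_idem_carrier: "(tensor_idem \<beta> \<gamma> :: ('i, 'k) free) \<in> free_carrier (gens (\<beta> + \<gamma>))"
  using L.E_carrier unfolding LE .

lemma tensor_idem_idem: "klr_cong D (\<beta> + \<gamma>) (tensor_idem \<beta> \<gamma> * tensor_idem \<beta> \<gamma>) (tensor_idem \<beta> \<gamma>)"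
  using L.E_idem unfolding LE .

lemma tensor_idem_homogeneous: "klr_homogeneous D (\<beta> + \<gamma>) 0 (klr_class D (\<beta> + \<gamma>) (tensor_idem \<beta> \<gamma>))"
  using L.E_homogeneous unfolding LE .

text \<open>The factors occupy disjoint strands. Crossings l of the right and
  \<open>size \<gamma> + k\<close> of the left factor are at distance at least 2, because l <
  \<open>size \<gamma>\<close> and k \<ge> 1, so the relation for distant crossings applies.\<close>

lemma left_right_gens_commute:
  assumes g: "g \<in> gens \<beta>" and h: "h \<in> gens \<gamma>"
  shows "klr_cong D (\<beta> + \<gamma>) (left_gen \<gamma> g * right_gen \<beta> h) (right_gen \<beta> h * left_gen \<gamma> g)"
  using g
proof (cases rule: gens_cases)
  case (1 \<mu>)
  define A where "A = (\<lambda>\<nu>. \<mu> @ \<nu>) ` seqs \<gamma>"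
  have A: "A \<subseteq> seqs (\<beta> + \<gamma>)" using 1 by (auto simp: A_def seqs_append)
  have gA: "left_gen \<gamma> g = (\<Sum>\<nu>\<in>A. mon [Idm \<nu>])" using 1 by (simp add: A_def left_gen_block_gen)
  show ?thesis
    using h
  proof (cases rule: gens_cases)
    case (1 \<nu>)
    have "(\<lambda>\<mu>. \<mu> @ \<nu>) ` seqs \<beta> \<subseteq> seqs (\<beta> + \<gamma>)" using 1 by (auto simp: seqs_append)
    from kc_idem_sums_commute[OF A this, of D] show ?thesis
      unfolding gA using 1 by (simp add: right_gen_block_gen)
  next
    case (2 k)
    then show ?thesis
      unfolding gA using kc_sym[OF kc_dot_idem_sum[OF A, of k D]] by simp
  next
    case (3 k)
    have "swap_seq k ` A \<subseteq> A"
      unfolding A_def using 3 seqs_length[of _ \<gamma>] by (auto simp: swap_seq_append_right swap_seq_seqs)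
    then show ?thesis
      unfolding gA using kc_sym[OF kc_cross_idem_sum[OF A, of k A D]] 3 by simp
  qed
next
  case (2 k)
  show ?thesis
    using h
  proof (cases rule: gens_cases)
    case (1 \<nu>)
    have "(\<lambda>\<mu>. \<mu> @ \<nu>) ` seqs \<beta> \<subseteq> seqs (\<beta> + \<gamma>)" using 1 by (auto simp: seqs_append)
    from kc_dot_idem_sum[OF this, of "size \<gamma> + k" D] show ?thesis
      using 1 2 by (simp add: right_gen_block_gen)
  next
    case (2 l)
    have "klr_cong D (\<beta> + \<gamma>) (mon [Dot (size \<gamma> + k), Dot l]) (mon [Dot l, Dot (size \<gamma> + k)])"
      by (rule kc_relator[OF relators.dot_dot]) (use 2 \<open>1 \<le> k\<close> \<open>k \<le> size \<beta>\<close> in auto)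
    then show ?thesis using 2 \<open>g = Dot k\<close> by simp
  next
    case (3 l)
    then show ?thesis
      using kc_sym[OF kc_cross_dot_far[of l "\<beta> + \<gamma>" "size \<gamma> + k" D]] 2 by simp
  qed
next
  case (3 k)
  show ?thesis
    using h
  proof (cases rule: gens_cases)
    case (1 \<nu>)
    define A where "A = (\<lambda>\<mu>. \<mu> @ \<nu>) ` seqs \<beta>"
    have A: "A \<subseteq> seqs (\<beta> + \<gamma>)" using 1 by (auto simp: A_def seqs_append)
    have "swap_seq (size \<gamma> + k) ` A \<subseteq> A"
    proof
      fix \<kappa> assume "\<kappa> \<in> swap_seq (size \<gamma> + k) ` A"
      then obtain \<mu> where \<mu>: "\<mu> \<in> seqs \<beta>" "\<kappa> = swap_seq (size \<gamma> + k) (\<mu> @ \<nu>)" by (auto simp: A_def)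
      then have "\<kappa> = swap_seq k \<mu> @ \<nu>"
        using swap_seq_append_left[of k \<mu> \<nu>] 3 seqs_length[OF \<mu>(1)] seqs_length[OF 1(2)] by simp
      then show "\<kappa> \<in> A" using swap_seq_seqs[OF \<mu>(1), of k] 3 by (auto simp: A_def)
    qed
    then show ?thesis
      using kc_cross_idem_sum[OF A, of "size \<gamma> + k" A D] 1 3 by (simp add: right_gen_block_gen A_def)
  next
    case (2 l)
    then show ?thesis
      using kc_cross_dot_far[of "size \<gamma> + k" "\<beta> + \<gamma>" l D] 3 by simp
  next
    case (3 l)
    have "klr_cong D (\<beta> + \<gamma>) (mon [Cross (size \<gamma> + k), Cross l]) (mon [Cross l, Cross (size \<gamma> + k)])"
      by (rule kc_relator[OF relators.cross_cross]) (use 3 \<open>1 \<le> k\<close> \<open>k < size \<beta>\<close> in auto)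
    then show ?thesis using 3 \<open>g = Cross k\<close> by simp
  qed
qed

lemma left_right_commute:
  assumes p: "p \<in> free_carrier (gens \<beta>)" and q: "q \<in> free_carrier (gens \<gamma>)"
  shows "klr_cong D (\<beta> + \<gamma>) (FL p * FR q) (FR q * FL p)"
proof (rule kc_commute_subst[OF FL_props(1)[OF p] q])
  fix h assume h: "h \<in> gens \<gamma>"
  show c: "right_gen \<beta> h \<in> free_carrier (gens (\<beta> + \<gamma>))"
    using R.block_gen_carrier[OF h] by (simp add: right_gen_block_gen)
  show "klr_cong D (\<beta> + \<gamma>) (FL p * right_gen \<beta> h) (right_gen \<beta> h * FL p)"
  proof (rule kc_commute_sym[OF kc_commute_subst[OF c p]])
    fix g assume g: "g \<in> gens \<beta>"
    show "left_gen \<gamma> g \<in> free_carrier (gens (\<beta> + \<gamma>))"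
      using L.block_gen_carrier[OF g] by (simp add: left_gen_block_gen)
    show "klr_cong D (\<beta> + \<gamma>) (right_gen \<beta> h * left_gen \<gamma> g) (left_gen \<gamma> g * right_gen \<beta> h)"
      by (rule kc_sym[OF left_right_gens_commute[OF g h]])
  qed
qed

text \<open>The embeddings respect congruence only beside \<open>1_{\<beta>,\<gamma>}\<close>. The
  idempotent first serves to replace q, is then moved past the image of q' to stand beside that of
  p, serves there, and is moved back.\<close>

lemma diamond_rep_cong:
  assumes p: "klr_cong D \<beta> p p'" and q: "klr_cong D \<gamma> q q'"
  shows "klr_cong D (\<beta> + \<gamma>) (FL p * FR q * tensor_idem \<beta> \<gamma>) (FL p' * FR q' * tensor_idem \<beta> \<gamma>)"
proof -
  note c = kc_carrier[OF p] kc_carrier[OF q]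
  note FLc = FL_props(1)[OF c(1)] FL_props(1)[OF c(2)] FR_props(1)[OF c(3)] FR_props(1)[OF c(4)]
  have "FL p * FR q * tensor_idem \<beta> \<gamma> = FL p * (FR q * tensor_idem \<beta> \<gamma>)" by (simp add: mult.assoc)
  also have "klr_cong D (\<beta> + \<gamma>) \<dots> (FL p * (FR q' * tensor_idem \<beta> \<gamma>))"
    by (rule kc_mult_left[OF FR_props(3)[OF q] FLc(1)])
  also have "klr_cong D (\<beta> + \<gamma>) \<dots> (FL p * (tensor_idem \<beta> \<gamma> * FR q'))"
    by (rule kc_mult_left[OF kc_sym[OF FR_props(2)[OF c(4)]] FLc(1)])
  also have "\<dots> = (FL p * tensor_idem \<beta> \<gamma>) * FR q'" by (simp add: mult.assoc)
  also have "klr_cong D (\<beta> + \<gamma>) \<dots> ((FL p' * tensor_idem \<beta> \<gamma>) * FR q')"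
    by (rule kc_mult_right[OF FL_props(3)[OF p] FLc(4)])
  also have "\<dots> = FL p' * (tensor_idem \<beta> \<gamma> * FR q')" by (simp add: mult.assoc)
  also have "klr_cong D (\<beta> + \<gamma>) \<dots> (FL p' * (FR q' * tensor_idem \<beta> \<gamma>))"
    by (rule kc_mult_left[OF FR_props(2)[OF c(4)] FLc(2)])
  finally show ?thesis by (simp add: mult.assoc)
qed

lemma diamond_class:
  assumes p: "p \<in> free_carrier (gens \<beta>)" and q: "q \<in> free_carrier (gens \<gamma>)"
  shows "diamond D \<beta> \<gamma> (klr_class D \<beta> p) (klr_class D \<gamma> q) = klr_class D (\<beta> + \<gamma>) (FL p * FR q * tensor_idem \<beta> \<gamma>)"
proof -
  have "klr_class D (\<beta> + \<gamma>) (FL p' * FR q' * tensor_idem \<beta> \<gamma>) = klr_class D (\<beta> + \<gamma>) (FL p * FR q * tensor_idem \<beta> \<gamma>)"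
    if "p' \<in> klr_class D \<beta> p" "q' \<in> klr_class D \<gamma> q" for p' q'
    by (rule kc_class[OF diamond_rep_cong]) (use that klr_class_mem[OF p] klr_class_mem[OF q] in auto)
  then show ?thesis
    unfolding diamond_def tensor_idem_def[symmetric]
    using klr_class_self[OF p, of D] klr_class_self[OF q, of D] by blast
qed

lemma diamond_rep_carrier:
  assumes p: "p \<in> free_carrier (gens \<beta>)" and q: "q \<in> free_carrier (gens \<gamma>)"
  shows "FL p * FR q * tensor_idem \<beta> \<gamma> \<in> free_carrier (gens (\<beta> + \<gamma>))"
  using FL_props(1)[OF p] FR_props(1)[OF q] tensor_idem_carrier by auto

lemma diamond_closed:
  "y \<in> carrier (KLR D \<beta>) \<Longrightarrow> z \<in> carrier (KLR D \<gamma>) \<Longrightarrow> diamond D \<beta> \<gamma> y z \<in> carrier (KLR D (\<beta> + \<gamma>))"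
  by (auto simp: KLR_carrier diamond_class intro!: imageI diamond_rep_carrier)

lemma diamond_add_left:
  "y \<in> carrier (KLR D \<beta>) \<Longrightarrow> y' \<in> carrier (KLR D \<beta>) \<Longrightarrow> z \<in> carrier (KLR D \<gamma>) \<Longrightarrow>
    diamond D \<beta> \<gamma> (y \<oplus>\<^bsub>KLR D \<beta>\<^esub> y') z = diamond D \<beta> \<gamma> y z \<oplus>\<^bsub>KLR D (\<beta> + \<gamma>)\<^esub> diamond D \<beta> \<gamma> y' z"
  by (auto simp: KLR_carrier klr_class_add diamond_class diamond_rep_carrier subst_free_add distrib_right)

lemma diamond_add_right:
  "y \<in> carrier (KLR D \<beta>) \<Longrightarrow> z \<in> carrier (KLR D \<gamma>) \<Longrightarrow> z' \<in> carrier (KLR D \<gamma>) \<Longrightarrow>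
    diamond D \<beta> \<gamma> y (z \<oplus>\<^bsub>KLR D \<gamma>\<^esub> z') = diamond D \<beta> \<gamma> y z \<oplus>\<^bsub>KLR D (\<beta> + \<gamma>)\<^esub> diamond D \<beta> \<gamma> y z'"
  by (auto simp: KLR_carrier klr_class_add diamond_class diamond_rep_carrier subst_free_add distrib_right distrib_left)

lemma diamond_mult:
  assumes "y \<in> carrier (KLR D \<beta>)" "y' \<in> carrier (KLR D \<beta>)" "z \<in> carrier (KLR D \<gamma>)" "z' \<in> carrier (KLR D \<gamma>)"
  shows "diamond D \<beta> \<gamma> (y \<otimes>\<^bsub>KLR D \<beta>\<^esub> y') (z \<otimes>\<^bsub>KLR D \<gamma>\<^esub> z') =
    diamond D \<beta> \<gamma> y z \<otimes>\<^bsub>KLR D (\<beta> + \<gamma>)\<^esub> diamond D \<beta> \<gamma> y' z'"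
proof -
  from assms obtain p p' q q' where eq: "y = klr_class D \<beta> p" "y' = klr_class D \<beta> p'" "z = klr_class D \<gamma> q" "z' = klr_class D \<gamma> q'"
    and c: "p \<in> free_carrier (gens \<beta>)" "p' \<in> free_carrier (gens \<beta>)" "q \<in> free_carrier (gens \<gamma>)" "q' \<in> free_carrier (gens \<gamma>)"
    by (auto simp: KLR_carrier)
  note FLc = FL_props(1)[OF c(1)] FL_props(1)[OF c(2)] FR_props(1)[OF c(3)] FR_props(1)[OF c(4)]
  define e :: "('i, 'k) free" where "e = tensor_idem \<beta> \<gamma>"
  have e: "e \<in> free_carrier (gens (\<beta> + \<gamma>))" unfolding e_def by (rule tensor_idem_carrier)
  have "FL p * FL p' * (FR q * FR q') * e = FL p * (FL p' * FR q) * (FR q' * e)" by (simp add: mult.assoc)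
  \<comment> \<open>The idempotent is doubled so that each of the two products receives a
    copy.\<close>
  also have "klr_cong D (\<beta> + \<gamma>) \<dots> (FL p * (FR q * FL p') * (FR q' * (e * e)))"
    using FLc e unfolding e_def
    by (intro kc_mult kc_mult_left left_right_commute[OF c(2,3)] kc_sym[OF tensor_idem_idem] kc_refl) auto
  also have "\<dots> = FL p * FR q * FL p' * ((FR q' * e) * e)" by (simp add: mult.assoc)
  also have "klr_cong D (\<beta> + \<gamma>) \<dots> (FL p * FR q * FL p' * ((e * FR q') * e))"
    using FLc e unfolding e_def by (intro kc_mult_left kc_mult_right kc_sym[OF FR_props(2)[OF c(4)]]) auto
  also have "\<dots> = FL p * FR q * (FL p' * e) * (FR q' * e)" by (simp add: mult.assoc)
  also have "klr_cong D (\<beta> + \<gamma>) \<dots> (FL p * FR q * (e * FL p') * (FR q' * e))"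
    using FLc e unfolding e_def by (intro kc_mult_left kc_mult_right kc_sym[OF FL_props(2)[OF c(2)]]) auto
  finally have "klr_cong D (\<beta> + \<gamma>) (FL (p * p') * FR (q * q') * e) ((FL p * FR q * e) * (FL p' * FR q' * e))"
    by (simp add: mult.assoc subst_free_mult)
  then show ?thesis
    unfolding eq using c by (simp add: klr_class_mult diamond_class diamond_rep_carrier e_def kc_class)
qed

lemma klr_idem_class: "klr_idem D \<beta> \<gamma> = klr_class D (\<beta> + \<gamma>) (tensor_idem \<beta> \<gamma>)"
  unfolding klr_idem_def klr_class_one by (subst diamond_class) auto

lemma klr_idem_closed: "klr_idem D \<beta> \<gamma> \<in> carrier (KLR D (\<beta> + \<gamma>))"
  unfolding klr_idem_class using tensor_idem_carrier by auto

lemma klr_idem_homogeneous: "klr_homogeneous D (\<beta> + \<gamma>) 0 (klr_idem D \<beta> \<gamma>)"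
  unfolding klr_idem_class by (rule tensor_idem_homogeneous)

lemma klr_idem_diamond:
  assumes "y \<in> carrier (KLR D \<beta>)" "z \<in> carrier (KLR D \<gamma>)"
  shows "klr_idem D \<beta> \<gamma> \<otimes>\<^bsub>KLR D (\<beta> + \<gamma>)\<^esub> diamond D \<beta> \<gamma> y z = diamond D \<beta> \<gamma> y z"
    "diamond D \<beta> \<gamma> y z \<otimes>\<^bsub>KLR D (\<beta> + \<gamma>)\<^esub> klr_idem D \<beta> \<gamma> = diamond D \<beta> \<gamma> y z"
  unfolding klr_idem_def using assms by (simp_all flip: diamond_mult)

lemma klr_idem_idem: "klr_idem D \<beta> \<gamma> \<otimes>\<^bsub>KLR D (\<beta> + \<gamma>)\<^esub> klr_idem D \<beta> \<gamma> = klr_idem D \<beta> \<gamma>"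
  using klr_idem_diamond(1)[of "\<one>\<^bsub>KLR D \<beta>\<^esub>" "\<one>\<^bsub>KLR D \<gamma>\<^esub>"] by (simp add: klr_idem_def)

lemma diamond_scalar_left:
  assumes "y \<in> carrier (KLR D \<beta>)" "z \<in> carrier (KLR D \<gamma>)"
  shows "diamond D \<beta> \<gamma> (klr_scalar D \<beta> c \<otimes>\<^bsub>KLR D \<beta>\<^esub> y) z = klr_scalar D (\<beta> + \<gamma>) c \<otimes>\<^bsub>KLR D (\<beta> + \<gamma>)\<^esub> diamond D \<beta> \<gamma> y z"
  using assms
  by (auto simp: KLR_carrier klr_scalar_mult diamond_class diamond_rep_carrier subst_free_mult simp flip: mult.assoc)

lemma diamond_split:
  assumes "y \<in> carrier (KLR D \<beta>)" "z \<in> carrier (KLR D \<gamma>)"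
  shows "diamond D \<beta> \<gamma> y z = diamond D \<beta> \<gamma> y \<one>\<^bsub>KLR D \<gamma>\<^esub> \<otimes>\<^bsub>KLR D (\<beta> + \<gamma>)\<^esub> diamond D \<beta> \<gamma> \<one>\<^bsub>KLR D \<beta>\<^esub> z"
    "diamond D \<beta> \<gamma> y z = diamond D \<beta> \<gamma> \<one>\<^bsub>KLR D \<beta>\<^esub> z \<otimes>\<^bsub>KLR D (\<beta> + \<gamma>)\<^esub> diamond D \<beta> \<gamma> y \<one>\<^bsub>KLR D \<gamma>\<^esub>"
  using assms by (simp_all flip: diamond_mult)

lemma diamond_zero:
  "z \<in> carrier (KLR D \<gamma>) \<Longrightarrow> diamond D \<beta> \<gamma> \<zero>\<^bsub>KLR D \<beta>\<^esub> z = \<zero>\<^bsub>KLR D (\<beta> + \<gamma>)\<^esub>"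
  "y \<in> carrier (KLR D \<beta>) \<Longrightarrow> diamond D \<beta> \<gamma> y \<zero>\<^bsub>KLR D \<gamma>\<^esub> = \<zero>\<^bsub>KLR D (\<beta> + \<gamma>)\<^esub>"
  by (auto simp: KLR_carrier klr_class_zero diamond_class)

text \<open>Induction along the generation of homogeneous elements. Dots and crossings next to an
  idempotent go to sums over the extending sequences, all of one degree because the degree depends
  on the entries of the strands involved.\<close>

lemma diamond_left_homogeneous:
  assumes "klr_homogeneous D \<beta> d y"
  shows "klr_homogeneous D (\<beta> + \<gamma>) d (diamond D \<beta> \<gamma> y \<one>\<^bsub>KLR D \<gamma>\<^esub>)"
  using assms
proof (induction rule: klr_homogeneous.induct)
  case (hom_zero d)
  then show ?case using klr_homogeneous.hom_zero by (simp add: diamond_zero)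
next
  case (hom_add d a b)
  then show ?case
    using klr_homogeneous.hom_add[OF hom_add.IH] klr_homogeneous_carrier[OF hom_add(1)] klr_homogeneous_carrier[OF hom_add(2)]
    by (simp add: diamond_add_left)
next
  case (hom_mult d a e b)
  then show ?case
    using klr_homogeneous.hom_mult[OF hom_mult.IH] klr_homogeneous_carrier[OF hom_mult(1)] klr_homogeneous_carrier[OF hom_mult(2)]
    by (simp flip: diamond_mult)
next
  case (hom_scalar c)
  have "diamond D \<beta> \<gamma> (klr_scalar D \<beta> c) \<one>\<^bsub>KLR D \<gamma>\<^esub> = klr_scalar D (\<beta> + \<gamma>) c \<otimes>\<^bsub>KLR D (\<beta> + \<gamma>)\<^esub> klr_idem D \<beta> \<gamma>"
    using diamond_scalar_left[of "\<one>\<^bsub>KLR D \<beta>\<^esub>" "\<one>\<^bsub>KLR D \<gamma>\<^esub>" c] klr_scalar_closed[of D \<beta> c] by (simp add: klr_idem_def)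
  then show ?case
    using klr_homogeneous.hom_mult[OF klr_homogeneous.hom_scalar klr_idem_homogeneous, of c] by simp
next
  case (hom_idem \<nu>)
  have "klr_homogeneous D (\<beta> + \<gamma>) 0 (klr_class D (\<beta> + \<gamma>) (FL (mon [Idm \<nu>])) \<otimes>\<^bsub>KLR D (\<beta> + \<gamma>)\<^esub> klr_class D (\<beta> + \<gamma>) (tensor_idem \<beta> \<gamma>))"
    using klr_homogeneous.hom_mult[OF L.F_idem_homogeneous[folded left_gen_block_gen, OF hom_idem] tensor_idem_homogeneous] by simp
  then show ?case
    using hom_idem FL_props(1)[of "mon [Idm \<nu>]"] tensor_idem_carrier by (simp add: klr_class_one diamond_class klr_class_mult)
next
  case (hom_dot \<nu> k)
  have "klr_homogeneous D (\<beta> + \<gamma>) (form D (entry \<nu> k) (entry \<nu> k)) (klr_class D (\<beta> + \<gamma>) (FL (mon [Dot k, Idm \<nu>])) \<otimes>\<^bsub>KLR D (\<beta> + \<gamma>)\<^esub> klr_class D (\<beta> + \<gamma>) (tensor_idem \<beta> \<gamma>))"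
    using klr_homogeneous.hom_mult[OF L.F_dot_homogeneous[folded left_gen_block_gen, of \<nu> k] tensor_idem_homogeneous] hom_dot by simp
  then show ?case
    using hom_dot FL_props(1)[of "mon [Dot k, Idm \<nu>]"] tensor_idem_carrier by (simp add: klr_class_one diamond_class klr_class_mult)
next
  case (hom_cross \<nu> k)
  have "klr_homogeneous D (\<beta> + \<gamma>) (- form D (entry \<nu> k) (entry \<nu> (k + 1))) (klr_class D (\<beta> + \<gamma>) (FL (mon [Cross k, Idm \<nu>])) \<otimes>\<^bsub>KLR D (\<beta> + \<gamma>)\<^esub> klr_class D (\<beta> + \<gamma>) (tensor_idem \<beta> \<gamma>))"
    using klr_homogeneous.hom_mult[OF L.F_cross_homogeneous[folded left_gen_block_gen, of \<nu> k] tensor_idem_homogeneous] hom_cross by simp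
  then show ?case
    using hom_cross FL_props(1)[of "mon [Cross k, Idm \<nu>]"] tensor_idem_carrier by (simp add: klr_class_one diamond_class klr_class_mult)
qed

lemma diamond_right_homogeneous:
  assumes "klr_homogeneous D \<gamma> d z"
  shows "klr_homogeneous D (\<beta> + \<gamma>) d (diamond D \<beta> \<gamma> \<one>\<^bsub>KLR D \<beta>\<^esub> z)"
  using assms
proof (induction rule: klr_homogeneous.induct)
  case (hom_zero d)
  then show ?case using klr_homogeneous.hom_zero by (simp add: diamond_zero)
next
  case (hom_add d a b)
  then show ?case
    using klr_homogeneous.hom_add[OF hom_add.IH] klr_homogeneous_carrier[OF hom_add(1)] klr_homogeneous_carrier[OF hom_add(2)]
    by (simp add: diamond_add_right)
next
  case (hom_mult d a e b)
  then show ?case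
    using klr_homogeneous.hom_mult[OF hom_mult.IH] klr_homogeneous_carrier[OF hom_mult(1)] klr_homogeneous_carrier[OF hom_mult(2)]
    by (simp flip: diamond_mult)
next
  case (hom_scalar c)
  have "diamond D \<beta> \<gamma> \<one>\<^bsub>KLR D \<beta>\<^esub> (klr_scalar D \<gamma> c) = klr_scalar D (\<beta> + \<gamma>) c \<otimes>\<^bsub>KLR D (\<beta> + \<gamma>)\<^esub> klr_idem D \<beta> \<gamma>"
    unfolding klr_scalar_def klr_class_one klr_idem_class using tensor_idem_carrier
    by (simp add: diamond_class klr_class_mult)
  then show ?case
    using klr_homogeneous.hom_mult[OF klr_homogeneous.hom_scalar klr_idem_homogeneous, of c] by simp
next
  case (hom_idem \<nu>)
  have "klr_homogeneous D (\<beta> + \<gamma>) 0 (klr_class D (\<beta> + \<gamma>) (FR (mon [Idm \<nu>])) \<otimes>\<^bsub>KLR D (\<beta> + \<gamma>)\<^esub> klr_class D (\<beta> + \<gamma>) (tensor_idem \<beta> \<gamma>))"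
    using klr_homogeneous.hom_mult[OF R.F_idem_homogeneous[folded right_gen_block_gen, OF hom_idem] tensor_idem_homogeneous] by simp
  then show ?case
    using hom_idem FR_props(1)[of "mon [Idm \<nu>]"] tensor_idem_carrier by (simp add: klr_class_one diamond_class klr_class_mult)
next
  case (hom_dot \<nu> k)
  have "klr_homogeneous D (\<beta> + \<gamma>) (form D (entry \<nu> k) (entry \<nu> k)) (klr_class D (\<beta> + \<gamma>) (FR (mon [Dot k, Idm \<nu>])) \<otimes>\<^bsub>KLR D (\<beta> + \<gamma>)\<^esub> klr_class D (\<beta> + \<gamma>) (tensor_idem \<beta> \<gamma>))"
    using klr_homogeneous.hom_mult[OF R.F_dot_homogeneous[folded right_gen_block_gen, of \<nu> k] tensor_idem_homogeneous] hom_dot by simp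
  then show ?case
    using hom_dot FR_props(1)[of "mon [Dot k, Idm \<nu>]"] tensor_idem_carrier by (simp add: klr_class_one diamond_class klr_class_mult)
next
  case (hom_cross \<nu> k)
  have "klr_homogeneous D (\<beta> + \<gamma>) (- form D (entry \<nu> k) (entry \<nu> (k + 1))) (klr_class D (\<beta> + \<gamma>) (FR (mon [Cross k, Idm \<nu>])) \<otimes>\<^bsub>KLR D (\<beta> + \<gamma>)\<^esub> klr_class D (\<beta> + \<gamma>) (tensor_idem \<beta> \<gamma>))"
    using klr_homogeneous.hom_mult[OF R.F_cross_homogeneous[folded right_gen_block_gen, of \<nu> k] tensor_idem_homogeneous] hom_cross by simp
  then show ?case
    using hom_cross FR_props(1)[of "mon [Cross k, Idm \<nu>]"] tensor_idem_carrier by (simp add: klr_class_one diamond_class klr_class_mult)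
qed

lemma diamond_homogeneous:
  assumes "klr_homogeneous D \<beta> d y" "klr_homogeneous D \<gamma> e z"
  shows "klr_homogeneous D (\<beta> + \<gamma>) (d + e) (diamond D \<beta> \<gamma> y z)"
  using klr_homogeneous.hom_mult[OF diamond_left_homogeneous[OF assms(1)] diamond_right_homogeneous[OF assms(2)]]
    diamond_split(1)[OF klr_homogeneous_carrier[OF assms(1)] klr_homogeneous_carrier[OF assms(2)]] by simp

lemma diamond_one_class:
  "q \<in> free_carrier (gens \<gamma>) \<Longrightarrow> diamond D \<beta> \<gamma> \<one>\<^bsub>KLR D \<beta>\<^esub> (klr_class D \<gamma> q) = klr_class D (\<beta> + \<gamma>) (FR q * tensor_idem \<beta> \<gamma>)"
  by (simp add: klr_class_one diamond_class)

lemma diamond_one_rep_carrier: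
  "q \<in> free_carrier (gens \<gamma>) \<Longrightarrow> FR q * tensor_idem \<beta> \<gamma> \<in> free_carrier (gens (\<beta> + \<gamma>))"
  using FR_props(1) tensor_idem_carrier by auto

end

section \<open>Composition of embeddings whose left factor has weight ni\<close>

lemma subst_free_compose: "subst_free f (subst_free g p) = subst_free (\<lambda>x. subst_free f (g x)) p"
proof -
  have "subst_free f (foldr (\<lambda>g' q. g g' * q) w (mon [])) = foldr (\<lambda>x q. subst_free f (g x) * q) w (mon [])" for w
    by (induction w) (simp_all add: subst_free_mult)
  then have "subst_free f (subst_free g (Poly_Mapping.single w c)) = subst_free (\<lambda>x. subst_free f (g x)) (Poly_Mapping.single w c)" for w c
    by (simp add: subst_free_single subst_free_mult)
  with free_carrier_UNIV[of p] show ?thesis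
    by (induction p rule: free_carrier_induct) (simp_all add: subst_free_add)
qed

lemma subst_free_id:
  assumes "p \<in> free_carrier S" "\<And>g. g \<in> S \<Longrightarrow> f g = mon [g]"
  shows "subst_free f p = p"
  using assms(1)
proof (induction rule: free_carrier_induct)
  case (single w c)
  then have "foldr (\<lambda>g q. f g * q) w (mon []) = mon w"
    by (induction w) (simp_all add: assms(2))
  then show ?case by (simp add: subst_free_single)
qed (simp_all add: subst_free_add)

text \<open>Prefixing the empty sequence changes no letter, and the sum of all idempotents is the
  unit. This is the base case n = 0 of the comparison.\<close>

lemma diamond_empty:
  assumes "z \<in> carrier (KLR D \<beta>)"
  shows "diamond D {#} \<beta> \<one>\<^bsub>KLR D {#}\<^esub> z = z"
proof -
  obtain q where q: "q \<in> free_carrier (gens \<beta>)" "z = klr_class D \<beta> q"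
    using assms by (auto simp: KLR_carrier)
  have "right_gen {#} g = mon [g]" for g :: "'a gen"
    by (cases g) simp_all
  then have "subst_free (right_gen {#}) q = q"
    by (rule subst_free_id[OF q(1)])
  moreover have "klr_cong D \<beta> (q * (\<Sum>\<nu>\<in>seqs \<beta>. mon [Idm \<nu>])) q"
    using kc_mult_left[OF kc_idem_sum q(1), of D] by simp
  ultimately show ?thesis
    using q kc_class[of D \<beta>] diamond_one_class[OF q(1), where \<beta> = "{#}"] by (simp add: tensor_idem_def)
qed

lemma tensor_idem_replicate:
  "tensor_idem (replicate_mset n i) \<beta> = (\<Sum>\<nu>\<in>seqs \<beta>. mon [Idm (replicate n i @ \<nu>)])"
  by (simp add: tensor_idem_def seqs_replicate)

text \<open>On letters the two embeddings compose to the third, since each of them prefixes copies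
  of i. The idempotent of the outer one is absorbed, because a sequence with n + 1 leading copies of
  i has a leading i.\<close>

lemma diamond_assoc:
  assumes "z \<in> carrier (KLR D \<beta>)"
  shows "diamond D {#i#} (replicate_mset n i + \<beta>) \<one>\<^bsub>KLR D {#i#}\<^esub> (diamond D (replicate_mset n i) \<beta> \<one>\<^bsub>KLR D (replicate_mset n i)\<^esub> z) =
    diamond D (replicate_mset (Suc n) i) \<beta> \<one>\<^bsub>KLR D (replicate_mset (Suc n) i)\<^esub> z"
proof -
  obtain q where q: "q \<in> free_carrier (gens \<beta>)" "z = klr_class D \<beta> q"
    using assms by (auto simp: KLR_carrier)
  let ?B = "add_mset i (replicate_mset n i + \<beta>)"
  define e1 :: "('a, 'b) free" where "e1 = tensor_idem {#i#} (replicate_mset n i + \<beta>)"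
  define e2 :: "('a, 'b) free" where "e2 = tensor_idem (replicate_mset (Suc n) i) \<beta>"
  have g: "subst_free (right_gen {#i#}) (right_gen (replicate_mset n i) g) = right_gen (replicate_mset (Suc n) i) g" for g :: "'a gen"
    using seqs_replicate[of "Suc n" i] by (cases g) (simp_all add: subst_free_single seqs_replicate subst_free_sum)
  have 1: "subst_free (right_gen {#i#}) (subst_free (right_gen (replicate_mset n i)) q * tensor_idem (replicate_mset n i) \<beta>)
      = subst_free (right_gen (replicate_mset (Suc n) i)) q * e2"
  proof -
    have "subst_free (right_gen {#i#}) (tensor_idem (replicate_mset n i) \<beta>) = e2"
      unfolding e2_def tensor_idem_replicate by (simp add: subst_free_sum subst_free_single)
    then show ?thesis by (simp only: subst_free_mult subst_free_compose g)
  qed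
  have e1: "e1 = (\<Sum>\<nu>\<in>(\<lambda>\<nu>. i # \<nu>) ` seqs (replicate_mset n i + \<beta>). mon [Idm \<nu>])"
    by (simp add: e1_def tensor_idem_def sum.reindex)
  have e2: "e2 = (\<Sum>\<nu>\<in>(\<lambda>\<nu>. replicate (Suc n) i @ \<nu>) ` seqs \<beta>. mon [Idm \<nu>])"
    unfolding e2_def tensor_idem_replicate by (simp add: sum.reindex inj_on_def)
  have sub: "(\<lambda>\<nu>. replicate (Suc n) i @ \<nu>) ` seqs \<beta> \<subseteq> (\<lambda>\<nu>. i # \<nu>) ` seqs (replicate_mset n i + \<beta>)"
    "(\<lambda>\<nu>. i # \<nu>) ` seqs (replicate_mset n i + \<beta>) \<subseteq> seqs ?B"
    by (auto simp: seqs_def)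
  have "klr_cong D ?B (e2 * e1) e2"
    unfolding e1 e2 using kc_idem_sums_mult[OF order_trans[OF sub] sub(2), of D] sub(1) by (simp only: Int_absorb2)
  moreover have "subst_free (right_gen (replicate_mset (Suc n) i)) q \<in> free_carrier (gens ?B)"
    using FR_props(1)[OF q(1), where \<beta> = "replicate_mset (Suc n) i"] by simp
  ultimately have "klr_cong D ?B (subst_free (right_gen (replicate_mset (Suc n) i)) q * (e2 * e1)) (subst_free (right_gen (replicate_mset (Suc n) i)) q * e2)"
    by (rule kc_mult_left)
  then have "klr_class D ?B (subst_free (right_gen (replicate_mset (Suc n) i)) q * e2 * e1) = klr_class D ?B (subst_free (right_gen (replicate_mset (Suc n) i)) q * e2)"
    by (intro kc_class) (simp add: mult.assoc)
  then show ?thesis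
    unfolding q(2) diamond_one_class[OF q(1)] diamond_one_class[OF diamond_one_rep_carrier[OF q(1)]] 1
    by (simp add: e1_def e2_def)
qed

lemma klr_idem_at_closed: "klr_idem_at D i \<beta> \<in> carrier (KLR D \<beta>)"
  using klr_idem_closed[of D "\<beta> - {#i#}" "{#i#}"] ring.ring_simprules(2)[OF ring_KLR] by (auto simp: klr_idem_at_def)

lemma klr_idem_at_homogeneous: "klr_homogeneous D \<beta> 0 (klr_idem_at D i \<beta>)"
  using klr_idem_homogeneous[of D "\<beta> - {#i#}" "{#i#}"] klr_homogeneous.hom_zero by (auto simp: klr_idem_at_def)

text \<open>The sequences occurring in \<open>1_i \<diamondop> 1_{\<beta>-i,i}\<close> have the form
  i \<mu> i, so they are among those of \<open>1_{\<beta>,i}\<close>. If i does not occur in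
  \<beta>, both sides vanish. This makes restriction along
  \<open>z \<mapsto> 1_i \<diamondop> z\<close> preserve the condition that defines the
  subcategory.\<close>

lemma klr_idem_at_absorb:
  "klr_idem_at D i ({#i#} + \<beta>) \<otimes>\<^bsub>KLR D ({#i#} + \<beta>)\<^esub> diamond D {#i#} \<beta> \<one>\<^bsub>KLR D {#i#}\<^esub> (klr_idem_at D i \<beta>) =
    diamond D {#i#} \<beta> \<one>\<^bsub>KLR D {#i#}\<^esub> (klr_idem_at D i \<beta>)"
proof (cases "i \<in># \<beta>")
  case False
  interpret H: ring "KLR D ({#i#} + \<beta>)" by (rule ring_KLR)
  have "diamond D {#i#} \<beta> \<one>\<^bsub>KLR D {#i#}\<^esub> (klr_idem_at D i \<beta>) = \<zero>\<^bsub>KLR D ({#i#} + \<beta>)\<^esub>"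
    using False diamond_zero(2)[OF ring.ring_simprules(6)[OF ring_KLR], of D "{#i#}" \<beta>] by (simp add: klr_idem_at_def)
  then show ?thesis using klr_idem_at_closed[of D i "{#i#} + \<beta>"] by (simp only: H.r_null)
next
  case True
  define \<alpha> where "\<alpha> = \<beta> - {#i#}"
  have \<beta>: "\<beta> = add_mset i \<alpha>" using True by (simp add: \<alpha>_def)
  let ?B = "add_mset i \<beta>"
  have c: "tensor_idem \<alpha> {#i#} \<in> free_carrier (gens \<beta>)"
    using tensor_idem_carrier[of \<alpha> "{#i#}"] by (simp add: \<beta>)
  define P :: "('a, 'b) free" where "P = (\<Sum>\<nu>\<in>(\<lambda>\<mu>. i # \<mu> @ [i]) ` seqs \<alpha>. mon [Idm \<nu>])"
  define e :: "('a, 'b) free" where "e = tensor_idem {#i#} \<beta>"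
  define e' :: "('a, 'b) free" where "e' = tensor_idem \<beta> {#i#}"
  have P: "subst_free (right_gen {#i#}) (tensor_idem \<alpha> {#i#}) = P"
    by (simp add: P_def tensor_idem_def subst_free_sum subst_free_single sum.reindex inj_on_def)
  have e': "e' = (\<Sum>\<nu>\<in>(\<lambda>\<mu>. \<mu> @ [i]) ` seqs \<beta>. mon [Idm \<nu>])"
    by (simp add: e'_def tensor_idem_def sum.reindex inj_on_def)
  have sub: "(\<lambda>\<mu>. i # \<mu> @ [i]) ` seqs \<alpha> \<subseteq> (\<lambda>\<mu>. \<mu> @ [i]) ` seqs \<beta>" "(\<lambda>\<mu>. \<mu> @ [i]) ` seqs \<beta> \<subseteq> seqs ?B"
    by (auto simp: seqs_def \<beta> image_iff intro!: exI[of _ "i # _"])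
  have eP: "klr_cong D ?B (e' * P) P"
    unfolding e' P_def using kc_idem_sums_mult[OF sub(2) order_trans[OF sub], of D] sub(1) by (simp only: Int_absorb1)
  have ec: "e \<in> free_carrier (gens ?B)" "e' \<in> free_carrier (gens ?B)"
    using tensor_idem_carrier[of "{#i#}" \<beta>] tensor_idem_carrier[of \<beta> "{#i#}"] by (simp_all add: e_def e'_def)
  have x: "diamond D {#i#} \<beta> \<one>\<^bsub>KLR D {#i#}\<^esub> (klr_idem_at D i \<beta>) = klr_class D ?B (P * e)"
    using diamond_one_class[OF c, where \<beta> = "{#i#}" and D = D] klr_idem_class[of D \<alpha> "{#i#}"]
    by (simp add: klr_idem_at_def \<beta> P[symmetric] e_def)
  have y: "klr_idem_at D i ({#i#} + \<beta>) = klr_class D ?B e'"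
    using klr_idem_class[of D \<beta> "{#i#}"] by (simp add: klr_idem_at_def e'_def)
  have "klr_cong D ?B (e' * (P * e)) (P * e)"
    using kc_mult_right[OF eP ec(1)] by (simp add: mult.assoc)
  then show ?thesis
    unfolding x y using ec kc_carrier(2)[OF eP] by (simp add: klr_class_mult kc_class)
qed

section \<open>Induction products\<close>

lemma left_module_ring: "left_module R M \<Longrightarrow> ring R"
  by (simp add: left_module_def)

lemma left_module_abelian_group: "left_module R M \<Longrightarrow> abelian_group M"
  by (simp add: left_module_def)

lemma smult_add_hom: "left_module R M \<Longrightarrow> a \<in> carrier R \<Longrightarrow> add_hom M M (\<lambda>x. a \<odot>\<^bsub>M\<^esub> x)"
  by (simp add: add_hom_def left_module.lm_closed left_module.lm_r_distr)

lemma smult_left_add_hom: "left_module R M \<Longrightarrow> x \<in> carrier M \<Longrightarrow> add_hom R M (\<lambda>a. a \<odot>\<^bsub>M\<^esub> x)"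
  by (simp add: add_hom_def left_module.lm_closed left_module.lm_l_distr)

lemma smult_zero: "left_module R M \<Longrightarrow> a \<in> carrier R \<Longrightarrow> a \<odot>\<^bsub>M\<^esub> \<zero>\<^bsub>M\<^esub> = \<zero>\<^bsub>M\<^esub>"
  using add_hom_zero[OF left_module_abelian_group left_module_abelian_group smult_add_hom] by fast

lemma zero_smult: "left_module R M \<Longrightarrow> x \<in> carrier M \<Longrightarrow> \<zero>\<^bsub>R\<^esub> \<odot>\<^bsub>M\<^esub> x = \<zero>\<^bsub>M\<^esub>"
  using add_hom_zero[OF ring.is_abelian_group[OF left_module_ring] left_module_abelian_group smult_left_add_hom] by fast

text \<open>Unlike \<open>linear_maps\<close> this asks for no extensionality, so composites of
  linear maps are linear as they stand; \<open>lin_map_restrict\<close> recovers the extensional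
  version.\<close>

definition lin_map :: "('h, 'x) ring_scheme \<Rightarrow> ('h, 'u, 'y) module_scheme \<Rightarrow> ('h, 'v, 'z) module_scheme \<Rightarrow> ('u \<Rightarrow> 'v) \<Rightarrow> bool" where
  "lin_map R M N f \<longleftrightarrow> add_hom M N f \<and> (\<forall>a\<in>carrier R. \<forall>x\<in>carrier M. f (a \<odot>\<^bsub>M\<^esub> x) = a \<odot>\<^bsub>N\<^esub> f x)"

locale tens_prod =
  fixes D :: "('i, 'k::{comm_ring,comm_monoid_mult}) klr_datum" and \<beta> \<gamma> :: "'i multiset"
    and M N :: "('i, 'k, 'a) kmod"
  assumes lmM: "left_module (KLR D \<beta>) M" and lmN: "left_module (KLR D \<gamma>) N"
begin

abbreviation H :: "('i, 'k) klr ring" where "H \<equiv> KLR D (\<beta> + \<gamma>)"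
abbreviation e :: "('i, 'k) klr" where "e \<equiv> klr_idem D \<beta> \<gamma>"
abbreviation T :: "(('i, 'k) klr \<times> ('i, 'k, 'a) kelt \<times> ('i, 'k, 'a) kelt) set" where "T \<equiv> triples D \<beta> \<gamma> M N"
abbreviation cl :: "(('i, 'k) klr \<times> ('i, 'k, 'a) kelt \<times> ('i, 'k, 'a) kelt) list \<Rightarrow> ('i, 'k, 'a) kelt" where
  "cl \<equiv> tens_class D \<beta> \<gamma> M N"
abbreviation P :: "('i, 'k, 'a) kmod" where "P \<equiv> ind_prod D \<beta> \<gamma> M N"
abbreviation sm :: "('i, 'k) klr \<Rightarrow> ('i, 'k) klr \<times> ('i, 'k, 'a) kelt \<times> ('i, 'k, 'a) kelt
    \<Rightarrow> ('i, 'k) klr \<times> ('i, 'k, 'a) kelt \<times> ('i, 'k, 'a) kelt" where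
  "sm a \<equiv> \<lambda>(h, m, n). (a \<otimes>\<^bsub>H\<^esub> h, m, n)"

sublocale H: ring H by (rule ring_KLR)
sublocale MG: abelian_group M by (rule left_module_abelian_group[OF lmM])
sublocale NG: abelian_group N by (rule left_module_abelian_group[OF lmN])

lemma e_closed: "e \<in> carrier H"
  by (rule klr_idem_closed)

lemma e_e: "e \<otimes>\<^bsub>H\<^esub> e = e"
  by (rule klr_idem_idem)

text \<open>As \<open>e\<close> is idempotent, the left ideal \<open>H e\<close> consists of the
  elements fixed by right multiplication with \<open>e\<close>.\<close>

lemma triples_iff: "(h, m, n) \<in> T \<longleftrightarrow> h \<in> carrier H \<and> h \<otimes>\<^bsub>H\<^esub> e = h \<and> m \<in> carrier M \<and> n \<in> carrier N"
proof -
  have "(\<exists>h'. h = h' \<otimes>\<^bsub>H\<^esub> e \<and> h' \<in> carrier H) \<longleftrightarrow> h \<in> carrier H \<and> h \<otimes>\<^bsub>H\<^esub> e = h"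
    using e_closed e_e by (auto simp: H.m_assoc intro!: exI[of _ h])
  then show ?thesis by (simp add: triples_def)
qed

lemma diamond_closed': "y \<in> carrier (KLR D \<beta>) \<Longrightarrow> z \<in> carrier (KLR D \<gamma>) \<Longrightarrow> diamond D \<beta> \<gamma> y z \<in> carrier H"
  by (rule diamond_closed)

lemma tens_eq_lists: "tens_eq D \<beta> \<gamma> M N xs ys \<Longrightarrow> xs \<in> lists T \<and> ys \<in> lists T"
proof (induction rule: tens_eq.induct)
  case (balance h m n y z)
  then show ?case
    using diamond_closed'[of y z] klr_idem_diamond(2)[of y D \<beta> z \<gamma>] left_module.lm_closed[OF lmM] left_module.lm_closed[OF lmN]
    by (auto simp: triples_iff H.m_assoc e_closed)
qed (auto simp: triples_iff H.l_distr e_closed)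

text \<open>Equivalent lists have the same set of equivalents, hence the same chosen one.\<close>

lemma cl_cong:
  assumes "tens_eq D \<beta> \<gamma> M N xs ys"
  shows "cl xs = cl ys"
proof -
  have "tens_eq D \<beta> \<gamma> M N xs = tens_eq D \<beta> \<gamma> M N ys"
    using assms tens_eq.trans[OF assms] tens_eq.trans[OF tens_eq.sym[OF assms]] by blast
  then show ?thesis by (simp add: tens_class_def)
qed

lemma cl_rep: "xs \<in> lists T \<Longrightarrow> tens_eq D \<beta> \<gamma> M N xs (unTens (cl xs))"
  unfolding tens_class_def by (auto intro: someI tens_eq.refl)

lemma P_simps:
  "carrier P = cl ` lists T" "zero P = cl []"
  "add P = (\<lambda>x y. cl (unTens x @ unTens y))" "smult P = (\<lambda>a x. cl (map (sm a) (unTens x)))"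
  by (simp_all add: ind_prod_def Let_def)

lemma cl_closed: "xs \<in> lists T \<Longrightarrow> cl xs \<in> carrier P"
  by (simp add: P_simps)

lemma P_add: "xs \<in> lists T \<Longrightarrow> ys \<in> lists T \<Longrightarrow> cl xs \<oplus>\<^bsub>P\<^esub> cl ys = cl (xs @ ys)"
  unfolding P_simps by (intro cl_cong[symmetric] tens_eq.append cl_rep)

lemma sm_lists: "a \<in> carrier H \<Longrightarrow> xs \<in> lists T \<Longrightarrow> map (sm a) xs \<in> lists T"
  by (induction xs) (auto simp: triples_iff H.m_assoc e_closed)

lemma tens_eq_sm:
  assumes "tens_eq D \<beta> \<gamma> M N xs ys" and a: "a \<in> carrier H"
  shows "tens_eq D \<beta> \<gamma> M N (map (sm a) xs) (map (sm a) ys)"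
  using assms(1)
proof (induction rule: tens_eq.induct)
  case (refl xs)
  then show ?case by (intro tens_eq.refl sm_lists a)
next
  case (sym xs ys)
  from tens_eq.sym[OF sym.IH] show ?case .
next
  case (trans xs ys zs)
  from tens_eq.trans[OF trans.IH] show ?case .
next
  case (append xs xs' ys ys')
  then show ?case by (simp add: tens_eq.append)
next
  case (commute xs ys)
  from tens_eq.commute[OF sm_lists[OF a commute(1)] sm_lists[OF a commute(2)]] show ?case by simp
next
  case (zero m n)
  then show ?case using tens_eq.zero[of D \<beta> \<gamma> m n M N] a by (simp add: triples_iff)
next
  case (add1 h m n h')
  then show ?case using tens_eq.add1[of "a \<otimes>\<^bsub>H\<^esub> h" m n D \<beta> \<gamma> M N "a \<otimes>\<^bsub>H\<^esub> h'"] a e_closed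
    by (simp add: triples_iff H.r_distr H.m_assoc)
next
  case (add2 h m n m')
  then show ?case using tens_eq.add2[of "a \<otimes>\<^bsub>H\<^esub> h" m n D \<beta> \<gamma> M N m'] a e_closed
    by (simp add: triples_iff H.m_assoc)
next
  case (add3 h m n n')
  then show ?case using tens_eq.add3[of "a \<otimes>\<^bsub>H\<^esub> h" m n D \<beta> \<gamma> M N n'] a e_closed
    by (simp add: triples_iff H.m_assoc)
next
  case (balance h m n y z)
  then show ?case using tens_eq.balance[of "a \<otimes>\<^bsub>H\<^esub> h" m n D \<beta> \<gamma> M N y z] a e_closed diamond_closed'[of y z]
    by (simp add: triples_iff H.m_assoc)
qed

lemma P_smult: "a \<in> carrier H \<Longrightarrow> xs \<in> lists T \<Longrightarrow> a \<odot>\<^bsub>P\<^esub> cl xs = cl (map (sm a) xs)"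
  unfolding P_simps by (intro cl_cong[symmetric] tens_eq_sm cl_rep)

lemma P_carrierE:
  assumes "x \<in> carrier P" obtains xs where "xs \<in> lists T" "x = cl xs"
  using assms by (auto simp: P_simps)

lemma P_abelian_monoid: "abelian_monoid P"
proof (rule abelian_monoidI)
  fix x y z assume xyz: "x \<in> carrier P" "y \<in> carrier P" "z \<in> carrier P"
  then obtain xs ys zs where *: "xs \<in> lists T" "x = cl xs" "ys \<in> lists T" "y = cl ys" "zs \<in> lists T" "z = cl zs"
    by (auto elim!: P_carrierE)
  then show "x \<oplus>\<^bsub>P\<^esub> y \<in> carrier P" "(x \<oplus>\<^bsub>P\<^esub> y) \<oplus>\<^bsub>P\<^esub> z = x \<oplus>\<^bsub>P\<^esub> (y \<oplus>\<^bsub>P\<^esub> z)"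
    by (simp_all add: P_add cl_closed append_in_lists_conv)
  show "\<zero>\<^bsub>P\<^esub> \<oplus>\<^bsub>P\<^esub> x = x" using * P_add[of "[]" xs] by (simp add: P_simps(2))
  show "x \<oplus>\<^bsub>P\<^esub> y = y \<oplus>\<^bsub>P\<^esub> x" using * cl_cong[OF tens_eq.commute[OF *(1,3)]] by (simp add: P_add)
qed (simp add: P_simps(2) cl_closed)

lemma cl_Cons: "t \<in> T \<Longrightarrow> xs \<in> lists T \<Longrightarrow> cl (t # xs) = cl [t] \<oplus>\<^bsub>P\<^esub> cl xs"
  by (simp add: P_add)

text \<open>Formal sums contain no negatives. The inverse of a triple negates its algebra component,
  and the relations \<open>add1\<close> and \<open>zero\<close> cancel the pair.\<close>

lemma P_abelian_group: "abelian_group P"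
proof -
  interpret P: abelian_monoid P by (rule P_abelian_monoid)
  have "\<exists>y\<in>carrier P. y \<oplus>\<^bsub>P\<^esub> cl xs = \<zero>\<^bsub>P\<^esub>" if "xs \<in> lists T" for xs
    using that
  proof (induction xs)
    case Nil
    then show ?case by (auto simp: P_simps(2) intro!: bexI[of _ "cl []"] P_add cl_closed) (simp add: P_add)
  next
    case (Cons t xs)
    then obtain y where y: "y \<in> carrier P" "y \<oplus>\<^bsub>P\<^esub> cl xs = \<zero>\<^bsub>P\<^esub>" by auto
    obtain h m n where t: "t = (h, m, n)" by (cases t)
    have h: "(h, m, n) \<in> T" "(\<ominus>\<^bsub>H\<^esub> h, m, n) \<in> T" "(\<zero>\<^bsub>H\<^esub>, m, n) \<in> T"
      using Cons t e_closed by (auto simp: triples_iff H.l_minus)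
    have "cl [(\<ominus>\<^bsub>H\<^esub> h, m, n)] \<oplus>\<^bsub>P\<^esub> cl [(h, m, n)] = cl [(\<ominus>\<^bsub>H\<^esub> h \<oplus>\<^bsub>H\<^esub> h, m, n)]"
      using cl_cong[OF tens_eq.add1[OF h(2,1)]] h by (simp add: P_add)
    also have "\<dots> = \<zero>\<^bsub>P\<^esub>"
      using cl_cong[OF tens_eq.zero[OF h(3)]] h(1) by (simp add: triples_iff H.l_neg P_simps(2))
    finally have 0: "cl [(\<ominus>\<^bsub>H\<^esub> h, m, n)] \<oplus>\<^bsub>P\<^esub> cl [(h, m, n)] = \<zero>\<^bsub>P\<^esub>" .
    have c: "cl [(\<ominus>\<^bsub>H\<^esub> h, m, n)] \<in> carrier P" "cl [(h, m, n)] \<in> carrier P" "cl xs \<in> carrier P"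
      using h Cons by (auto intro!: cl_closed)
    have "(y \<oplus>\<^bsub>P\<^esub> cl [(\<ominus>\<^bsub>H\<^esub> h, m, n)]) \<oplus>\<^bsub>P\<^esub> (cl [(h, m, n)] \<oplus>\<^bsub>P\<^esub> cl xs) =
      (cl [(\<ominus>\<^bsub>H\<^esub> h, m, n)] \<oplus>\<^bsub>P\<^esub> cl [(h, m, n)]) \<oplus>\<^bsub>P\<^esub> (y \<oplus>\<^bsub>P\<^esub> cl xs)"
      using c y(1) by (simp add: P.a_ac)
    then have "(y \<oplus>\<^bsub>P\<^esub> cl [(\<ominus>\<^bsub>H\<^esub> h, m, n)]) \<oplus>\<^bsub>P\<^esub> cl (t # xs) = \<zero>\<^bsub>P\<^esub>"
      using Cons by (simp add: cl_Cons[of t xs] 0 y(2)) (simp add: t)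
    then show ?case using c y(1) by (intro bexI[of _ "y \<oplus>\<^bsub>P\<^esub> cl [(\<ominus>\<^bsub>H\<^esub> h, m, n)]"]) auto
  qed
  then show ?thesis
  proof (intro abelian_groupI)
    show "\<exists>y\<in>carrier P. y \<oplus>\<^bsub>P\<^esub> x = \<zero>\<^bsub>P\<^esub>" if "x \<in> carrier P" for x
      using \<open>\<And>xs. xs \<in> lists T \<Longrightarrow> \<exists>y\<in>carrier P. y \<oplus>\<^bsub>P\<^esub> cl xs = \<zero>\<^bsub>P\<^esub>\<close> P_carrierE[OF that] by metis
  qed (simp_all add: P.a_ac)
qed

sublocale PG: abelian_group P by (rule P_abelian_group)

text \<open>The pure tensor for arbitrary h in \<open>H\<close>, cut down by \<open>e\<close>. It is
  additive on all of \<open>H\<close>, so membership in \<open>H e\<close> need not be carried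
  along.\<close>

definition tri :: "('i, 'k) klr \<Rightarrow> ('i, 'k, 'a) kelt \<Rightarrow> ('i, 'k, 'a) kelt \<Rightarrow> ('i, 'k, 'a) kelt" where
  "tri h m n = cl [(h \<otimes>\<^bsub>H\<^esub> e, m, n)]"

lemma tri_triple: "h \<in> carrier H \<Longrightarrow> m \<in> carrier M \<Longrightarrow> n \<in> carrier N \<Longrightarrow> (h \<otimes>\<^bsub>H\<^esub> e, m, n) \<in> T"
  using e_closed e_e by (simp add: triples_iff H.m_assoc)

lemma tri_closed: "h \<in> carrier H \<Longrightarrow> m \<in> carrier M \<Longrightarrow> n \<in> carrier N \<Longrightarrow> tri h m n \<in> carrier P"
  unfolding tri_def using tri_triple by (auto intro!: cl_closed)

lemma tri_eq: "(h, m, n) \<in> T \<Longrightarrow> cl [(h, m, n)] = tri h m n"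
  by (simp add: tri_def triples_iff)

lemma tri_add1:
  assumes "h \<in> carrier H" "h' \<in> carrier H" "m \<in> carrier M" "n \<in> carrier N"
  shows "tri (h \<oplus>\<^bsub>H\<^esub> h') m n = tri h m n \<oplus>\<^bsub>P\<^esub> tri h' m n"
  using cl_cong[OF tens_eq.add1[OF tri_triple[OF assms(1,3,4)] tri_triple[OF assms(2,3,4)]]]
    tri_triple[OF assms(1,3,4)] tri_triple[OF assms(2,3,4)] assms
  by (simp add: tri_def H.l_distr e_closed P_add)

lemma tri_add2:
  assumes "h \<in> carrier H" "m \<in> carrier M" "m' \<in> carrier M" "n \<in> carrier N"
  shows "tri h (m \<oplus>\<^bsub>M\<^esub> m') n = tri h m n \<oplus>\<^bsub>P\<^esub> tri h m' n"
  using cl_cong[OF tens_eq.add2[OF tri_triple[OF assms(1,2,4)] tri_triple[OF assms(1,3,4)]]]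
    tri_triple[OF assms(1,2,4)] tri_triple[OF assms(1,3,4)]
  by (simp add: tri_def P_add)

lemma tri_add3:
  assumes "h \<in> carrier H" "m \<in> carrier M" "n \<in> carrier N" "n' \<in> carrier N"
  shows "tri h m (n \<oplus>\<^bsub>N\<^esub> n') = tri h m n \<oplus>\<^bsub>P\<^esub> tri h m n'"
  using cl_cong[OF tens_eq.add3[OF tri_triple[OF assms(1,2,3)] tri_triple[OF assms(1,2,4)]]]
    tri_triple[OF assms(1,2,3)] tri_triple[OF assms(1,2,4)]
  by (simp add: tri_def P_add)

lemma tri_balance:
  assumes "h \<in> carrier H" "m \<in> carrier M" "n \<in> carrier N" "y \<in> carrier (KLR D \<beta>)" "z \<in> carrier (KLR D \<gamma>)"
  shows "tri (h \<otimes>\<^bsub>H\<^esub> diamond D \<beta> \<gamma> y z) m n = tri h (y \<odot>\<^bsub>M\<^esub> m) (z \<odot>\<^bsub>N\<^esub> n)"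
  using cl_cong[OF tens_eq.balance[OF tri_triple[OF assms(1,2,3)] assms(4,5)]]
    assms(1) diamond_closed'[OF assms(4,5)] klr_idem_diamond[OF assms(4,5)]
  by (simp add: tri_def H.m_assoc e_closed)

lemma tri_smult:
  assumes "a \<in> carrier H" "h \<in> carrier H" "m \<in> carrier M" "n \<in> carrier N"
  shows "a \<odot>\<^bsub>P\<^esub> tri h m n = tri (a \<otimes>\<^bsub>H\<^esub> h) m n"
  using P_smult[OF assms(1), of "[(h \<otimes>\<^bsub>H\<^esub> e, m, n)]"] tri_triple[OF assms(2-4)] assms e_closed
  by (simp add: tri_def H.m_assoc)

lemma tri_idem: "h \<in> carrier H \<Longrightarrow> tri (h \<otimes>\<^bsub>H\<^esub> e) m n = tri h m n"
  by (simp add: tri_def H.m_assoc e_closed e_e)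

lemma tri_add_hom1: "m \<in> carrier M \<Longrightarrow> n \<in> carrier N \<Longrightarrow> add_hom H P (\<lambda>h. tri h m n)"
  by (rule add_homI) (auto simp: tri_closed tri_add1)

lemma tri_add_hom2: "h \<in> carrier H \<Longrightarrow> n \<in> carrier N \<Longrightarrow> add_hom M P (\<lambda>m. tri h m n)"
  by (rule add_homI) (auto simp: tri_closed tri_add2)

lemma tri_add_hom3: "h \<in> carrier H \<Longrightarrow> m \<in> carrier M \<Longrightarrow> add_hom N P (\<lambda>n. tri h m n)"
  by (rule add_homI) (auto simp: tri_closed tri_add3)

lemma P_induct [consumes 1, case_names zero add]:
  assumes "x \<in> carrier P" "Q \<zero>\<^bsub>P\<^esub>"
    and "\<And>h m n x. (h, m, n) \<in> T \<Longrightarrow> x \<in> carrier P \<Longrightarrow> Q x \<Longrightarrow> Q (tri h m n \<oplus>\<^bsub>P\<^esub> x)"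
  shows "Q x"
proof -
  have "Q (cl xs)" if "xs \<in> lists T" for xs
    using that
  proof (induction xs)
    case Nil
    then show ?case using assms(2) by (simp add: P_simps(2))
  next
    case (Cons t xs)
    obtain h m n where t: "t = (h, m, n)" by (cases t)
    have T: "(h, m, n) \<in> T" "xs \<in> lists T" "Q (cl xs)" using Cons t by auto
    have "cl (t # xs) = tri h m n \<oplus>\<^bsub>P\<^esub> cl xs"
      using cl_Cons[OF T(1,2)] tri_eq[OF T(1)] by (simp only: t)
    then show ?case using assms(3)[OF T(1) cl_closed[OF T(2)] T(3)] by simp
  qed
  then show ?thesis using assms(1) by (auto elim!: P_carrierE)
qed

definition tris :: "('i, 'k, 'a) kelt set" where
  "tris = {tri h m n |h m n. h \<in> carrier H \<and> m \<in> carrier M \<and> n \<in> carrier N}"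

lemma tris_carrier: "tris \<subseteq> carrier P"
  by (auto simp: tris_def tri_closed)

lemma P_generate: "x \<in> carrier P \<Longrightarrow> x \<in> generate (add_monoid P) tris"
proof (induction rule: P_induct)
  case zero
  then show ?case using generate.one[of "add_monoid P"] by simp
next
  case (add h m n x)
  then have "tri h m n \<in> tris" by (auto simp: triples_iff tris_def)
  then show ?case using generate.eng[OF generate.incl add(3), of "tri h m n"] by simp
qed

lemma P_left_module: "left_module H P"
proof -
  have closed: "a \<odot>\<^bsub>P\<^esub> x \<in> carrier P" if "a \<in> carrier H" "x \<in> carrier P" for a x
  proof -
    from that(2) obtain xs where "xs \<in> lists T" "x = cl xs" by (rule P_carrierE)
    then show ?thesis using P_smult[OF that(1)] cl_closed[OF sm_lists[OF that(1)]] by metis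
  qed
  have hom: "add_hom P P (\<lambda>x. a \<odot>\<^bsub>P\<^esub> x)" if a: "a \<in> carrier H" for a
  proof (rule add_homI)
    fix x y assume "x \<in> carrier P" "y \<in> carrier P"
    then obtain xs ys where *: "xs \<in> lists T" "x = cl xs" "ys \<in> lists T" "y = cl ys"
      by (auto elim!: P_carrierE)
    then show "a \<odot>\<^bsub>P\<^esub> (x \<oplus>\<^bsub>P\<^esub> y) = a \<odot>\<^bsub>P\<^esub> x \<oplus>\<^bsub>P\<^esub> a \<odot>\<^bsub>P\<^esub> y"
      using a P_add[OF sm_lists[OF a *(1)] sm_lists[OF a *(3)]] by (simp add: P_add P_smult append_in_lists_conv)
  qed (rule closed[OF a])
  have hom_plus: "add_hom P P (\<lambda>x. f x \<oplus>\<^bsub>P\<^esub> g x)" if "add_hom P P f" "add_hom P P g" for f g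
    using that by (auto simp: add_hom_def PG.a_ac)
  show ?thesis
  proof (intro left_module.intro left_module_axioms.intro H.ring_axioms P_abelian_group closed)
    fix a b x assume ab: "a \<in> carrier H" "b \<in> carrier H" and x: "x \<in> carrier P"
    show "(a \<oplus>\<^bsub>H\<^esub> b) \<odot>\<^bsub>P\<^esub> x = a \<odot>\<^bsub>P\<^esub> x \<oplus>\<^bsub>P\<^esub> b \<odot>\<^bsub>P\<^esub> x"
    proof (rule add_hom_eq_on_generate[OF P_abelian_group P_abelian_group hom[OF H.a_closed[OF ab]]
          hom_plus[OF hom[OF ab(1)] hom[OF ab(2)]] tris_carrier _ P_generate[OF x]])
      fix t assume "t \<in> tris"
      then show "(a \<oplus>\<^bsub>H\<^esub> b) \<odot>\<^bsub>P\<^esub> t = a \<odot>\<^bsub>P\<^esub> t \<oplus>\<^bsub>P\<^esub> b \<odot>\<^bsub>P\<^esub> t"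
        using ab by (auto simp: tris_def tri_smult H.l_distr tri_add1)
    qed
    show "(a \<otimes>\<^bsub>H\<^esub> b) \<odot>\<^bsub>P\<^esub> x = a \<odot>\<^bsub>P\<^esub> (b \<odot>\<^bsub>P\<^esub> x)"
    proof (rule add_hom_eq_on_generate[OF P_abelian_group P_abelian_group hom[OF H.m_closed[OF ab]]
          add_hom_comp[OF hom[OF ab(2)] hom[OF ab(1)]] tris_carrier _ P_generate[OF x]])
      fix t assume "t \<in> tris"
      then show "(a \<otimes>\<^bsub>H\<^esub> b) \<odot>\<^bsub>P\<^esub> t = a \<odot>\<^bsub>P\<^esub> (b \<odot>\<^bsub>P\<^esub> t)"
        using ab by (auto simp: tris_def tri_smult H.m_assoc)
    qed
  next
    fix a x y assume a: "a \<in> carrier H" and xy: "x \<in> carrier P" "y \<in> carrier P"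
    show "a \<odot>\<^bsub>P\<^esub> (x \<oplus>\<^bsub>P\<^esub> y) = a \<odot>\<^bsub>P\<^esub> x \<oplus>\<^bsub>P\<^esub> a \<odot>\<^bsub>P\<^esub> y"
      by (rule add_hom_add[OF hom[OF a] xy])
  next
    fix x assume x: "x \<in> carrier P"
    show "\<one>\<^bsub>H\<^esub> \<odot>\<^bsub>P\<^esub> x = x"
    proof (rule add_hom_eq_on_generate[OF P_abelian_group P_abelian_group hom[OF H.one_closed]
          add_hom_id tris_carrier _ P_generate[OF x]])
      fix t assume "t \<in> tris"
      then show "\<one>\<^bsub>H\<^esub> \<odot>\<^bsub>P\<^esub> t = t" by (auto simp: tris_def tri_smult)
    qed
  qed
qed

text \<open>A condition on maps defined on all of \<open>H\<close> rather than on
  \<open>H e\<close>: the last clause with y = z = 1 forces \<open>b (h e) m n = b h m n\<close>, as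
  \<open>lift_tri\<close> uses.\<close>

definition balanced :: "('c, 'x) ring_scheme \<Rightarrow> (('i, 'k) klr \<Rightarrow> ('i, 'k, 'a) kelt \<Rightarrow> ('i, 'k, 'a) kelt \<Rightarrow> 'c) \<Rightarrow> bool" where
  "balanced G b \<longleftrightarrow>
     (\<forall>m\<in>carrier M. \<forall>n\<in>carrier N. add_hom H G (\<lambda>h. b h m n)) \<and>
     (\<forall>h\<in>carrier H. \<forall>n\<in>carrier N. add_hom M G (\<lambda>m. b h m n)) \<and>
     (\<forall>h\<in>carrier H. \<forall>m\<in>carrier M. add_hom N G (\<lambda>n. b h m n)) \<and>
     (\<forall>h\<in>carrier H. \<forall>m\<in>carrier M. \<forall>n\<in>carrier N. \<forall>y\<in>carrier (KLR D \<beta>). \<forall>z\<in>carrier (KLR D \<gamma>).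
        b (h \<otimes>\<^bsub>H\<^esub> diamond D \<beta> \<gamma> y z) m n = b h (y \<odot>\<^bsub>M\<^esub> m) (z \<odot>\<^bsub>N\<^esub> n))"

definition fold_sum :: "('c, 'x) ring_scheme \<Rightarrow> (('i, 'k) klr \<Rightarrow> ('i, 'k, 'a) kelt \<Rightarrow> ('i, 'k, 'a) kelt \<Rightarrow> 'c)
    \<Rightarrow> (('i, 'k) klr \<times> ('i, 'k, 'a) kelt \<times> ('i, 'k, 'a) kelt) list \<Rightarrow> 'c" where
  "fold_sum G b xs = foldr (\<lambda>(h, m, n) s. b h m n \<oplus>\<^bsub>G\<^esub> s) xs \<zero>\<^bsub>G\<^esub>"

text \<open>Evaluated on the list stored in the element; \<open>fold_sum_cong\<close> makes the
  choice of that list immaterial.\<close>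

definition lift :: "('c, 'x) ring_scheme \<Rightarrow> (('i, 'k) klr \<Rightarrow> ('i, 'k, 'a) kelt \<Rightarrow> ('i, 'k, 'a) kelt \<Rightarrow> 'c)
    \<Rightarrow> ('i, 'k, 'a) kelt \<Rightarrow> 'c" where
  "lift G b x = fold_sum G b (unTens x)"

context
  fixes G :: "('c, 'x) ring_scheme" and b
  assumes G: "abelian_group G" and b: "balanced G b"
begin

interpretation G: abelian_group G by (rule G)

lemma balanced_closed: "(h, m, n) \<in> T \<Longrightarrow> b h m n \<in> carrier G"
  using b by (auto simp: balanced_def triples_iff add_hom_def)

lemma fold_sum_closed: "xs \<in> lists T \<Longrightarrow> fold_sum G b xs \<in> carrier G"
  by (induction xs) (auto simp: fold_sum_def balanced_closed)

lemma fold_sum_append: "xs \<in> lists T \<Longrightarrow> ys \<in> lists T \<Longrightarrow> fold_sum G b (xs @ ys) = fold_sum G b xs \<oplus>\<^bsub>G\<^esub> fold_sum G b ys"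
proof (induction xs)
  case Nil
  then show ?case using fold_sum_closed by (simp add: fold_sum_def)
next
  case (Cons t xs)
  moreover have "fold_sum G b (t # zs) = b (fst t) (fst (snd t)) (snd (snd t)) \<oplus>\<^bsub>G\<^esub> fold_sum G b zs" for zs
    by (simp add: fold_sum_def case_prod_unfold)
  moreover have "b (fst t) (fst (snd t)) (snd (snd t)) \<in> carrier G"
    using Cons by (intro balanced_closed) simp
  ultimately show ?case using fold_sum_closed by (simp add: G.a_assoc)
qed

lemma fold_sum_cong:
  assumes "tens_eq D \<beta> \<gamma> M N xs ys"
  shows "fold_sum G b xs = fold_sum G b ys"
  using assms
proof (induction rule: tens_eq.induct)
  case (append xs xs' ys ys')
  then show ?case using tens_eq_lists[OF append(1)] tens_eq_lists[OF append(2)] by (simp add: fold_sum_append)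
next
  case (commute xs ys)
  then show ?case using fold_sum_closed by (simp add: fold_sum_append G.a_comm)
next
  case (zero m n)
  then have "b \<zero>\<^bsub>H\<^esub> m n = \<zero>\<^bsub>G\<^esub>"
    using b by (intro add_hom_zero[OF H.is_abelian_group G, of "\<lambda>h. b h m n"]) (auto simp: balanced_def triples_iff)
  then show ?case by (simp add: fold_sum_def)
next
  case (add1 h m n h')
  then have "b (h \<oplus>\<^bsub>H\<^esub> h') m n = b h m n \<oplus>\<^bsub>G\<^esub> b h' m n"
    using b by (auto simp: balanced_def triples_iff add_hom_def)
  then show ?case using add1 balanced_closed by (simp add: fold_sum_def)
next
  case (add2 h m n m')
  then have "b h (m \<oplus>\<^bsub>M\<^esub> m') n = b h m n \<oplus>\<^bsub>G\<^esub> b h m' n"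
    using b by (auto simp: balanced_def triples_iff add_hom_def)
  then show ?case using add2 balanced_closed by (simp add: fold_sum_def)
next
  case (add3 h m n n')
  then have "b h m (n \<oplus>\<^bsub>N\<^esub> n') = b h m n \<oplus>\<^bsub>G\<^esub> b h m n'"
    using b by (auto simp: balanced_def triples_iff add_hom_def)
  then show ?case using add3 balanced_closed by (simp add: fold_sum_def)
next
  case (balance h m n y z)
  then show ?case using b by (auto simp: balanced_def triples_iff fold_sum_def)
qed auto

lemma lift_cl: "xs \<in> lists T \<Longrightarrow> lift G b (cl xs) = fold_sum G b xs"
  unfolding lift_def by (rule fold_sum_cong[OF tens_eq.sym[OF cl_rep]])

lemma lift_add_hom: "add_hom P G (lift G b)"
proof (rule add_homI)
  fix x assume "x \<in> carrier P"
  then obtain xs where "xs \<in> lists T" "x = cl xs" by (rule P_carrierE)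
  then show "lift G b x \<in> carrier G" using lift_cl fold_sum_closed by metis
next
  fix x y assume "x \<in> carrier P" "y \<in> carrier P"
  then obtain xs ys where "xs \<in> lists T" "x = cl xs" "ys \<in> lists T" "y = cl ys"
    by (auto elim!: P_carrierE)
  then show "lift G b (x \<oplus>\<^bsub>P\<^esub> y) = lift G b x \<oplus>\<^bsub>G\<^esub> lift G b y"
    by (simp add: P_add lift_cl fold_sum_append append_in_lists_conv)
qed

lemma lift_tri:
  assumes "h \<in> carrier H" "m \<in> carrier M" "n \<in> carrier N"
  shows "lift G b (tri h m n) = b h m n"
proof -
  have "b (h \<otimes>\<^bsub>H\<^esub> e) m n = b h (\<one>\<^bsub>KLR D \<beta>\<^esub> \<odot>\<^bsub>M\<^esub> m) (\<one>\<^bsub>KLR D \<gamma>\<^esub> \<odot>\<^bsub>N\<^esub> n)"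
  proof -
    have "\<forall>h\<in>carrier H. \<forall>m\<in>carrier M. \<forall>n\<in>carrier N. \<forall>y\<in>carrier (KLR D \<beta>). \<forall>z\<in>carrier (KLR D \<gamma>).
        b (h \<otimes>\<^bsub>H\<^esub> diamond D \<beta> \<gamma> y z) m n = b h (y \<odot>\<^bsub>M\<^esub> m) (z \<odot>\<^bsub>N\<^esub> n)"
      using b by (simp add: balanced_def)
    from this[rule_format, OF assms ring.ring_simprules(6)[OF ring_KLR] ring.ring_simprules(6)[OF ring_KLR]]
    show ?thesis by (simp add: klr_idem_def)
  qed
  then have "b (h \<otimes>\<^bsub>H\<^esub> e) m n = b h m n"
    using assms left_module.lm_one[OF lmM] left_module.lm_one[OF lmN] by simp
  then show ?thesis
    unfolding tri_def using tri_triple[OF assms] balanced_closed[OF tri_triple[OF assms]]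
    by (simp add: lift_cl) (simp add: fold_sum_def)
qed

end

lemma add_hom_eq_on_tri:
  assumes "abelian_group G" "add_hom P G f" "add_hom P G g"
    and "\<And>h m n. h \<in> carrier H \<Longrightarrow> m \<in> carrier M \<Longrightarrow> n \<in> carrier N \<Longrightarrow> f (tri h m n) = g (tri h m n)"
    and "x \<in> carrier P"
  shows "f x = g x"
  by (rule add_hom_eq_on_generate[OF P_abelian_group assms(1-3) tris_carrier _ P_generate[OF assms(5)]])
    (use assms(4) in \<open>auto simp: tris_def\<close>)

end

text \<open>\<open>ind_prod_map\<close> rewrites the stored list entrywise. It is identified with
  the lift of the balanced map sending h, m, n to the tensor of h, \<open>f m\<close> and
  \<open>g n\<close>, which gives additivity and the values on pure tensors.\<close>

lemma ind_prod_map_lift: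
  assumes t: "tens_prod D \<beta> \<gamma> M N" and t': "tens_prod D \<beta> \<gamma> M' N'"
    and f: "lin_map (KLR D \<beta>) M M' f" and g: "lin_map (KLR D \<gamma>) N N' g"
  shows "add_hom (ind_prod D \<beta> \<gamma> M N) (ind_prod D \<beta> \<gamma> M' N') (ind_prod_map D \<beta> \<gamma> M N M' N' f g)"
    "\<And>h m n. h \<in> carrier (KLR D (\<beta> + \<gamma>)) \<Longrightarrow> m \<in> carrier M \<Longrightarrow> n \<in> carrier N \<Longrightarrow>
      ind_prod_map D \<beta> \<gamma> M N M' N' f g (tens_prod.tri D \<beta> \<gamma> M N h m n) = tens_prod.tri D \<beta> \<gamma> M' N' h (f m) (g n)"
proof -
  interpret t: tens_prod D \<beta> \<gamma> M N by (rule t)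
  interpret t': tens_prod D \<beta> \<gamma> M' N' by (rule t')
  define b where "b h m n = t'.tri h (f m) (g n)" for h m n
  have fc: "f m \<in> carrier M'" if "m \<in> carrier M" for m using f that by (auto simp: lin_map_def add_hom_def)
  have gc: "g n \<in> carrier N'" if "n \<in> carrier N" for n using g that by (auto simp: lin_map_def add_hom_def)
  have fh: "add_hom M M' f" and gh: "add_hom N N' g"
    using f g by (auto simp: lin_map_def)
  have b: "t.balanced t'.P b"
    unfolding t.balanced_def b_def
  proof (intro conjI ballI)
    fix h m n y z assume "h \<in> carrier t.H" "m \<in> carrier M" "n \<in> carrier N" "y \<in> carrier (KLR D \<beta>)" "z \<in> carrier (KLR D \<gamma>)"
    moreover from this have "f (y \<odot>\<^bsub>M\<^esub> m) = y \<odot>\<^bsub>M'\<^esub> f m" "g (z \<odot>\<^bsub>N\<^esub> n) = z \<odot>\<^bsub>N'\<^esub> g n"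
      using f g by (auto simp: lin_map_def)
    ultimately show "t'.tri (h \<otimes>\<^bsub>t.H\<^esub> diamond D \<beta> \<gamma> y z) (f m) (g n) = t'.tri h (f (y \<odot>\<^bsub>M\<^esub> m)) (g (z \<odot>\<^bsub>N\<^esub> n))"
      using t'.tri_balance fc gc by simp
  qed (auto intro: t'.tri_add_hom1 add_hom_comp[OF fh t'.tri_add_hom2] add_hom_comp[OF gh t'.tri_add_hom3] fc gc)
  have eq: "ind_prod_map D \<beta> \<gamma> M N M' N' f g x = t.lift t'.P b x" if x: "x \<in> carrier t.P" for x
  proof -
    from x obtain xs where xs: "xs \<in> lists t.T" "x = t.cl xs" by (rule t.P_carrierE)
    have rep: "unTens x \<in> lists t.T" using t.tens_eq_lists[OF t.cl_rep[OF xs(1)]] xs by simp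
    have "t'.cl (map (\<lambda>(h, m, n). (h, f m, g n)) ys) = t.fold_sum t'.P b ys \<and>
        map (\<lambda>(h, m, n). (h, f m, g n)) ys \<in> lists t'.T" if "ys \<in> lists t.T" for ys
      using that
    proof (induction ys)
      case Nil
      then show ?case by (simp add: t.fold_sum_def t'.P_simps(2))
    next
      case (Cons s ys)
      obtain h m n where s: "s = (h, m, n)" by (cases s)
      have "(h, f m, g n) \<in> t'.T" using Cons fc gc by (auto simp: s t.triples_iff t'.triples_iff)
      then show ?case
        using Cons t'.cl_Cons[of "(h, f m, g n)"] t'.tri_eq[of h "f m" "g n"] by (simp add: s t.fold_sum_def b_def)
    qed
    from this[OF rep] show ?thesis
      using x by (simp add: ind_prod_map_def t.lift_def)
  qed
  show "add_hom t.P t'.P (ind_prod_map D \<beta> \<gamma> M N M' N' f g)"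
    using t.lift_add_hom[OF t'.P_abelian_group b] t.PG.a_closed by (auto simp: add_hom_def eq)
  show "ind_prod_map D \<beta> \<gamma> M N M' N' f g (t.tri h m n) = t'.tri h (f m) (g n)"
    if "h \<in> carrier (KLR D (\<beta> + \<gamma>))" "m \<in> carrier M" "n \<in> carrier N" for h m n
    using that t.lift_tri[OF t'.P_abelian_group b] eq[OF t.tri_closed] by (simp add: b_def)
qed

section \<open>Grading and finite generation of induction products\<close>

lemma uminus_one_smult:
  assumes "left_module R M" "x \<in> carrier M"
  shows "(\<ominus>\<^bsub>R\<^esub> \<one>\<^bsub>R\<^esub>) \<odot>\<^bsub>M\<^esub> x = \<ominus>\<^bsub>M\<^esub> x"
  using add_hom_a_inv[OF ring.is_abelian_group[OF left_module_ring[OF assms(1)]] left_module_abelian_group[OF assms(1)]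
      smult_left_add_hom[OF assms], of "\<one>\<^bsub>R\<^esub>"]
    left_module.lm_one[OF assms] ring.ring_simprules(6)[OF left_module_ring[OF assms(1)]] by simp

lemma add_hom_zero_map:
  assumes "abelian_group B"
  shows "add_hom A B (\<lambda>_. \<zero>\<^bsub>B\<^esub>)"
proof -
  interpret B: abelian_group B by fact
  show ?thesis by (simp add: add_hom_def)
qed

lemma mult_left_add_hom: "ring R \<Longrightarrow> a \<in> carrier R \<Longrightarrow> add_hom R R (\<lambda>x. a \<otimes>\<^bsub>R\<^esub> x)"
  by (simp add: add_hom_def ring.ring_simprules)

lemma mult_right_add_hom: "ring R \<Longrightarrow> a \<in> carrier R \<Longrightarrow> add_hom R R (\<lambda>x. x \<otimes>\<^bsub>R\<^esub> a)"
  by (simp add: add_hom_def ring.ring_simprules)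

lemma generate_subgroup: "abelian_group M \<Longrightarrow> S \<subseteq> carrier M \<Longrightarrow> subgroup (generate (add_monoid M) S) (add_monoid M)"
  using group.generate_is_subgroup[OF abelian_group.a_group, of M S] by simp

lemma generate_closed:
  assumes "abelian_group M" "S \<subseteq> carrier M" "x \<in> generate (add_monoid M) S"
  shows "x \<in> carrier M"
  using subgroup.subset[OF generate_subgroup[OF assms(1,2)]] assms(3) by auto

text \<open>Additivity in a parameter c on which every map of the family depends additively; used
  for the arguments that are not being decomposed.\<close>

lemma (in graded_group) graded_ext_param:
  assumes B: "abelian_group B" and f: "\<And>c d. c \<in> carrier C \<Longrightarrow> add_hom M B (f c d)"
    and f': "\<And>d x. x \<in> carrier M \<Longrightarrow> add_hom C B (\<lambda>c. f c d x)" and C: "abelian_group C" and x: "x \<in> carrier M"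
  shows "add_hom C B (\<lambda>c. graded_ext B (f c) x)"
proof (rule add_homI)
  show "graded_ext B (f c) x \<in> carrier B" if "c \<in> carrier C" for c
    by (rule graded_ext_closed[OF B f[OF that] x])
  interpret C: abelian_group C by (rule C)
  show "graded_ext B (f (c \<oplus>\<^bsub>C\<^esub> c')) x = graded_ext B (f c) x \<oplus>\<^bsub>B\<^esub> graded_ext B (f c') x"
    if c: "c \<in> carrier C" "c' \<in> carrier C" for c c'
    by (rule graded_ext_add[OF B f[OF c(1)] f[OF c(2)] add_hom_add[OF f' c] x])
qed

lemma fg_graded_moduleD:
  assumes "fg_graded_module D \<beta> M"
  shows "left_module (KLR D \<beta>) M" "finitely_generated (KLR D \<beta>) M" "graded_group M (grade M)"
    "\<And>d e a x. klr_homogeneous D \<beta> d a \<Longrightarrow> x \<in> grade M e \<Longrightarrow> a \<odot>\<^bsub>M\<^esub> x \<in> grade M (d + e)"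
  using assms left_module_abelian_group
  by (auto simp: fg_graded_module_def graded_group_def graded_group_axioms_def)

locale graded_tens_prod = tens_prod D \<beta> \<gamma> M N
  for D :: "('i, 'k::{comm_ring,comm_monoid_mult}) klr_datum" and \<beta> \<gamma> :: "'i multiset" and M N :: "('i, 'k, 'a) kmod" +
  assumes D: "is_klr_datum D" and gM: "fg_graded_module D \<beta> M" and gN: "fg_graded_module D \<gamma> N"
begin

sublocale GH: graded_group H "\<lambda>d. {a. klr_homogeneous D (\<beta> + \<gamma>) d a}" by (rule klr_graded_group[OF D])
sublocale GM: graded_group M "grade M" by (rule fg_graded_moduleD(3)[OF gM])
sublocale GN: graded_group N "grade N" by (rule fg_graded_moduleD(3)[OF gN])

text \<open>Pure tensors with homogeneous h in \<open>H\<close>, whereas \<open>hT\<close> has the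
  literal triples of \<open>ind_prod\<close> with h in \<open>H e\<close>. Since \<open>e\<close>
  has degree 0, both give the same graded pieces.\<close>

definition htri :: "int \<Rightarrow> ('i, 'k, 'a) kelt set" where
  "htri d = {tri h m n |h m n. \<exists>a b c. a + b + c = d \<and> klr_homogeneous D (\<beta> + \<gamma>) a h \<and> m \<in> grade M b \<and> n \<in> grade N c}"

definition hT :: "int \<Rightarrow> (('i, 'k) klr \<times> ('i, 'k, 'a) kelt \<times> ('i, 'k, 'a) kelt) set" where
  "hT d = {(h, m, n) \<in> T. \<exists>a b c. a + b + c = d \<and> klr_homogeneous D (\<beta> + \<gamma>) a h \<and> m \<in> grade M b \<and> n \<in> grade N c}"

lemma grade_P: "grade P d = cl ` lists (hT d)"
  by (simp add: ind_prod_def Let_def hT_def)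

lemma hT_T: "lists (hT d) \<subseteq> lists T"
  by (rule lists_mono) (auto simp: hT_def)

lemma htri_carrier: "htri d \<subseteq> carrier P"
  using klr_homogeneous_carrier GM.G_carrier GN.G_carrier by (auto simp: htri_def intro!: tri_closed)

lemma htri_grade: "x \<in> htri d \<Longrightarrow> x \<in> grade P d"
proof -
  assume "x \<in> htri d"
  then obtain h m n a b c where x: "x = tri h m n" and abc: "a + b + c = d"
    and h: "klr_homogeneous D (\<beta> + \<gamma>) a h" "m \<in> grade M b" "n \<in> grade N c"
    by (auto simp: htri_def)
  have "klr_homogeneous D (\<beta> + \<gamma>) a (h \<otimes>\<^bsub>H\<^esub> e)"
    using klr_homogeneous.hom_mult[OF h(1) klr_idem_homogeneous] by simp
  then have "(h \<otimes>\<^bsub>H\<^esub> e, m, n) \<in> hT d"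
    using tri_triple klr_homogeneous_carrier[OF h(1)] GM.G_carrier[OF h(2)] GN.G_carrier[OF h(3)] h abc
    unfolding hT_def by blast
  then show ?thesis
    unfolding x grade_P tri_def by (intro imageI) simp
qed

lemma grade_generate: "x \<in> grade P d \<Longrightarrow> x \<in> generate (add_monoid P) (htri d)"
proof -
  have "cl xs \<in> generate (add_monoid P) (htri d)" if "xs \<in> lists (hT d)" for xs
    using that
  proof (induction xs)
    case Nil
    then show ?case using generate.one[of "add_monoid P"] by (simp add: P_simps(2))
  next
    case (Cons t xs)
    obtain h m n where t: "t = (h, m, n)" by (cases t)
    have "tri h m n \<in> htri d"
      using Cons(1) unfolding t hT_def htri_def by blast
    moreover have "cl [t] = tri h m n"
      using Cons(1) tri_eq[of h m n] by (auto simp: t hT_def)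
    ultimately have "cl [t] \<in> htri d" by simp
    then show ?case
      using generate.eng[OF generate.incl Cons.IH, of "cl [t]"] Cons(1,2) hT_T[of d] cl_Cons[of t xs]
      by (auto simp: hT_def subset_iff)
  qed
  then show "x \<in> grade P d \<Longrightarrow> x \<in> generate (add_monoid P) (htri d)" by (auto simp: grade_P)
qed

lemma grade_subgroup: "subgroup (grade P d) (add_monoid P)"
proof (rule group.subgroupI[OF PG.a_group])
  show "grade P d \<subseteq> carrier (add_monoid P)" using hT_T by (auto simp: grade_P intro!: cl_closed)
  show "grade P d \<noteq> {}" by (auto simp: grade_P)
  show "a \<otimes>\<^bsub>add_monoid P\<^esub> b \<in> grade P d" if "a \<in> grade P d" "b \<in> grade P d" for a b
  proof -
    from that obtain xs ys where "xs \<in> lists (hT d)" "a = cl xs" "ys \<in> lists (hT d)" "b = cl ys"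
      by (auto simp: grade_P)
    then show ?thesis
      using hT_T[of d] P_add[of xs ys] by (auto simp: grade_P subset_iff intro!: imageI)
  qed
  show "inv\<^bsub>add_monoid P\<^esub> a \<in> grade P d" if a: "a \<in> grade P d" for a
  proof -
    from a obtain xs where xs: "xs \<in> lists (hT d)" "a = cl xs" by (auto simp: grade_P)
    have xT: "xs \<in> lists T" using xs hT_T by blast
    have o: "\<ominus>\<^bsub>H\<^esub> \<one>\<^bsub>H\<^esub> \<in> carrier H" by simp
    have "\<ominus>\<^bsub>P\<^esub> a = cl (map (sm (\<ominus>\<^bsub>H\<^esub> \<one>\<^bsub>H\<^esub>)) xs)"
      using uminus_one_smult[OF P_left_module cl_closed[OF xT]] P_smult[OF o xT] xs(2) by simp
    moreover have "sm (\<ominus>\<^bsub>H\<^esub> \<one>\<^bsub>H\<^esub>) t \<in> hT d" if t: "t \<in> hT d" for t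
    proof -
      obtain h m n where t': "t = (h, m, n)" by (cases t)
      have hT: "(h, m, n) \<in> T" using t by (simp add: hT_def t')
      then have "(\<ominus>\<^bsub>H\<^esub> \<one>\<^bsub>H\<^esub>) \<otimes>\<^bsub>H\<^esub> h = \<ominus>\<^bsub>H\<^esub> h" "(\<ominus>\<^bsub>H\<^esub> h, m, n) \<in> T"
        by (auto simp: triples_iff H.l_minus e_closed)
      moreover obtain a b c where "a + b + c = d" "klr_homogeneous D (\<beta> + \<gamma>) a (\<ominus>\<^bsub>H\<^esub> h)" "m \<in> grade M b" "n \<in> grade N c"
        using t klr_homogeneous_uminus[of D "\<beta> + \<gamma>" _ h] unfolding t' hT_def by blast
      ultimately show ?thesis unfolding t' hT_def by auto
    qed
    then have "map (sm (\<ominus>\<^bsub>H\<^esub> \<one>\<^bsub>H\<^esub>)) xs \<in> lists (hT d)" using xs(1) by (induction xs) auto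
    ultimately show ?thesis by (simp add: a_inv_def grade_P)
  qed
qed

context
  fixes d :: int
begin

text \<open>Uniqueness of homogeneous decompositions: the degree \<open>d\<close> component of \<open>h \<otimes> m \<otimes> n\<close>, a finite sum
  over the components of \<open>h\<close>, \<open>m\<close> and \<open>n\<close>, is balanced and so descends to the tensor product.\<close>

definition proj0 :: "int \<Rightarrow> int \<Rightarrow> int \<Rightarrow> ('i, 'k) klr \<Rightarrow> ('i, 'k, 'a) kelt \<Rightarrow> ('i, 'k, 'a) kelt \<Rightarrow> ('i, 'k, 'a) kelt" where
  "proj0 a b c h m n = (if a + b + c = d then tri h m n else \<zero>\<^bsub>P\<^esub>)"
definition proj1 :: "int \<Rightarrow> int \<Rightarrow> ('i, 'k) klr \<Rightarrow> ('i, 'k, 'a) kelt \<Rightarrow> ('i, 'k, 'a) kelt \<Rightarrow> ('i, 'k, 'a) kelt" where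
  "proj1 a b h m n = GN.graded_ext P (\<lambda>c. proj0 a b c h m) n"
definition proj2 :: "int \<Rightarrow> ('i, 'k) klr \<Rightarrow> ('i, 'k, 'a) kelt \<Rightarrow> ('i, 'k, 'a) kelt \<Rightarrow> ('i, 'k, 'a) kelt" where
  "proj2 a h m n = GM.graded_ext P (\<lambda>b m'. proj1 a b h m' n) m"
definition proj3 :: "('i, 'k) klr \<Rightarrow> ('i, 'k, 'a) kelt \<Rightarrow> ('i, 'k, 'a) kelt \<Rightarrow> ('i, 'k, 'a) kelt" where
  "proj3 h m n = GH.graded_ext P (\<lambda>a h'. proj2 a h' m n) h"

lemmas ab = H.is_abelian_group GM.is_abelian GN.is_abelian P_abelian_group

lemma proj0_add_hom:
  "m \<in> carrier M \<Longrightarrow> n \<in> carrier N \<Longrightarrow> add_hom H P (\<lambda>h. proj0 a b c h m n)"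
  "h \<in> carrier H \<Longrightarrow> n \<in> carrier N \<Longrightarrow> add_hom M P (\<lambda>m. proj0 a b c h m n)"
  "h \<in> carrier H \<Longrightarrow> m \<in> carrier M \<Longrightarrow> add_hom N P (\<lambda>n. proj0 a b c h m n)"
  by (cases "a + b + c = d";
      simp add: proj0_def tri_add_hom1 tri_add_hom2 tri_add_hom3 add_hom_zero_map[OF P_abelian_group])+

text \<open>In the argument just decomposed additivity is \<open>graded_ext_add_hom\<close>, in the
  other two it is \<open>graded_ext_param\<close>. The pattern repeats for \<open>proj2\<close> and
  \<open>proj3\<close>.\<close>

lemma proj1_add_hom:
  "m \<in> carrier M \<Longrightarrow> n \<in> carrier N \<Longrightarrow> add_hom H P (\<lambda>h. proj1 a b h m n)"
  "h \<in> carrier H \<Longrightarrow> n \<in> carrier N \<Longrightarrow> add_hom M P (\<lambda>m. proj1 a b h m n)"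
  "h \<in> carrier H \<Longrightarrow> m \<in> carrier M \<Longrightarrow> add_hom N P (\<lambda>n. proj1 a b h m n)"
proof -
  show "m \<in> carrier M \<Longrightarrow> n \<in> carrier N \<Longrightarrow> add_hom H P (\<lambda>h. proj1 a b h m n)"
    unfolding proj1_def
    by (rule GN.graded_ext_param[OF P_abelian_group]; (rule proj0_add_hom ab)?; assumption)
  show "h \<in> carrier H \<Longrightarrow> n \<in> carrier N \<Longrightarrow> add_hom M P (\<lambda>m. proj1 a b h m n)"
    unfolding proj1_def
    by (rule GN.graded_ext_param[OF P_abelian_group]; (rule proj0_add_hom ab)?; assumption)
  show "h \<in> carrier H \<Longrightarrow> m \<in> carrier M \<Longrightarrow> add_hom N P (\<lambda>n. proj1 a b h m n)"
    unfolding proj1_def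
    by (rule GN.graded_ext_add_hom[OF P_abelian_group]; (rule proj0_add_hom)?; assumption)
qed

lemma proj2_add_hom:
  "m \<in> carrier M \<Longrightarrow> n \<in> carrier N \<Longrightarrow> add_hom H P (\<lambda>h. proj2 a h m n)"
  "h \<in> carrier H \<Longrightarrow> n \<in> carrier N \<Longrightarrow> add_hom M P (\<lambda>m. proj2 a h m n)"
  "h \<in> carrier H \<Longrightarrow> m \<in> carrier M \<Longrightarrow> add_hom N P (\<lambda>n. proj2 a h m n)"
proof -
  show "m \<in> carrier M \<Longrightarrow> n \<in> carrier N \<Longrightarrow> add_hom H P (\<lambda>h. proj2 a h m n)"
    unfolding proj2_def
    by (rule GM.graded_ext_param[OF P_abelian_group]; (rule proj1_add_hom ab)?; assumption)
  show "h \<in> carrier H \<Longrightarrow> n \<in> carrier N \<Longrightarrow> add_hom M P (\<lambda>m. proj2 a h m n)"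
    unfolding proj2_def
    by (rule GM.graded_ext_add_hom[OF P_abelian_group]; (rule proj1_add_hom)?; assumption)
  show "h \<in> carrier H \<Longrightarrow> m \<in> carrier M \<Longrightarrow> add_hom N P (\<lambda>n. proj2 a h m n)"
    unfolding proj2_def
    by (rule GM.graded_ext_param[OF P_abelian_group]; (rule proj1_add_hom ab)?; assumption)
qed

lemma proj3_add_hom:
  "m \<in> carrier M \<Longrightarrow> n \<in> carrier N \<Longrightarrow> add_hom H P (\<lambda>h. proj3 h m n)"
  "h \<in> carrier H \<Longrightarrow> n \<in> carrier N \<Longrightarrow> add_hom M P (\<lambda>m. proj3 h m n)"
  "h \<in> carrier H \<Longrightarrow> m \<in> carrier M \<Longrightarrow> add_hom N P (\<lambda>n. proj3 h m n)"
proof -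
  show "m \<in> carrier M \<Longrightarrow> n \<in> carrier N \<Longrightarrow> add_hom H P (\<lambda>h. proj3 h m n)"
    unfolding proj3_def
    by (rule GH.graded_ext_add_hom[OF P_abelian_group]; (rule proj2_add_hom)?; assumption)
  show "h \<in> carrier H \<Longrightarrow> n \<in> carrier N \<Longrightarrow> add_hom M P (\<lambda>m. proj3 h m n)"
    unfolding proj3_def
    by (rule GH.graded_ext_param[OF P_abelian_group]; (rule proj2_add_hom ab)?; assumption)
  show "h \<in> carrier H \<Longrightarrow> m \<in> carrier M \<Longrightarrow> add_hom N P (\<lambda>n. proj3 h m n)"
    unfolding proj3_def
    by (rule GH.graded_ext_param[OF P_abelian_group]; (rule proj2_add_hom ab)?; assumption)
qed

lemma proj3_homogeneous:
  assumes h: "klr_homogeneous D (\<beta> + \<gamma>) a h" and m: "m \<in> grade M b" and n: "n \<in> grade N c"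
  shows "proj3 h m n = (if a + b + c = d then tri h m n else \<zero>\<^bsub>P\<^esub>)"
proof -
  have hc: "h \<in> carrier H" "m \<in> carrier M" "n \<in> carrier N"
    using klr_homogeneous_carrier[OF h] GM.G_carrier[OF m] GN.G_carrier[OF n] by auto
  have "proj3 h m n = proj2 a h m n"
    unfolding proj3_def
    by (rule GH.graded_ext_homogeneous[OF P_abelian_group proj2_add_hom(1)[OF hc(2,3)]]) (use h in simp)
  also have "\<dots> = proj1 a b h m n"
    unfolding proj2_def
    by (rule GM.graded_ext_homogeneous[OF P_abelian_group proj1_add_hom(2)[OF hc(1,3)] m])
  also have "\<dots> = proj0 a b c h m n"
    unfolding proj1_def
    by (rule GN.graded_ext_homogeneous[OF P_abelian_group proj0_add_hom(3)[OF hc(1,2)] n])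
  finally show ?thesis by (simp add: proj0_def)
qed

text \<open>Both tensors have total degree a + b + c + p + q, so the projection keeps both or
  neither.\<close>

lemma proj3_balanced_homogeneous:
  assumes h: "klr_homogeneous D (\<beta> + \<gamma>) a h" and m: "m \<in> grade M b" and n: "n \<in> grade N c"
    and y: "klr_homogeneous D \<beta> p y" and z: "klr_homogeneous D \<gamma> q z"
  shows "proj3 (h \<otimes>\<^bsub>H\<^esub> diamond D \<beta> \<gamma> y z) m n = proj3 h (y \<odot>\<^bsub>M\<^esub> m) (z \<odot>\<^bsub>N\<^esub> n)"
proof -
  have hc: "h \<in> carrier H" "m \<in> carrier M" "n \<in> carrier N" "y \<in> carrier (KLR D \<beta>)" "z \<in> carrier (KLR D \<gamma>)"
    using klr_homogeneous_carrier[OF h] GM.G_carrier[OF m] GN.G_carrier[OF n] klr_homogeneous_carrier[OF y] klr_homogeneous_carrier[OF z] by auto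
  have "proj3 (h \<otimes>\<^bsub>H\<^esub> diamond D \<beta> \<gamma> y z) m n =
      (if a + (p + q) + b + c = d then tri (h \<otimes>\<^bsub>H\<^esub> diamond D \<beta> \<gamma> y z) m n else \<zero>\<^bsub>P\<^esub>)"
    by (rule proj3_homogeneous[OF klr_homogeneous.hom_mult[OF h diamond_homogeneous[OF y z]] m n])
  moreover have "proj3 h (y \<odot>\<^bsub>M\<^esub> m) (z \<odot>\<^bsub>N\<^esub> n) =
      (if a + (p + b) + (q + c) = d then tri h (y \<odot>\<^bsub>M\<^esub> m) (z \<odot>\<^bsub>N\<^esub> n) else \<zero>\<^bsub>P\<^esub>)"
    by (rule proj3_homogeneous[OF h fg_graded_moduleD(4)[OF gM y m] fg_graded_moduleD(4)[OF gN z n]])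
  moreover have "a + (p + q) + b + c = a + (p + b) + (q + c)" by simp
  ultimately show ?thesis using tri_balance[OF hc] by simp
qed

text \<open>The balancing identity is additive in each of its five arguments, so the assumption of
  homogeneity is dropped for one argument at a time: h, y, z, m and finally n.\<close>

lemma proj3_balanced: "balanced P proj3"
  unfolding balanced_def
proof (intro conjI ballI)
  interpret GL: graded_group "KLR D \<beta>" "\<lambda>d. {a. klr_homogeneous D \<beta> d a}" by (rule klr_graded_group[OF D])
  interpret GR: graded_group "KLR D \<gamma>" "\<lambda>d. {a. klr_homogeneous D \<gamma> d a}" by (rule klr_graded_group[OF D])
  fix h m n y z
  assume c: "h \<in> carrier H" "m \<in> carrier M" "n \<in> carrier N" "y \<in> carrier (KLR D \<beta>)" "z \<in> carrier (KLR D \<gamma>)"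
  define eqn where "eqn h m n y z \<longleftrightarrow> proj3 (h \<otimes>\<^bsub>H\<^esub> diamond D \<beta> \<gamma> y z) m n = proj3 h (y \<odot>\<^bsub>M\<^esub> m) (z \<odot>\<^bsub>N\<^esub> n)" for h m n y z
  note hcl = klr_homogeneous_carrier GM.G_carrier GN.G_carrier
  note dc = diamond_closed' left_module.lm_closed[OF lmM] left_module.lm_closed[OF lmN]
  have 1: "eqn h m n y z" if "klr_homogeneous D \<beta> p y" "klr_homogeneous D \<gamma> q z" "m \<in> grade M b" "n \<in> grade N k"
    for m n y z p q b k
    unfolding eqn_def
  proof (rule GH.eq_on_homogeneous[OF P_abelian_group _ _ _ c(1)])
    show "add_hom H P (\<lambda>h. proj3 (h \<otimes>\<^bsub>H\<^esub> diamond D \<beta> \<gamma> y z) m n)"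
      using that by (intro add_hom_comp[OF mult_right_add_hom[OF H.ring_axioms] proj3_add_hom(1)] dc hcl)
    show "add_hom H P (\<lambda>h. proj3 h (y \<odot>\<^bsub>M\<^esub> m) (z \<odot>\<^bsub>N\<^esub> n))"
      using that by (intro proj3_add_hom(1) dc hcl)
  qed (use that proj3_balanced_homogeneous in auto)
  have 2: "eqn h m n y z" if "klr_homogeneous D \<gamma> q z" "m \<in> grade M b" "n \<in> grade N k" for m n z q b k
    unfolding eqn_def
  proof (rule GL.eq_on_homogeneous[OF P_abelian_group _ _ _ c(4)])
    note cc = klr_homogeneous_carrier[OF that(1)] GM.G_carrier[OF that(2)] GN.G_carrier[OF that(3)]
    have "add_hom (KLR D \<beta>) H (\<lambda>y. diamond D \<beta> \<gamma> y z)"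
      using cc by (intro add_homI dc diamond_add_left) auto
    then show "add_hom (KLR D \<beta>) P (\<lambda>y. proj3 (h \<otimes>\<^bsub>H\<^esub> diamond D \<beta> \<gamma> y z) m n)"
      using cc c by (intro add_hom_comp[OF add_hom_comp[OF _ mult_left_add_hom[OF H.ring_axioms]] proj3_add_hom(1)]) auto
    show "add_hom (KLR D \<beta>) P (\<lambda>y. proj3 h (y \<odot>\<^bsub>M\<^esub> m) (z \<odot>\<^bsub>N\<^esub> n))"
      using cc c dc by (intro add_hom_comp[OF smult_left_add_hom[OF lmM] proj3_add_hom(2)]) auto
  qed (use that 1[unfolded eqn_def] in auto)
  have 3: "eqn h m n y z" if "m \<in> grade M b" "n \<in> grade N k" for m n b k
    unfolding eqn_def
  proof (rule GR.eq_on_homogeneous[OF P_abelian_group _ _ _ c(5)])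
    note cc = GM.G_carrier[OF that(1)] GN.G_carrier[OF that(2)]
    have "add_hom (KLR D \<gamma>) H (\<lambda>z. diamond D \<beta> \<gamma> y z)"
      using c by (intro add_homI dc diamond_add_right) auto
    then show "add_hom (KLR D \<gamma>) P (\<lambda>z. proj3 (h \<otimes>\<^bsub>H\<^esub> diamond D \<beta> \<gamma> y z) m n)"
      using cc c by (intro add_hom_comp[OF add_hom_comp[OF _ mult_left_add_hom[OF H.ring_axioms]] proj3_add_hom(1)]) auto
    show "add_hom (KLR D \<gamma>) P (\<lambda>z. proj3 h (y \<odot>\<^bsub>M\<^esub> m) (z \<odot>\<^bsub>N\<^esub> n))"
      using cc c dc by (intro add_hom_comp[OF smult_left_add_hom[OF lmN] proj3_add_hom(3)]) auto
  qed (use that 2[unfolded eqn_def] in auto)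
  have 4: "eqn h m n y z" if "n \<in> grade N k" for n k
    unfolding eqn_def
  proof (rule GM.eq_on_homogeneous[OF P_abelian_group _ _ _ c(2)])
    show "add_hom M P (\<lambda>m. proj3 (h \<otimes>\<^bsub>H\<^esub> diamond D \<beta> \<gamma> y z) m n)"
      using GN.G_carrier[OF that] c dc by (intro proj3_add_hom(2)) auto
    show "add_hom M P (\<lambda>m. proj3 h (y \<odot>\<^bsub>M\<^esub> m) (z \<odot>\<^bsub>N\<^esub> n))"
      using GN.G_carrier[OF that] c dc by (intro add_hom_comp[OF smult_add_hom[OF lmM] proj3_add_hom(2)]) auto
  qed (use that 3[unfolded eqn_def] in auto)
  show "proj3 (h \<otimes>\<^bsub>H\<^esub> diamond D \<beta> \<gamma> y z) m n = proj3 h (y \<odot>\<^bsub>M\<^esub> m) (z \<odot>\<^bsub>N\<^esub> n)"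
  proof (rule GN.eq_on_homogeneous[OF P_abelian_group _ _ _ c(3)])
    show "add_hom N P (\<lambda>n. proj3 (h \<otimes>\<^bsub>H\<^esub> diamond D \<beta> \<gamma> y z) m n)"
      using c dc by (intro proj3_add_hom(3)) auto
    show "add_hom N P (\<lambda>n. proj3 h (y \<odot>\<^bsub>M\<^esub> m) (z \<odot>\<^bsub>N\<^esub> n))"
      using c dc by (intro add_hom_comp[OF smult_add_hom[OF lmN] proj3_add_hom(3)]) auto
  qed (use 4[unfolded eqn_def] in auto)
qed (auto intro: proj3_add_hom)

end

lemma P_graded_by: "graded_by P (grade P)"
proof (rule graded_groupI[where p = "\<lambda>d. lift P (proj3 d)", OF P_abelian_group grade_subgroup])
  show hom: "add_hom P P (lift P (proj3 d))" for d
    by (rule lift_add_hom[OF P_abelian_group proj3_balanced])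
  show "lift P (proj3 d) x = (if d = e' then x else \<zero>\<^bsub>P\<^esub>)" if x: "x \<in> grade P e'" for d e' x
  proof (rule add_hom_eq_on_generate[OF P_abelian_group P_abelian_group hom _ htri_carrier _ grade_generate[OF x]])
    show "add_hom P P (\<lambda>x. if d = e' then x else \<zero>\<^bsub>P\<^esub>)"
      using add_hom_id add_hom_zero_map[OF P_abelian_group] by (cases "d = e'") auto
    show "lift P (proj3 d) t = (if d = e' then t else \<zero>\<^bsub>P\<^esub>)" if t: "t \<in> htri e'" for t
    proof -
      from t obtain h m n a b c where t: "t = tri h m n" and abc: "a + b + c = e'"
        and h: "klr_homogeneous D (\<beta> + \<gamma>) a h" "m \<in> grade M b" "n \<in> grade N c"
        by (auto simp: htri_def)
      have "lift P (proj3 d) t = proj3 d h m n"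
        unfolding t using klr_homogeneous_carrier[OF h(1)] GM.G_carrier[OF h(2)] GN.G_carrier[OF h(3)]
        by (intro lift_tri[OF P_abelian_group proj3_balanced])
      then show ?thesis using proj3_homogeneous[OF h, of d] abc t by auto
    qed
  qed
  show "carrier P \<subseteq> generate (add_monoid P) (\<Union>d. grade P d)"
  proof
    fix x assume x: "x \<in> carrier P"
    have gP: "grade P d \<subseteq> carrier P" for d using subgroup.subset[OF grade_subgroup] by auto
    define S where "S = generate (add_monoid P) (\<Union>d. grade P d)"
    have S: "subgroup S (add_monoid P)" unfolding S_def using gP by (intro generate_subgroup[OF P_abelian_group]) auto
    \<comment> \<open>A pure tensor is decomposed in its three arguments in turn.\<close>
    have tS: "tri h m n \<in> S" if "h \<in> carrier H" "m \<in> carrier M" "n \<in> carrier N" for h m n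
    proof (rule GH.in_subgroup_on_homogeneous[OF P_abelian_group tri_add_hom1[OF that(2,3)] S _ that(1)])
      fix a h assume h: "h \<in> {h. klr_homogeneous D (\<beta> + \<gamma>) a h}"
      have hc: "h \<in> carrier H" using h klr_homogeneous_carrier by auto
      show "tri h m n \<in> S"
      proof (rule GM.in_subgroup_on_homogeneous[OF P_abelian_group tri_add_hom2[OF hc that(3)] S _ that(2)])
        fix b m assume m: "m \<in> grade M b"
        show "tri h m n \<in> S"
        proof (rule GN.in_subgroup_on_homogeneous[OF P_abelian_group tri_add_hom3[OF hc GM.G_carrier[OF m]] S _ that(3)])
          fix c n assume n: "n \<in> grade N c"
          have "tri h m n \<in> htri (a + b + c)" using h m n unfolding htri_def by blast
          then show "tri h m n \<in> S" unfolding S_def by (intro generate.incl) (auto dest: htri_grade)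
        qed
      qed
    qed
    show "x \<in> generate (add_monoid P) (\<Union>d. grade P d)"
      unfolding S_def[symmetric]
      by (rule add_hom_generate_in_subgroup[OF P_abelian_group P_abelian_group add_hom_id S tris_carrier _ P_generate[OF x]])
        (auto simp: tris_def intro: tS)
  qed
qed

text \<open>For generators s and t of the two modules, the tensor of h, \<open>y s\<close> and
  \<open>z t\<close> is \<open>h (y \<diamondop> z)\<close> times the tensor of \<open>e\<close>, s
  and t. So finitely many tensors of generators suffice.\<close>

lemma P_finitely_generated: "finitely_generated H P"
proof -
  obtain SM where SM: "SM \<subseteq> carrier M" "finite SM" "carrier M = generate (add_monoid M) {a \<odot>\<^bsub>M\<^esub> s |a s. a \<in> carrier (KLR D \<beta>) \<and> s \<in> SM}"
    using fg_graded_moduleD(2)[OF gM] unfolding finitely_generated_def by blast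
  obtain SN where SN: "SN \<subseteq> carrier N" "finite SN" "carrier N = generate (add_monoid N) {a \<odot>\<^bsub>N\<^esub> s |a s. a \<in> carrier (KLR D \<gamma>) \<and> s \<in> SN}"
    using fg_graded_moduleD(2)[OF gN] unfolding finitely_generated_def by blast
  define S where "S = (\<lambda>(s, t). tri e s t) ` (SM \<times> SN)"
  have SP: "S \<subseteq> carrier P" using SM(1) SN(1) e_closed by (auto simp: S_def intro!: tri_closed)
  define A where "A = {a \<odot>\<^bsub>P\<^esub> s |a s. a \<in> carrier H \<and> s \<in> S}"
  have A: "A \<subseteq> carrier P" unfolding A_def using SP left_module.lm_closed[OF P_left_module] by blast
  note GS = generate_subgroup[OF P_abelian_group A]
  have gen: "tri h m n \<in> generate (add_monoid P) A" if c: "h \<in> carrier H" "m \<in> carrier M" "n \<in> carrier N" for h m n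
  proof (rule add_hom_generate_in_subgroup[OF GM.is_abelian P_abelian_group tri_add_hom2[OF c(1,3)] GS _ _ subsetD[OF equalityD1[OF SM(3)] c(2)]])
    show "{a \<odot>\<^bsub>M\<^esub> s |a s. a \<in> carrier (KLR D \<beta>) \<and> s \<in> SM} \<subseteq> carrier M"
      using SM(1) left_module.lm_closed[OF lmM] by blast
    fix m assume "m \<in> {a \<odot>\<^bsub>M\<^esub> s |a s. a \<in> carrier (KLR D \<beta>) \<and> s \<in> SM}"
    then obtain y s where m: "m = y \<odot>\<^bsub>M\<^esub> s" "y \<in> carrier (KLR D \<beta>)" "s \<in> SM" by blast
    have s: "s \<in> carrier M" using m SM(1) by auto
    have mc: "m \<in> carrier M" unfolding m(1) by (rule left_module.lm_closed[OF lmM m(2) s])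
    show "tri h m n \<in> generate (add_monoid P) A"
    proof (rule add_hom_generate_in_subgroup[OF GN.is_abelian P_abelian_group tri_add_hom3[OF c(1) mc] GS _ _ subsetD[OF equalityD1[OF SN(3)] c(3)]])
      show "{a \<odot>\<^bsub>N\<^esub> s |a s. a \<in> carrier (KLR D \<gamma>) \<and> s \<in> SN} \<subseteq> carrier N"
        using SN(1) left_module.lm_closed[OF lmN] by blast
      fix n assume "n \<in> {a \<odot>\<^bsub>N\<^esub> s |a s. a \<in> carrier (KLR D \<gamma>) \<and> s \<in> SN}"
      then obtain z t where n: "n = z \<odot>\<^bsub>N\<^esub> t" "z \<in> carrier (KLR D \<gamma>)" "t \<in> SN" by blast
      have t: "t \<in> carrier N" using n SN(1) by auto
      have k: "h \<otimes>\<^bsub>H\<^esub> diamond D \<beta> \<gamma> y z \<in> carrier H"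
        using c diamond_closed' m n by auto
      have "tri h m n = tri (h \<otimes>\<^bsub>H\<^esub> diamond D \<beta> \<gamma> y z) s t"
        unfolding m(1) n(1) by (rule tri_balance[OF c(1) s t m(2) n(2), symmetric])
      also have "\<dots> = (h \<otimes>\<^bsub>H\<^esub> diamond D \<beta> \<gamma> y z) \<odot>\<^bsub>P\<^esub> tri e s t"
        using tri_smult[OF k e_closed s t] tri_idem[OF k, of s t] by simp
      finally have "tri h m n \<in> A" unfolding A_def S_def using k m(3) n(3) by auto
      then show "tri h m n \<in> generate (add_monoid P) A" by (rule generate.incl)
    qed
  qed
  have "carrier P = generate (add_monoid P) A"
  proof
    show "generate (add_monoid P) A \<subseteq> carrier P" using generate_closed[OF P_abelian_group A] by blast
    show "carrier P \<subseteq> generate (add_monoid P) A"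
    proof
      fix x assume x: "x \<in> carrier P"
      show "x \<in> generate (add_monoid P) A"
        by (rule add_hom_generate_in_subgroup[OF P_abelian_group P_abelian_group add_hom_id GS tris_carrier _ P_generate[OF x]])
          (auto simp: tris_def intro: gen)
    qed
  qed
  then show ?thesis
    unfolding finitely_generated_def A_def using SP SM(2) SN(2) by (intro exI[of _ S]) (auto simp: S_def)
qed

lemma P_fg_graded_module: "fg_graded_module D (\<beta> + \<gamma>) P"
  unfolding fg_graded_module_def
proof (intro conjI allI impI P_left_module P_finitely_generated P_graded_by)
  fix d e' a x assume a: "klr_homogeneous D (\<beta> + \<gamma>) d a" and x: "x \<in> grade P e'"
  note ac = klr_homogeneous_carrier[OF a]
  show "a \<odot>\<^bsub>P\<^esub> x \<in> grade P (d + e')"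
  proof (rule add_hom_generate_in_subgroup[OF P_abelian_group P_abelian_group smult_add_hom[OF P_left_module ac] grade_subgroup htri_carrier _ grade_generate[OF x]])
    fix t assume "t \<in> htri e'"
    then obtain h m n p b c where t: "t = tri h m n" and abc: "p + b + c = e'"
      and h: "klr_homogeneous D (\<beta> + \<gamma>) p h" "m \<in> grade M b" "n \<in> grade N c"
      by (auto simp: htri_def)
    have "a \<odot>\<^bsub>P\<^esub> t = tri (a \<otimes>\<^bsub>H\<^esub> h) m n"
      unfolding t using ac klr_homogeneous_carrier[OF h(1)] GM.G_carrier[OF h(2)] GN.G_carrier[OF h(3)] by (rule tri_smult)
    moreover have "d + p + b + c = d + e'" using abc by simp
    ultimately have "a \<odot>\<^bsub>P\<^esub> t \<in> htri (d + e')"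
      using klr_homogeneous.hom_mult[OF a h(1)] h(2,3) unfolding htri_def by blast
    then show "a \<odot>\<^bsub>P\<^esub> t \<in> grade P (d + e')" by (rule htri_grade)
  qed
qed

end

section \<open>The functor \<open>\<pi>\<^sub>i\<close>\<close>

lemma linear_maps_lin_map: "f \<in> linear_maps R M N \<longleftrightarrow> f \<in> extensional (carrier M) \<and> lin_map R M N f"
  by (auto simp: linear_maps_def lin_map_def add_hom_def PiE_def Pi_def)

lemma lin_map_restrict: "left_module R M \<Longrightarrow> lin_map R M N f \<Longrightarrow> (\<lambda>x\<in>carrier M. f x) \<in> linear_maps R M N"
  using abelian_groupE(1)[OF left_module_abelian_group, of R M]
  by (auto simp: linear_maps_def lin_map_def add_hom_def left_module.lm_closed)

lemma lin_map_add_hom: "lin_map R M N f \<Longrightarrow> add_hom M N f"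
  by (simp add: lin_map_def)

lemma lin_map_smult: "lin_map R M N f \<Longrightarrow> a \<in> carrier R \<Longrightarrow> x \<in> carrier M \<Longrightarrow> f (a \<odot>\<^bsub>M\<^esub> x) = a \<odot>\<^bsub>N\<^esub> f x"
  by (simp add: lin_map_def)

lemma lin_map_closed: "lin_map R M N f \<Longrightarrow> x \<in> carrier M \<Longrightarrow> f x \<in> carrier N"
  by (simp add: lin_map_def add_hom_def)

lemma lin_map_comp: "lin_map R M N f \<Longrightarrow> lin_map R N P g \<Longrightarrow> lin_map R M P (\<lambda>x. g (f x))"
  by (auto simp: lin_map_def add_hom_def)

lemma lin_map_id: "lin_map R M M (\<lambda>x. x)"
  by (simp add: lin_map_def add_hom_id)

lemma lin_map_cong:
  assumes "left_module R M" "lin_map R M N f" "\<And>x. x \<in> carrier M \<Longrightarrow> f x = g x"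
  shows "lin_map R M N g"
  using assms(2,3) abelian_groupE(1)[OF left_module_abelian_group[OF assms(1)]] left_module.lm_closed[OF assms(1)]
  by (simp add: lin_map_def add_hom_def)

lemma lin_map_eq_on_span:
  assumes "left_module R M" "left_module R N" "lin_map R M N f" "lin_map R M N g" "G \<subseteq> carrier M"
    and "\<And>m. m \<in> G \<Longrightarrow> f m = g m" "x \<in> generate (add_monoid M) {a \<odot>\<^bsub>M\<^esub> m |a m. a \<in> carrier R \<and> m \<in> G}"
  shows "f x = g x"
  by (rule add_hom_eq_on_generate[OF left_module_abelian_group[OF assms(1)] left_module_abelian_group[OF assms(2)]
        lin_map_add_hom[OF assms(3)] lin_map_add_hom[OF assms(4)] _ _ assms(7)])
    (use assms(5,6) left_module.lm_closed[OF assms(1)] in \<open>auto simp: lin_map_smult[OF assms(3)] lin_map_smult[OF assms(4)] subset_iff\<close>)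

text \<open>The elements annihilating M form a two-sided ideal. Hence the condition in
  \<open>Obj_i\<close> can be tested on the idempotent alone, the form adopted in
  \<open>killed_module\<close>.\<close>

lemma annihilated_by_ideal:
  assumes M: "left_module R M" and c: "c \<in> carrier R" and z: "\<And>x. x \<in> carrier M \<Longrightarrow> c \<odot>\<^bsub>M\<^esub> x = \<zero>\<^bsub>M\<^esub>"
    and a: "a \<in> genideal R {c}" and x: "x \<in> carrier M"
  shows "a \<odot>\<^bsub>M\<^esub> x = \<zero>\<^bsub>M\<^esub>"
proof -
  interpret R: ring R by (rule left_module_ring[OF M])
  interpret M: abelian_group M by (rule left_module_abelian_group[OF M])
  define A where "A = {a \<in> carrier R. \<forall>x\<in>carrier M. a \<odot>\<^bsub>M\<^esub> x = \<zero>\<^bsub>M\<^esub>}"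
  note lm = left_module.lm_closed[OF M] left_module.lm_l_distr[OF M] left_module.lm_assoc[OF M] zero_smult[OF M] smult_zero[OF M]
  have "ideal A R"
  proof (rule idealI[OF R.ring_axioms])
    show "subgroup A (add_monoid R)"
    proof (rule group.subgroupI[OF R.a_group])
      show "inv\<^bsub>add_monoid R\<^esub> b \<in> A" if b: "b \<in> A" for b
      proof -
        have "(\<ominus>\<^bsub>R\<^esub> b) \<odot>\<^bsub>M\<^esub> x = \<zero>\<^bsub>M\<^esub>" if x: "x \<in> carrier M" for x
          using add_hom_a_inv[OF R.is_abelian_group M.abelian_group_axioms smult_left_add_hom[OF M x], of b] b x
          by (simp add: A_def)
        then show ?thesis using b by (simp add: A_def a_inv_def[symmetric])
      qed
      show "A \<noteq> {}" using lm(4) by (auto simp: A_def)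
    qed (auto simp: A_def lm)
  qed (auto simp: A_def lm)
  moreover have "{c} \<subseteq> A" using c z by (simp add: A_def)
  ultimately have "genideal R {c} \<subseteq> A" by (rule R.genideal_minimal)
  then show ?thesis using a x by (auto simp: A_def)
qed

locale pi_module =
  fixes D :: "('i, 'k::{comm_ring,comm_monoid_mult}) klr_datum" and i :: 'i and \<beta> :: "'i multiset" and X :: "('i, 'k, 'a) kmod"
  assumes lm: "left_module (KLR D \<beta>) X"
begin

abbreviation R :: "('i, 'k) klr ring" where "R \<equiv> KLR D \<beta>"
abbreviation \<epsilon> :: "('i, 'k) klr" where "\<epsilon> \<equiv> klr_idem_at D i \<beta>"
abbreviation S :: "('i, 'k, 'a) kelt set" where "S \<equiv> pi_sub D i \<beta> X"
abbreviation pc :: "('i, 'k, 'a) kelt \<Rightarrow> ('i, 'k, 'a) kelt" where "pc \<equiv> pi_class D i \<beta> X"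
abbreviation Q :: "('i, 'k, 'a) kmod" where "Q \<equiv> pi_mod D i \<beta> X"

sublocale R: ring R by (rule ring_KLR)
sublocale XG: abelian_group X by (rule left_module_abelian_group[OF lm])

lemma \<epsilon>_closed: "\<epsilon> \<in> carrier R"
  by (rule klr_idem_at_closed)

definition S_gens :: "('i, 'k, 'a) kelt set" where
  "S_gens = {a \<odot>\<^bsub>X\<^esub> (\<epsilon> \<odot>\<^bsub>X\<^esub> x) |a x. a \<in> carrier R \<and> x \<in> carrier X}"

lemma S_eq: "S = generate (add_monoid X) S_gens"
  by (simp add: pi_sub_def S_gens_def)

lemma S_gens_carrier: "S_gens \<subseteq> carrier X"
  unfolding S_gens_def using left_module.lm_closed[OF lm] \<epsilon>_closed by blast

lemma S_subgroup: "subgroup S (add_monoid X)"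
  unfolding S_eq by (rule generate_subgroup[OF XG.abelian_group_axioms S_gens_carrier])

sublocale S: abelian_subgroup S X
  by (rule abelian_subgroupI3[OF additive_subgroup.intro[OF S_subgroup] XG.abelian_group_axioms])

lemma S_hom:
  assumes "add_hom X B f" "abelian_group B" "subgroup A (add_monoid B)"
    and "\<And>a x. a \<in> carrier R \<Longrightarrow> x \<in> carrier X \<Longrightarrow> f (a \<odot>\<^bsub>X\<^esub> (\<epsilon> \<odot>\<^bsub>X\<^esub> x)) \<in> A" "s \<in> S"
  shows "f s \<in> A"
  by (rule add_hom_generate_in_subgroup[OF XG.abelian_group_axioms assms(2,1,3) S_gens_carrier _ assms(5)[unfolded S_eq]])
    (use assms(4) in \<open>auto simp: S_gens_def\<close>)

lemma S_smult:
  assumes "a \<in> carrier R" "s \<in> S"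
  shows "a \<odot>\<^bsub>X\<^esub> s \<in> S"
proof (rule S_hom[OF smult_add_hom[OF lm assms(1)] XG.abelian_group_axioms S_subgroup _ assms(2)])
  fix b x assume bx: "b \<in> carrier R" "x \<in> carrier X"
  have "a \<odot>\<^bsub>X\<^esub> (b \<odot>\<^bsub>X\<^esub> (\<epsilon> \<odot>\<^bsub>X\<^esub> x)) = (a \<otimes>\<^bsub>R\<^esub> b) \<odot>\<^bsub>X\<^esub> (\<epsilon> \<odot>\<^bsub>X\<^esub> x)"
    using left_module.lm_assoc[OF lm assms(1) bx(1)] left_module.lm_closed[OF lm \<epsilon>_closed bx(2)] by simp
  then have "a \<odot>\<^bsub>X\<^esub> (b \<odot>\<^bsub>X\<^esub> (\<epsilon> \<odot>\<^bsub>X\<^esub> x)) \<in> S_gens"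
    using assms(1) bx unfolding S_gens_def by blast
  then show "a \<odot>\<^bsub>X\<^esub> (b \<odot>\<^bsub>X\<^esub> (\<epsilon> \<odot>\<^bsub>X\<^esub> x)) \<in> S"
    unfolding S_eq by (rule generate.incl)
qed

lemma pc_props:
  assumes x: "x \<in> carrier X"
  shows "pc x \<in> carrier X" "pc x \<ominus>\<^bsub>X\<^esub> x \<in> S"
proof -
  have m: "pc x \<in> S +>\<^bsub>X\<^esub> x"
    unfolding pi_class_def using S.a_rcos_self[OF x] by (rule someI)
  show c: "pc x \<in> carrier X" by (rule S.a_elemrcos_carrier[OF x m])
  show "pc x \<ominus>\<^bsub>X\<^esub> x \<in> S"
    using S.a_rcos_module[OF x c] m by (simp add: a_minus_def)
qed

lemma pc_eqI:
  assumes "x \<in> carrier X" "y \<in> carrier X" "x \<ominus>\<^bsub>X\<^esub> y \<in> S"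
  shows "pc x = pc y"
proof -
  have "x \<in> S +>\<^bsub>X\<^esub> y"
    using S.a_rcos_module[OF assms(2,1)] assms(3) by (simp add: a_minus_def)
  then have "S +>\<^bsub>X\<^esub> y = S +>\<^bsub>X\<^esub> x"
    by (rule S.a_repr_independence'[OF _ assms(2)])
  then show ?thesis by (simp add: pi_class_def)
qed

text \<open>If f preserves the submodule, replacing an argument by its chosen representative does
  not change the class of the value. Applied to scalars, to the identity and to homogeneous
  components.\<close>

lemma pc_cong_hom:
  assumes f: "add_hom X X f" "\<And>s. s \<in> S \<Longrightarrow> f s \<in> S" and x: "x \<in> carrier X"
  shows "pc (f (pc x)) = pc (f x)"
proof (rule pc_eqI)
  note p = pc_props[OF x]
  show "f (pc x) \<in> carrier X" "f x \<in> carrier X" using add_hom_closed[OF f(1)] p x by auto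
  have "f (pc x \<ominus>\<^bsub>X\<^esub> x) = f (pc x) \<ominus>\<^bsub>X\<^esub> f x"
    using add_hom_add[OF f(1) p(1), of "\<ominus>\<^bsub>X\<^esub> x"] add_hom_a_inv[OF XG.abelian_group_axioms XG.abelian_group_axioms f(1) x] x
    by (simp add: a_minus_def)
  then show "f (pc x) \<ominus>\<^bsub>X\<^esub> f x \<in> S" using f(2)[OF p(2)] by simp
qed

lemma pc_pc: "x \<in> carrier X \<Longrightarrow> pc (pc x) = pc x"
  using pc_cong_hom[OF add_hom_id] by simp

lemma pc_add_cong:
  assumes x: "x \<in> carrier X" and y: "y \<in> carrier X"
  shows "pc (pc x \<oplus>\<^bsub>X\<^esub> pc y) = pc (x \<oplus>\<^bsub>X\<^esub> y)"
proof (rule pc_eqI)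
  note p = pc_props[OF x] pc_props[OF y]
  have "(pc x \<oplus>\<^bsub>X\<^esub> pc y) \<ominus>\<^bsub>X\<^esub> (x \<oplus>\<^bsub>X\<^esub> y) = (pc x \<ominus>\<^bsub>X\<^esub> x) \<oplus>\<^bsub>X\<^esub> (pc y \<ominus>\<^bsub>X\<^esub> y)"
    using p(1,3) x y by (simp add: a_minus_def XG.minus_add XG.a_ac)
  then show "(pc x \<oplus>\<^bsub>X\<^esub> pc y) \<ominus>\<^bsub>X\<^esub> (x \<oplus>\<^bsub>X\<^esub> y) \<in> S"
    using subgroup.m_closed[OF S_subgroup p(2,4)] by simp
qed (use pc_props x y in auto)

lemma Q_simps:
  "carrier Q = pc ` carrier X" "zero Q = pc \<zero>\<^bsub>X\<^esub>" "add Q = (\<lambda>x y. pc (x \<oplus>\<^bsub>X\<^esub> y))"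
  "smult Q = (\<lambda>a x. pc (a \<odot>\<^bsub>X\<^esub> x))" "grade Q = (\<lambda>d. pc ` grade X d)"
  by (simp_all add: pi_mod_def Let_def)

lemma pc_closed: "x \<in> carrier X \<Longrightarrow> pc x \<in> carrier Q"
  by (simp add: Q_simps)

lemma pc_add: "x \<in> carrier X \<Longrightarrow> y \<in> carrier X \<Longrightarrow> pc (x \<oplus>\<^bsub>X\<^esub> y) = pc x \<oplus>\<^bsub>Q\<^esub> pc y"
  by (simp add: Q_simps(3) pc_add_cong)

lemma pc_smult: "a \<in> carrier R \<Longrightarrow> x \<in> carrier X \<Longrightarrow> pc (a \<odot>\<^bsub>X\<^esub> x) = a \<odot>\<^bsub>Q\<^esub> pc x"
  by (simp add: Q_simps(4) pc_cong_hom[OF smult_add_hom[OF lm] S_smult])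

text \<open>The quotient consists of representatives, so any map on X can be applied to its elements
  directly.\<close>

lemma Q_carrier_X: "q \<in> carrier Q \<Longrightarrow> q \<in> carrier X \<and> pc q = q"
  by (auto simp: Q_simps(1) pc_props pc_pc)

lemma Q_left_module: "left_module R Q"
proof (intro left_module.intro left_module_axioms.intro R.ring_axioms)
  show "abelian_group Q"
  proof (rule abelian_groupI)
    fix q assume "q \<in> carrier Q"
    then obtain x where x: "x \<in> carrier X" "q = pc x" by (auto simp: Q_simps(1))
    then show "\<exists>p\<in>carrier Q. p \<oplus>\<^bsub>Q\<^esub> q = \<zero>\<^bsub>Q\<^esub>"
      by (intro bexI[of _ "pc (\<ominus>\<^bsub>X\<^esub> x)"]) (simp_all flip: pc_add add: pc_closed XG.l_neg Q_simps(2))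
    show "\<zero>\<^bsub>Q\<^esub> \<oplus>\<^bsub>Q\<^esub> q = q"
      using pc_add[OF XG.zero_closed x(1)] x by (simp add: Q_simps(2))
  next
    fix p q assume "p \<in> carrier Q" "q \<in> carrier Q"
    then obtain x y where xy: "x \<in> carrier X" "p = pc x" "y \<in> carrier X" "q = pc y" by (auto simp: Q_simps(1))
    show "p \<oplus>\<^bsub>Q\<^esub> q = q \<oplus>\<^bsub>Q\<^esub> p" using pc_add[OF xy(1,3)] pc_add[OF xy(3,1)] xy by (simp add: XG.a_comm)
    show "p \<oplus>\<^bsub>Q\<^esub> q \<in> carrier Q" using pc_add[OF xy(1,3)] xy pc_closed[of "x \<oplus>\<^bsub>X\<^esub> y"] by simp
  next
    fix p q r assume "p \<in> carrier Q" "q \<in> carrier Q" "r \<in> carrier Q"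
    then obtain x y z where xyz: "x \<in> carrier X" "p = pc x" "y \<in> carrier X" "q = pc y" "z \<in> carrier X" "r = pc z"
      by (auto simp: Q_simps(1))
    show "p \<oplus>\<^bsub>Q\<^esub> q \<oplus>\<^bsub>Q\<^esub> r = p \<oplus>\<^bsub>Q\<^esub> (q \<oplus>\<^bsub>Q\<^esub> r)"
      unfolding xyz(2,4,6) using xyz(1,3,5) by (simp flip: pc_add add: XG.a_assoc)
  qed (simp add: Q_simps(2) pc_closed)
  show "a \<odot>\<^bsub>Q\<^esub> q \<in> carrier Q" if a: "a \<in> carrier R" and q: "q \<in> carrier Q" for a q
  proof -
    from q obtain x where x: "x \<in> carrier X" "q = pc x" by (auto simp: Q_simps(1))
    show ?thesis using pc_smult[OF a x(1)] pc_closed[OF left_module.lm_closed[OF lm a x(1)]] x by simp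
  qed
  show "(a \<oplus>\<^bsub>R\<^esub> b) \<odot>\<^bsub>Q\<^esub> q = a \<odot>\<^bsub>Q\<^esub> q \<oplus>\<^bsub>Q\<^esub> b \<odot>\<^bsub>Q\<^esub> q" if ab: "a \<in> carrier R" "b \<in> carrier R" and q: "q \<in> carrier Q" for a b q
  proof -
    from q obtain x where x: "x \<in> carrier X" "q = pc x" by (auto simp: Q_simps(1))
    show ?thesis unfolding x(2) using ab x(1)
      by (simp flip: pc_smult pc_add add: left_module.lm_closed[OF lm] left_module.lm_l_distr[OF lm])
  qed
  show "(a \<otimes>\<^bsub>R\<^esub> b) \<odot>\<^bsub>Q\<^esub> q = a \<odot>\<^bsub>Q\<^esub> (b \<odot>\<^bsub>Q\<^esub> q)" if ab: "a \<in> carrier R" "b \<in> carrier R" and q: "q \<in> carrier Q" for a b q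
  proof -
    from q obtain x where x: "x \<in> carrier X" "q = pc x" by (auto simp: Q_simps(1))
    show ?thesis unfolding x(2) using ab x(1)
      by (simp flip: pc_smult add: left_module.lm_closed[OF lm] left_module.lm_assoc[OF lm])
  qed
  show "a \<odot>\<^bsub>Q\<^esub> (p \<oplus>\<^bsub>Q\<^esub> q) = a \<odot>\<^bsub>Q\<^esub> p \<oplus>\<^bsub>Q\<^esub> a \<odot>\<^bsub>Q\<^esub> q" if a: "a \<in> carrier R" and pq: "p \<in> carrier Q" "q \<in> carrier Q" for a p q
  proof -
    from pq obtain x y where xy: "x \<in> carrier X" "p = pc x" "y \<in> carrier X" "q = pc y" by (auto simp: Q_simps(1))
    show ?thesis unfolding xy(2,4) using a xy(1,3)
      by (simp flip: pc_smult pc_add add: left_module.lm_closed[OF lm] left_module.lm_r_distr[OF lm])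
  qed
  show "\<one>\<^bsub>R\<^esub> \<odot>\<^bsub>Q\<^esub> q = q" if q: "q \<in> carrier Q" for q
  proof -
    from q obtain x where x: "x \<in> carrier X" "q = pc x" by (auto simp: Q_simps(1))
    show ?thesis unfolding x(2) using x(1) by (simp flip: pc_smult add: left_module.lm_one[OF lm])
  qed
qed

lemma pc_lin_map: "lin_map R X Q pc"
  by (simp add: lin_map_def add_hom_def pc_closed pc_add pc_smult)

lemma Q_killed: "q \<in> carrier Q \<Longrightarrow> \<epsilon> \<odot>\<^bsub>Q\<^esub> q = \<zero>\<^bsub>Q\<^esub>"
proof -
  assume "q \<in> carrier Q"
  then obtain x where x: "x \<in> carrier X" "q = pc x" by (auto simp: Q_simps(1))
  have "\<one>\<^bsub>R\<^esub> \<odot>\<^bsub>X\<^esub> (\<epsilon> \<odot>\<^bsub>X\<^esub> x) \<in> S_gens" unfolding S_gens_def using x by blast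
  then have "\<epsilon> \<odot>\<^bsub>X\<^esub> x \<in> S"
    unfolding S_eq using left_module.lm_one[OF lm left_module.lm_closed[OF lm \<epsilon>_closed x(1)]] by (auto intro: generate.incl)
  then have "pc (\<epsilon> \<odot>\<^bsub>X\<^esub> x) = pc \<zero>\<^bsub>X\<^esub>"
    using left_module.lm_closed[OF lm \<epsilon>_closed x(1)] by (intro pc_eqI) (simp_all add: a_minus_def)
  then show ?thesis using x pc_smult[OF \<epsilon>_closed x(1)] by (simp add: Q_simps(2))
qed

text \<open>The induced map is f itself, evaluated on representatives. It kills the submodule
  because the image of \<epsilon> x under f is \<epsilon> applied to an element of N, hence
  zero.\<close>

lemma descend:
  assumes N: "left_module R N" and f: "lin_map R X N f"
    and kill: "\<And>y. y \<in> carrier N \<Longrightarrow> \<epsilon> \<odot>\<^bsub>N\<^esub> y = \<zero>\<^bsub>N\<^esub>"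
  shows "lin_map R Q N f" "\<And>x. x \<in> carrier X \<Longrightarrow> f (pc x) = f x"
proof -
  interpret N: abelian_group N by (rule left_module_abelian_group[OF N])
  have 0: "subgroup {\<zero>\<^bsub>N\<^esub>} (add_monoid N)"
    by (rule group.subgroupI[OF N.a_group]) (auto simp: a_inv_def[symmetric])
  have fS: "f s \<in> {\<zero>\<^bsub>N\<^esub>}" if "s \<in> S" for s
  proof (rule S_hom[OF lin_map_add_hom[OF f] N.abelian_group_axioms 0 _ that])
    fix a x assume "a \<in> carrier R" "x \<in> carrier X"
    then show "f (a \<odot>\<^bsub>X\<^esub> (\<epsilon> \<odot>\<^bsub>X\<^esub> x)) \<in> {\<zero>\<^bsub>N\<^esub>}"
      using lin_map_smult[OF f] left_module.lm_closed[OF lm \<epsilon>_closed] kill lin_map_closed[OF f] smult_zero[OF N] \<epsilon>_closed by simp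
  qed
  show *: "f (pc x) = f x" if x: "x \<in> carrier X" for x
  proof -
    note p = pc_props[OF x]
    have "f (pc x \<ominus>\<^bsub>X\<^esub> x) \<oplus>\<^bsub>N\<^esub> f x = f ((pc x \<ominus>\<^bsub>X\<^esub> x) \<oplus>\<^bsub>X\<^esub> x)"
      using add_hom_add[OF lin_map_add_hom[OF f]] p x by simp
    moreover have "(pc x \<ominus>\<^bsub>X\<^esub> x) \<oplus>\<^bsub>X\<^esub> x = pc x" using p x by (simp add: a_minus_def XG.a_assoc XG.l_neg)
    ultimately show ?thesis using fS[OF p(2)] lin_map_closed[OF f x] by simp
  qed
  have "f q \<in> carrier N" if "q \<in> carrier Q" for q
    using lin_map_closed[OF f] Q_carrier_X[OF that] by simp
  moreover have "f (p \<oplus>\<^bsub>Q\<^esub> q) = f p \<oplus>\<^bsub>N\<^esub> f q" if "p \<in> carrier Q" "q \<in> carrier Q" for p q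
    using Q_carrier_X[OF that(1)] Q_carrier_X[OF that(2)] * add_hom_add[OF lin_map_add_hom[OF f]] by (simp add: Q_simps(3))
  moreover have "f (a \<odot>\<^bsub>Q\<^esub> q) = a \<odot>\<^bsub>N\<^esub> f q" if "a \<in> carrier R" "q \<in> carrier Q" for a q
    using Q_carrier_X[OF that(2)] that(1) * lin_map_smult[OF f] left_module.lm_closed[OF lm] by (simp add: Q_simps(4))
  ultimately show "lin_map R Q N f" by (simp add: lin_map_def add_hom_def)
qed

lemma generate_pc:
  assumes "A \<subseteq> carrier X" "carrier X = generate (add_monoid X) A" "\<And>x. x \<in> A \<Longrightarrow> pc x \<in> B" "B \<subseteq> carrier Q" "q \<in> carrier Q"
  shows "q \<in> generate (add_monoid Q) B"
proof -
  note QG = left_module_abelian_group[OF Q_left_module]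
  from assms(5) obtain x where x: "x \<in> carrier X" "q = pc x" by (auto simp: Q_simps(1))
  show ?thesis
    unfolding x(2)
    by (rule add_hom_generate_in_subgroup[OF XG.abelian_group_axioms QG lin_map_add_hom[OF pc_lin_map] generate_subgroup[OF QG assms(4)]
          assms(1) _ subsetD[OF equalityD1[OF assms(2)] x(1)]])
      (rule generate.incl[OF assms(3)])
qed

end

lemma subgroup_image:
  assumes A: "abelian_group A" and B: "abelian_group B" and f: "add_hom A B f" and G: "subgroup G (add_monoid A)"
  shows "subgroup (f ` G) (add_monoid B)"
proof -
  interpret B: abelian_group B by (rule B)
  have GA: "x \<in> carrier A" if "x \<in> G" for x using subgroup.subset[OF G] that by auto
  show ?thesis
  proof (rule group.subgroupI[OF B.a_group])
    show "f ` G \<noteq> {}" using subgroup.one_closed[OF G] by blast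
    show "f ` G \<subseteq> carrier (add_monoid B)" using GA add_hom_closed[OF f] by auto
    show "inv\<^bsub>add_monoid B\<^esub> y \<in> f ` G" if "y \<in> f ` G" for y
    proof -
      from that obtain x where x: "x \<in> G" "y = f x" by auto
      have "inv\<^bsub>add_monoid B\<^esub> y = f (\<ominus>\<^bsub>A\<^esub> x)"
        using add_hom_a_inv[OF A B f GA[OF x(1)]] x(2) by (simp add: a_inv_def)
      then show ?thesis using subgroup.m_inv_closed[OF G x(1)] by (simp add: a_inv_def)
    qed
    show "y \<otimes>\<^bsub>add_monoid B\<^esub> z \<in> f ` G" if yz: "y \<in> f ` G" "z \<in> f ` G" for y z
    proof -
      from yz obtain x x' where x: "x \<in> G" "y = f x" "x' \<in> G" "z = f x'" by auto
      then have "y \<otimes>\<^bsub>add_monoid B\<^esub> z = f (x \<oplus>\<^bsub>A\<^esub> x')" using add_hom_add[OF f] GA by simp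
      then show ?thesis using subgroup.m_closed[OF G x(1,3)] by simp
    qed
  qed
qed

locale graded_pi = pi_module D i \<beta> X
  for D :: "('i, 'k::{comm_ring,comm_monoid_mult}) klr_datum" and i :: 'i and \<beta> :: "'i multiset" and X :: "('i, 'k, 'a) kmod" +
  assumes D: "is_klr_datum D" and gX: "fg_graded_module D \<beta> X"
begin

sublocale GR: graded_group R "\<lambda>d. {a. klr_homogeneous D \<beta> d a}" by (rule klr_graded_group[OF D])
sublocale GX: graded_group X "grade X" by (rule fg_graded_moduleD(3)[OF gX])

text \<open>The idempotent has degree 0, so for homogeneous a and x the generators of the submodule
  are homogeneous, and their components are themselves or zero. The submodule is therefore a graded
  one.\<close>

lemma comp_S:
  assumes s: "s \<in> S"
  shows "graded_comp X (grade X) s d \<in> S"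
proof (rule S_hom[OF GX.comp_add_hom XG.abelian_group_axioms S_subgroup _ s])
  fix a x assume a: "a \<in> carrier R" and x: "x \<in> carrier X"
  note \<epsilon>x = left_module.lm_closed[OF lm \<epsilon>_closed]
  show "graded_comp X (grade X) (a \<odot>\<^bsub>X\<^esub> (\<epsilon> \<odot>\<^bsub>X\<^esub> x)) d \<in> S"
  proof (rule GR.in_subgroup_on_homogeneous[OF XG.abelian_group_axioms
        add_hom_comp[OF smult_left_add_hom[OF lm \<epsilon>x[OF x]] GX.comp_add_hom] S_subgroup _ a])
    fix p a assume ap: "a \<in> {a. klr_homogeneous D \<beta> p a}"
    then have a: "klr_homogeneous D \<beta> p a" by simp
    note ac = klr_homogeneous_carrier[OF a]
    show "graded_comp X (grade X) (a \<odot>\<^bsub>X\<^esub> (\<epsilon> \<odot>\<^bsub>X\<^esub> x)) d \<in> S"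
    proof (rule GX.in_subgroup_on_homogeneous[OF XG.abelian_group_axioms
        add_hom_comp[OF add_hom_comp[OF smult_add_hom[OF lm \<epsilon>_closed] smult_add_hom[OF lm ac]] GX.comp_add_hom] S_subgroup _ x])
      fix e x assume x: "x \<in> grade X e"
      have "a \<odot>\<^bsub>X\<^esub> (\<epsilon> \<odot>\<^bsub>X\<^esub> x) \<in> grade X (p + (0 + e))"
        by (intro fg_graded_moduleD(4)[OF gX] a klr_idem_at_homogeneous x)
      moreover have "a \<odot>\<^bsub>X\<^esub> (\<epsilon> \<odot>\<^bsub>X\<^esub> x) \<in> S"
        unfolding S_eq S_gens_def using ac GX.G_carrier[OF x] by (intro generate.incl) blast
      ultimately show "graded_comp X (grade X) (a \<odot>\<^bsub>X\<^esub> (\<epsilon> \<odot>\<^bsub>X\<^esub> x)) d \<in> S"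
        using GX.comp_homogeneous subgroup.one_closed[OF S_subgroup] by (simp split: if_splits)
    qed
  qed
qed

lemma Q_graded_by: "graded_by Q (grade Q)"
proof (rule graded_groupI[where p = "\<lambda>d q. pc (graded_comp X (grade X) q d)"])
  show QG: "abelian_group Q" by (rule left_module_abelian_group[OF Q_left_module])
  note pch = lin_map_add_hom[OF pc_lin_map]
  show "subgroup (grade Q d) (add_monoid Q)" for d
    unfolding Q_simps(5) by (rule subgroup_image[OF XG.abelian_group_axioms QG pch GX.G_subgroup])
  \<comment> \<open>Components in the quotient are taken on representatives; by
    \<open>comp_S\<close> their classes do not depend on the choice.\<close>
  have cong: "pc (graded_comp X (grade X) (pc x) d) = pc (graded_comp X (grade X) x d)" if "x \<in> carrier X" for x d
    by (rule pc_cong_hom[OF GX.comp_add_hom comp_S that])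
  show "add_hom Q Q (\<lambda>q. pc (graded_comp X (grade X) q d))" for d
  proof (rule add_homI)
    show "pc (graded_comp X (grade X) q d) \<in> carrier Q" if "q \<in> carrier Q" for q
      using Q_carrier_X[OF that] by (intro pc_closed GX.comp_carrier) simp
    show "pc (graded_comp X (grade X) (p \<oplus>\<^bsub>Q\<^esub> q) d) =
        pc (graded_comp X (grade X) p d) \<oplus>\<^bsub>Q\<^esub> pc (graded_comp X (grade X) q d)" if "p \<in> carrier Q" "q \<in> carrier Q" for p q
    proof -
      have c: "p \<in> carrier X" "q \<in> carrier X" using Q_carrier_X that by auto
      have "pc (graded_comp X (grade X) (p \<oplus>\<^bsub>Q\<^esub> q) d) = pc (graded_comp X (grade X) (p \<oplus>\<^bsub>X\<^esub> q) d)"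
        using cong[of "p \<oplus>\<^bsub>X\<^esub> q" d] c by (simp add: Q_simps(3))
      then show ?thesis using c by (simp add: GX.comp_add GX.comp_carrier pc_add)
    qed
  qed
  show "pc (graded_comp X (grade X) q d) = (if d = e then q else \<zero>\<^bsub>Q\<^esub>)" if "q \<in> grade Q e" for d e q
  proof -
    from that obtain x where x: "x \<in> grade X e" "q = pc x" by (auto simp: Q_simps(5))
    show ?thesis
      using cong[OF GX.G_carrier[OF x(1)], of d] GX.comp_homogeneous[OF x(1), of d] x(2) by (simp add: Q_simps(2))
  qed
  show "carrier Q \<subseteq> generate (add_monoid Q) (\<Union>d. grade Q d)"
  proof
    fix q assume q: "q \<in> carrier Q"
    show "q \<in> generate (add_monoid Q) (\<Union>d. grade Q d)"
    proof (rule generate_pc[OF _ GX.generate_homogeneous[symmetric] _ _ q])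
      show "(\<Union>d. grade X d) \<subseteq> carrier X" using GX.G_carrier by blast
      show "pc x \<in> (\<Union>d. grade Q d)" if "x \<in> (\<Union>d. grade X d)" for x
        using that by (auto simp: Q_simps(5))
      show "(\<Union>d. grade Q d) \<subseteq> carrier Q" using GX.G_carrier by (auto simp: Q_simps(1,5))
    qed
  qed
qed

lemma Q_finitely_generated: "finitely_generated R Q"
proof -
  obtain A where A: "A \<subseteq> carrier X" "finite A" "carrier X = generate (add_monoid X) {a \<odot>\<^bsub>X\<^esub> s |a s. a \<in> carrier R \<and> s \<in> A}"
    using fg_graded_moduleD(2)[OF gX] unfolding finitely_generated_def by blast
  define B where "B = {a \<odot>\<^bsub>Q\<^esub> s |a s. a \<in> carrier R \<and> s \<in> pc ` A}"
  have BQ: "B \<subseteq> carrier Q" unfolding B_def using A(1) pc_closed left_module.lm_closed[OF Q_left_module] by blast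
  have "carrier Q = generate (add_monoid Q) B"
  proof
    show "carrier Q \<subseteq> generate (add_monoid Q) B"
    proof
      fix q assume q: "q \<in> carrier Q"
      show "q \<in> generate (add_monoid Q) B"
      proof (rule generate_pc[OF _ A(3) _ BQ q])
        show "{a \<odot>\<^bsub>X\<^esub> s |a s. a \<in> carrier R \<and> s \<in> A} \<subseteq> carrier X"
          using A(1) left_module.lm_closed[OF lm] by blast
        fix x assume "x \<in> {a \<odot>\<^bsub>X\<^esub> s |a s. a \<in> carrier R \<and> s \<in> A}"
        then obtain a s where as: "x = a \<odot>\<^bsub>X\<^esub> s" "a \<in> carrier R" "s \<in> A" by blast
        have "pc x = a \<odot>\<^bsub>Q\<^esub> pc s" unfolding as(1) using as A(1) by (intro pc_smult) auto
        then show "pc x \<in> B" unfolding B_def using as by blast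
      qed
    qed
    show "generate (add_monoid Q) B \<subseteq> carrier Q"
      using generate_closed[OF left_module_abelian_group[OF Q_left_module] BQ] by blast
  qed
  then show ?thesis
    unfolding finitely_generated_def B_def using A(1,2) pc_closed by (intro exI[of _ "pc ` A"]) auto
qed

lemma Q_fg_graded_module: "fg_graded_module D \<beta> Q"
  unfolding fg_graded_module_def
proof (intro conjI allI impI Q_left_module Q_finitely_generated Q_graded_by)
  fix d e a q assume a: "klr_homogeneous D \<beta> d a" and "q \<in> grade Q e"
  then obtain x where x: "x \<in> grade X e" "q = pc x" by (auto simp: Q_simps(5))
  have "a \<odot>\<^bsub>Q\<^esub> q = pc (a \<odot>\<^bsub>X\<^esub> x)"
    unfolding x(2) by (rule pc_smult[OF klr_homogeneous_carrier[OF a] GX.G_carrier[OF x(1)], symmetric])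
  then show "a \<odot>\<^bsub>Q\<^esub> q \<in> grade Q (d + e)"
    using fg_graded_moduleD(4)[OF gX a x(1)] by (simp add: Q_simps(5))
qed

end

section \<open>The universal property\<close>

lemma E_pow_simps:
  "carrier (E_pow D i n) = Alg ` carrier (KLR D (replicate_mset n i))"
  "zero (E_pow D i n) = Alg \<zero>\<^bsub>KLR D (replicate_mset n i)\<^esub>"
  "add (E_pow D i n) = (\<lambda>x y. Alg (unAlg x \<oplus>\<^bsub>KLR D (replicate_mset n i)\<^esub> unAlg y))"
  "smult (E_pow D i n) = (\<lambda>a x. Alg (a \<otimes>\<^bsub>KLR D (replicate_mset n i)\<^esub> unAlg x))"
  "grade (E_pow D i n) = (\<lambda>d. Alg ` {a. klr_homogeneous D (replicate_mset n i) d a})"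
  by (simp_all add: E_pow_def Let_def)

lemma E_pow_left_module: "left_module (KLR D (replicate_mset n i)) (E_pow D i n)"
proof -
  interpret R: ring "KLR D (replicate_mset n i)" by (rule ring_KLR)
  have "abelian_group (E_pow D i n)"
  proof (rule abelian_groupI)
    show "\<exists>y\<in>carrier (E_pow D i n). y \<oplus>\<^bsub>E_pow D i n\<^esub> x = \<zero>\<^bsub>E_pow D i n\<^esub>" if "x \<in> carrier (E_pow D i n)" for x
      using that by (intro bexI[of _ "Alg (\<ominus>\<^bsub>KLR D (replicate_mset n i)\<^esub> (unAlg x))"]) (auto simp: E_pow_simps R.l_neg)
  qed (auto simp: E_pow_simps R.a_ac)
  then show ?thesis
    by (intro left_module.intro left_module_axioms.intro R.ring_axioms)
      (auto simp: E_pow_simps R.l_distr R.r_distr R.m_assoc)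
qed

lemma Alg_add_hom: "add_hom (KLR D (replicate_mset n i)) (E_pow D i n) Alg"
  by (auto simp: add_hom_def E_pow_simps)

lemma unAlg_add_hom: "add_hom (E_pow D i n) (KLR D (replicate_mset n i)) unAlg"
  using ring.ring_simprules(1)[OF ring_KLR] by (auto simp: add_hom_def E_pow_simps)

lemma E_pow_fg_graded_module:
  fixes D :: "('i, 'k::{comm_ring,comm_monoid_mult}) klr_datum"
  assumes D: "is_klr_datum D"
  shows "fg_graded_module D (replicate_mset n i) (E_pow D i n :: ('i, 'k, 'a) kmod)"
  unfolding fg_graded_module_def
proof (intro conjI allI impI E_pow_left_module)
  let ?E = "E_pow D i n :: ('i, 'k, 'a) kmod"
  interpret G: graded_group "KLR D (replicate_mset n i)" "\<lambda>d. {a. klr_homogeneous D (replicate_mset n i) d a}"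
    by (rule klr_graded_group[OF D])
  interpret R: ring "KLR D (replicate_mset n i)" by (rule ring_KLR)
  note E = left_module_abelian_group[OF E_pow_left_module[where D = D and i = i and n = n]]
  show "finitely_generated (KLR D (replicate_mset n i)) ?E"
  proof -
    define A where "A = {a \<odot>\<^bsub>?E\<^esub> s |a s. a \<in> carrier (KLR D (replicate_mset n i)) \<and> s \<in> {Alg \<one>\<^bsub>KLR D (replicate_mset n i)\<^esub> :: ('i, 'k, 'a) kelt}}"
    have A: "A = carrier ?E" by (auto simp: A_def E_pow_simps) (metis R.r_one)
    have eq: "carrier ?E = generate (add_monoid ?E) A"
      using generate_closed[OF E, of A] generate.incl[of _ A "add_monoid ?E"] unfolding A by blast
    have sub: "{Alg \<one>\<^bsub>KLR D (replicate_mset n i)\<^esub> :: ('i, 'k, 'a) kelt} \<subseteq> carrier ?E"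
      by (simp add: E_pow_simps)
    show ?thesis
      unfolding finitely_generated_def
    proof (intro exI conjI)
      show "carrier ?E = generate (add_monoid ?E) {a \<odot>\<^bsub>?E\<^esub> s |a s.
          a \<in> carrier (KLR D (replicate_mset n i)) \<and> s \<in> {Alg \<one>\<^bsub>KLR D (replicate_mset n i)\<^esub> :: ('i, 'k, 'a) kelt}}"
        using eq unfolding A_def .
    qed (use sub in simp_all)
  qed
  show "graded_by ?E (grade ?E)"
  proof (rule graded_groupI[where p = "\<lambda>d (x :: ('i, 'k, 'a) kelt). Alg (graded_comp (KLR D (replicate_mset n i)) (\<lambda>d. {a. klr_homogeneous D (replicate_mset n i) d a}) (unAlg x) d)", OF E])
    show "subgroup (grade ?E d) (add_monoid ?E)" for d
      unfolding E_pow_simps(5) by (rule subgroup_image[OF G.is_abelian E Alg_add_hom G.G_subgroup])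
    show "add_hom ?E ?E (\<lambda>x. Alg (graded_comp (KLR D (replicate_mset n i)) (\<lambda>d. {a. klr_homogeneous D (replicate_mset n i) d a}) (unAlg x) d))" for d
      by (rule add_hom_comp[OF add_hom_comp[OF unAlg_add_hom G.comp_add_hom] Alg_add_hom])
    show "Alg (graded_comp (KLR D (replicate_mset n i)) (\<lambda>d. {a. klr_homogeneous D (replicate_mset n i) d a}) (unAlg x) d) =
        (if d = e then x else \<zero>\<^bsub>?E\<^esub>)" if "x \<in> grade ?E e" for d e x
      using that G.comp_homogeneous[of _ e d] by (auto simp: E_pow_simps)
    show "carrier ?E \<subseteq> generate (add_monoid ?E) (\<Union>d. grade ?E d)"
    proof
      fix x assume "x \<in> carrier ?E"
      then obtain y where y: "y \<in> carrier (KLR D (replicate_mset n i))" "x = Alg y" by (auto simp: E_pow_simps)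
      have sub: "(\<Union>d. grade ?E d) \<subseteq> carrier ?E"
        by (auto simp: E_pow_simps intro!: imageI intro: klr_homogeneous_carrier)
      show "x \<in> generate (add_monoid ?E) (\<Union>d. grade ?E d)"
        unfolding y(2)
        by (rule G.in_subgroup_on_homogeneous[OF E Alg_add_hom generate_subgroup[OF E sub] _ y(1)])
          (auto simp: E_pow_simps intro!: generate.incl)
    qed
  qed
  fix d e a x assume "klr_homogeneous D (replicate_mset n i) d a" "x \<in> grade ?E e"
  then show "a \<odot>\<^bsub>?E\<^esub> x \<in> grade ?E (d + e)"
    by (auto simp: E_pow_simps intro: klr_homogeneous.hom_mult)
qed

lemma zero_module_simps:
  "carrier zero_module = {Tens []}" "zero zero_module = Tens []" "add zero_module = (\<lambda>x y. Tens [])"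
  "smult zero_module = (\<lambda>h x. Tens [])" "grade zero_module = (\<lambda>d. {Tens []})"
  by (simp_all add: zero_module_def)

lemma zero_module_left_module: "ring R \<Longrightarrow> left_module R zero_module"
  by (intro left_module.intro left_module_axioms.intro abelian_groupI) (auto simp: zero_module_simps)

lemma zero_module_fg_graded_module:
  fixes D :: "('i, 'k::{comm_ring,comm_monoid_mult}) klr_datum"
  shows "fg_graded_module D \<gamma> (zero_module :: ('i, 'k, 'a) kmod)"
  unfolding fg_graded_module_def
proof (intro conjI allI impI zero_module_left_module ring_KLR)
  let ?Z = "zero_module :: ('i, 'k, 'a) kmod"
  note Z = left_module_abelian_group[OF zero_module_left_module[OF ring_KLR[of D \<gamma>]]]
  show "finitely_generated (KLR D \<gamma>) ?Z"
    unfolding finitely_generated_def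
    using generate.one[of "add_monoid ?Z"] generate_closed[OF Z, of "{}"]
    by (intro exI[of _ "{}"]) (auto simp: zero_module_simps)
  show "graded_by ?Z (grade ?Z)"
  proof (rule graded_groupI[where p = "\<lambda>d (x :: ('i, 'k, 'a) kelt). x", OF Z])
    have sg: "subgroup (carrier ?Z) (add_monoid ?Z)"
      using group.subgroup_self[OF abelian_group.a_group[OF Z]] by simp
    show "subgroup (grade ?Z d) (add_monoid ?Z)" for d
      using sg by (simp add: zero_module_simps)
    show "carrier ?Z \<subseteq> generate (add_monoid ?Z) (\<Union>d. grade ?Z d)"
      using generate.one[of "add_monoid ?Z"] by (auto simp: zero_module_simps)
  qed (auto simp: zero_module_simps add_hom_id)
qed (auto simp: zero_module_simps)

text \<open>For z = 1 the condition says that \<open>1_{\<delta>,\<beta>}\<close> fixes the values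
  of s, which therefore lie where \<open>z \<mapsto> 1_\<delta> \<diamondop> z\<close> is a unital
  action.\<close>

definition semilinear :: "('i, 'k::{comm_ring,comm_monoid_mult}) klr_datum \<Rightarrow> 'i multiset \<Rightarrow> 'i multiset
    \<Rightarrow> ('i, 'k, 'a) kmod \<Rightarrow> ('i, 'k, 'a) kmod \<Rightarrow> (('i, 'k, 'a) kelt \<Rightarrow> ('i, 'k, 'a) kelt) \<Rightarrow> bool" where
  "semilinear D \<delta> \<beta> M N s \<longleftrightarrow> add_hom M N s \<and>
     (\<forall>z\<in>carrier (KLR D \<beta>). \<forall>m\<in>carrier M. s (z \<odot>\<^bsub>M\<^esub> m) = diamond D \<delta> \<beta> \<one>\<^bsub>KLR D \<delta>\<^esub> z \<odot>\<^bsub>N\<^esub> s m)"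

text \<open>Neither a grading nor finite generation is demanded, so that the class of test modules
  is stable under the restriction \<open>res_module\<close>.\<close>

definition killed_module :: "('i, 'k::{comm_ring,comm_monoid_mult}) klr_datum \<Rightarrow> 'i \<Rightarrow> 'i multiset \<Rightarrow> ('i, 'k, 'a) kmod \<Rightarrow> bool" where
  "killed_module D i \<gamma> N \<longleftrightarrow> left_module (KLR D \<gamma>) N \<and> (\<forall>y\<in>carrier N. klr_idem_at D i \<gamma> \<odot>\<^bsub>N\<^esub> y = \<zero>\<^bsub>N\<^esub>)"

text \<open>\<open>X\<close> represents the functor taking a module \<open>N\<close> killed by \<open>1\<^sub>\<beta>\<^sub>-\<^sub>i\<^sub>,\<^sub>i\<close> to the maps from \<open>M\<close> to \<open>N\<close>
  that are linear along \<open>z \<mapsto> 1\<^sub>\<delta> \<diamondop> z\<close>. Both \<open>ad\<^sup>n\<close> and \<open>\<pi>\<^sub>i(E\<^sub>i\<^sup>n -)\<close> have this property for \<open>\<delta> = ni\<close>.\<close>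

definition universal :: "('i, 'k::{comm_ring,comm_monoid_mult}) klr_datum \<Rightarrow> 'i \<Rightarrow> 'i multiset \<Rightarrow> 'i multiset
    \<Rightarrow> ('i, 'k, 'a) kmod \<Rightarrow> ('i, 'k, 'a) kmod \<Rightarrow> (('i, 'k, 'a) kelt \<Rightarrow> ('i, 'k, 'a) kelt) \<Rightarrow> bool" where
  "universal D i \<delta> \<beta> X M g \<longleftrightarrow>
     killed_module D i (\<delta> + \<beta>) X \<and> semilinear D \<delta> \<beta> M X g \<and>
     (\<forall>x\<in>carrier X. x \<in> generate (add_monoid X) {a \<odot>\<^bsub>X\<^esub> y |a y. a \<in> carrier (KLR D (\<delta> + \<beta>)) \<and> y \<in> g ` carrier M}) \<and>
     (\<forall>N s. killed_module D i (\<delta> + \<beta>) N \<longrightarrow> semilinear D \<delta> \<beta> M N s \<longrightarrow>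
        (\<exists>f. lin_map (KLR D (\<delta> + \<beta>)) X N f \<and> (\<forall>m\<in>carrier M. f (g m) = s m))) \<and>
     (\<forall>d. \<forall>m\<in>grade M d. g m \<in> grade X d) \<and>
     (\<forall>d. \<forall>x\<in>grade X d. x \<in> generate (add_monoid X)
        {a \<odot>\<^bsub>X\<^esub> g m |a m. \<exists>p q. p + q = d \<and> klr_homogeneous D (\<delta> + \<beta>) p a \<and> m \<in> grade M q})"

lemma semilinear_closed: "semilinear D \<delta> \<beta> M N s \<Longrightarrow> m \<in> carrier M \<Longrightarrow> s m \<in> carrier N"
  by (simp add: semilinear_def add_hom_def)

locale piE_module =
  fixes D :: "('i, 'k::{comm_ring,comm_monoid_mult}) klr_datum" and i :: 'i and n :: nat and \<beta> :: "'i multiset"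
    and M :: "('i, 'k, 'a) kmod"
  assumes D: "is_klr_datum D" and gM: "fg_graded_module D \<beta> M"
begin

abbreviation \<delta> :: "'i multiset" where "\<delta> \<equiv> replicate_mset n i"
abbreviation En :: "('i, 'k, 'a) kmod" where "En \<equiv> E_pow D i n"

sublocale T: graded_tens_prod D \<delta> \<beta> En M
  by (intro graded_tens_prod.intro graded_tens_prod_axioms.intro tens_prod.intro E_pow_left_module fg_graded_moduleD(1)[OF gM]
      D E_pow_fg_graded_module gM)

sublocale X: graded_pi D i "\<delta> + \<beta>" T.P
  by (intro graded_pi.intro graded_pi_axioms.intro pi_module.intro T.P_left_module D T.P_fg_graded_module)

abbreviation oneE :: "('i, 'k, 'a) kelt" where "oneE \<equiv> Alg \<one>\<^bsub>KLR D \<delta>\<^esub>"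

definition gen :: "('i, 'k, 'a) kelt \<Rightarrow> ('i, 'k, 'a) kelt" where
  "gen m = X.pc (T.tri \<one>\<^bsub>T.H\<^esub> oneE m)"

lemma oneE_closed: "oneE \<in> carrier En"
  using ring.ring_simprules(6)[OF ring_KLR] by (auto simp: E_pow_simps)

lemma gen_class: "gen m = X.pc (T.cl [(klr_idem D \<delta> \<beta>, oneE, m)])"
  by (simp add: gen_def T.tri_def T.e_closed)

lemma one_right: "y \<in> carrier (KLR D \<delta>) \<Longrightarrow> y \<odot>\<^bsub>En\<^esub> oneE = Alg y"
  using ring.ring_simprules(6)[OF ring_KLR] monoid.r_one[OF ring.is_monoid[OF ring_KLR]] by (simp add: E_pow_simps)

text \<open>Balancing moves y from the free module into the algebra as
  \<open>y \<diamondop> 1\<close>. So the tensors of 1, 1 and m generate, and the same formula later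
  turns right multiplication by y into the action of \<open>y \<diamondop> 1\<close>.\<close>

lemma tri_gen:
  assumes h: "h \<in> carrier T.H" and y: "y \<in> carrier (KLR D \<delta>)" and m: "m \<in> carrier M"
  shows "T.tri h (Alg y) m = (h \<otimes>\<^bsub>T.H\<^esub> diamond D \<delta> \<beta> y \<one>\<^bsub>KLR D \<beta>\<^esub>) \<odot>\<^bsub>T.P\<^esub> T.tri \<one>\<^bsub>T.H\<^esub> oneE m"
proof -
  note o = ring.ring_simprules(6)[OF ring_KLR]
  have d: "diamond D \<delta> \<beta> y \<one>\<^bsub>KLR D \<beta>\<^esub> \<in> carrier T.H" by (rule T.diamond_closed'[OF y o])
  have "T.tri h (Alg y) m = T.tri (h \<otimes>\<^bsub>T.H\<^esub> diamond D \<delta> \<beta> y \<one>\<^bsub>KLR D \<beta>\<^esub>) oneE m"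
    using T.tri_balance[OF h oneE_closed m y o] left_module.lm_one[OF T.lmN m] by (simp add: one_right[OF y])
  also have "\<dots> = (h \<otimes>\<^bsub>T.H\<^esub> diamond D \<delta> \<beta> y \<one>\<^bsub>KLR D \<beta>\<^esub>) \<odot>\<^bsub>T.P\<^esub> T.tri \<one>\<^bsub>T.H\<^esub> oneE m"
    using T.tri_smult[OF _ T.H.one_closed oneE_closed m, of "h \<otimes>\<^bsub>T.H\<^esub> diamond D \<delta> \<beta> y \<one>\<^bsub>KLR D \<beta>\<^esub>"] h d by simp
  finally show ?thesis .
qed

lemma tri_one_closed: "m \<in> carrier M \<Longrightarrow> T.tri \<one>\<^bsub>T.H\<^esub> oneE m \<in> carrier T.P"
  by (rule T.tri_closed[OF T.H.one_closed oneE_closed])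

lemma pc_tri:
  assumes h: "h \<in> carrier T.H" and y: "y \<in> carrier (KLR D \<delta>)" and m: "m \<in> carrier M"
  shows "X.pc (T.tri h (Alg y) m) = (h \<otimes>\<^bsub>T.H\<^esub> diamond D \<delta> \<beta> y \<one>\<^bsub>KLR D \<beta>\<^esub>) \<odot>\<^bsub>X.Q\<^esub> gen m"
  unfolding tri_gen[OF assms] gen_def
  by (rule X.pc_smult[OF _ tri_one_closed[OF m]])
    (use h T.diamond_closed'[OF y ring.ring_simprules(6)[OF ring_KLR]] in simp)

lemma gen_semilinear: "semilinear D \<delta> \<beta> M X.Q gen"
  unfolding semilinear_def
proof (intro conjI ballI)
  show "add_hom M X.Q gen"
    unfolding gen_def
    by (rule add_hom_comp[OF T.tri_add_hom3[OF T.H.one_closed oneE_closed] lin_map_add_hom[OF X.pc_lin_map]])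
  fix z m assume z: "z \<in> carrier (KLR D \<beta>)" and m: "m \<in> carrier M"
  note o = ring.ring_simprules(6)[OF ring_KLR]
  have d: "diamond D \<delta> \<beta> \<one>\<^bsub>KLR D \<delta>\<^esub> z \<in> carrier T.H" by (rule T.diamond_closed'[OF o z])
  have "T.tri \<one>\<^bsub>T.H\<^esub> oneE (z \<odot>\<^bsub>M\<^esub> m) = T.tri (\<one>\<^bsub>T.H\<^esub> \<otimes>\<^bsub>T.H\<^esub> diamond D \<delta> \<beta> \<one>\<^bsub>KLR D \<delta>\<^esub> z) oneE m"
    using T.tri_balance[OF T.H.one_closed oneE_closed m o z] by (simp only: one_right[OF o])
  also have "\<dots> = diamond D \<delta> \<beta> \<one>\<^bsub>KLR D \<delta>\<^esub> z \<odot>\<^bsub>T.P\<^esub> T.tri \<one>\<^bsub>T.H\<^esub> oneE m"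
    using T.tri_smult[OF d T.H.one_closed oneE_closed m] d by simp
  finally show "gen (z \<odot>\<^bsub>M\<^esub> m) = diamond D \<delta> \<beta> \<one>\<^bsub>KLR D \<delta>\<^esub> z \<odot>\<^bsub>X.Q\<^esub> gen m"
    unfolding gen_def by (simp only: X.pc_smult[OF d tri_one_closed[OF m]])
qed

lemma gen_span:
  assumes q: "q \<in> carrier X.Q"
  shows "q \<in> generate (add_monoid X.Q) {a \<odot>\<^bsub>X.Q\<^esub> y |a y. a \<in> carrier T.H \<and> y \<in> gen ` carrier M}"
proof (rule X.generate_pc[OF T.tris_carrier _ _ _ q])
  show "carrier T.P = generate (add_monoid T.P) T.tris"
    using T.P_generate generate_closed[OF T.P_abelian_group T.tris_carrier] by blast
  show "{a \<odot>\<^bsub>X.Q\<^esub> y |a y. a \<in> carrier T.H \<and> y \<in> gen ` carrier M} \<subseteq> carrier X.Q"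
    using left_module.lm_closed[OF X.Q_left_module] semilinear_closed[OF gen_semilinear] by blast
  fix x assume "x \<in> T.tris"
  then obtain h y m where "x = T.tri h (Alg y) m" and c: "h \<in> carrier T.H" "y \<in> carrier (KLR D \<delta>)" "m \<in> carrier M"
    by (auto simp: T.tris_def E_pow_simps)
  then have "X.pc x = (h \<otimes>\<^bsub>T.H\<^esub> diamond D \<delta> \<beta> y \<one>\<^bsub>KLR D \<beta>\<^esub>) \<odot>\<^bsub>X.Q\<^esub> gen m" by (simp add: pc_tri)
  moreover have "h \<otimes>\<^bsub>T.H\<^esub> diamond D \<delta> \<beta> y \<one>\<^bsub>KLR D \<beta>\<^esub> \<in> carrier T.H"
    using c T.diamond_closed'[OF c(2) ring.ring_simprules(6)[OF ring_KLR]] by simp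
  ultimately show "X.pc x \<in> {a \<odot>\<^bsub>X.Q\<^esub> y |a y. a \<in> carrier T.H \<and> y \<in> gen ` carrier M}" using c by blast
qed

text \<open>A lift of s is forced to send the tensor of h, x and m to
  \<open>h (x \<diamondop> 1) s(m)\<close>. This is balanced because \<open>(y \<diamondop> z) (x
  \<diamondop> 1) = (y x \<diamondop> 1) (1 \<diamondop> z)\<close> and s is semilinear; it descends
  to the quotient because N is killed.\<close>

lemma gen_lift:
  assumes N: "killed_module D i (\<delta> + \<beta>) N" and s: "semilinear D \<delta> \<beta> M N s"
  shows "\<exists>f. lin_map T.H X.Q N f \<and> (\<forall>m\<in>carrier M. f (gen m) = s m)"
proof -
  have lmN: "left_module T.H N" and kN: "\<And>y. y \<in> carrier N \<Longrightarrow> klr_idem_at D i (\<delta> + \<beta>) \<odot>\<^bsub>N\<^esub> y = \<zero>\<^bsub>N\<^esub>"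
    using N by (auto simp: killed_module_def)
  note NG = left_module_abelian_group[OF lmN]
  note o = ring.ring_simprules(6)[OF ring_KLR]
  have sh: "add_hom M N s" and sz: "\<And>z m. z \<in> carrier (KLR D \<beta>) \<Longrightarrow> m \<in> carrier M \<Longrightarrow> s (z \<odot>\<^bsub>M\<^esub> m) = diamond D \<delta> \<beta> \<one>\<^bsub>KLR D \<delta>\<^esub> z \<odot>\<^bsub>N\<^esub> s m"
    using s by (auto simp: semilinear_def)
  define b where "b h x m = h \<odot>\<^bsub>N\<^esub> (diamond D \<delta> \<beta> (unAlg x) \<one>\<^bsub>KLR D \<beta>\<^esub> \<odot>\<^bsub>N\<^esub> s m)" for h m and x :: "('i, 'k, 'a) kelt"
  have uc: "unAlg x \<in> carrier (KLR D \<delta>)" if "x \<in> carrier En" for x using that by (auto simp: E_pow_simps)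
  have dc: "diamond D \<delta> \<beta> (unAlg x) \<one>\<^bsub>KLR D \<beta>\<^esub> \<in> carrier T.H" if "x \<in> carrier En" for x
    by (rule T.diamond_closed'[OF uc[OF that] o])
  have sc: "s m \<in> carrier N" if "m \<in> carrier M" for m by (rule add_hom_closed[OF sh that])
  note lmc = left_module.lm_closed[OF lmN]
  have bal: "T.balanced N b"
    unfolding T.balanced_def
  proof (intro conjI ballI)
    show "add_hom T.H N (\<lambda>h. b h x m)" if "x \<in> carrier En" "m \<in> carrier M" for x m
      unfolding b_def by (rule smult_left_add_hom[OF lmN lmc[OF dc[OF that(1)] sc[OF that(2)]]])
    show "add_hom En N (\<lambda>x. b h x m)" if "h \<in> carrier T.H" "m \<in> carrier M" for h m
    proof -
      have "add_hom (KLR D \<delta>) T.H (\<lambda>y. diamond D \<delta> \<beta> y \<one>\<^bsub>KLR D \<beta>\<^esub>)"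
        by (intro add_homI T.diamond_closed' diamond_add_left o)
      then show ?thesis
        unfolding b_def
        by (intro add_hom_comp[OF add_hom_comp[OF add_hom_comp[OF unAlg_add_hom] smult_left_add_hom[OF lmN sc[OF that(2)]]] smult_add_hom[OF lmN that(1)]])
    qed
    show "add_hom M N (\<lambda>m. b h x m)" if "h \<in> carrier T.H" "x \<in> carrier En" for h x
      unfolding b_def
      by (rule add_hom_comp[OF add_hom_comp[OF sh smult_add_hom[OF lmN dc[OF that(2)]]] smult_add_hom[OF lmN that(1)]])
    fix h x m y z assume c: "h \<in> carrier T.H" "x \<in> carrier En" "m \<in> carrier M" "y \<in> carrier (KLR D \<delta>)" "z \<in> carrier (KLR D \<beta>)"
    note d = T.diamond_closed'[OF c(4,5)] T.diamond_closed'[OF o c(5)] dc[OF c(2)]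
    have "b (h \<otimes>\<^bsub>T.H\<^esub> diamond D \<delta> \<beta> y z) x m = h \<odot>\<^bsub>N\<^esub> ((diamond D \<delta> \<beta> y z \<otimes>\<^bsub>T.H\<^esub> diamond D \<delta> \<beta> (unAlg x) \<one>\<^bsub>KLR D \<beta>\<^esub>) \<odot>\<^bsub>N\<^esub> s m)"
      unfolding b_def using c d sc[OF c(3)] lmc by (simp add: left_module.lm_assoc[OF lmN])
    also have "diamond D \<delta> \<beta> y z \<otimes>\<^bsub>T.H\<^esub> diamond D \<delta> \<beta> (unAlg x) \<one>\<^bsub>KLR D \<beta>\<^esub> = diamond D \<delta> \<beta> (y \<otimes>\<^bsub>KLR D \<delta>\<^esub> unAlg x) z"
      using diamond_mult[OF c(4) uc[OF c(2)] c(5) o] monoid.r_one[OF ring.is_monoid[OF ring_KLR] c(5)] by simp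
    also have "\<dots> = diamond D \<delta> \<beta> (y \<otimes>\<^bsub>KLR D \<delta>\<^esub> unAlg x) \<one>\<^bsub>KLR D \<beta>\<^esub> \<otimes>\<^bsub>T.H\<^esub> diamond D \<delta> \<beta> \<one>\<^bsub>KLR D \<delta>\<^esub> z"
      by (rule diamond_split(1)[OF ring.ring_simprules(5)[OF ring_KLR c(4) uc[OF c(2)]] c(5)])
    also have "h \<odot>\<^bsub>N\<^esub> (\<dots> \<odot>\<^bsub>N\<^esub> s m) = b h (y \<odot>\<^bsub>En\<^esub> x) (z \<odot>\<^bsub>M\<^esub> m)"
      unfolding b_def sz[OF c(5,3)]
      using left_module.lm_assoc[OF lmN T.diamond_closed'[OF ring.ring_simprules(5)[OF ring_KLR c(4) uc[OF c(2)]] o] d(2) sc[OF c(3)]]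
      by (simp add: E_pow_simps)
    finally show "b (h \<otimes>\<^bsub>T.H\<^esub> diamond D \<delta> \<beta> y z) x m = b h (y \<odot>\<^bsub>En\<^esub> x) (z \<odot>\<^bsub>M\<^esub> m)" .
  qed
  define f where "f = T.lift N b"
  have fa: "add_hom T.P N f" unfolding f_def by (rule T.lift_add_hom[OF NG bal])
  have ft: "f (T.tri h x m) = b h x m" if "h \<in> carrier T.H" "x \<in> carrier En" "m \<in> carrier M" for h x m
    unfolding f_def by (rule T.lift_tri[OF NG bal that])
  have fl: "lin_map T.H T.P N f"
    unfolding lin_map_def
  proof (intro conjI ballI fa)
    fix a x assume a: "a \<in> carrier T.H" and x: "x \<in> carrier T.P"
    show "f (a \<odot>\<^bsub>T.P\<^esub> x) = a \<odot>\<^bsub>N\<^esub> f x"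
    proof (rule T.add_hom_eq_on_tri[OF NG add_hom_comp[OF smult_add_hom[OF T.P_left_module a] fa] add_hom_comp[OF fa smult_add_hom[OF lmN a]] _ x])
      fix h y m assume c: "h \<in> carrier T.H" "y \<in> carrier En" "m \<in> carrier M"
      then show "f (a \<odot>\<^bsub>T.P\<^esub> T.tri h y m) = a \<odot>\<^bsub>N\<^esub> f (T.tri h y m)"
        using a dc[OF c(2)] sc[OF c(3)] lmc by (simp add: T.tri_smult ft b_def left_module.lm_assoc[OF lmN])
    qed
  qed
  have "f (gen m) = s m" if m: "m \<in> carrier M" for m
  proof -
    have "f (gen m) = b \<one>\<^bsub>T.H\<^esub> oneE m"
      using X.descend(2)[OF lmN fl kN tri_one_closed[OF m]] ft[OF T.H.one_closed oneE_closed m] by (simp only: gen_def)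
    also have "\<dots> = diamond D \<delta> \<beta> \<one>\<^bsub>KLR D \<delta>\<^esub> \<one>\<^bsub>KLR D \<beta>\<^esub> \<odot>\<^bsub>N\<^esub> s m"
      unfolding b_def using left_module.lm_one[OF lmN lmc[OF T.diamond_closed'[OF o o] sc[OF m]]] by simp
    \<comment> \<open>\<open>1 \<diamondop> 1\<close> is the idempotent, which fixes
      \<open>s m\<close> by semilinearity at z = 1.\<close>
    also have "\<dots> = s m"
      using sz[OF o m] left_module.lm_one[OF T.lmN m] by simp
    finally show ?thesis .
  qed
  then show ?thesis using X.descend(1)[OF lmN fl kN] by blast
qed

lemma gen_homogeneous: "m \<in> grade M d \<Longrightarrow> gen m \<in> grade X.Q d"
proof -
  assume m: "m \<in> grade M d"
  have "oneE \<in> grade En 0" by (simp add: E_pow_simps klr_homogeneous_one)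
  then have "T.tri \<one>\<^bsub>T.H\<^esub> oneE m \<in> T.htri (0 + 0 + d)"
    unfolding T.htri_def using klr_homogeneous_one m by blast
  then show ?thesis unfolding gen_def X.Q_simps(5) using T.htri_grade by simp
qed

lemma gen_homogeneous_span:
  assumes q: "q \<in> grade X.Q d"
  shows "q \<in> generate (add_monoid X.Q) {a \<odot>\<^bsub>X.Q\<^esub> gen m |a m. \<exists>p r. p + r = d \<and> klr_homogeneous D (\<delta> + \<beta>) p a \<and> m \<in> grade M r}"
    (is "_ \<in> generate _ ?G")
proof -
  from q obtain x where x: "x \<in> grade T.P d" "q = X.pc x" by (auto simp: X.Q_simps(5))
  note QG = left_module_abelian_group[OF X.Q_left_module]
  have G: "?G \<subseteq> carrier X.Q"
  proof
    fix x assume "x \<in> ?G"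
    then obtain a m p r where x: "x = a \<odot>\<^bsub>X.Q\<^esub> gen m" and a: "klr_homogeneous D (\<delta> + \<beta>) p a" and m: "m \<in> grade M r" by blast
    show "x \<in> carrier X.Q"
      unfolding x
      by (rule left_module.lm_closed[OF X.Q_left_module klr_homogeneous_carrier[OF a] semilinear_closed[OF gen_semilinear T.GN.G_carrier[OF m]]])
  qed
  show ?thesis
    unfolding x(2)
  proof (rule add_hom_generate_in_subgroup[OF T.P_abelian_group QG lin_map_add_hom[OF X.pc_lin_map] generate_subgroup[OF QG G]
        T.htri_carrier _ T.grade_generate[OF x(1)]])
    fix t assume "t \<in> T.htri d"
    then obtain h y m a b c where t: "t = T.tri h (Alg y) m" and abc: "a + b + c = d"
      and h: "klr_homogeneous D (\<delta> + \<beta>) a h" "klr_homogeneous D \<delta> b y" "m \<in> grade M c"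
      by (auto simp: T.htri_def E_pow_simps)
    have "X.pc t = (h \<otimes>\<^bsub>T.H\<^esub> diamond D \<delta> \<beta> y \<one>\<^bsub>KLR D \<beta>\<^esub>) \<odot>\<^bsub>X.Q\<^esub> gen m"
      unfolding t by (rule pc_tri[OF klr_homogeneous_carrier[OF h(1)] klr_homogeneous_carrier[OF h(2)] T.GN.G_carrier[OF h(3)]])
    moreover have "klr_homogeneous D (\<delta> + \<beta>) (a + b) (h \<otimes>\<^bsub>T.H\<^esub> diamond D \<delta> \<beta> y \<one>\<^bsub>KLR D \<beta>\<^esub>)"
      by (rule klr_homogeneous.hom_mult[OF h(1) diamond_left_homogeneous[OF h(2)]])
    ultimately have "X.pc t \<in> ?G" using h(3) abc by blast
    then show "X.pc t \<in> generate (add_monoid X.Q) ?G" by (rule generate.incl)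
  qed
qed

lemma piE_universal: "universal D i \<delta> \<beta> X.Q M gen"
  unfolding universal_def
proof (intro conjI allI ballI impI)
  show "killed_module D i (\<delta> + \<beta>) X.Q"
    unfolding killed_module_def using X.Q_left_module X.Q_killed by simp
qed (fact gen_semilinear, erule gen_span, erule (1) gen_lift, erule gen_homogeneous, erule gen_homogeneous_span)

end

section \<open>Maps between modules with the universal property\<close>

lemma universalD:
  assumes "universal D i \<delta> \<beta> X M g"
  shows "killed_module D i (\<delta> + \<beta>) X" "left_module (KLR D (\<delta> + \<beta>)) X" "semilinear D \<delta> \<beta> M X g"
    "\<And>x. x \<in> carrier X \<Longrightarrow> x \<in> generate (add_monoid X) {a \<odot>\<^bsub>X\<^esub> y |a y. a \<in> carrier (KLR D (\<delta> + \<beta>)) \<and> y \<in> g ` carrier M}"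
    "\<And>N s. killed_module D i (\<delta> + \<beta>) N \<Longrightarrow> semilinear D \<delta> \<beta> M N s \<Longrightarrow>
        \<exists>f. lin_map (KLR D (\<delta> + \<beta>)) X N f \<and> (\<forall>m\<in>carrier M. f (g m) = s m)"
    "\<And>d m. m \<in> grade M d \<Longrightarrow> g m \<in> grade X d"
    "\<And>d x. x \<in> grade X d \<Longrightarrow> x \<in> generate (add_monoid X)
        {a \<odot>\<^bsub>X\<^esub> g m |a m. \<exists>p q. p + q = d \<and> klr_homogeneous D (\<delta> + \<beta>) p a \<and> m \<in> grade M q}"
proof -
  note u = assms[unfolded universal_def]
  show k: "killed_module D i (\<delta> + \<beta>) X" by (rule u[THEN conjunct1])
  then show "left_module (KLR D (\<delta> + \<beta>)) X" by (simp only: killed_module_def)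
  note u = u[THEN conjunct2]
  show "semilinear D \<delta> \<beta> M X g" by (rule u[THEN conjunct1])
  note u = u[THEN conjunct2]
  show "\<And>x. x \<in> carrier X \<Longrightarrow> x \<in> generate (add_monoid X) {a \<odot>\<^bsub>X\<^esub> y |a y. a \<in> carrier (KLR D (\<delta> + \<beta>)) \<and> y \<in> g ` carrier M}"
    by (rule u[THEN conjunct1, THEN bspec])
  note u = u[THEN conjunct2]
  show "\<And>N s. killed_module D i (\<delta> + \<beta>) N \<Longrightarrow> semilinear D \<delta> \<beta> M N s \<Longrightarrow>
      \<exists>f. lin_map (KLR D (\<delta> + \<beta>)) X N f \<and> (\<forall>m\<in>carrier M. f (g m) = s m)"
    by (rule u[THEN conjunct1, THEN spec, THEN spec, THEN mp, THEN mp])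
  note u = u[THEN conjunct2]
  show "\<And>d m. m \<in> grade M d \<Longrightarrow> g m \<in> grade X d"
    by (rule u[THEN conjunct1, THEN spec, THEN bspec])
  show "\<And>d x. x \<in> grade X d \<Longrightarrow> x \<in> generate (add_monoid X)
      {a \<odot>\<^bsub>X\<^esub> g m |a m. \<exists>p q. p + q = d \<and> klr_homogeneous D (\<delta> + \<beta>) p a \<and> m \<in> grade M q}"
    by (rule u[THEN conjunct2, THEN spec, THEN bspec])
qed

lemma universal_eq:
  assumes u: "universal D i \<delta> \<beta> X M g" and N: "left_module (KLR D (\<delta> + \<beta>)) N"
    and f: "lin_map (KLR D (\<delta> + \<beta>)) X N f" "lin_map (KLR D (\<delta> + \<beta>)) X N f'"
    and eq: "\<And>m. m \<in> carrier M \<Longrightarrow> f (g m) = f' (g m)" and x: "x \<in> carrier X"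
  shows "f x = f' x"
proof (rule lin_map_eq_on_span[OF universalD(2)[OF u] N f])
  show "g ` carrier M \<subseteq> carrier X" using semilinear_closed[OF universalD(3)[OF u]] by blast
  show "f y = f' y" if "y \<in> g ` carrier M" for y using that eq by blast
qed (rule universalD(4)[OF u x])

text \<open>The lifting clause ignores degrees. Homogeneity comes from the graded spanning clause:
  elements of degree d are generated by products \<open>a g(m)\<close> of total degree d, and their
  images \<open>a g'(m)\<close> have that degree too.\<close>

lemma universal_map:
  assumes u: "universal D i \<delta> \<beta> X M g" and u': "universal D i \<delta> \<beta> X' M g'"
    and X': "fg_graded_module D (\<delta> + \<beta>) X'" and M: "fg_graded_module D \<beta> M"
  shows "\<exists>f\<in>linear_maps (KLR D (\<delta> + \<beta>)) X X'. (\<forall>d. f ` grade X d \<subseteq> grade X' d) \<and> (\<forall>m\<in>carrier M. f (g m) = g' m)"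
proof -
  from universalD(5)[OF u universalD(1,3)[OF u']] obtain f where
    f: "lin_map (KLR D (\<delta> + \<beta>)) X X' f" and fg: "\<And>m. m \<in> carrier M \<Longrightarrow> f (g m) = g' m" by blast
  note X = universalD(2)[OF u]
  note XG = left_module_abelian_group[OF X]
  interpret X': graded_group X' "grade X'" by (rule fg_graded_moduleD(3)[OF X'])
  interpret M: graded_group M "grade M" by (rule fg_graded_moduleD(3)[OF M])
  note gc = semilinear_closed[OF universalD(3)[OF u]]
  define S where "S d = {a \<odot>\<^bsub>X\<^esub> g m |a m. \<exists>p q. p + q = d \<and> klr_homogeneous D (\<delta> + \<beta>) p a \<and> m \<in> grade M q}" for d
  have SX: "S d \<subseteq> carrier X" for d
    using gc[OF M.G_carrier] left_module.lm_closed[OF X klr_homogeneous_carrier] unfolding S_def by blast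
  have gr: "f x \<in> grade X' d" if "x \<in> grade X d" for x d
  proof (rule add_hom_generate_in_subgroup[OF XG X'.is_abelian lin_map_add_hom[OF f] X'.G_subgroup SX])
    show "x \<in> generate (add_monoid X) (S d)" unfolding S_def by (rule universalD(7)[OF u that])
    fix t assume "t \<in> S d"
    then obtain a m p q where t: "t = a \<odot>\<^bsub>X\<^esub> g m" "p + q = d" "klr_homogeneous D (\<delta> + \<beta>) p a" "m \<in> grade M q"
      unfolding S_def by blast
    have "f t = a \<odot>\<^bsub>X'\<^esub> g' m"
      unfolding t(1) using lin_map_smult[OF f klr_homogeneous_carrier[OF t(3)] gc[OF M.G_carrier[OF t(4)]]] fg[OF M.G_carrier[OF t(4)]] by simp
    then show "f t \<in> grade X' d"
      using fg_graded_moduleD(4)[OF X' t(3) universalD(6)[OF u' t(4)]] t(2) by simp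
  qed
  have GX: "x \<in> carrier X" if "x \<in> grade X d" for x d
    using generate_closed[OF XG SX] universalD(7)[OF u that] unfolding S_def .
  have "(\<lambda>x\<in>carrier X. f x) \<in> linear_maps (KLR D (\<delta> + \<beta>)) X X'"
    by (rule lin_map_restrict[OF X f])
  then show ?thesis
    using gr GX fg gc by (intro bexI[of _ "\<lambda>x\<in>carrier X. f x"]) auto
qed

text \<open>The case n = 0: by \<open>diamond_empty\<close> semilinear maps are linear maps, so M
  represents them through the identity.\<close>

lemma universal_refl:
  assumes k: "killed_module D i \<beta> M" and M: "fg_graded_module D \<beta> M"
  shows "universal D i {#} \<beta> M M (\<lambda>m. m)"
proof -
  have lm: "left_module (KLR D \<beta>) M" using k by (simp add: killed_module_def)
  have sl: "semilinear D {#} \<beta> M N s \<longleftrightarrow> lin_map (KLR D \<beta>) M N s" for N s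
    by (auto simp: semilinear_def lin_map_def diamond_empty)
  have span: "x \<in> generate (add_monoid M) A" if "x \<in> A" for x A
    using that by (rule generate.incl)
  show ?thesis
    unfolding universal_def
  proof (intro conjI allI ballI impI)
    show "killed_module D i ({#} + \<beta>) M" using k by simp
    show "semilinear D {#} \<beta> M M (\<lambda>m. m)" by (simp add: sl lin_map_id)
    show "x \<in> generate (add_monoid M) {a \<odot>\<^bsub>M\<^esub> y |a y. a \<in> carrier (KLR D ({#} + \<beta>)) \<and> y \<in> (\<lambda>m. m) ` carrier M}" if x: "x \<in> carrier M" for x
    proof (rule span)
      show "x \<in> {a \<odot>\<^bsub>M\<^esub> y |a y. a \<in> carrier (KLR D ({#} + \<beta>)) \<and> y \<in> (\<lambda>m. m) ` carrier M}"
        using left_module.lm_one[OF lm x, symmetric] x ring.ring_simprules(6)[OF ring_KLR] by auto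
    qed
    show "\<exists>f. lin_map (KLR D ({#} + \<beta>)) M N f \<and> (\<forall>m\<in>carrier M. f m = s m)" if "semilinear D {#} \<beta> M N s" for N s
      using that by (auto simp: sl)
    show "x \<in> generate (add_monoid M) {a \<odot>\<^bsub>M\<^esub> m |a m. \<exists>p q. p + q = d \<and> klr_homogeneous D ({#} + \<beta>) p a \<and> m \<in> grade M q}"
      if x: "x \<in> grade M d" for d x
    proof (rule span)
      have "x = \<one>\<^bsub>KLR D \<beta>\<^esub> \<odot>\<^bsub>M\<^esub> x"
        using left_module.lm_one[OF lm] graded_group.G_carrier[OF fg_graded_moduleD(3)[OF M] x] by simp
      moreover have "0 + d = d" by simp
      ultimately show "x \<in> {a \<odot>\<^bsub>M\<^esub> m |a m. \<exists>p q. p + q = d \<and> klr_homogeneous D ({#} + \<beta>) p a \<and> m \<in> grade M q}"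
        using klr_homogeneous_one[of D "{#} + \<beta>"] x by fastforce
    qed
  qed
qed

text \<open>This is \<open>1_{i,\<gamma>}N\<close> over \<open>KLR D \<gamma>\<close>. The image of
  an idempotent is its set of fixed points, and since
  \<open>1_{i,\<gamma>} = 1_i \<diamondop> 1\<close> these are the elements on which the unit acts
  as the identity.\<close>

definition res_module :: "('i, 'k::{comm_ring,comm_monoid_mult}) klr_datum \<Rightarrow> 'i \<Rightarrow> 'i multiset \<Rightarrow> ('i, 'k, 'a) kmod \<Rightarrow> ('i, 'k, 'a) kmod" where
  "res_module D i \<gamma> N = N\<lparr>carrier := {y \<in> carrier N. klr_idem D {#i#} \<gamma> \<odot>\<^bsub>N\<^esub> y = y},
     smult := (\<lambda>z y. diamond D {#i#} \<gamma> \<one>\<^bsub>KLR D {#i#}\<^esub> z \<odot>\<^bsub>N\<^esub> y)\<rparr>"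

lemma res_module_killed:
  assumes N: "killed_module D i ({#i#} + \<gamma>) N"
  shows "killed_module D i \<gamma> (res_module D i \<gamma> N)"
proof -
  have lm: "left_module (KLR D ({#i#} + \<gamma>)) N" and k: "\<And>y. y \<in> carrier N \<Longrightarrow> klr_idem_at D i ({#i#} + \<gamma>) \<odot>\<^bsub>N\<^esub> y = \<zero>\<^bsub>N\<^esub>"
    using N by (auto simp: killed_module_def)
  interpret N: abelian_group N by (rule left_module_abelian_group[OF lm])
  note o = ring.ring_simprules(6)[OF ring_KLR]
  let ?e = "klr_idem D {#i#} \<gamma>" and ?\<Phi> = "\<lambda>z. diamond D {#i#} \<gamma> \<one>\<^bsub>KLR D {#i#}\<^esub> z"
  let ?N = "res_module D i \<gamma> N"
  have e: "?e \<in> carrier (KLR D ({#i#} + \<gamma>))" by (rule klr_idem_closed)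
  have \<Phi>: "?\<Phi> z \<in> carrier (KLR D ({#i#} + \<gamma>))" if "z \<in> carrier (KLR D \<gamma>)" for z by (rule diamond_closed[OF o that])
  have simps: "carrier ?N = {y \<in> carrier N. ?e \<odot>\<^bsub>N\<^esub> y = y}" "zero ?N = \<zero>\<^bsub>N\<^esub>" "add ?N = add N"
    "smult ?N = (\<lambda>z y. ?\<Phi> z \<odot>\<^bsub>N\<^esub> y)"
    by (simp_all add: res_module_def)
  note lmN = left_module.lm_closed[OF lm] left_module.lm_l_distr[OF lm] left_module.lm_r_distr[OF lm]
  have "abelian_group ?N"
  proof (rule abelian_groupI)
    fix x assume x: "x \<in> carrier ?N"
    have "?e \<odot>\<^bsub>N\<^esub> (\<ominus>\<^bsub>N\<^esub> x) = \<ominus>\<^bsub>N\<^esub> x"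
      using add_hom_a_inv[OF N.abelian_group_axioms N.abelian_group_axioms smult_add_hom[OF lm e], of x] x by (simp add: simps)
    then show "\<exists>y\<in>carrier ?N. y \<oplus>\<^bsub>?N\<^esub> x = \<zero>\<^bsub>?N\<^esub>"
      using x by (intro bexI[of _ "\<ominus>\<^bsub>N\<^esub> x"]) (auto simp: simps N.l_neg)
  qed (use e in \<open>auto simp: simps N.a_ac lmN smult_zero[OF lm]\<close>)
  moreover have "left_module (KLR D \<gamma>) ?N" if "abelian_group ?N"
  proof (intro left_module.intro left_module_axioms.intro ring_KLR that)
    show "z \<odot>\<^bsub>?N\<^esub> y \<in> carrier ?N" if z: "z \<in> carrier (KLR D \<gamma>)" and y: "y \<in> carrier ?N" for z y
      using left_module.lm_assoc[OF lm e \<Phi>[OF z], of y] klr_idem_diamond(1)[where \<beta> = "{#i#}", OF o z] y lmN(1)[OF \<Phi>[OF z], of y]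
      by (simp add: simps)
    show "(a \<otimes>\<^bsub>KLR D \<gamma>\<^esub> b) \<odot>\<^bsub>?N\<^esub> x = a \<odot>\<^bsub>?N\<^esub> (b \<odot>\<^bsub>?N\<^esub> x)" if "a \<in> carrier (KLR D \<gamma>)" "b \<in> carrier (KLR D \<gamma>)" "x \<in> carrier ?N" for a b x
    proof -
      have "?\<Phi> (a \<otimes>\<^bsub>KLR D \<gamma>\<^esub> b) = ?\<Phi> a \<otimes>\<^bsub>KLR D ({#i#} + \<gamma>)\<^esub> ?\<Phi> b"
        using diamond_mult[where \<beta> = "{#i#}", OF o o that(1,2)] unfolding monoid.l_one[OF ring.is_monoid[OF ring_KLR] o] .
      then show ?thesis
        using left_module.lm_assoc[OF lm \<Phi>[OF that(1)] \<Phi>[OF that(2)], of x] that(3) by (simp add: simps)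
    qed
    show "\<one>\<^bsub>KLR D \<gamma>\<^esub> \<odot>\<^bsub>?N\<^esub> x = x" if "x \<in> carrier ?N" for x
      using that by (simp add: simps klr_idem_def)
    show "(a \<oplus>\<^bsub>KLR D \<gamma>\<^esub> b) \<odot>\<^bsub>?N\<^esub> x = a \<odot>\<^bsub>?N\<^esub> x \<oplus>\<^bsub>?N\<^esub> b \<odot>\<^bsub>?N\<^esub> x" if "a \<in> carrier (KLR D \<gamma>)" "b \<in> carrier (KLR D \<gamma>)" "x \<in> carrier ?N" for a b x
      using diamond_add_right[where \<beta> = "{#i#}", OF o that(1,2)] lmN(2)[OF \<Phi>[OF that(1)] \<Phi>[OF that(2)], of x] that(3) by (simp add: simps)
    show "a \<odot>\<^bsub>?N\<^esub> (x \<oplus>\<^bsub>?N\<^esub> y) = a \<odot>\<^bsub>?N\<^esub> x \<oplus>\<^bsub>?N\<^esub> a \<odot>\<^bsub>?N\<^esub> y" if "a \<in> carrier (KLR D \<gamma>)" "x \<in> carrier ?N" "y \<in> carrier ?N" for a x y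
      using lmN(3)[OF \<Phi>[OF that(1)], of x y] that(2,3) by (simp add: simps)
  qed
  moreover have "klr_idem_at D i \<gamma> \<odot>\<^bsub>?N\<^esub> y = \<zero>\<^bsub>?N\<^esub>" if y: "y \<in> carrier ?N" for y
  proof -
    let ?z = "klr_idem_at D i \<gamma>"
    have yN: "y \<in> carrier N" using y by (simp add: simps)
    \<comment> \<open>By \<open>klr_idem_at_absorb\<close> the idempotent of the larger weight can
      be put in front, and it kills N.\<close>
    have "?\<Phi> ?z \<odot>\<^bsub>N\<^esub> y = (klr_idem_at D i ({#i#} + \<gamma>) \<otimes>\<^bsub>KLR D ({#i#} + \<gamma>)\<^esub> ?\<Phi> ?z) \<odot>\<^bsub>N\<^esub> y"
      by (simp only: klr_idem_at_absorb)
    also have "\<dots> = klr_idem_at D i ({#i#} + \<gamma>) \<odot>\<^bsub>N\<^esub> (?\<Phi> ?z \<odot>\<^bsub>N\<^esub> y)"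
      by (rule left_module.lm_assoc[OF lm klr_idem_at_closed \<Phi>[OF klr_idem_at_closed] yN])
    also have "\<dots> = \<zero>\<^bsub>N\<^esub>" by (rule k[OF lmN(1)[OF \<Phi>[OF klr_idem_at_closed] yN]])
    finally show ?thesis by (simp add: simps)
  qed
  ultimately show ?thesis by (simp add: killed_module_def)
qed

text \<open>The induction step in abstract form. A map is lifted in two stages, from M into the
  restriction of N and from X into N; the degree clauses compose because
  \<open>z \<mapsto> 1_i \<diamondop> z\<close> preserves degrees.\<close>

lemma universal_comp:
  assumes u': "universal D i {#i#} (replicate_mset n i + \<beta>) X' X g'"
    and u: "universal D i (replicate_mset n i) \<beta> X M g"
    and X: "fg_graded_module D (replicate_mset n i + \<beta>) X" and X': "fg_graded_module D ({#i#} + (replicate_mset n i + \<beta>)) X'"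
    and M: "fg_graded_module D \<beta> M"
  shows "universal D i (replicate_mset (Suc n) i) \<beta> X' M (\<lambda>m. g' (g m))"
proof -
  define \<gamma> where "\<gamma> = replicate_mset n i + \<beta>"
  define B where "B = {#i#} + \<gamma>"
  have B: "replicate_mset (Suc n) i + \<beta> = B" by (simp add: B_def \<gamma>_def)
  define \<Phi> where "\<Phi> z = diamond D {#i#} \<gamma> \<one>\<^bsub>KLR D {#i#}\<^esub> z" for z
  define \<Psi> where "\<Psi> z = diamond D (replicate_mset n i) \<beta> \<one>\<^bsub>KLR D (replicate_mset n i)\<^esub> z" for z
  note o = ring.ring_simprules(6)[OF ring_KLR]
  note u' = u'[folded \<gamma>_def] and X = X[folded \<gamma>_def] and X' = X'[folded \<gamma>_def, folded B_def]
  have \<Phi>\<Psi>: "diamond D (replicate_mset (Suc n) i) \<beta> \<one>\<^bsub>KLR D (replicate_mset (Suc n) i)\<^esub> z = \<Phi> (\<Psi> z)"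
    if "z \<in> carrier (KLR D \<beta>)" for z
    unfolding \<Phi>_def \<Psi>_def \<gamma>_def by (rule diamond_assoc[OF that, symmetric])
  have \<Psi>c: "\<Psi> z \<in> carrier (KLR D \<gamma>)" if "z \<in> carrier (KLR D \<beta>)" for z
    unfolding \<Psi>_def \<gamma>_def by (rule diamond_closed[OF o that])
  have \<Phi>c: "\<Phi> z \<in> carrier (KLR D B)" if "z \<in> carrier (KLR D \<gamma>)" for z
    unfolding \<Phi>_def B_def by (rule diamond_closed[OF o that])
  have lmX': "left_module (KLR D B) X'" and lmX: "left_module (KLR D \<gamma>) X" and lmM: "left_module (KLR D \<beta>) M"
    using fg_graded_moduleD(1) X X' M by blast+
  note XG = left_module_abelian_group[OF lmX] and XG' = left_module_abelian_group[OF lmX']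
  have g: "add_hom M X g" and gz: "\<And>z m. z \<in> carrier (KLR D \<beta>) \<Longrightarrow> m \<in> carrier M \<Longrightarrow> g (z \<odot>\<^bsub>M\<^esub> m) = \<Psi> z \<odot>\<^bsub>X\<^esub> g m"
    using universalD(3)[OF u] by (auto simp: semilinear_def \<Psi>_def)
  have g': "add_hom X X' g'" and gz': "\<And>z x. z \<in> carrier (KLR D \<gamma>) \<Longrightarrow> x \<in> carrier X \<Longrightarrow> g' (z \<odot>\<^bsub>X\<^esub> x) = \<Phi> z \<odot>\<^bsub>X'\<^esub> g' x"
    using universalD(3)[OF u'] by (auto simp: semilinear_def \<Phi>_def)
  note gc = add_hom_closed[OF g] and gc' = add_hom_closed[OF g']
  interpret X: graded_group X "grade X" by (rule fg_graded_moduleD(3)[OF X])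
  interpret M: graded_group M "grade M" by (rule fg_graded_moduleD(3)[OF M])
  \<comment> \<open>A scalar applied between the two stages is carried to the front, so that a span
    of a span is again a span of generators.\<close>
  have agbg: "a \<odot>\<^bsub>X'\<^esub> g' (b \<odot>\<^bsub>X\<^esub> g m) = (a \<otimes>\<^bsub>KLR D B\<^esub> \<Phi> b) \<odot>\<^bsub>X'\<^esub> g' (g m)"
    if "a \<in> carrier (KLR D B)" "b \<in> carrier (KLR D \<gamma>)" "m \<in> carrier M" for a b m
    using gz'[OF that(2) gc[OF that(3)]] left_module.lm_assoc[OF lmX' that(1) \<Phi>c[OF that(2)] gc'[OF gc[OF that(3)]]] by simp
  show ?thesis
    unfolding universal_def B
  proof (intro conjI allI ballI impI)
    show "killed_module D i B X'" unfolding B_def by (rule universalD(1)[OF u'])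
    show "semilinear D (replicate_mset (Suc n) i) \<beta> M X' (\<lambda>m. g' (g m))"
      unfolding semilinear_def
    proof (intro conjI ballI add_hom_comp[OF g g'])
      fix z m assume z: "z \<in> carrier (KLR D \<beta>)" and m: "m \<in> carrier M"
      show "g' (g (z \<odot>\<^bsub>M\<^esub> m)) = diamond D (replicate_mset (Suc n) i) \<beta> \<one>\<^bsub>KLR D (replicate_mset (Suc n) i)\<^esub> z \<odot>\<^bsub>X'\<^esub> g' (g m)"
        by (simp only: \<Phi>\<Psi>[OF z] gz[OF z m] gz'[OF \<Psi>c[OF z] gc[OF m]])
    qed
  next
    fix x assume x: "x \<in> carrier X'"
    define S where "S = {a \<odot>\<^bsub>X'\<^esub> y |a y. a \<in> carrier (KLR D B) \<and> y \<in> (\<lambda>m. g' (g m)) ` carrier M}"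
    have S: "S \<subseteq> carrier X'" unfolding S_def using left_module.lm_closed[OF lmX'] gc gc' by blast
    note GS = generate_subgroup[OF XG' S]
    have "x \<in> generate (add_monoid X') S"
    proof (rule add_hom_generate_in_subgroup[OF XG' XG' add_hom_id GS _ _ universalD(4)[OF u' x, folded B_def]])
      show "{a \<odot>\<^bsub>X'\<^esub> y |a y. a \<in> carrier (KLR D B) \<and> y \<in> g' ` carrier X} \<subseteq> carrier X'"
        using left_module.lm_closed[OF lmX'] gc' by blast
      fix t assume "t \<in> {a \<odot>\<^bsub>X'\<^esub> y |a y. a \<in> carrier (KLR D B) \<and> y \<in> g' ` carrier X}"
      then obtain a y where t: "t = a \<odot>\<^bsub>X'\<^esub> g' y" "a \<in> carrier (KLR D B)" "y \<in> carrier X" by blast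
      show "t \<in> generate (add_monoid X') S"
        unfolding t(1)
      proof (rule add_hom_generate_in_subgroup[OF XG XG' add_hom_comp[OF g' smult_add_hom[OF lmX' t(2)]] GS _ _ universalD(4)[OF u t(3), folded \<gamma>_def]])
        show "{a \<odot>\<^bsub>X\<^esub> y |a y. a \<in> carrier (KLR D \<gamma>) \<and> y \<in> g ` carrier M} \<subseteq> carrier X"
          using left_module.lm_closed[OF lmX] gc by blast
        fix s assume "s \<in> {a \<odot>\<^bsub>X\<^esub> y |a y. a \<in> carrier (KLR D \<gamma>) \<and> y \<in> g ` carrier M}"
        then obtain b m where s: "s = b \<odot>\<^bsub>X\<^esub> g m" "b \<in> carrier (KLR D \<gamma>)" "m \<in> carrier M" by blast
        have "a \<otimes>\<^bsub>KLR D B\<^esub> \<Phi> b \<in> carrier (KLR D B)"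
          by (rule ring.ring_simprules(5)[OF ring_KLR t(2) \<Phi>c[OF s(2)]])
        then have "a \<odot>\<^bsub>X'\<^esub> g' s \<in> S" unfolding s(1) agbg[OF t(2) s(2,3)] S_def using s(3) by blast
        then show "a \<odot>\<^bsub>X'\<^esub> g' s \<in> generate (add_monoid X') S" by (rule generate.incl)
      qed
    qed
    then show "x \<in> generate (add_monoid X') {a \<odot>\<^bsub>X'\<^esub> y |a y. a \<in> carrier (KLR D B) \<and> y \<in> (\<lambda>m. g' (g m)) ` carrier M}"
      by (simp only: S_def)
  next
    fix N s assume N: "killed_module D i B N" and s: "semilinear D (replicate_mset (Suc n) i) \<beta> M N s"
    have lmN: "left_module (KLR D B) N" using N by (simp add: killed_module_def)
    let ?R = "res_module D i \<gamma> N"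
    have R: "killed_module D i \<gamma> ?R" by (rule res_module_killed[OF N[unfolded B_def]])
    have sh: "add_hom M N s" and sz: "\<And>z m. z \<in> carrier (KLR D \<beta>) \<Longrightarrow> m \<in> carrier M \<Longrightarrow> s (z \<odot>\<^bsub>M\<^esub> m) = \<Phi> (\<Psi> z) \<odot>\<^bsub>N\<^esub> s m"
      using s by (auto simp: semilinear_def simp flip: \<Phi>\<Psi>)
    have sR: "s m \<in> carrier ?R" if m: "m \<in> carrier M" for m
    proof -
      have sm: "s m \<in> carrier N" by (rule add_hom_closed[OF sh m])
      \<comment> \<open>The unit of \<open>KLR D \<beta>\<close> goes to an element of the form
        \<open>1_i \<diamondop> z\<close>, which absorbs \<open>1_{i,\<gamma>}\<close> on its left;
        so s takes values in the restriction.\<close>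
      have 1: "s m = \<Phi> (\<Psi> \<one>\<^bsub>KLR D \<beta>\<^esub>) \<odot>\<^bsub>N\<^esub> s m"
        using sz[OF o m] left_module.lm_one[OF lmM m] by simp
      have "klr_idem D {#i#} \<gamma> \<odot>\<^bsub>N\<^esub> (\<Phi> (\<Psi> \<one>\<^bsub>KLR D \<beta>\<^esub>) \<odot>\<^bsub>N\<^esub> s m) = \<Phi> (\<Psi> \<one>\<^bsub>KLR D \<beta>\<^esub>) \<odot>\<^bsub>N\<^esub> s m"
        using left_module.lm_assoc[OF lmN klr_idem_closed[of D "{#i#}" \<gamma>, folded B_def] \<Phi>c[OF \<Psi>c[OF o]] sm]
          klr_idem_diamond(1)[where \<beta> = "{#i#}", OF o \<Psi>c[OF o]] by (simp add: \<Phi>_def B_def)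
      then show ?thesis using 1 sm by (simp add: res_module_def)
    qed
    have "semilinear D (replicate_mset n i) \<beta> M ?R s"
      unfolding semilinear_def \<Psi>_def[symmetric] using sh sR sz by (auto simp: add_hom_def res_module_def \<Phi>_def)
    from universalD(5)[OF u R[unfolded \<gamma>_def] this[unfolded \<gamma>_def]] obtain f where
      f: "lin_map (KLR D \<gamma>) X ?R f" and fs: "\<And>m. m \<in> carrier M \<Longrightarrow> f (g m) = s m"
      unfolding \<gamma>_def by blast
    \<comment> \<open>The action on the restriction goes through
      \<open>z \<mapsto> 1_i \<diamondop> z\<close>, so a linear map into it is a semilinear map
      into N.\<close>
    have "semilinear D {#i#} \<gamma> X N f"
      using f by (auto simp: semilinear_def lin_map_def add_hom_def res_module_def)
    from universalD(5)[OF u' N[unfolded B_def] this] obtain f' where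
      f': "lin_map (KLR D B) X' N f'" and fs': "\<And>x. x \<in> carrier X \<Longrightarrow> f' (g' x) = f x"
      unfolding B_def by blast
    show "\<exists>f. lin_map (KLR D B) X' N f \<and> (\<forall>m\<in>carrier M. f (g' (g m)) = s m)"
      using f' fs' fs gc by auto
  next
    show "g' (g m) \<in> grade X' d" if "m \<in> grade M d" for m d
      by (rule universalD(6)[OF u' universalD(6)[OF u that]])
  next
    fix d x assume x: "x \<in> grade X' d"
    define S where "S = {a \<odot>\<^bsub>X'\<^esub> g' (g m) |a m. \<exists>p q. p + q = d \<and> klr_homogeneous D B p a \<and> m \<in> grade M q}"
    have S: "S \<subseteq> carrier X'"
    proof
      fix y assume "y \<in> S"
      then obtain a m p q where y: "y = a \<odot>\<^bsub>X'\<^esub> g' (g m)" and a: "klr_homogeneous D B p a" and m: "m \<in> grade M q"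
        unfolding S_def by blast
      show "y \<in> carrier X'"
        unfolding y by (rule left_module.lm_closed[OF lmX' klr_homogeneous_carrier[OF a] gc'[OF gc[OF M.G_carrier[OF m]]]])
    qed
    note GS = generate_subgroup[OF XG' S]
    have "x \<in> generate (add_monoid X') S"
    proof (rule add_hom_generate_in_subgroup[OF XG' XG' add_hom_id GS _ _ universalD(7)[OF u' x, folded B_def]])
      show "{a \<odot>\<^bsub>X'\<^esub> g' m |a m. \<exists>p q. p + q = d \<and> klr_homogeneous D B p a \<and> m \<in> grade X q} \<subseteq> carrier X'"
        using left_module.lm_closed[OF lmX' klr_homogeneous_carrier] gc'[OF X.G_carrier] by blast
      fix t assume "t \<in> {a \<odot>\<^bsub>X'\<^esub> g' m |a m. \<exists>p q. p + q = d \<and> klr_homogeneous D B p a \<and> m \<in> grade X q}"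
      then obtain a y p q where t: "t = a \<odot>\<^bsub>X'\<^esub> g' y" "p + q = d" and a: "klr_homogeneous D B p a" and y: "y \<in> grade X q" by blast
      note ac = klr_homogeneous_carrier[OF a]
      show "t \<in> generate (add_monoid X') S"
        unfolding t(1)
      proof (rule add_hom_generate_in_subgroup[OF XG XG' add_hom_comp[OF g' smult_add_hom[OF lmX' ac]] GS _ _ universalD(7)[OF u y, folded \<gamma>_def]])
        show "{a \<odot>\<^bsub>X\<^esub> g m |a m. \<exists>p r. p + r = q \<and> klr_homogeneous D \<gamma> p a \<and> m \<in> grade M r} \<subseteq> carrier X"
          using left_module.lm_closed[OF lmX klr_homogeneous_carrier] gc[OF M.G_carrier] by blast
        fix s assume "s \<in> {a \<odot>\<^bsub>X\<^esub> g m |a m. \<exists>p r. p + r = q \<and> klr_homogeneous D \<gamma> p a \<and> m \<in> grade M r}"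
        then obtain b m r k where s: "s = b \<odot>\<^bsub>X\<^esub> g m" "r + k = q" and b: "klr_homogeneous D \<gamma> r b" and m: "m \<in> grade M k" by blast
        have h: "klr_homogeneous D B (p + r) (a \<otimes>\<^bsub>KLR D B\<^esub> \<Phi> b)"
          using klr_homogeneous.hom_mult[OF a diamond_right_homogeneous[OF b, of "{#i#}", folded B_def]] by (simp add: \<Phi>_def)
        have "p + r + k = d" using t(2) s(2) by simp
        then have "a \<odot>\<^bsub>X'\<^esub> g' s \<in> S"
          unfolding s(1) agbg[OF ac klr_homogeneous_carrier[OF b] M.G_carrier[OF m]] S_def using h m by blast
        then show "a \<odot>\<^bsub>X'\<^esub> g' s \<in> generate (add_monoid X') S" by (rule generate.incl)
      qed
    qed
    then show "x \<in> generate (add_monoid X') {a \<odot>\<^bsub>X'\<^esub> g' (g m) |a m. \<exists>p q. p + q = d \<and> klr_homogeneous D B p a \<and> m \<in> grade M q}"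
      by (simp only: S_def)
  qed
qed

section \<open>Comparison of \<open>ad\<^sup>n\<close> and \<open>\<pi>\<^sub>i(E\<^sub>i\<^sup>n -)\<close>\<close>

lemma piE_at: "piE D i n M (replicate_mset n i + \<beta>) =
    pi_mod D i (replicate_mset n i + \<beta>) (ind_prod D (replicate_mset n i) \<beta> (E_pow D i n) (M \<beta>))"
  by (simp add: piE_def pi_obj_def E_prod_def Let_def)

lemma E_prod_at: "E_prod D i n M (replicate_mset n i + \<beta>) = ind_prod D (replicate_mset n i) \<beta> (E_pow D i n) (M \<beta>)"
  by (simp add: E_prod_def Let_def)

lemma E_prod_other: "\<not> replicate_mset n i \<subseteq># \<gamma> \<Longrightarrow> E_prod D i n M \<gamma> = zero_module"
  by (simp add: E_prod_def Let_def)

lemma subseteq_weightE: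
  assumes "replicate_mset n i \<subseteq># \<gamma>" obtains \<beta> where "\<gamma> = replicate_mset n i + \<beta>"
  using assms by (metis subset_mset.add_diff_inverse)

lemma ObjD: "M \<in> Obj D \<Longrightarrow> fg_graded_module D \<beta> (M \<beta>)"
  by (simp add: Obj_def)

lemma Obj_iD: "M \<in> Obj_i D i \<Longrightarrow> M \<in> Obj D"
  by (simp add: Obj_i_def)

lemma Obj_i_killed:
  assumes "M \<in> Obj_i D i"
  shows "killed_module D i \<beta> (M \<beta>)"
proof -
  have "klr_idem_at D i \<beta> \<in> genideal (KLR D \<beta>) {klr_idem_at D i \<beta>}"
    by (rule ring.genideal_self'[OF ring_KLR klr_idem_at_closed])
  then show ?thesis
    using assms fg_graded_moduleD(1)[OF ObjD[OF Obj_iD[OF assms]]] by (auto simp: killed_module_def Obj_i_def)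
qed

lemma piE_moduleI: "is_klr_datum D \<Longrightarrow> M \<in> Obj D \<Longrightarrow> piE_module D \<beta> (M \<beta>)"
  by (simp add: piE_module_def ObjD)

lemma piE_gen_eq:
  assumes "is_klr_datum D" "M \<in> Obj D"
  shows "piE_gen D i n M \<beta> = piE_module.gen D i n \<beta> (M \<beta>)"
  using piE_module.gen_class[OF piE_moduleI[OF assms, of \<beta>], of i n]
  by (simp add: fun_eq_iff piE_gen_def Let_def E_prod_at)

lemma E_prod_fg_graded_module:
  assumes D: "is_klr_datum D" and M: "M \<in> Obj D"
  shows "fg_graded_module D \<gamma> (E_prod D i n M \<gamma>)"
proof (cases "replicate_mset n i \<subseteq># \<gamma>")
  case True
  then obtain \<beta> where \<gamma>: "\<gamma> = replicate_mset n i + \<beta>" by (rule subseteq_weightE)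
  interpret piE_module D i n \<beta> "M \<beta>" by (rule piE_moduleI[OF D M])
  show ?thesis unfolding \<gamma> E_prod_at by (rule T.P_fg_graded_module)
next
  case False
  then show ?thesis using zero_module_fg_graded_module by (simp add: E_prod_other)
qed

lemma graded_pi_E_prod:
  assumes D: "is_klr_datum D" and M: "M \<in> Obj D"
  shows "graded_pi D \<gamma> (E_prod D i n M \<gamma>)"
  using E_prod_fg_graded_module[OF assms] fg_graded_moduleD(1)[OF E_prod_fg_graded_module[OF assms]] D
  by (simp add: graded_pi_def graded_pi_axioms_def pi_module_def)

lemma piE_fg_graded_module:
  assumes D: "is_klr_datum D" and M: "M \<in> Obj D"
  shows "fg_graded_module D \<gamma> (piE D i n M \<gamma>)"
  unfolding piE_def pi_obj_def by (rule graded_pi.Q_fg_graded_module[OF graded_pi_E_prod[OF assms]])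

lemma piE_killed:
  assumes D: "is_klr_datum D" and M: "M \<in> Obj D"
  shows "killed_module D i \<gamma> (piE D i n M \<gamma>)"
  unfolding piE_def pi_obj_def killed_module_def
  using graded_pi_E_prod[OF assms, of \<gamma> i n] pi_module.Q_left_module pi_module.Q_killed
  by (metis graded_pi.axioms(1))

text \<open>The hypothesis is vacuous in weights not of the form ni + \<beta>, so vanishing by
  weight and vanishing because M is zero are covered together.\<close>

lemma E_prod_zero:
  assumes D: "is_klr_datum D" and M: "M \<in> Obj D"
    and z: "\<And>\<beta>. \<gamma> = replicate_mset n i + \<beta> \<Longrightarrow> carrier (M \<beta>) = {\<zero>\<^bsub>M \<beta>\<^esub>}"
  shows "carrier (E_prod D i n M \<gamma>) = {\<zero>\<^bsub>E_prod D i n M \<gamma>\<^esub>}"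
proof (cases "replicate_mset n i \<subseteq># \<gamma>")
  case True
  then obtain \<beta> where \<gamma>: "\<gamma> = replicate_mset n i + \<beta>" by (rule subseteq_weightE)
  interpret piE_module D i n \<beta> "M \<beta>" by (rule piE_moduleI[OF D M])
  have "x = \<zero>\<^bsub>T.P\<^esub>" if x: "x \<in> carrier T.P" for x
  proof (rule T.add_hom_eq_on_tri[OF T.P_abelian_group add_hom_id add_hom_zero_map[OF T.P_abelian_group] _ x])
    fix h y m assume c: "h \<in> carrier T.H" "y \<in> carrier En" "m \<in> carrier (M \<beta>)"
    then have "m = \<zero>\<^bsub>M \<beta>\<^esub>" using z[OF \<gamma>] by simp
    then show "T.tri h y m = \<zero>\<^bsub>T.P\<^esub>"
      using add_hom_zero[OF T.NG.abelian_group_axioms T.P_abelian_group T.tri_add_hom3[OF c(1,2)]] by simp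
  qed
  then show ?thesis unfolding \<gamma> E_prod_at using T.PG.zero_closed by blast
next
  case False
  then show ?thesis by (simp add: E_prod_other zero_module_simps)
qed

lemma piE_zero:
  assumes D: "is_klr_datum D" and M: "M \<in> Obj D"
    and z: "\<And>\<beta>. \<gamma> = replicate_mset n i + \<beta> \<Longrightarrow> carrier (M \<beta>) = {\<zero>\<^bsub>M \<beta>\<^esub>}"
  shows "carrier (piE D i n M \<gamma>) = {\<zero>\<^bsub>piE D i n M \<gamma>\<^esub>}"
  unfolding piE_def pi_obj_def pi_mod_def Let_def using E_prod_zero[OF assms] by simp

text \<open>The nonzero weights lie among those of M shifted by ni, hence are finite in
  number.\<close>

lemma piE_Obj_i:
  assumes D: "is_klr_datum D" and M: "M \<in> Obj D"
  shows "piE D i n M \<in> Obj_i D i"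
proof -
  have "{\<gamma>. carrier (piE D i n M \<gamma>) \<noteq> {\<zero>\<^bsub>piE D i n M \<gamma>\<^esub>}} \<subseteq>
      (\<lambda>\<beta>. replicate_mset n i + \<beta>) ` {\<beta>. carrier (M \<beta>) \<noteq> {\<zero>\<^bsub>M \<beta>\<^esub>}}"
  proof
    fix \<gamma> assume "\<gamma> \<in> {\<gamma>. carrier (piE D i n M \<gamma>) \<noteq> {\<zero>\<^bsub>piE D i n M \<gamma>\<^esub>}}"
    then obtain \<beta> where "\<gamma> = replicate_mset n i + \<beta>" "carrier (M \<beta>) \<noteq> {\<zero>\<^bsub>M \<beta>\<^esub>}"
      using piE_zero[OF D M, of \<gamma> n i] by blast
    then show "\<gamma> \<in> (\<lambda>\<beta>. replicate_mset n i + \<beta>) ` {\<beta>. carrier (M \<beta>) \<noteq> {\<zero>\<^bsub>M \<beta>\<^esub>}}" by blast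
  qed
  moreover have "finite {\<beta>. carrier (M \<beta>) \<noteq> {\<zero>\<^bsub>M \<beta>\<^esub>}}" using M by (simp add: Obj_def)
  ultimately have "finite {\<gamma>. carrier (piE D i n M \<gamma>) \<noteq> {\<zero>\<^bsub>piE D i n M \<gamma>\<^esub>}}"
    using finite_subset finite_imageI by blast
  then have obj: "piE D i n M \<in> Obj D"
    using piE_fg_graded_module[OF D M] by (simp add: Obj_def)
  have "a \<odot>\<^bsub>piE D i n M \<gamma>\<^esub> x = \<zero>\<^bsub>piE D i n M \<gamma>\<^esub>"
    if "a \<in> genideal (KLR D \<gamma>) {klr_idem_at D i \<gamma>}" "x \<in> carrier (piE D i n M \<gamma>)" for \<gamma> a x
  proof -
    have k: "left_module (KLR D \<gamma>) (piE D i n M \<gamma>)"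
      "\<And>y. y \<in> carrier (piE D i n M \<gamma>) \<Longrightarrow> klr_idem_at D i \<gamma> \<odot>\<^bsub>piE D i n M \<gamma>\<^esub> y = \<zero>\<^bsub>piE D i n M \<gamma>\<^esub>"
      using piE_killed[OF D M, of i \<gamma> n] by (simp_all add: killed_module_def)
    show ?thesis by (rule annihilated_by_ideal[OF k(1) klr_idem_at_closed k(2) that])
  qed
  with obj show ?thesis by (simp add: Obj_i_def)
qed

lemma piE_universal:
  assumes D: "is_klr_datum D" and M: "M \<in> Obj D"
  shows "universal D i (replicate_mset n i) \<beta> (piE D i n M (replicate_mset n i + \<beta>)) (M \<beta>) (piE_gen D i n M \<beta>)"
  unfolding piE_gen_eq[OF assms] piE_at by (rule piE_module.piE_universal[OF piE_moduleI[OF assms]])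

lemma ad_Suc: "(ad D i ^^ Suc n) M = piE D i 1 ((ad D i ^^ n) M)"
  by (simp add: ad_def[of D i "(ad D i ^^ n) M"])

lemma ad_Obj_i: "is_klr_datum D \<Longrightarrow> M \<in> Obj_i D i \<Longrightarrow> (ad D i ^^ n) M \<in> Obj_i D i"
proof (induction n)
  case (Suc n)
  then show ?case unfolding ad_Suc by (intro piE_Obj_i Obj_iD)
qed simp

lemma ad_fg_graded_module: "is_klr_datum D \<Longrightarrow> M \<in> Obj_i D i \<Longrightarrow> fg_graded_module D \<gamma> ((ad D i ^^ n) M \<gamma>)"
  using ObjD[OF Obj_iD[OF ad_Obj_i]] .

text \<open>Induction on n from \<open>universal_refl\<close>, applying
  \<open>universal_comp\<close> with \<open>piE_universal\<close> for a single strand.\<close>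

lemma ad_universal:
  assumes D: "is_klr_datum D" and M: "M \<in> Obj_i D i"
  shows "universal D i (replicate_mset n i) \<beta> ((ad D i ^^ n) M (replicate_mset n i + \<beta>)) (M \<beta>) (\<lambda>m. ad_gen D i M \<beta> m n)"
proof (induction n)
  case 0
  then show ?case using universal_refl[OF Obj_i_killed[OF M] ObjD[OF Obj_iD[OF M]]] by simp
next
  case (Suc n)
  note A = ad_Obj_i[OF D M, of n]
  have r: "replicate_mset 1 i = {#i#}" by simp
  have eq: "{#i#} + (replicate_mset n i + \<beta>) = replicate_mset (Suc n) i + \<beta>" by simp
  have X': "fg_graded_module D ({#i#} + (replicate_mset n i + \<beta>)) ((ad D i ^^ Suc n) M ({#i#} + (replicate_mset n i + \<beta>)))"
    by (rule ad_fg_graded_module[OF D M])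
  have u': "universal D i {#i#} (replicate_mset n i + \<beta>) ((ad D i ^^ Suc n) M ({#i#} + (replicate_mset n i + \<beta>)))
      ((ad D i ^^ n) M (replicate_mset n i + \<beta>)) (piE_gen D i 1 ((ad D i ^^ n) M) (replicate_mset n i + \<beta>))"
    using piE_universal[OF D Obj_iD[OF A], of i 1 "replicate_mset n i + \<beta>"] unfolding r ad_Suc .
  from universal_comp[OF u' Suc.IH ad_fg_graded_module[OF D M] X' ObjD[OF Obj_iD[OF M]]]
  show ?case unfolding eq ad_gen.simps .
qed

text \<open>The universal property is silent about weights that do not contain ni. There the iterate
  vanishes, as each application of \<open>ad\<close> takes its component from the weight with one i
  less.\<close>

lemma zero_weight:
  assumes "\<not> replicate_mset n i \<subseteq># \<gamma>" and D: "is_klr_datum D" and M: "M \<in> Obj_i D i"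
  shows "carrier ((ad D i ^^ n) M \<gamma>) = {\<zero>\<^bsub>(ad D i ^^ n) M \<gamma>\<^esub>}"
  using assms(1)
proof (induction n arbitrary: \<gamma>)
  case 0
  then show ?case by simp
next
  case (Suc n)
  have "carrier (piE D i 1 ((ad D i ^^ n) M) \<gamma>) = {\<zero>\<^bsub>piE D i 1 ((ad D i ^^ n) M) \<gamma>\<^esub>}"
  proof (rule piE_zero[OF D Obj_iD[OF ad_Obj_i[OF D M]]])
    fix \<beta> assume "\<gamma> = replicate_mset 1 i + \<beta>"
    then have "\<not> replicate_mset n i \<subseteq># \<beta>" using Suc.prems by auto
    then show "carrier ((ad D i ^^ n) M \<beta>) = {\<zero>\<^bsub>(ad D i ^^ n) M \<beta>\<^esub>}" by (rule Suc.IH)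
  qed
  then show ?case unfolding ad_Suc .
qed

section \<open>Functoriality, and the values of the functors on generators\<close>

lemma right_mult_lin_map:
  assumes "a \<in> carrier (KLR D (replicate_mset n i))"
  shows "lin_map (KLR D (replicate_mset n i)) (E_pow D i n) (E_pow D i n) (right_mult D i n a)"
proof -
  interpret R: ring "KLR D (replicate_mset n i)" by (rule ring_KLR)
  show ?thesis
    using assms by (auto simp: lin_map_def add_hom_def E_pow_simps right_mult_def R.l_distr R.m_assoc)
qed

lemma ind_prod_map_lin_map:
  assumes t: "tens_prod D \<beta> \<gamma> M N" and t': "tens_prod D \<beta> \<gamma> M' N'"
    and f: "lin_map (KLR D \<beta>) M M' f" and g: "lin_map (KLR D \<gamma>) N N' g"
  shows "lin_map (KLR D (\<beta> + \<gamma>)) (ind_prod D \<beta> \<gamma> M N) (ind_prod D \<beta> \<gamma> M' N') (ind_prod_map D \<beta> \<gamma> M N M' N' f g)"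
proof -
  interpret t: tens_prod D \<beta> \<gamma> M N by (rule t)
  interpret t': tens_prod D \<beta> \<gamma> M' N' by (rule t')
  note k = ind_prod_map_lift[OF assms]
  show ?thesis
    unfolding lin_map_def
  proof (intro conjI ballI k(1))
    fix a x assume a: "a \<in> carrier t.H" and x: "x \<in> carrier t.P"
    show "ind_prod_map D \<beta> \<gamma> M N M' N' f g (a \<odot>\<^bsub>t.P\<^esub> x) = a \<odot>\<^bsub>t'.P\<^esub> ind_prod_map D \<beta> \<gamma> M N M' N' f g x"
    proof (rule t.add_hom_eq_on_tri[OF t'.P_abelian_group add_hom_comp[OF smult_add_hom[OF t.P_left_module a] k(1)]
          add_hom_comp[OF k(1) smult_add_hom[OF t'.P_left_module a]] _ x])
      fix h m n assume c: "h \<in> carrier t.H" "m \<in> carrier M" "n \<in> carrier N"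
      then show "ind_prod_map D \<beta> \<gamma> M N M' N' f g (a \<odot>\<^bsub>t.P\<^esub> t.tri h m n) = a \<odot>\<^bsub>t'.P\<^esub> ind_prod_map D \<beta> \<gamma> M N M' N' f g (t.tri h m n)"
        using a lin_map_closed[OF f c(2)] lin_map_closed[OF g c(3)] by (simp add: t.tri_smult k(2) t'.tri_smult)
    qed
  qed
qed

context
  fixes D :: "('i, 'k::{comm_ring,comm_monoid_mult}) klr_datum" and i :: 'i and n :: nat
    and M N :: "('i, 'k, 'a) obj" and f :: "('i, 'k, 'a) mor" and u :: "('i, 'k, 'a) kelt \<Rightarrow> ('i, 'k, 'a) kelt"
  assumes D: "is_klr_datum D" and M: "M \<in> Obj D" and N: "N \<in> Obj D"
    and f: "\<And>\<beta>. lin_map (KLR D \<beta>) (M \<beta>) (N \<beta>) (f \<beta>)"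
    and u: "lin_map (KLR D (replicate_mset n i)) (E_pow D i n) (E_pow D i n) u"
begin

lemma E_prod_map_lin_map: "lin_map (KLR D \<gamma>) (E_prod D i n M \<gamma>) (E_prod D i n N \<gamma>) (E_prod_map D i n u M N f \<gamma>)"
proof (cases "replicate_mset n i \<subseteq># \<gamma>")
  case True
  then obtain \<beta> where \<gamma>: "\<gamma> = replicate_mset n i + \<beta>" by (rule subseteq_weightE)
  interpret M: piE_module D i n \<beta> "M \<beta>" by (rule piE_moduleI[OF D M])
  interpret N: piE_module D i n \<beta> "N \<beta>" by (rule piE_moduleI[OF D N])
  show ?thesis
    unfolding \<gamma> E_prod_at E_prod_map_def Let_def
    using ind_prod_map_lin_map[OF M.T.tens_prod_axioms N.T.tens_prod_axioms u f] by simp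
next
  case False
  then show ?thesis by (simp add: E_prod_map_def E_prod_def Let_def lin_map_def add_hom_def zero_module_simps)
qed

lemma piE_map_descend:
  "piE_map D i n u M N f \<gamma> \<in> linear_maps (KLR D \<gamma>) (piE D i n M \<gamma>) (piE D i n N \<gamma>)"
  "\<And>x. x \<in> carrier (E_prod D i n M \<gamma>) \<Longrightarrow> piE_map D i n u M N f \<gamma> (pi_class D i \<gamma> (E_prod D i n M \<gamma>) x) =
    pi_class D i \<gamma> (E_prod D i n N \<gamma>) (E_prod_map D i n u M N f \<gamma> x)"
proof -
  interpret M: graded_pi D i \<gamma> "E_prod D i n M \<gamma>" by (rule graded_pi_E_prod[OF D M])
  interpret N: graded_pi D i \<gamma> "E_prod D i n N \<gamma>" by (rule graded_pi_E_prod[OF D N])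
  have k: "lin_map (KLR D \<gamma>) (E_prod D i n M \<gamma>) N.Q (\<lambda>x. N.pc (E_prod_map D i n u M N f \<gamma> x))"
    by (rule lin_map_comp[OF E_prod_map_lin_map N.pc_lin_map])
  have d1: "lin_map (KLR D \<gamma>) M.Q N.Q (\<lambda>x. N.pc (E_prod_map D i n u M N f \<gamma> x))"
    by (rule M.descend(1)[OF N.Q_left_module k]) (rule N.Q_killed)
  have d2: "N.pc (E_prod_map D i n u M N f \<gamma> (M.pc x)) = N.pc (E_prod_map D i n u M N f \<gamma> x)"
    if "x \<in> carrier (E_prod D i n M \<gamma>)" for x
    by (rule M.descend(2)[OF N.Q_left_module k _ that]) (rule N.Q_killed)
  have eq: "piE_map D i n u M N f \<gamma> = (\<lambda>x\<in>carrier M.Q. N.pc (E_prod_map D i n u M N f \<gamma> x))"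
    by (simp add: piE_map_def pi_map_def)
  show "piE_map D i n u M N f \<gamma> \<in> linear_maps (KLR D \<gamma>) (piE D i n M \<gamma>) (piE D i n N \<gamma>)"
    unfolding eq piE_def pi_obj_def by (rule lin_map_restrict[OF M.Q_left_module d1])
  show "piE_map D i n u M N f \<gamma> (M.pc x) = N.pc (E_prod_map D i n u M N f \<gamma> x)" if "x \<in> carrier (E_prod D i n M \<gamma>)" for x
    using d2[OF that] M.pc_closed[OF that] by (simp add: eq)
qed

text \<open>If u sends 1 to a, the tensor of 1, 1 and m goes to that of 1, a and \<open>f m\<close>,
  which is \<open>a \<diamondop> 1\<close> times the generator of \<open>f m\<close>. The case a = 1
  describes the functor on morphisms, and f = id the effect of right multiplication by a.\<close>

lemma piE_map_gen:
  assumes a: "a \<in> carrier (KLR D (replicate_mset n i))" "u (Alg \<one>\<^bsub>KLR D (replicate_mset n i)\<^esub>) = Alg a"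
    and m: "m \<in> carrier (M \<beta>)"
  shows "piE_map D i n u M N f (replicate_mset n i + \<beta>) (piE_gen D i n M \<beta> m) =
    diamond D (replicate_mset n i) \<beta> a \<one>\<^bsub>KLR D \<beta>\<^esub> \<odot>\<^bsub>piE D i n N (replicate_mset n i + \<beta>)\<^esub> piE_gen D i n N \<beta> (f \<beta> m)"
proof -
  interpret M: piE_module D i n \<beta> "M \<beta>" by (rule piE_moduleI[OF D M])
  interpret N: piE_module D i n \<beta> "N \<beta>" by (rule piE_moduleI[OF D N])
  have fm: "f \<beta> m \<in> carrier (N \<beta>)" by (rule lin_map_closed[OF f m])
  have map: "E_prod_map D i n u M N f (M.\<delta> + \<beta>) = ind_prod_map D M.\<delta> \<beta> M.En (M \<beta>) M.En (N \<beta>) u (f \<beta>)"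
    by (simp add: E_prod_map_def Let_def)
  have "piE_map D i n u M N f (M.\<delta> + \<beta>) (M.gen m) =
      N.X.pc (ind_prod_map D M.\<delta> \<beta> M.En (M \<beta>) M.En (N \<beta>) u (f \<beta>) (M.T.tri \<one>\<^bsub>M.T.H\<^esub> M.oneE m))"
    unfolding M.gen_def using piE_map_descend(2)[of "M.T.tri \<one>\<^bsub>M.T.H\<^esub> M.oneE m" "M.\<delta> + \<beta>"] M.tri_one_closed[OF m]
    unfolding E_prod_at map by simp
  also have "\<dots> = N.X.pc (N.T.tri \<one>\<^bsub>M.T.H\<^esub> (Alg a) (f \<beta> m))"
    using ind_prod_map_lift(2)[OF M.T.tens_prod_axioms N.T.tens_prod_axioms u f M.T.H.one_closed M.oneE_closed m] a(2) by simp
  also have "\<dots> = (\<one>\<^bsub>M.T.H\<^esub> \<otimes>\<^bsub>M.T.H\<^esub> diamond D M.\<delta> \<beta> a \<one>\<^bsub>KLR D \<beta>\<^esub>) \<odot>\<^bsub>N.X.Q\<^esub> N.gen (f \<beta> m)"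
    by (rule N.pc_tri[OF M.T.H.one_closed a(1) fm])
  also have "\<one>\<^bsub>M.T.H\<^esub> \<otimes>\<^bsub>M.T.H\<^esub> diamond D M.\<delta> \<beta> a \<one>\<^bsub>KLR D \<beta>\<^esub> = diamond D M.\<delta> \<beta> a \<one>\<^bsub>KLR D \<beta>\<^esub>"
    using diamond_closed[OF a(1) ring.ring_simprules(6)[OF ring_KLR]] by simp
  finally show ?thesis
    unfolding piE_gen_eq[OF D M] piE_gen_eq[OF D N] piE_at .
qed

end

lemma semilinear_smult:
  "semilinear D \<delta> \<beta> M N s \<Longrightarrow> z \<in> carrier (KLR D \<beta>) \<Longrightarrow> m \<in> carrier M \<Longrightarrow>
    s (z \<odot>\<^bsub>M\<^esub> m) = diamond D \<delta> \<beta> \<one>\<^bsub>KLR D \<delta>\<^esub> z \<odot>\<^bsub>N\<^esub> s m"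
  by (simp add: semilinear_def)

lemma piE_map_id_gen:
  assumes D: "is_klr_datum D" and M: "M \<in> Obj D" and N: "N \<in> Obj D"
    and f: "\<And>\<beta>. lin_map (KLR D \<beta>) (M \<beta>) (N \<beta>) (f \<beta>)" and m: "m \<in> carrier (M \<beta>)"
  shows "piE_map D i n (\<lambda>x. x) M N f (replicate_mset n i + \<beta>) (piE_gen D i n M \<beta> m) = piE_gen D i n N \<beta> (f \<beta> m)"
proof -
  have fm: "f \<beta> m \<in> carrier (N \<beta>)" by (rule lin_map_closed[OF f m])
  note o = ring.ring_simprules(6)[OF ring_KLR]
  have "semilinear D (replicate_mset n i) \<beta> (N \<beta>) (piE D i n N (replicate_mset n i + \<beta>)) (piE_gen D i n N \<beta>)"
    by (rule universalD(3)[OF piE_universal[OF D N]])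
  then have "diamond D (replicate_mset n i) \<beta> \<one>\<^bsub>KLR D (replicate_mset n i)\<^esub> \<one>\<^bsub>KLR D \<beta>\<^esub> \<odot>\<^bsub>piE D i n N (replicate_mset n i + \<beta>)\<^esub> piE_gen D i n N \<beta> (f \<beta> m)
      = piE_gen D i n N \<beta> (\<one>\<^bsub>KLR D \<beta>\<^esub> \<odot>\<^bsub>N \<beta>\<^esub> f \<beta> m)"
    by (rule semilinear_smult[symmetric, OF _ o fm])
  then show ?thesis
    using piE_map_gen[OF D M N f lin_map_id o HOL.refl m, where i = i and n = n] left_module.lm_one[OF fg_graded_moduleD(1)[OF ObjD[OF N]] fm] by simp
qed

text \<open>Linearity and the values on generators are proved together, as the next application of
  the functor requires the map of the previous stage to be linear.\<close>

lemma ad_pow_map_props: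
  assumes D: "is_klr_datum D" and M: "M \<in> Obj_i D i" and N: "N \<in> Obj_i D i"
    and f: "\<And>\<beta>. f \<beta> \<in> linear_maps (KLR D \<beta>) (M \<beta>) (N \<beta>)"
  shows "(\<forall>\<gamma>. ad_pow_map D i n M N f \<gamma> \<in> linear_maps (KLR D \<gamma>) ((ad D i ^^ n) M \<gamma>) ((ad D i ^^ n) N \<gamma>)) \<and>
    (\<forall>\<beta>. \<forall>m\<in>carrier (M \<beta>). ad_pow_map D i n M N f (replicate_mset n i + \<beta>) (ad_gen D i M \<beta> m n) = ad_gen D i N \<beta> (f \<beta> m) n)"
proof (induction n)
  case 0
  then show ?case using f by simp
next
  case (Suc n)
  let ?M = "(ad D i ^^ n) M" and ?N = "(ad D i ^^ n) N" and ?f = "ad_pow_map D i n M N f"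
  note M' = Obj_iD[OF ad_Obj_i[OF D M, of n]] and N' = Obj_iD[OF ad_Obj_i[OF D N, of n]]
  have f': "lin_map (KLR D \<gamma>) (?M \<gamma>) (?N \<gamma>) (?f \<gamma>)" for \<gamma>
    using Suc.IH by (simp add: linear_maps_lin_map)
  have "piE_map D i 1 (\<lambda>x. x) ?M ?N ?f \<gamma> \<in> linear_maps (KLR D \<gamma>) (piE D i 1 ?M \<gamma>) (piE D i 1 ?N \<gamma>)" for \<gamma>
    by (rule piE_map_descend(1)[OF D M' N' f' lin_map_id])
  moreover have "piE_map D i 1 (\<lambda>x. x) ?M ?N ?f (replicate_mset (Suc n) i + \<beta>) (ad_gen D i M \<beta> m (Suc n)) = ad_gen D i N \<beta> (f \<beta> m) (Suc n)"
    if m: "m \<in> carrier (M \<beta>)" for \<beta> m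
  proof -
    have eq: "replicate_mset (Suc n) i + \<beta> = replicate_mset 1 i + (replicate_mset n i + \<beta>)" by simp
    have "ad_gen D i M \<beta> m n \<in> carrier (?M (replicate_mset n i + \<beta>))"
      by (rule semilinear_closed[OF universalD(3)[OF ad_universal[OF D M]] m])
    from piE_map_id_gen[OF D M' N' f' this, of i 1] show ?thesis
      unfolding eq ad_gen.simps using Suc.IH m by simp
  qed
  ultimately show ?case unfolding ad_pow_map.simps ad_map_def ad_Suc by blast
qed

text \<open>Equality on generators suffices in every weight: by the spanning clause if the weight
  contains ni, and because the module is zero otherwise.\<close>

lemma piE_lin_map_eq:
  assumes D: "is_klr_datum D" and M: "M \<in> Obj D" and Y: "left_module (KLR D \<gamma>) Y"
    and f: "lin_map (KLR D \<gamma>) (piE D i n M \<gamma>) Y f" "lin_map (KLR D \<gamma>) (piE D i n M \<gamma>) Y f'"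
    and eq: "\<And>\<beta> m. \<gamma> = replicate_mset n i + \<beta> \<Longrightarrow> m \<in> carrier (M \<beta>) \<Longrightarrow> f (piE_gen D i n M \<beta> m) = f' (piE_gen D i n M \<beta> m)"
    and x: "x \<in> carrier (piE D i n M \<gamma>)"
  shows "f x = f' x"
proof (cases "replicate_mset n i \<subseteq># \<gamma>")
  case True
  then obtain \<beta> where \<gamma>: "\<gamma> = replicate_mset n i + \<beta>" by (rule subseteq_weightE)
  show ?thesis
    by (rule universal_eq[OF piE_universal[OF D M] Y[unfolded \<gamma>] f[unfolded \<gamma>] eq[OF \<gamma>] x[unfolded \<gamma>]])
next
  case False
  then have "carrier (piE D i n M \<gamma>) = {\<zero>\<^bsub>piE D i n M \<gamma>\<^esub>}"
    by (intro piE_zero[OF D M]) simp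
  moreover have X: "abelian_group (piE D i n M \<gamma>)"
    by (rule left_module_abelian_group[OF fg_graded_moduleD(1)[OF piE_fg_graded_module[OF D M]]])
  ultimately show ?thesis
    using x add_hom_zero[OF X left_module_abelian_group[OF Y] lin_map_add_hom[OF f(1)]]
      add_hom_zero[OF X left_module_abelian_group[OF Y] lin_map_add_hom[OF f(2)]] by simp
qed

lemma ad_lin_map_eq:
  assumes D: "is_klr_datum D" and M: "M \<in> Obj_i D i" and Y: "left_module (KLR D \<gamma>) Y"
    and f: "lin_map (KLR D \<gamma>) ((ad D i ^^ n) M \<gamma>) Y f" "lin_map (KLR D \<gamma>) ((ad D i ^^ n) M \<gamma>) Y f'"
    and eq: "\<And>\<beta> m. \<gamma> = replicate_mset n i + \<beta> \<Longrightarrow> m \<in> carrier (M \<beta>) \<Longrightarrow> f (ad_gen D i M \<beta> m n) = f' (ad_gen D i M \<beta> m n)"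
    and x: "x \<in> carrier ((ad D i ^^ n) M \<gamma>)"
  shows "f x = f' x"
proof (cases "replicate_mset n i \<subseteq># \<gamma>")
  case True
  then obtain \<beta> where \<gamma>: "\<gamma> = replicate_mset n i + \<beta>" by (rule subseteq_weightE)
  show ?thesis
    by (rule universal_eq[OF ad_universal[OF D M] Y[unfolded \<gamma>] f[unfolded \<gamma>] eq[OF \<gamma>] x[unfolded \<gamma>]])
next
  case False
  then have "carrier ((ad D i ^^ n) M \<gamma>) = {\<zero>\<^bsub>(ad D i ^^ n) M \<gamma>\<^esub>}"
    by (rule zero_weight[OF _ D M])
  moreover have X: "abelian_group ((ad D i ^^ n) M \<gamma>)"
    by (rule left_module_abelian_group[OF fg_graded_moduleD(1)[OF ad_fg_graded_module[OF D M]]])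
  ultimately show ?thesis
    using x add_hom_zero[OF X left_module_abelian_group[OF Y] lin_map_add_hom[OF f(1)]]
      add_hom_zero[OF X left_module_abelian_group[OF Y] lin_map_add_hom[OF f(2)]] by simp
qed

text \<open>Supplies the comparison maps in weights without generators.\<close>

lemma zero_graded_map:
  assumes X: "fg_graded_module D \<gamma> X" and Y: "fg_graded_module D \<gamma> Y" and z: "carrier X = {\<zero>\<^bsub>X\<^esub>}"
  shows "\<exists>f\<in>linear_maps (KLR D \<gamma>) X Y. \<forall>d. f ` grade X d \<subseteq> grade Y d"
proof -
  interpret Y: graded_group Y "grade Y" by (rule fg_graded_moduleD(3)[OF Y])
  interpret X: graded_group X "grade X" by (rule fg_graded_moduleD(3)[OF X])
  have "lin_map (KLR D \<gamma>) X Y (\<lambda>_. \<zero>\<^bsub>Y\<^esub>)"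
    using add_hom_zero_map[OF Y.is_abelian] smult_zero[OF fg_graded_moduleD(1)[OF Y]] by (simp add: lin_map_def)
  from lin_map_restrict[OF fg_graded_moduleD(1)[OF X] this] show ?thesis
    using Y.G_zero X.G_carrier by (intro bexI[of _ "\<lambda>x\<in>carrier X. \<zero>\<^bsub>Y\<^esub>"]) auto
qed

text \<open>Both modules represent the same functor, so \<open>universal_map\<close> gives maps in
  both directions that match the generators. In weights without generators the last condition is
  empty and the zero map serves.\<close>

lemma ad_piE_comparison:
  assumes D: "is_klr_datum D" and M: "M \<in> Obj_i D i"
  shows "\<exists>f\<in>linear_maps (KLR D \<gamma>) ((ad D i ^^ n) M \<gamma>) (piE D i n M \<gamma>).
      (\<forall>d. f ` grade ((ad D i ^^ n) M \<gamma>) d \<subseteq> grade (piE D i n M \<gamma>) d) \<and>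
      (\<forall>\<beta>. \<gamma> = replicate_mset n i + \<beta> \<longrightarrow> (\<forall>m\<in>carrier (M \<beta>). f (ad_gen D i M \<beta> m n) = piE_gen D i n M \<beta> m))"
    and "\<exists>f\<in>linear_maps (KLR D \<gamma>) (piE D i n M \<gamma>) ((ad D i ^^ n) M \<gamma>).
      (\<forall>d. f ` grade (piE D i n M \<gamma>) d \<subseteq> grade ((ad D i ^^ n) M \<gamma>) d) \<and>
      (\<forall>\<beta>. \<gamma> = replicate_mset n i + \<beta> \<longrightarrow> (\<forall>m\<in>carrier (M \<beta>). f (piE_gen D i n M \<beta> m) = ad_gen D i M \<beta> m n))"
proof -
  have A: "fg_graded_module D \<gamma> ((ad D i ^^ n) M \<gamma>)" and P: "fg_graded_module D \<gamma> (piE D i n M \<gamma>)" for \<gamma>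
    by (rule ad_fg_graded_module[OF D M], rule piE_fg_graded_module[OF D Obj_iD[OF M]])
  show "\<exists>f\<in>linear_maps (KLR D \<gamma>) ((ad D i ^^ n) M \<gamma>) (piE D i n M \<gamma>).
      (\<forall>d. f ` grade ((ad D i ^^ n) M \<gamma>) d \<subseteq> grade (piE D i n M \<gamma>) d) \<and>
      (\<forall>\<beta>. \<gamma> = replicate_mset n i + \<beta> \<longrightarrow> (\<forall>m\<in>carrier (M \<beta>). f (ad_gen D i M \<beta> m n) = piE_gen D i n M \<beta> m))"
  proof (cases "replicate_mset n i \<subseteq># \<gamma>")
    case True
    then obtain \<beta> where \<gamma>: "\<gamma> = replicate_mset n i + \<beta>" by (rule subseteq_weightE)
    from universal_map[OF ad_universal[OF D M] piE_universal[OF D Obj_iD[OF M]] P ObjD[OF Obj_iD[OF M]]]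
    show ?thesis unfolding \<gamma> by auto
  next
    case False
    with zero_graded_map[OF A P zero_weight[OF False D M]] show ?thesis by fastforce
  qed
  show "\<exists>f\<in>linear_maps (KLR D \<gamma>) (piE D i n M \<gamma>) ((ad D i ^^ n) M \<gamma>).
      (\<forall>d. f ` grade (piE D i n M \<gamma>) d \<subseteq> grade ((ad D i ^^ n) M \<gamma>) d) \<and>
      (\<forall>\<beta>. \<gamma> = replicate_mset n i + \<beta> \<longrightarrow> (\<forall>m\<in>carrier (M \<beta>). f (piE_gen D i n M \<beta> m) = ad_gen D i M \<beta> m n))"
  proof (cases "replicate_mset n i \<subseteq># \<gamma>")
    case True
    then obtain \<beta> where \<gamma>: "\<gamma> = replicate_mset n i + \<beta>" by (rule subseteq_weightE)
    from universal_map[OF piE_universal[OF D Obj_iD[OF M]] ad_universal[OF D M] A ObjD[OF Obj_iD[OF M]]]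
    show ?thesis unfolding \<gamma> by auto
  next
    case False
    then have "carrier (piE D i n M \<gamma>) = {\<zero>\<^bsub>piE D i n M \<gamma>\<^esub>}" by (intro piE_zero[OF D Obj_iD[OF M]]) simp
    with False zero_graded_map[OF P A] show ?thesis by fastforce
  qed
qed

section \<open>The isomorphism and the natural endomorphisms it induces\<close>

lemma lin_map_sum:
  assumes N: "left_module R N" and f: "lin_map R M N f" and g: "lin_map R M N g"
  shows "lin_map R M N (\<lambda>x. f x \<oplus>\<^bsub>N\<^esub> g x)"
proof -
  interpret N: abelian_group N by (rule left_module_abelian_group[OF N])
  show ?thesis
    using f g by (simp add: lin_map_def add_hom_def left_module.lm_r_distr[OF N] N.a_ac)
qed

text \<open>Scalars are central in \<open>KLR D \<beta>\<close>, so multiplication by them keeps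
  linearity.\<close>

lemma lin_map_scalar:
  assumes N: "left_module (KLR D \<beta>) N" and f: "lin_map (KLR D \<beta>) M N f"
  shows "lin_map (KLR D \<beta>) M N (\<lambda>x. klr_scalar D \<beta> c \<odot>\<^bsub>N\<^esub> f x)"
proof -
  note s = klr_scalar_closed[of D \<beta> c]
  have "klr_scalar D \<beta> c \<odot>\<^bsub>N\<^esub> (a \<odot>\<^bsub>N\<^esub> y) = a \<odot>\<^bsub>N\<^esub> (klr_scalar D \<beta> c \<odot>\<^bsub>N\<^esub> y)"
    if "a \<in> carrier (KLR D \<beta>)" "y \<in> carrier N" for a y
    using left_module.lm_assoc[OF N s that] left_module.lm_assoc[OF N that(1) s that(2)] klr_scalar_commute[OF that(1)] by metis
  then show ?thesis
    using f by (simp add: lin_map_def add_hom_def left_module.lm_r_distr[OF N] left_module.lm_closed[OF N] s)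
qed

text \<open>Comparison maps in both directions, known through linearity, degrees and values on
  generators. Nothing else about them enters, so any choice will do.\<close>

locale ad_comparison =
  fixes D :: "('i, 'k::{comm_ring,comm_monoid_mult}) klr_datum" and i :: 'i and n :: nat
    and \<phi> \<psi> :: "('i, 'k, 'a) obj \<Rightarrow> ('i, 'k, 'a) mor"
  assumes D: "is_klr_datum D"
    and \<phi>: "M \<in> Obj_i D i \<Longrightarrow> \<phi> M \<gamma> \<in> linear_maps (KLR D \<gamma>) ((ad D i ^^ n) M \<gamma>) (piE D i n M \<gamma>)"
    and \<phi>_grade: "M \<in> Obj_i D i \<Longrightarrow> \<phi> M \<gamma> ` grade ((ad D i ^^ n) M \<gamma>) d \<subseteq> grade (piE D i n M \<gamma>) d"
    and \<phi>_gen: "M \<in> Obj_i D i \<Longrightarrow> m \<in> carrier (M \<beta>) \<Longrightarrow>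
      \<phi> M (replicate_mset n i + \<beta>) (ad_gen D i M \<beta> m n) = piE_gen D i n M \<beta> m"
    and \<psi>: "M \<in> Obj_i D i \<Longrightarrow> \<psi> M \<gamma> \<in> linear_maps (KLR D \<gamma>) (piE D i n M \<gamma>) ((ad D i ^^ n) M \<gamma>)"
    and \<psi>_grade: "M \<in> Obj_i D i \<Longrightarrow> \<psi> M \<gamma> ` grade (piE D i n M \<gamma>) d \<subseteq> grade ((ad D i ^^ n) M \<gamma>) d"
    and \<psi>_gen: "M \<in> Obj_i D i \<Longrightarrow> m \<in> carrier (M \<beta>) \<Longrightarrow>
      \<psi> M (replicate_mset n i + \<beta>) (piE_gen D i n M \<beta> m) = ad_gen D i M \<beta> m n"
begin

abbreviation "\<delta> \<equiv> replicate_mset n i"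
abbreviation A :: "('i, 'k, 'a) obj \<Rightarrow> ('i, 'k, 'a) obj" where "A \<equiv> ad D i ^^ n"
abbreviation P :: "('i, 'k, 'a) obj \<Rightarrow> ('i, 'k, 'a) obj" where "P \<equiv> piE D i n"

lemma \<phi>_lin: "M \<in> Obj_i D i \<Longrightarrow> lin_map (KLR D \<gamma>) (A M \<gamma>) (P M \<gamma>) (\<phi> M \<gamma>)"
  using \<phi> by (simp add: linear_maps_lin_map)

lemma \<psi>_lin: "M \<in> Obj_i D i \<Longrightarrow> lin_map (KLR D \<gamma>) (P M \<gamma>) (A M \<gamma>) (\<psi> M \<gamma>)"
  using \<psi> by (simp add: linear_maps_lin_map)

lemma A_left_module: "M \<in> Obj_i D i \<Longrightarrow> left_module (KLR D \<gamma>) (A M \<gamma>)"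
  by (rule fg_graded_moduleD(1)[OF ad_fg_graded_module[OF D]])

lemma P_left_module: "M \<in> Obj_i D i \<Longrightarrow> left_module (KLR D \<gamma>) (P M \<gamma>)"
  by (rule fg_graded_moduleD(1)[OF piE_fg_graded_module[OF D Obj_iD]])

lemma ad_gen_closed: "M \<in> Obj_i D i \<Longrightarrow> m \<in> carrier (M \<beta>) \<Longrightarrow> ad_gen D i M \<beta> m n \<in> carrier (A M (\<delta> + \<beta>))"
  by (rule semilinear_closed[OF universalD(3)[OF ad_universal[OF D]]])

lemma piE_gen_closed: "M \<in> Obj_i D i \<Longrightarrow> m \<in> carrier (M \<beta>) \<Longrightarrow> piE_gen D i n M \<beta> m \<in> carrier (P M (\<delta> + \<beta>))"
  by (rule semilinear_closed[OF universalD(3)[OF piE_universal[OF D Obj_iD]]])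

lemma \<psi>_\<phi>:
  assumes M: "M \<in> Obj_i D i" and x: "x \<in> carrier (A M \<gamma>)"
  shows "\<psi> M \<gamma> (\<phi> M \<gamma> x) = x"
  by (rule ad_lin_map_eq[OF D M A_left_module[OF M] lin_map_comp[OF \<phi>_lin[OF M] \<psi>_lin[OF M]] lin_map_id _ x])
    (simp add: \<phi>_gen[OF M] \<psi>_gen[OF M])

lemma \<phi>_\<psi>:
  assumes M: "M \<in> Obj_i D i" and y: "y \<in> carrier (P M \<gamma>)"
  shows "\<phi> M \<gamma> (\<psi> M \<gamma> y) = y"
  by (rule piE_lin_map_eq[OF D Obj_iD[OF M] P_left_module[OF M] lin_map_comp[OF \<psi>_lin[OF M] \<phi>_lin[OF M]] lin_map_id _ y])
    (simp add: \<phi>_gen[OF M] \<psi>_gen[OF M])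

text \<open>Identifies the \<open>inv_into\<close> of \<open>induced_endo\<close> with \<psi>, whose
  linearity and values on generators are known.\<close>

lemma inv_\<phi>:
  assumes M: "M \<in> Obj_i D i" and y: "y \<in> carrier (P M \<gamma>)"
  shows "inv_into (carrier (A M \<gamma>)) (\<phi> M \<gamma>) y = \<psi> M \<gamma> y"
proof (rule inv_into_f_eq)
  show "inj_on (\<phi> M \<gamma>) (carrier (A M \<gamma>))" by (rule inj_on_inverseI[where g = "\<psi> M \<gamma>"]) (rule \<psi>_\<phi>[OF M])
qed (rule lin_map_closed[OF \<psi>_lin[OF M] y], rule \<phi>_\<psi>[OF M y])

lemma HomD: "f \<in> Hom D M N \<Longrightarrow> f \<beta> \<in> linear_maps (KLR D \<beta>) (M \<beta>) (N \<beta>)"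
  by (simp add: Hom_def)

lemma ad_pow_map_lin:
  assumes "M \<in> Obj_i D i" "N \<in> Obj_i D i" "f \<in> Hom D M N"
  shows "lin_map (KLR D \<gamma>) (A M \<gamma>) (A N \<gamma>) (ad_pow_map D i n M N f \<gamma>)"
  using ad_pow_map_props[OF D assms(1,2) HomD[OF assms(3)]] by (simp add: linear_maps_lin_map)

lemma ad_pow_map_gen:
  assumes "M \<in> Obj_i D i" "N \<in> Obj_i D i" "f \<in> Hom D M N" "m \<in> carrier (M \<beta>)"
  shows "ad_pow_map D i n M N f (\<delta> + \<beta>) (ad_gen D i M \<beta> m n) = ad_gen D i N \<beta> (f \<beta> m) n"
  using ad_pow_map_props[OF D assms(1,2) HomD[OF assms(3)]] assms(4) by simp

lemma nat_iso_\<phi>: "nat_iso D i A (ad_pow_map D i n) P (piE_map D i n (\<lambda>x. x)) \<phi>"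
  unfolding nat_iso_def natural_def
proof (intro conjI ballI allI)
  fix M :: "('i, 'k, 'a) obj" assume M: "M \<in> Obj_i D i"
  have "\<phi> M \<in> Hom D (A M) (P M)" "\<psi> M \<in> Hom D (P M) (A M)"
    using \<phi>[OF M] \<phi>_grade[OF M] \<psi>[OF M] \<psi>_grade[OF M] by (simp_all add: Hom_def)
  then show "\<phi> M \<in> iso_i D i (A M) (P M)"
    using ad_Obj_i[OF D M] piE_Obj_i[OF D Obj_iD[OF M]] \<psi>_\<phi>[OF M] \<phi>_\<psi>[OF M] unfolding iso_i_def by blast
next
  fix M N :: "('i, 'k, 'a) obj" and f \<gamma> x assume M: "M \<in> Obj_i D i" and N: "N \<in> Obj_i D i" and f: "f \<in> Hom D M N" and x: "x \<in> carrier (A M \<gamma>)"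
  have fl: "lin_map (KLR D \<beta>) (M \<beta>) (N \<beta>) (f \<beta>)" for \<beta>
    using HomD[OF f] by (simp add: linear_maps_lin_map)
  have pl: "lin_map (KLR D \<gamma>) (P M \<gamma>) (P N \<gamma>) (piE_map D i n (\<lambda>x. x) M N f \<gamma>)"
    using piE_map_descend(1)[OF D Obj_iD[OF M] Obj_iD[OF N] fl lin_map_id] by (simp add: linear_maps_lin_map)
  show "\<phi> N \<gamma> (ad_pow_map D i n M N f \<gamma> x) = piE_map D i n (\<lambda>x. x) M N f \<gamma> (\<phi> M \<gamma> x)"
  proof (rule ad_lin_map_eq[OF D M P_left_module[OF N]
        lin_map_comp[OF ad_pow_map_lin[OF M N f] \<phi>_lin[OF N]] lin_map_comp[OF \<phi>_lin[OF M] pl] _ x])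
    fix \<beta> m assume \<gamma>: "\<gamma> = \<delta> + \<beta>" and m: "m \<in> carrier (M \<beta>)"
    show "\<phi> N \<gamma> (ad_pow_map D i n M N f \<gamma> (ad_gen D i M \<beta> m n)) =
        piE_map D i n (\<lambda>x. x) M N f \<gamma> (\<phi> M \<gamma> (ad_gen D i M \<beta> m n))"
      unfolding \<gamma> ad_pow_map_gen[OF M N f m] \<phi>_gen[OF M m] \<phi>_gen[OF N lin_map_closed[OF fl m]]
      by (rule piE_map_id_gen[OF D Obj_iD[OF M] Obj_iD[OF N] fl m, symmetric])
  qed
qed

lemma id_mor_lin: "M \<in> Obj D \<Longrightarrow> lin_map (KLR D \<beta>) (M \<beta>) (M \<beta>) (id_mor M \<beta>)"
  using lin_map_restrict[OF fg_graded_moduleD(1)[OF ObjD] lin_map_id] by (simp add: id_mor_def linear_maps_lin_map)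

lemma right_mult_one: "a \<in> carrier (KLR D \<delta>) \<Longrightarrow> right_mult D i n a (Alg \<one>\<^bsub>KLR D \<delta>\<^esub>) = Alg a"
  by (simp add: right_mult_def monoid.l_one[OF ring.is_monoid[OF ring_KLR]])

abbreviation "\<rho> a \<equiv> induced_endo D i n \<phi> a"

lemma \<rho>_ext: "M \<in> Obj_i D i \<Longrightarrow> \<rho> a M \<gamma> \<in> extensional (carrier (A M \<gamma>))"
  by (simp add: induced_endo_def)

text \<open>\<phi> and \<psi> match generators, so by \<open>piE_map_gen\<close> the induced
  endomorphism multiplies each generator by \<open>a \<diamondop> 1\<close>. Together with linearity
  this determines it.\<close>

lemma \<rho>_props:
  assumes a: "a \<in> carrier (KLR D \<delta>)" and M: "M \<in> Obj_i D i"
  shows "\<rho> a M \<gamma> \<in> linear_maps (KLR D \<gamma>) (A M \<gamma>) (A M \<gamma>)"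
    and "m \<in> carrier (M \<beta>) \<Longrightarrow>
      \<rho> a M (\<delta> + \<beta>) (ad_gen D i M \<beta> m n) = diamond D \<delta> \<beta> a \<one>\<^bsub>KLR D \<beta>\<^esub> \<odot>\<^bsub>A M (\<delta> + \<beta>)\<^esub> ad_gen D i M \<beta> m n"
proof -
  note M' = Obj_iD[OF M] and r = right_mult_lin_map[OF a] and o = ring.ring_simprules(6)[OF ring_KLR]
  let ?r = "piE_map D i n (right_mult D i n a) M M (id_mor M)"
  have rl: "lin_map (KLR D \<gamma>) (P M \<gamma>) (P M \<gamma>) (?r \<gamma>)" for \<gamma>
    using piE_map_descend(1)[OF D M' M' id_mor_lin[OF M'] r] by (simp add: linear_maps_lin_map)
  have eq: "\<rho> a M \<gamma> x = \<psi> M \<gamma> (?r \<gamma> (\<phi> M \<gamma> x))" if x: "x \<in> carrier (A M \<gamma>)" for \<gamma> x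
    using M x inv_\<phi>[OF M lin_map_closed[OF rl lin_map_closed[OF \<phi>_lin[OF M] x]]] by (simp add: induced_endo_def)
  have "lin_map (KLR D \<gamma>) (A M \<gamma>) (A M \<gamma>) (\<lambda>x. \<psi> M \<gamma> (?r \<gamma> (\<phi> M \<gamma> x)))"
    by (rule lin_map_comp[OF lin_map_comp[OF \<phi>_lin[OF M] rl] \<psi>_lin[OF M]])
  from lin_map_cong[OF A_left_module[OF M] this eq[symmetric]] show "\<rho> a M \<gamma> \<in> linear_maps (KLR D \<gamma>) (A M \<gamma>) (A M \<gamma>)"
    by (simp add: linear_maps_lin_map \<rho>_ext[OF M])
  assume m: "m \<in> carrier (M \<beta>)"
  have i: "id_mor M \<beta> m = m" using m by (simp add: id_mor_def)
  have "\<rho> a M (\<delta> + \<beta>) (ad_gen D i M \<beta> m n) = \<psi> M (\<delta> + \<beta>) (?r (\<delta> + \<beta>) (piE_gen D i n M \<beta> m))"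
    unfolding eq[OF ad_gen_closed[OF M m]] \<phi>_gen[OF M m] ..
  also have "\<dots> = \<psi> M (\<delta> + \<beta>) (diamond D \<delta> \<beta> a \<one>\<^bsub>KLR D \<beta>\<^esub> \<odot>\<^bsub>P M (\<delta> + \<beta>)\<^esub> piE_gen D i n M \<beta> m)"
    unfolding piE_map_gen[OF D M' M' id_mor_lin[OF M'] r a right_mult_one[OF a] m] i ..
  also have "\<dots> = diamond D \<delta> \<beta> a \<one>\<^bsub>KLR D \<beta>\<^esub> \<odot>\<^bsub>A M (\<delta> + \<beta>)\<^esub> ad_gen D i M \<beta> m n"
    using lin_map_smult[OF \<psi>_lin[OF M] diamond_closed[OF a o] piE_gen_closed[OF M m]] \<psi>_gen[OF M m] by simp
  finally show "\<rho> a M (\<delta> + \<beta>) (ad_gen D i M \<beta> m n) = diamond D \<delta> \<beta> a \<one>\<^bsub>KLR D \<beta>\<^esub> \<odot>\<^bsub>A M (\<delta> + \<beta>)\<^esub> ad_gen D i M \<beta> m n" .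
qed

lemma \<rho>_lin: "a \<in> carrier (KLR D \<delta>) \<Longrightarrow> M \<in> Obj_i D i \<Longrightarrow> lin_map (KLR D \<gamma>) (A M \<gamma>) (A M \<gamma>) (\<rho> a M \<gamma>)"
  using \<rho>_props(1) by (simp add: linear_maps_lin_map)

text \<open>An induced endomorphism is recognised by its values on generators. The laws for
  products, sums, unit and scalars all take this form, with g one side of the law.\<close>

lemma \<rho>_eqI:
  assumes a: "a \<in> carrier (KLR D \<delta>)"
    and g: "\<And>M \<gamma>. M \<in> Obj_i D i \<Longrightarrow> lin_map (KLR D \<gamma>) (A M \<gamma>) (A M \<gamma>) (g M \<gamma>)"
    and eq: "\<And>M \<beta> m. M \<in> Obj_i D i \<Longrightarrow> m \<in> carrier (M \<beta>) \<Longrightarrow>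
      g M (\<delta> + \<beta>) (ad_gen D i M \<beta> m n) = diamond D \<delta> \<beta> a \<one>\<^bsub>KLR D \<beta>\<^esub> \<odot>\<^bsub>A M (\<delta> + \<beta>)\<^esub> ad_gen D i M \<beta> m n"
  shows "\<rho> a = (\<lambda>M\<in>Obj_i D i. \<lambda>\<gamma>. \<lambda>x\<in>carrier (A M \<gamma>). g M \<gamma> x)"
proof (rule extensionalityI)
  show "\<rho> a \<in> extensional (Obj_i D i)" by (simp add: induced_endo_def)
  show "\<rho> a M = (\<lambda>M\<in>Obj_i D i. \<lambda>\<gamma>. \<lambda>x\<in>carrier (A M \<gamma>). g M \<gamma> x) M" if M: "M \<in> Obj_i D i" for M
  proof (rule HOL.ext)
    fix \<gamma>
    have "\<rho> a M \<gamma> x = g M \<gamma> x" if x: "x \<in> carrier (A M \<gamma>)" for x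
      by (rule ad_lin_map_eq[OF D M A_left_module[OF M] \<rho>_lin[OF a M] g[OF M] _ x])
        (simp add: \<rho>_props(2)[OF a M] eq[OF M])
    then have "\<rho> a M \<gamma> = (\<lambda>x\<in>carrier (A M \<gamma>). g M \<gamma> x)"
      by (intro extensionalityI[OF \<rho>_ext[OF M]]) auto
    then show "\<rho> a M \<gamma> = (\<lambda>M\<in>Obj_i D i. \<lambda>\<gamma>. \<lambda>x\<in>carrier (A M \<gamma>). g M \<gamma> x) M \<gamma>" using M by simp
  qed
qed simp

text \<open>Naturality holds because the maps \<open>ad_pow_map\<close> carry generators to
  generators and, being linear, commute with multiplication by
  \<open>a \<diamondop> 1\<close>.\<close>

lemma \<rho>_nat_End:
  assumes a: "a \<in> carrier (KLR D \<delta>)"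
  shows "\<rho> a \<in> carrier (nat_End D i A (ad_pow_map D i n))"
proof -
  note o = ring.ring_simprules(6)[OF ring_KLR]
  have "\<rho> a N \<gamma> (ad_pow_map D i n M N f \<gamma> x) = ad_pow_map D i n M N f \<gamma> (\<rho> a M \<gamma> x)"
    if M: "M \<in> Obj_i D i" and N: "N \<in> Obj_i D i" and f: "f \<in> Hom D M N" and x: "x \<in> carrier (A M \<gamma>)" for M N f \<gamma> x
  proof (rule ad_lin_map_eq[OF D M A_left_module[OF N] lin_map_comp[OF ad_pow_map_lin[OF M N f] \<rho>_lin[OF a N]]
        lin_map_comp[OF \<rho>_lin[OF a M] ad_pow_map_lin[OF M N f]] _ x])
    fix \<beta> m assume \<gamma>: "\<gamma> = \<delta> + \<beta>" and m: "m \<in> carrier (M \<beta>)"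
    have fm: "f \<beta> m \<in> carrier (N \<beta>)" using HomD[OF f, of \<beta>] m unfolding linear_maps_lin_map by (blast intro: lin_map_closed)
    show "\<rho> a N \<gamma> (ad_pow_map D i n M N f \<gamma> (ad_gen D i M \<beta> m n)) = ad_pow_map D i n M N f \<gamma> (\<rho> a M \<gamma> (ad_gen D i M \<beta> m n))"
      unfolding \<gamma> ad_pow_map_gen[OF M N f m] \<rho>_props(2)[OF a M m] \<rho>_props(2)[OF a N fm]
        lin_map_smult[OF ad_pow_map_lin[OF M N f] diamond_closed[OF a o] ad_gen_closed[OF M m]] ..
  qed
  then show ?thesis
    using \<rho>_props(1)[OF a] by (simp add: nat_End_def natural_def) (simp add: induced_endo_def)
qed

lemma \<rho>_ring_hom: "induced_endo D i n \<phi> \<in> ring_hom (opposite_ring (KLR D \<delta>)) (nat_End D i A (ad_pow_map D i n))"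
proof (rule ring_hom_memI)
  interpret R: ring "KLR D \<delta>" by (rule ring_KLR)
  note o = ring.ring_simprules(6)[OF ring_KLR]
  have carrier: "carrier (opposite_ring (KLR D \<delta>)) = carrier (KLR D \<delta>)" by (simp add: opposite_ring_def)
  fix x assume "x \<in> carrier (opposite_ring (KLR D \<delta>))"
  then have x: "x \<in> carrier (KLR D \<delta>)" by (simp only: carrier)
  then show "\<rho> x \<in> carrier (nat_End D i A (ad_pow_map D i n))" by (rule \<rho>_nat_End)
  fix y assume "y \<in> carrier (opposite_ring (KLR D \<delta>))"
  then have y: "y \<in> carrier (KLR D \<delta>)" by (simp only: carrier)
  \<comment> \<open>The outer map \<rho> x is linear, so it passes \<open>y \<diamondop> 1\<close>
    and acts directly on the generator: the composite multiplies by y x rather than x y.\<close>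
  have "\<rho> (y \<otimes>\<^bsub>KLR D \<delta>\<^esub> x) = (\<lambda>M\<in>Obj_i D i. \<lambda>\<gamma>. \<lambda>v\<in>carrier (A M \<gamma>). \<rho> x M \<gamma> (\<rho> y M \<gamma> v))"
  proof (rule \<rho>_eqI)
    fix M :: "('i, 'k, 'a) obj" and \<beta> m assume M: "M \<in> Obj_i D i" and m: "m \<in> carrier (M \<beta>)"
    let ?g = "ad_gen D i M \<beta> m n" and ?x = "diamond D \<delta> \<beta> x \<one>\<^bsub>KLR D \<beta>\<^esub>" and ?y = "diamond D \<delta> \<beta> y \<one>\<^bsub>KLR D \<beta>\<^esub>"
    have "\<rho> x M (\<delta> + \<beta>) (\<rho> y M (\<delta> + \<beta>) ?g) = ?y \<odot>\<^bsub>A M (\<delta> + \<beta>)\<^esub> (?x \<odot>\<^bsub>A M (\<delta> + \<beta>)\<^esub> ?g)"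
      unfolding \<rho>_props(2)[OF y M m] lin_map_smult[OF \<rho>_lin[OF x M] diamond_closed[OF y o] ad_gen_closed[OF M m]]
        \<rho>_props(2)[OF x M m] ..
    also have "\<dots> = (?y \<otimes>\<^bsub>KLR D (\<delta> + \<beta>)\<^esub> ?x) \<odot>\<^bsub>A M (\<delta> + \<beta>)\<^esub> ?g"
      by (rule left_module.lm_assoc[OF A_left_module[OF M] diamond_closed[OF y o] diamond_closed[OF x o] ad_gen_closed[OF M m], symmetric])
    also have "?y \<otimes>\<^bsub>KLR D (\<delta> + \<beta>)\<^esub> ?x = diamond D \<delta> \<beta> (y \<otimes>\<^bsub>KLR D \<delta>\<^esub> x) \<one>\<^bsub>KLR D \<beta>\<^esub>"
      using diamond_mult[OF y x o o, of \<beta>] monoid.l_one[OF ring.is_monoid[OF ring_KLR] o] by metis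
    finally show "\<rho> x M (\<delta> + \<beta>) (\<rho> y M (\<delta> + \<beta>) ?g) = diamond D \<delta> \<beta> (y \<otimes>\<^bsub>KLR D \<delta>\<^esub> x) \<one>\<^bsub>KLR D \<beta>\<^esub> \<odot>\<^bsub>A M (\<delta> + \<beta>)\<^esub> ?g" .
  qed (use x y in \<open>auto intro: lin_map_comp \<rho>_lin\<close>)
  then show "\<rho> (x \<otimes>\<^bsub>opposite_ring (KLR D \<delta>)\<^esub> y) = \<rho> x \<otimes>\<^bsub>nat_End D i A (ad_pow_map D i n)\<^esub> \<rho> y"
    by (simp add: opposite_ring_def nat_End_def)
  have "\<rho> (x \<oplus>\<^bsub>KLR D \<delta>\<^esub> y) = (\<lambda>M\<in>Obj_i D i. \<lambda>\<gamma>. \<lambda>v\<in>carrier (A M \<gamma>). \<rho> x M \<gamma> v \<oplus>\<^bsub>A M \<gamma>\<^esub> \<rho> y M \<gamma> v)"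
  proof (rule \<rho>_eqI)
    fix M :: "('i, 'k, 'a) obj" and \<beta> m assume M: "M \<in> Obj_i D i" and m: "m \<in> carrier (M \<beta>)"
    show "\<rho> x M (\<delta> + \<beta>) (ad_gen D i M \<beta> m n) \<oplus>\<^bsub>A M (\<delta> + \<beta>)\<^esub> \<rho> y M (\<delta> + \<beta>) (ad_gen D i M \<beta> m n) =
        diamond D \<delta> \<beta> (x \<oplus>\<^bsub>KLR D \<delta>\<^esub> y) \<one>\<^bsub>KLR D \<beta>\<^esub> \<odot>\<^bsub>A M (\<delta> + \<beta>)\<^esub> ad_gen D i M \<beta> m n"
      unfolding \<rho>_props(2)[OF x M m] \<rho>_props(2)[OF y M m] diamond_add_left[OF x y o]
      by (rule left_module.lm_l_distr[OF A_left_module[OF M] diamond_closed[OF x o] diamond_closed[OF y o] ad_gen_closed[OF M m], symmetric])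
  qed (use x y in \<open>auto intro: lin_map_sum A_left_module \<rho>_lin\<close>)
  then show "\<rho> (x \<oplus>\<^bsub>opposite_ring (KLR D \<delta>)\<^esub> y) = \<rho> x \<oplus>\<^bsub>nat_End D i A (ad_pow_map D i n)\<^esub> \<rho> y"
    by (simp add: opposite_ring_def nat_End_def)
next
  note o = ring.ring_simprules(6)[OF ring_KLR]
  have "\<rho> \<one>\<^bsub>KLR D \<delta>\<^esub> = (\<lambda>M\<in>Obj_i D i. \<lambda>\<gamma>. \<lambda>v\<in>carrier (A M \<gamma>). v)"
  proof (rule \<rho>_eqI[OF o lin_map_id])
    fix M :: "('i, 'k, 'a) obj" and \<beta> m assume M: "M \<in> Obj_i D i" and m: "m \<in> carrier (M \<beta>)"
    show "ad_gen D i M \<beta> m n = diamond D \<delta> \<beta> \<one>\<^bsub>KLR D \<delta>\<^esub> \<one>\<^bsub>KLR D \<beta>\<^esub> \<odot>\<^bsub>A M (\<delta> + \<beta>)\<^esub> ad_gen D i M \<beta> m n"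
      using semilinear_smult[OF universalD(3)[OF ad_universal[OF D M]] o m]
        left_module.lm_one[OF fg_graded_moduleD(1)[OF ObjD[OF Obj_iD[OF M]]] m] by simp
  qed
  then show "\<rho> \<one>\<^bsub>opposite_ring (KLR D \<delta>)\<^esub> = \<one>\<^bsub>nat_End D i A (ad_pow_map D i n)\<^esub>"
    by (simp add: opposite_ring_def nat_End_def id_mor_def)
qed

lemma \<rho>_scalar:
  assumes a: "a \<in> carrier (KLR D \<delta>)"
  shows "\<rho> (klr_scalar D \<delta> c \<otimes>\<^bsub>KLR D \<delta>\<^esub> a) = nat_End_scale D i A c (\<rho> a)"
  unfolding nat_End_scale_def
proof (rule \<rho>_eqI)
  note o = ring.ring_simprules(6)[OF ring_KLR]
  show "klr_scalar D \<delta> c \<otimes>\<^bsub>KLR D \<delta>\<^esub> a \<in> carrier (KLR D \<delta>)"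
    by (rule monoid.m_closed[OF ring.is_monoid[OF ring_KLR] klr_scalar_closed a])
  fix M :: "('i, 'k, 'a) obj" and \<beta> m assume M: "M \<in> Obj_i D i" and m: "m \<in> carrier (M \<beta>)"
  show "klr_scalar D (\<delta> + \<beta>) c \<odot>\<^bsub>A M (\<delta> + \<beta>)\<^esub> \<rho> a M (\<delta> + \<beta>) (ad_gen D i M \<beta> m n) =
      diamond D \<delta> \<beta> (klr_scalar D \<delta> c \<otimes>\<^bsub>KLR D \<delta>\<^esub> a) \<one>\<^bsub>KLR D \<beta>\<^esub> \<odot>\<^bsub>A M (\<delta> + \<beta>)\<^esub> ad_gen D i M \<beta> m n"
    unfolding \<rho>_props(2)[OF a M m] diamond_scalar_left[OF a o]
    by (rule left_module.lm_assoc[OF A_left_module[OF M] klr_scalar_closed diamond_closed[OF a o] ad_gen_closed[OF M m], symmetric])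
qed (rule lin_map_scalar[OF A_left_module \<rho>_lin[OF a]])

end

theorem proposition4p11:
  fixes D :: "('i, 'k::{comm_ring,comm_monoid_mult}) klr_datum" and i :: 'i and n :: nat
  assumes "is_klr_datum D"
  shows "\<exists>\<phi> :: ('i, 'k, 'a) obj \<Rightarrow> ('i, 'k, 'a) mor.
     nat_iso D i (ad D i ^^ n) (ad_pow_map D i n) (piE D i n) (piE_map D i n (\<lambda>x. x)) \<phi> \<and>
     (\<forall>M\<in>Obj_i D i. \<forall>\<beta>. \<forall>m\<in>carrier (M \<beta>).
        \<phi> M (replicate_mset n i + \<beta>) (ad_gen D i M \<beta> m n) = piE_gen D i n M \<beta> m) \<and>
     induced_endo D i n \<phi> \<in> ring_hom (opposite_ring (KLR D (replicate_mset n i)))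
       (nat_End D i (ad D i ^^ n) (ad_pow_map D i n)) \<and>
     (\<forall>c. \<forall>a\<in>carrier (KLR D (replicate_mset n i)).
        induced_endo D i n \<phi> (klr_scalar D (replicate_mset n i) c \<otimes>\<^bsub>KLR D (replicate_mset n i)\<^esub> a) =
        nat_End_scale D i (ad D i ^^ n) c (induced_endo D i n \<phi> a))"
proof -
  let ?F = "\<lambda>(M :: ('i, 'k, 'a) obj) \<gamma> f. f \<in> linear_maps (KLR D \<gamma>) ((ad D i ^^ n) M \<gamma>) (piE D i n M \<gamma>) \<and>
      (\<forall>d. f ` grade ((ad D i ^^ n) M \<gamma>) d \<subseteq> grade (piE D i n M \<gamma>) d) \<and>
      (\<forall>\<beta>. \<gamma> = replicate_mset n i + \<beta> \<longrightarrow> (\<forall>m\<in>carrier (M \<beta>). f (ad_gen D i M \<beta> m n) = piE_gen D i n M \<beta> m))"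
  let ?G = "\<lambda>(M :: ('i, 'k, 'a) obj) \<gamma> f. f \<in> linear_maps (KLR D \<gamma>) (piE D i n M \<gamma>) ((ad D i ^^ n) M \<gamma>) \<and>
      (\<forall>d. f ` grade (piE D i n M \<gamma>) d \<subseteq> grade ((ad D i ^^ n) M \<gamma>) d) \<and>
      (\<forall>\<beta>. \<gamma> = replicate_mset n i + \<beta> \<longrightarrow> (\<forall>m\<in>carrier (M \<beta>). f (piE_gen D i n M \<beta> m) = ad_gen D i M \<beta> m n))"
  \<comment> \<open>The maps are chosen separately for each M and \<gamma>. Naturality survives
    because they are determined by their values on generators.\<close>
  define \<phi> where "\<phi> = (\<lambda>M \<gamma>. SOME f. ?F M \<gamma> f)"
  define \<psi> where "\<psi> = (\<lambda>M \<gamma>. SOME f. ?G M \<gamma> f)"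
  have \<phi>: "?F M \<gamma> (\<phi> M \<gamma>)" if "M \<in> Obj_i D i" for M \<gamma>
  proof -
    from ad_piE_comparison(1)[OF assms that] have "\<exists>f. ?F M \<gamma> f" by (simp only: Bex_def)
    then show ?thesis unfolding \<phi>_def by (rule someI_ex)
  qed
  have \<psi>: "?G M \<gamma> (\<psi> M \<gamma>)" if "M \<in> Obj_i D i" for M \<gamma>
  proof -
    from ad_piE_comparison(2)[OF assms that] have "\<exists>f. ?G M \<gamma> f" by (simp only: Bex_def)
    then show ?thesis unfolding \<psi>_def by (rule someI_ex)
  qed
  interpret ad_comparison D i n \<phi> \<psi>
    by unfold_locales (use assms \<phi> \<psi> in auto)
  show ?thesis
    using nat_iso_\<phi> \<phi>_gen \<rho>_ring_hom \<rho>_scalar by blast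
qed

end
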